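(* Let $X$ be the subproduct system of a monomial ideal $\mathcal I$ in $\mathbb C\langle x_1,\dots,x_d\rangle$ of finite type $k$, and let $q:C^*(T)\to C^*(T)/\mathcal K(\mathcal F_X)$ be the quotient map. Then $q(\mathcal A_X)$ is hyperrigid in $C^*(T)/\mathcal K(\mathcal F_X)$; hence the C*-envelope of $q(\mathcal A_X)$ is $C^*(T)/\mathcal K(\mathcal F_X)$.
   Context: $\mathbb F_+^d$ is the free monoid of words in $\{1,\dots,d\}$; for $\mu=\mu_1\cdots\mu_n$ put $x^\mu=x_{\mu_1}\cdots x_{\mu_n}$ in the ring $\mathbb C\langle x_1,\dots,x_d\rangle$ of polynomials in noncommuting variables. A monomial ideal is a two-sided ideal generated by monomials; throughout, monomial ideals are generated by monomials of degree at least 2. It is of finite type $k$ if it is generated by a set $S$ of monomials whose maximal degree is $k+1$ and every generating set of monomials has maximal degree at least $k+1$; equivalently, being of finite type means being generated by a finite set of monomials. For a monomial ideal $\mathcal I$ put $\Lambda^*=\{\mu: x^\mu\notin\mathcal I\}$. The subproduct system $X$ of $\mathcal I$ has fibres $X(n)=\mathrm{span}\{e_\mu:\mu\in\Lambda^*,|\mu|=n\}$; $\mathcal F_X=\bigoplus_nX(n)$ is the Hilbert space with orthonormal basis $\{e_\mu:\mu\in\Lambda^*\}$. $T_i\in B(\mathcal F_X)$: $T_ie_\nu=e_{i\nu}$ if $i\nu\in\Lambda^*$, $T_ie_\nu=0$ otherwise. $C^*(T)$ is the C*-algebra generated by $I,T_1,\dots,T_d$ (it contains $\mathcal K(\mathcal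 F_X)$), and $\mathcal A_X$ is the norm-closed algebra generated by $I,T_1,\dots,T_d$. Representations of an operator algebra $\mathcal A$ are completely contractive homomorphisms. $\rho:\mathcal A\to B(K)$ is a dilation of $\phi:\mathcal A\to B(H)$ if $H\subseteq K$ and $P_H\rho(a)|_H=\phi(a)$ for all $a\in\mathcal A$; it is trivial if $H$ reduces $\rho(\mathcal A)$. $\phi$ is maximal if all its dilations are trivial. $\mathcal A\subseteq C^*(\mathcal A)$ is hyperrigid if for every faithful (unital) $*$-representation $\pi$ of $C^*(\mathcal A)$ the restriction $\pi|_{\mathcal A}$ is maximal. The C*-envelope is the co-universal C*-cover: a C*-algebra generated by a completely isometric copy of $\mathcal A$ that is a quotient, compatibly with $\mathcal A$, of every other such C*-algebra. *)

theory Defs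
  imports
    "HOL-Analysis.Analysis"
    "HOL-Library.Poly_Mapping"
    "HOL-Library.Extended_Nat"
    "HOL-Algebra.QuotRing"
    "HOL-Algebra.Module"
begin

section \<open>Monomial ideals in noncommuting variables\<close>

text \<open>
  The letters \<open>1, \<dots>, d\<close> are the elements of a finite type \<open>'d\<close>. Words are wrapped lists, so that
  they can carry the free monoid structure (written additively); the ring of polynomials in
  noncommuting variables is then the library's monoid algebra of finitely supported functions
  with the convolution product.
\<close>

datatype 'd word = Word (letters: "'d list")

instantiation word :: (type) monoid_add
begin

definition zero_word :: "'a word" where
  "0 = Word []"

definition plus_word :: "'a word \<Rightarrow> 'a word \<Rightarrow> 'a word" where
  "u + v = Word (letters u @ letters v)"

instance
  by standard (simp_all add: zero_word_def plus_word_def)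

end

type_synonym 'd ncpoly = "'d word \<Rightarrow>\<^sub>0 complex"

definition word_length :: "'d word \<Rightarrow> nat" where
  "word_length w = length (letters w)"

definition nc_monomial :: "'d word \<Rightarrow> 'd ncpoly" where
  "nc_monomial w = Poly_Mapping.single w 1"

definition two_sided_ideal :: "'r::ring_1 set \<Rightarrow> bool" where
  "two_sided_ideal J \<longleftrightarrow> 0 \<in> J \<and> (\<forall>x\<in>J. \<forall>y\<in>J. x + y \<in> J) \<and> (\<forall>x\<in>J. \<forall>a. a * x \<in> J \<and> x * a \<in> J)"

definition ideal_of_words :: "'d word set \<Rightarrow> 'd ncpoly set" where
  "ideal_of_words S = two_sided_ideal hull (nc_monomial ` S)"

definition monomial_ideal :: "'d ncpoly set \<Rightarrow> bool" where
  "monomial_ideal I \<longleftrightarrow> (\<exists>S. (\<forall>w\<in>S. 2 \<le> word_length w) \<and> I = ideal_of_words S)"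

text \<open>
  The maximal degree of a set of monomials, infinite if the degrees are unbounded. As all
  generators have degree at least 2, inserting 1 matters only for the empty set: with this
  convention the zero ideal, which is finitely generated, has type 0.
\<close>

definition max_degree :: "'d word set \<Rightarrow> enat" where
  "max_degree S = Sup (insert 1 ((\<lambda>w. enat (word_length w)) ` S))"

definition finite_type :: "'d ncpoly set \<Rightarrow> nat \<Rightarrow> bool" where
  "finite_type I k \<longleftrightarrow>
     (\<exists>S. I = ideal_of_words S \<and> max_degree S = enat (k + 1)) \<and>
     (\<forall>S. I = ideal_of_words S \<longrightarrow> enat (k + 1) \<le> max_degree S)"

definition allowed_words :: "'d ncpoly set \<Rightarrow> 'd word set" where
  "allowed_words I = {w. nc_monomial w \<notin> I}"


section \<open>Complex Hilbert spaces\<close>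

text \<open>The complex inner product is linear in the first argument.\<close>

class complex_hilbert = real_inner + banach +
  fixes scaleC :: "complex \<Rightarrow> 'a \<Rightarrow> 'a" (infixr \<open>*\<^sub>C\<close> 75)
    and cinner :: "'a \<Rightarrow> 'a \<Rightarrow> complex"
  assumes scaleC_add_right: "c *\<^sub>C (x + y) = c *\<^sub>C x + c *\<^sub>C y"
    and scaleC_add_left: "(b + c) *\<^sub>C x = b *\<^sub>C x + c *\<^sub>C x"
    and scaleC_scaleC: "b *\<^sub>C (c *\<^sub>C x) = (b * c) *\<^sub>C x"
    and scaleC_of_real: "complex_of_real r *\<^sub>C x = r *\<^sub>R x"
    and cinner_commute: "cinner x y = cnj (cinner y x)"
    and cinner_add_left: "cinner (x + y) z = cinner x z + cinner y z"
    and cinner_scaleC_left: "cinner (c *\<^sub>C x) y = c * cinner x y"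
    and inner_eq_Re_cinner: "inner x y = Re (cinner x y)"

definition csubspace :: "'h::complex_hilbert set \<Rightarrow> bool" where
  "csubspace V \<longleftrightarrow> 0 \<in> V \<and> (\<forall>x\<in>V. \<forall>y\<in>V. x + y \<in> V) \<and> (\<forall>x\<in>V. \<forall>c. c *\<^sub>C x \<in> V)"

definition closed_csubspace :: "'h::complex_hilbert set \<Rightarrow> bool" where
  "closed_csubspace V \<longleftrightarrow> csubspace V \<and> closed V"


subsection \<open>Square-summable families\<close>

typedef 'a ell2 = "{f :: 'a \<Rightarrow> complex. (\<lambda>x. (cmod (f x))\<^sup>2) summable_on UNIV}"
  morphisms ell2_apply Abs_ell2
  by (rule exI[of _ "\<lambda>_. 0"]) simp

setup_lifting type_definition_ell2

lemma ell2_add_summable: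
  assumes "(\<lambda>x. (cmod (f x))\<^sup>2) summable_on UNIV" "(\<lambda>x. (cmod (g x))\<^sup>2) summable_on UNIV"
  shows "(\<lambda>x. (cmod (f x + g x))\<^sup>2) summable_on UNIV"
proof -
  have le: "(cmod (f x + g x))\<^sup>2 \<le> 2 * (cmod (f x))\<^sup>2 + 2 * (cmod (g x))\<^sup>2" for x
  proof -
    have "(cmod (f x + g x))\<^sup>2 \<le> (cmod (f x) + cmod (g x))\<^sup>2"
      by (intro power_mono norm_triangle_ineq) simp
    also have "\<dots> \<le> 2 * (cmod (f x))\<^sup>2 + 2 * (cmod (g x))\<^sup>2"
      using sum_squares_bound[of "cmod (f x)" "cmod (g x)"] by (simp add: power2_sum)
    finally show ?thesis .
  qed
  have "(\<lambda>x. 2 * (cmod (f x))\<^sup>2 + 2 * (cmod (g x))\<^sup>2) summable_on UNIV"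
    by (intro summable_on_add summable_on_cmult_right assms)
  then show ?thesis
    by (rule summable_on_comparison_test) (use le in auto)
qed

lemma ell2_scale_summable:
  assumes "(\<lambda>x. (cmod (f x))\<^sup>2) summable_on UNIV"
  shows "(\<lambda>x. (cmod (c * f x))\<^sup>2) summable_on UNIV"
  using summable_on_cmult_right[OF assms, of "(cmod c)\<^sup>2"]
  by (simp add: norm_mult power_mult_distrib)

lemma ell2_prod_summable:
  assumes "(\<lambda>x. (cmod (f x))\<^sup>2) summable_on UNIV" "(\<lambda>x. (cmod (g x))\<^sup>2) summable_on UNIV"
  shows "(\<lambda>x. f x * cnj (g x)) summable_on UNIV"
proof -
  have le: "norm (f x * cnj (g x)) \<le> (cmod (f x))\<^sup>2 + (cmod (g x))\<^sup>2" for x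
  proof -
    have "2 * (cmod (f x) * cmod (g x)) \<le> (cmod (f x))\<^sup>2 + (cmod (g x))\<^sup>2"
      using sum_squares_bound[of "cmod (f x)" "cmod (g x)"] by (simp add: mult.assoc)
    moreover have "0 \<le> cmod (f x) * cmod (g x)" by simp
    ultimately have "cmod (f x) * cmod (g x) \<le> (cmod (f x))\<^sup>2 + (cmod (g x))\<^sup>2" by linarith
    then show ?thesis by (simp add: norm_mult)
  qed
  have "(\<lambda>x. (cmod (f x))\<^sup>2 + (cmod (g x))\<^sup>2) summable_on UNIV"
    by (intro summable_on_add assms)
  then have "(\<lambda>x. norm (f x * cnj (g x))) summable_on UNIV"
    by (rule summable_on_comparison_test) (use le in auto)
  then show ?thesis
    by (rule abs_summable_summable)
qed

lemma ell2_apply_summable: "(\<lambda>x. (cmod (ell2_apply f x))\<^sup>2) summable_on UNIV"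
  using ell2_apply[of f] by simp

lemma ell2_infsum_of_real:
  fixes g :: "'a \<Rightarrow> real"
  assumes "g summable_on UNIV"
  shows "(\<Sum>\<^sub>\<infinity>x. complex_of_real (g x)) = complex_of_real (\<Sum>\<^sub>\<infinity>x. g x)"
  by (rule infsumI) (simp add: has_sum_of_real_iff assms)

instantiation ell2 :: (type) real_inner
begin

lift_definition zero_ell2 :: "'a ell2" is "\<lambda>_. 0" by simp
lift_definition plus_ell2 :: "'a ell2 \<Rightarrow> 'a ell2 \<Rightarrow> 'a ell2" is "\<lambda>f g x. f x + g x"
  by (rule ell2_add_summable)
lift_definition uminus_ell2 :: "'a ell2 \<Rightarrow> 'a ell2" is "\<lambda>f x. - f x" by simp
lift_definition minus_ell2 :: "'a ell2 \<Rightarrow> 'a ell2 \<Rightarrow> 'a ell2" is "\<lambda>f g x. f x - g x"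
  subgoal for f g using ell2_add_summable[of f "\<lambda>x. - g x"] by simp
  done
lift_definition scaleR_ell2 :: "real \<Rightarrow> 'a ell2 \<Rightarrow> 'a ell2" is "\<lambda>r f x. complex_of_real r * f x"
  by (rule ell2_scale_summable)
definition inner_ell2 :: "'a ell2 \<Rightarrow> 'a ell2 \<Rightarrow> real" where
  "inner_ell2 f g = Re (\<Sum>\<^sub>\<infinity>x. ell2_apply f x * cnj (ell2_apply g x))"
definition norm_ell2 :: "'a ell2 \<Rightarrow> real" where
  "norm_ell2 f = sqrt (inner f f)"
definition dist_ell2 :: "'a ell2 \<Rightarrow> 'a ell2 \<Rightarrow> real" where
  "dist_ell2 f g = norm (f - g)"
definition sgn_ell2 :: "'a ell2 \<Rightarrow> 'a ell2" where
  "sgn_ell2 f = inverse (norm f) *\<^sub>R f"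
definition uniformity_ell2 :: "('a ell2 \<times> 'a ell2) filter" where
  "uniformity_ell2 = (INF e\<in>{0<..}. principal {(x, y). dist x y < e})"
definition open_ell2 :: "'a ell2 set \<Rightarrow> bool" where
  "open_ell2 U = (\<forall>x\<in>U. eventually (\<lambda>(x', y). x' = x \<longrightarrow> y \<in> U) uniformity)"

instance
proof
  fix f g h :: "'a ell2" and r s :: real
  let ?p = "\<lambda>f g x. ell2_apply f x * cnj (ell2_apply g x)"
  have summ: "?p f g summable_on UNIV" for f g :: "'a ell2"
    by (intro ell2_prod_summable ell2_apply_summable)
  show "f + g + h = f + (g + h)" by transfer (simp add: add.assoc)
  show "f + g = g + f" by transfer (simp add: add.commute)
  show "0 + f = f" by transfer simp
  show "- f + f = 0" by transfer simp
  show "f - g = f + - g" by transfer simp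
  show "r *\<^sub>R (f + g) = r *\<^sub>R f + r *\<^sub>R g" by transfer (simp add: algebra_simps)
  show "(r + s) *\<^sub>R f = r *\<^sub>R f + s *\<^sub>R f" by transfer (simp add: algebra_simps)
  show "r *\<^sub>R s *\<^sub>R f = (r * s) *\<^sub>R f" by transfer (simp add: algebra_simps)
  show "1 *\<^sub>R f = f" by transfer simp
  show "sgn f = inverse (norm f) *\<^sub>R f" by (rule sgn_ell2_def)
  show "dist f g = norm (f - g)" by (rule dist_ell2_def)
  show "(uniformity :: ('a ell2 \<times> 'a ell2) filter) = (INF e\<in>{0<..}. principal {(x, y). dist x y < e})"
    by (rule uniformity_ell2_def)
  show "open U = (\<forall>x\<in>U. eventually (\<lambda>(x', y). x' = x \<longrightarrow> y \<in> U) uniformity)" for U :: "'a ell2 set"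
    by (rule open_ell2_def)
  have "cnj (infsum (?p g f) UNIV) = infsum (?p f g) UNIV"
    unfolding infsum_cnj[symmetric] by (simp add: mult.commute)
  from arg_cong[OF this, of Re]
  have "Re (infsum (?p f g) UNIV) = Re (infsum (?p g f) UNIV)" by simp
  then show "inner f g = inner g f" by (simp add: inner_ell2_def)
  have "infsum (?p (f + g) h) UNIV = infsum (?p f h) UNIV + infsum (?p g h) UNIV"
    unfolding infsum_add[OF summ summ, symmetric]
    by (rule infsum_cong) (simp add: plus_ell2.rep_eq algebra_simps)
  then show "inner (f + g) h = inner f h + inner g h" by (simp add: inner_ell2_def)
  have "infsum (?p (r *\<^sub>R f) g) UNIV = complex_of_real r * infsum (?p f g) UNIV"
    unfolding infsum_cmult_right[OF summ, symmetric]
    by (rule infsum_cong) (simp add: scaleR_ell2.rep_eq algebra_simps)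
  then show "inner (r *\<^sub>R f) g = r * inner f g" by (simp add: inner_ell2_def)
  have sq: "inner f f = (\<Sum>\<^sub>\<infinity>x. (cmod (ell2_apply f x))\<^sup>2)"
  proof -
    have "infsum (?p f f) UNIV = (\<Sum>\<^sub>\<infinity>x. complex_of_real ((cmod (ell2_apply f x))\<^sup>2))"
      by (rule infsum_cong) (simp add: complex_mult_cnj cmod_power2)
    also have "\<dots> = complex_of_real (\<Sum>\<^sub>\<infinity>x. (cmod (ell2_apply f x))\<^sup>2)"
      by (rule ell2_infsum_of_real[OF ell2_apply_summable])
    finally show ?thesis by (simp add: inner_ell2_def)
  qed
  show "0 \<le> inner f f" unfolding sq by (rule infsum_nonneg) simp
  show "inner f f = 0 \<longleftrightarrow> f = 0"
  proof
    assume "inner f f = 0"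
    have "(cmod (ell2_apply f x))\<^sup>2 = 0" for x
      by (rule nonneg_infsum_le_0D[of "\<lambda>x. (cmod (ell2_apply f x))\<^sup>2" UNIV])
        (use sq \<open>inner f f = 0\<close> ell2_apply_summable[of f] in auto)
    then have "ell2_apply f = ell2_apply 0" by (auto simp: zero_ell2.rep_eq)
    then show "f = 0" by (simp add: ell2_apply_inject)
  next
    assume "f = 0"
    then show "inner f f = 0" by (simp add: inner_ell2_def zero_ell2.rep_eq)
  qed
  show "norm f = sqrt (inner f f)" by (rule norm_ell2_def)
qed

end

lemma ell2_norm_sq: "(norm f)\<^sup>2 = (\<Sum>\<^sub>\<infinity>x. (cmod (ell2_apply f x))\<^sup>2)"
proof -
  have "(\<Sum>\<^sub>\<infinity>x. ell2_apply f x * cnj (ell2_apply f x))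
      = (\<Sum>\<^sub>\<infinity>x. complex_of_real ((cmod (ell2_apply f x))\<^sup>2))"
    by (rule infsum_cong) (simp add: complex_mult_cnj cmod_power2)
  also have "\<dots> = complex_of_real (\<Sum>\<^sub>\<infinity>x. (cmod (ell2_apply f x))\<^sup>2)"
    by (rule ell2_infsum_of_real[OF ell2_apply_summable])
  finally show ?thesis
    by (simp add: power2_norm_eq_inner inner_ell2_def)
qed

lemma ell2_sum_le_norm_sq:
  assumes "finite F"
  shows "(\<Sum>x\<in>F. (cmod (ell2_apply f x))\<^sup>2) \<le> (norm f)\<^sup>2"
  unfolding ell2_norm_sq
  by (rule finite_sum_le_infsum) (use ell2_apply_summable assms in auto)

lemma ell2_apply_le_norm: "cmod (ell2_apply f x) \<le> norm f"
  using ell2_sum_le_norm_sq[of "{x}" f] by (simp add: abs_le_square_iff[symmetric])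

instance ell2 :: (type) banach
proof
  fix X :: "nat \<Rightarrow> 'a ell2"
  assume "Cauchy X"
  have diff: "ell2_apply (f - g) x = ell2_apply f x - ell2_apply g x" for f g :: "'a ell2" and x
    by (simp add: minus_ell2.rep_eq)
  have "Cauchy (\<lambda>n. ell2_apply (X n) x)" for x
  proof (rule metric_CauchyI)
    fix e :: real assume "0 < e"
    then obtain N where N: "\<And>m n. m \<ge> N \<Longrightarrow> n \<ge> N \<Longrightarrow> dist (X m) (X n) < e"
      using metric_CauchyD[OF \<open>Cauchy X\<close>] by blast
    then have "dist (ell2_apply (X m) x) (ell2_apply (X n) x) < e" if "m \<ge> N" "n \<ge> N" for m n
      using that ell2_apply_le_norm[of "X m - X n" x] by (fastforce simp: dist_norm diff)
    then show "\<exists>N. \<forall>m\<ge>N. \<forall>n\<ge>N. dist (ell2_apply (X m) x) (ell2_apply (X n) x) < e" by blast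
  qed
  then have "\<exists>l. (\<lambda>n. ell2_apply (X n) x) \<longlonglongrightarrow> l" for x
    by (simp add: Cauchy_convergent_iff convergent_def)
  then obtain f where f: "\<And>x. (\<lambda>n. ell2_apply (X n) x) \<longlonglongrightarrow> f x" by metis
  have bound: "\<exists>N. \<forall>n\<ge>N. \<forall>F. finite F \<longrightarrow> (\<Sum>x\<in>F. (cmod (ell2_apply (X n) x - f x))\<^sup>2) \<le> e\<^sup>2"
    if "0 < e" for e :: real
  proof -
    obtain N where N: "\<And>m n. m \<ge> N \<Longrightarrow> n \<ge> N \<Longrightarrow> dist (X m) (X n) < e"
      using metric_CauchyD[OF \<open>Cauchy X\<close> \<open>0 < e\<close>] by blast
    have "(\<Sum>x\<in>F. (cmod (ell2_apply (X n) x - f x))\<^sup>2) \<le> e\<^sup>2" if "n \<ge> N" "finite F" for n F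
    proof (rule LIMSEQ_le_const2)
      show "(\<lambda>m. \<Sum>x\<in>F. (cmod (ell2_apply (X n) x - ell2_apply (X m) x))\<^sup>2)
              \<longlonglongrightarrow> (\<Sum>x\<in>F. (cmod (ell2_apply (X n) x - f x))\<^sup>2)"
        by (intro tendsto_intros f)
      have "(\<Sum>x\<in>F. (cmod (ell2_apply (X n) x - ell2_apply (X m) x))\<^sup>2) \<le> e\<^sup>2" if "m \<ge> N" for m
      proof -
        have "(\<Sum>x\<in>F. (cmod (ell2_apply (X n) x - ell2_apply (X m) x))\<^sup>2) \<le> (norm (X n - X m))\<^sup>2"
          using ell2_sum_le_norm_sq[OF \<open>finite F\<close>, of "X n - X m"] by (simp add: diff)
        also have "\<dots> \<le> e\<^sup>2"
          using N[OF \<open>n \<ge> N\<close> that] by (intro power_mono) (auto simp: dist_norm)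
        finally show ?thesis .
      qed
      then show "\<exists>N. \<forall>m\<ge>N. (\<Sum>x\<in>F. (cmod (ell2_apply (X n) x - ell2_apply (X m) x))\<^sup>2) \<le> e\<^sup>2"
        by blast
    qed
    then show ?thesis by blast
  qed
  have summ: "(\<lambda>x. (cmod (f x))\<^sup>2) summable_on UNIV"
  proof -
    obtain N where N: "\<And>F. finite F \<Longrightarrow> (\<Sum>x\<in>F. (cmod (ell2_apply (X N) x - f x))\<^sup>2) \<le> 1"
      using bound[of 1] by auto
    have "(\<lambda>x. (cmod (f x - ell2_apply (X N) x))\<^sup>2) summable_on UNIV"
      by (rule nonneg_bdd_above_summable_on)
        (use N in \<open>auto simp: bdd_above_def norm_minus_commute intro!: exI[of _ 1]\<close>)
    from ell2_add_summable[OF this ell2_apply_summable[of "X N"]] show ?thesis by simp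
  qed
  define L where "L = Abs_ell2 f"
  have L: "ell2_apply L = f" unfolding L_def using summ by (simp add: Abs_ell2_inverse)
  have "X \<longlonglongrightarrow> L"
  proof (rule metric_LIMSEQ_I)
    fix e :: real assume "0 < e"
    then obtain N where N: "\<And>n F. n \<ge> N \<Longrightarrow> finite F \<Longrightarrow>
        (\<Sum>x\<in>F. (cmod (ell2_apply (X n) x - f x))\<^sup>2) \<le> (e/2)\<^sup>2"
      using bound[of "e/2"] by auto
    have "dist (X n) L < e" if "n \<ge> N" for n
    proof -
      have "(norm (X n - L))\<^sup>2 \<le> (e/2)\<^sup>2"
        unfolding ell2_norm_sq
        by (rule infsum_le_finite_sums[OF ell2_apply_summable]) (use N[OF that] in \<open>simp add: diff L\<close>)
      then have "norm (X n - L) \<le> e/2"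
        by (rule power2_le_imp_le) (use \<open>0 < e\<close> in simp)
      then show ?thesis using \<open>0 < e\<close> by (simp add: dist_norm)
    qed
    then show "\<exists>N. \<forall>n\<ge>N. dist (X n) L < e" by blast
  qed
  then show "convergent X" by (auto simp: convergent_def)
qed

instantiation ell2 :: (type) complex_hilbert
begin

lift_definition scaleC_ell2 :: "complex \<Rightarrow> 'a ell2 \<Rightarrow> 'a ell2" is "\<lambda>c f x. c * f x"
  by (rule ell2_scale_summable)
definition cinner_ell2 :: "'a ell2 \<Rightarrow> 'a ell2 \<Rightarrow> complex" where
  "cinner_ell2 f g = (\<Sum>\<^sub>\<infinity>x. ell2_apply f x * cnj (ell2_apply g x))"

instance
proof
  fix f g h :: "'a ell2" and b c :: complex and r :: real
  let ?p = "\<lambda>f g x. ell2_apply f x * cnj (ell2_apply g x)"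
  have summ: "?p f g summable_on UNIV" for f g :: "'a ell2"
    by (intro ell2_prod_summable ell2_apply_summable)
  show "c *\<^sub>C (f + g) = c *\<^sub>C f + c *\<^sub>C g" by transfer (simp add: algebra_simps)
  show "(b + c) *\<^sub>C f = b *\<^sub>C f + c *\<^sub>C f" by transfer (simp add: algebra_simps)
  show "b *\<^sub>C (c *\<^sub>C f) = (b * c) *\<^sub>C f" by transfer (simp add: algebra_simps)
  show "complex_of_real r *\<^sub>C f = r *\<^sub>R f" by transfer simp
  show "cinner f g = cnj (cinner g f)"
    unfolding cinner_ell2_def infsum_cnj[symmetric] by (simp add: mult.commute)
  show "cinner (f + g) h = cinner f h + cinner g h"
    unfolding cinner_ell2_def infsum_add[OF summ summ, symmetric]
    by (rule infsum_cong) (simp add: plus_ell2.rep_eq algebra_simps)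
  show "cinner (c *\<^sub>C f) g = c * cinner f g"
    unfolding cinner_ell2_def infsum_cmult_right[OF summ, symmetric]
    by (rule infsum_cong) (simp add: scaleC_ell2.rep_eq algebra_simps)
  show "inner f g = Re (cinner f g)" by (simp add: inner_ell2_def cinner_ell2_def)
qed

end

lift_definition ket :: "'a \<Rightarrow> 'a ell2" is "\<lambda>a x. if x = a then 1 else 0"
  subgoal for a
    by (rule finite_nonzero_values_imp_summable_on) (simp add: if_distrib[of cmod] cong: if_cong)
  done


section \<open>Unital C*-algebras\<close>

record 'a cstar_alg = "(complex, 'a) module" +
  star :: "'a \<Rightarrow> 'a"
  nrm :: "'a \<Rightarrow> real"

definition complex_ring :: "complex ring" where
  "complex_ring = \<lparr>carrier = UNIV, mult = (*), one = 1, zero = 0, add = (+)\<rparr>"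

text \<open>Unital C*-algebras; the zero algebra, in which \<open>\<one> = \<zero>\<close>, is included.\<close>

locale cstar_algebra = ring A + Module.module complex_ring A for A (structure) +
  assumes smult_mult_left:
      "\<lbrakk>x \<in> carrier A; y \<in> carrier A\<rbrakk> \<Longrightarrow> (c \<odot>\<^bsub>A\<^esub> x) \<otimes>\<^bsub>A\<^esub> y = c \<odot>\<^bsub>A\<^esub> (x \<otimes>\<^bsub>A\<^esub> y)"
    and smult_mult_right:
      "\<lbrakk>x \<in> carrier A; y \<in> carrier A\<rbrakk> \<Longrightarrow> x \<otimes>\<^bsub>A\<^esub> (c \<odot>\<^bsub>A\<^esub> y) = c \<odot>\<^bsub>A\<^esub> (x \<otimes>\<^bsub>A\<^esub> y)"
    and star_closed: "x \<in> carrier A \<Longrightarrow> star A x \<in> carrier A"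
    and star_star: "x \<in> carrier A \<Longrightarrow> star A (star A x) = x"
    and star_add:
      "\<lbrakk>x \<in> carrier A; y \<in> carrier A\<rbrakk> \<Longrightarrow> star A (x \<oplus>\<^bsub>A\<^esub> y) = star A x \<oplus>\<^bsub>A\<^esub> star A y"
    and star_smult: "x \<in> carrier A \<Longrightarrow> star A (c \<odot>\<^bsub>A\<^esub> x) = cnj c \<odot>\<^bsub>A\<^esub> star A x"
    and star_mult:
      "\<lbrakk>x \<in> carrier A; y \<in> carrier A\<rbrakk> \<Longrightarrow> star A (x \<otimes>\<^bsub>A\<^esub> y) = star A y \<otimes>\<^bsub>A\<^esub> star A x"
    and nrm_nonneg: "x \<in> carrier A \<Longrightarrow> 0 \<le> nrm A x"
    and nrm_eq_0_iff: "x \<in> carrier A \<Longrightarrow> nrm A x = 0 \<longleftrightarrow> x = \<zero>\<^bsub>A\<^esub>"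
    and nrm_triangle:
      "\<lbrakk>x \<in> carrier A; y \<in> carrier A\<rbrakk> \<Longrightarrow> nrm A (x \<oplus>\<^bsub>A\<^esub> y) \<le> nrm A x + nrm A y"
    and nrm_smult: "x \<in> carrier A \<Longrightarrow> nrm A (c \<odot>\<^bsub>A\<^esub> x) = cmod c * nrm A x"
    and nrm_mult:
      "\<lbrakk>x \<in> carrier A; y \<in> carrier A\<rbrakk> \<Longrightarrow> nrm A (x \<otimes>\<^bsub>A\<^esub> y) \<le> nrm A x * nrm A y"
    and cstar_identity: "x \<in> carrier A \<Longrightarrow> nrm A (star A x \<otimes>\<^bsub>A\<^esub> x) = (nrm A x)\<^sup>2"
    and nrm_complete:
      "\<lbrakk>\<And>n. f n \<in> carrier A;
        \<And>e. 0 < e \<Longrightarrow> \<exists>N. \<forall>m\<ge>N. \<forall>n\<ge>N. nrm A (f m \<ominus>\<^bsub>A\<^esub> f n) < e\<rbrakk>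
       \<Longrightarrow> \<exists>x\<in>carrier A. (\<lambda>n. nrm A (f n \<ominus>\<^bsub>A\<^esub> x)) \<longlonglongrightarrow> 0"

definition nrm_closed :: "('a, 'm) cstar_alg_scheme \<Rightarrow> 'a set \<Rightarrow> bool" where
  "nrm_closed A S \<longleftrightarrow>
     (\<forall>f x. (\<forall>n::nat. f n \<in> S) \<and> x \<in> carrier A \<and> (\<lambda>n. nrm A (f n \<ominus>\<^bsub>A\<^esub> x)) \<longlonglongrightarrow> 0 \<longrightarrow> x \<in> S)"

definition closed_subalgebra :: "('a, 'm) cstar_alg_scheme \<Rightarrow> 'a set \<Rightarrow> bool" where
  "closed_subalgebra A S \<longleftrightarrow>
     S \<subseteq> carrier A \<and> \<zero>\<^bsub>A\<^esub> \<in> S \<and>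
     (\<forall>x\<in>S. \<forall>y\<in>S. x \<oplus>\<^bsub>A\<^esub> y \<in> S \<and> x \<otimes>\<^bsub>A\<^esub> y \<in> S) \<and>
     (\<forall>c. \<forall>x\<in>S. c \<odot>\<^bsub>A\<^esub> x \<in> S) \<and> nrm_closed A S"

definition cstar_subalgebra :: "('a, 'm) cstar_alg_scheme \<Rightarrow> 'a set \<Rightarrow> bool" where
  "cstar_subalgebra A S \<longleftrightarrow> closed_subalgebra A S \<and> (\<forall>x\<in>S. star A x \<in> S)"

definition generated_algebra :: "('a, 'm) cstar_alg_scheme \<Rightarrow> 'a set \<Rightarrow> 'a set" where
  "generated_algebra A S = closed_subalgebra A hull S"

definition generated_cstar :: "('a, 'm) cstar_alg_scheme \<Rightarrow> 'a set \<Rightarrow> 'a set" where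
  "generated_cstar A S = cstar_subalgebra A hull S"

text \<open>
  The quotient of a C*-algebra by a closed two-sided self-adjoint ideal \<open>J\<close>, with the quotient
  norm: the ring structure is that of the library's quotient ring of cosets.
\<close>

definition cstar_quotient :: "('a, 'm) cstar_alg_scheme \<Rightarrow> 'a set \<Rightarrow> 'a set cstar_alg" where
  "cstar_quotient A J =
     \<lparr>carrier = carrier (A Quot J), mult = mult (A Quot J), one = one (A Quot J),
      zero = zero (A Quot J), add = add (A Quot J),
      smult = (\<lambda>c X. \<Union>x\<in>X. J +>\<^bsub>A\<^esub> (c \<odot>\<^bsub>A\<^esub> x)),
      star = (\<lambda>X. \<Union>x\<in>X. J +>\<^bsub>A\<^esub> star A x),
      nrm = (\<lambda>X. INF x\<in>X. nrm A x)\<rparr>"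


subsection \<open>Matrix norms\<close>

text \<open>
  An \<open>n \<times> n\<close> matrix over \<open>A\<close> is a function on pairs of indices with zero entries outside the
  range. The matrix norm is the unique norm that makes the *-algebra of these matrices a
  C*-algebra; the side condition fixes its irrelevant values on non-matrices.
\<close>

definition matrices_over :: "('a, 'm) cstar_alg_scheme \<Rightarrow> nat \<Rightarrow> 'a set \<Rightarrow> (nat \<Rightarrow> nat \<Rightarrow> 'a) set" where
  "matrices_over A n S =
     {M. \<forall>i j. if i < n \<and> j < n then M i j \<in> S else M i j = \<zero>\<^bsub>A\<^esub>}"

definition matrix_algebra ::
    "('a, 'm) cstar_alg_scheme \<Rightarrow> nat \<Rightarrow> ((nat \<Rightarrow> nat \<Rightarrow> 'a) \<Rightarrow> real) \<Rightarrow> (nat \<Rightarrow> nat \<Rightarrow> 'a) cstar_alg" where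
  "matrix_algebra A n N =
     \<lparr>carrier = matrices_over A n (carrier A),
      mult = (\<lambda>L M i j. \<Oplus>\<^bsub>A\<^esub>k\<in>{..<n}. L i k \<otimes>\<^bsub>A\<^esub> M k j),
      one = (\<lambda>i j. if i = j \<and> i < n then \<one>\<^bsub>A\<^esub> else \<zero>\<^bsub>A\<^esub>),
      zero = (\<lambda>i j. \<zero>\<^bsub>A\<^esub>),
      add = (\<lambda>L M i j. L i j \<oplus>\<^bsub>A\<^esub> M i j),
      smult = (\<lambda>c M i j. c \<odot>\<^bsub>A\<^esub> M i j),
      star = (\<lambda>M i j. star A (M j i)),
      nrm = N\<rparr>"

definition matrix_norm :: "('a, 'm) cstar_alg_scheme \<Rightarrow> nat \<Rightarrow> (nat \<Rightarrow> nat \<Rightarrow> 'a) \<Rightarrow> real" where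
  "matrix_norm A n =
     (THE N. cstar_algebra (matrix_algebra A n N) \<and>
             (\<forall>M. M \<notin> matrices_over A n (carrier A) \<longrightarrow> N M = 0))"

definition matrix_map ::
    "('b, 'n) cstar_alg_scheme \<Rightarrow> nat \<Rightarrow> ('a \<Rightarrow> 'b) \<Rightarrow> (nat \<Rightarrow> nat \<Rightarrow> 'a) \<Rightarrow> nat \<Rightarrow> nat \<Rightarrow> 'b" where
  "matrix_map B n \<phi> M = (\<lambda>i j. if i < n \<and> j < n then \<phi> (M i j) else \<zero>\<^bsub>B\<^esub>)"


subsection \<open>Homomorphisms\<close>

text \<open>An operator algebra is a subalgebra \<open>A\<close> of a C*-algebra \<open>C\<close>, with the matrix norms of \<open>C\<close>.\<close>

definition algebra_hom ::
    "('a, 'm) cstar_alg_scheme \<Rightarrow> 'a set \<Rightarrow> ('b, 'n) cstar_alg_scheme \<Rightarrow> ('a \<Rightarrow> 'b) \<Rightarrow> bool" where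
  "algebra_hom C A B \<phi> \<longleftrightarrow>
     (\<forall>x\<in>A. \<phi> x \<in> carrier B) \<and>
     (\<forall>x\<in>A. \<forall>y\<in>A. \<phi> (x \<oplus>\<^bsub>C\<^esub> y) = \<phi> x \<oplus>\<^bsub>B\<^esub> \<phi> y \<and> \<phi> (x \<otimes>\<^bsub>C\<^esub> y) = \<phi> x \<otimes>\<^bsub>B\<^esub> \<phi> y) \<and>
     (\<forall>c. \<forall>x\<in>A. \<phi> (c \<odot>\<^bsub>C\<^esub> x) = c \<odot>\<^bsub>B\<^esub> \<phi> x)"

definition star_hom ::
    "('a, 'm) cstar_alg_scheme \<Rightarrow> ('b, 'n) cstar_alg_scheme \<Rightarrow> ('a \<Rightarrow> 'b) \<Rightarrow> bool" where
  "star_hom C B \<pi> \<longleftrightarrow>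
     algebra_hom C (carrier C) B \<pi> \<and> (\<forall>x\<in>carrier C. \<pi> (star C x) = star B (\<pi> x))"

definition completely_contractive ::
    "('a, 'm) cstar_alg_scheme \<Rightarrow> 'a set \<Rightarrow> ('b, 'n) cstar_alg_scheme \<Rightarrow> ('a \<Rightarrow> 'b) \<Rightarrow> bool" where
  "completely_contractive C A B \<phi> \<longleftrightarrow>
     (\<forall>n. \<forall>M\<in>matrices_over C n A. matrix_norm B n (matrix_map B n \<phi> M) \<le> matrix_norm C n M)"

definition completely_isometric ::
    "('a, 'm) cstar_alg_scheme \<Rightarrow> 'a set \<Rightarrow> ('b, 'n) cstar_alg_scheme \<Rightarrow> ('a \<Rightarrow> 'b) \<Rightarrow> bool" where
  "completely_isometric C A B \<phi> \<longleftrightarrow>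
     (\<forall>n. \<forall>M\<in>matrices_over C n A. matrix_norm B n (matrix_map B n \<phi> M) = matrix_norm C n M)"


section \<open>Operators on a Hilbert space\<close>

text \<open>
  Hilbert spaces occur as closed subspaces \<open>H\<close> of an ambient Hilbert space \<open>'h\<close>. An operator on
  \<open>H\<close> is represented by its extension by zero on the orthogonal complement of \<open>H\<close>; so the
  identity operator of \<open>H\<close> is the orthogonal projection onto \<open>H\<close>, and norms, adjoints and
  compactness may be computed in the ambient space.
\<close>

definition operators_on :: "'h::complex_hilbert set \<Rightarrow> ('h \<Rightarrow>\<^sub>L 'h) set" where
  "operators_on H =
     {a. (\<forall>c x. blinfun_apply a (c *\<^sub>C x) = c *\<^sub>C blinfun_apply a x) \<and>
         (\<forall>x. blinfun_apply a x \<in> H) \<and>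
         (\<forall>x. (\<forall>h\<in>H. cinner x h = 0) \<longrightarrow> blinfun_apply a x = 0)}"

definition proj :: "'h::complex_hilbert set \<Rightarrow> 'h \<Rightarrow>\<^sub>L 'h" where
  "proj H = (THE p. p \<in> operators_on H \<and> (\<forall>x\<in>H. blinfun_apply p x = x))"

definition adj :: "('h::complex_hilbert \<Rightarrow>\<^sub>L 'h) \<Rightarrow> 'h \<Rightarrow>\<^sub>L 'h" where
  "adj a = (THE b. \<forall>x y. cinner (blinfun_apply a x) y = cinner x (blinfun_apply b y))"

definition bounded_operators :: "'h::complex_hilbert set \<Rightarrow> ('h \<Rightarrow>\<^sub>L 'h) cstar_alg" where
  "bounded_operators H =
     \<lparr>carrier = operators_on H, mult = (o\<^sub>L), one = proj H, zero = 0, add = (+),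
      smult = (\<lambda>c a. Blinfun (\<lambda>x. c *\<^sub>C blinfun_apply a x)), star = adj, nrm = norm\<rparr>"

definition compact_operators :: "'h::complex_hilbert set \<Rightarrow> ('h \<Rightarrow>\<^sub>L 'h) set" where
  "compact_operators H =
     {a \<in> operators_on H. compact (closure (blinfun_apply a ` cball 0 1))}"


section \<open>Representations, dilations, hyperrigidity and the C*-envelope\<close>

definition representation ::
    "('a, 'm) cstar_alg_scheme \<Rightarrow> 'a set \<Rightarrow> 'h::complex_hilbert set \<Rightarrow> ('a \<Rightarrow> 'h \<Rightarrow>\<^sub>L 'h) \<Rightarrow> bool" where
  "representation C A H \<phi> \<longleftrightarrow>
     algebra_hom C A (bounded_operators H) \<phi> \<and> completely_contractive C A (bounded_operators H) \<phi>"

definition dilation ::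
    "('a, 'm) cstar_alg_scheme \<Rightarrow> 'a set \<Rightarrow> 'h::complex_hilbert set \<Rightarrow> ('a \<Rightarrow> 'h \<Rightarrow>\<^sub>L 'h) \<Rightarrow>
     'h set \<Rightarrow> ('a \<Rightarrow> 'h \<Rightarrow>\<^sub>L 'h) \<Rightarrow> bool" where
  "dilation C A H \<phi> K \<rho> \<longleftrightarrow>
     closed_csubspace K \<and> H \<subseteq> K \<and> representation C A K \<rho> \<and>
     (\<forall>a\<in>A. \<forall>h\<in>H. blinfun_apply (proj H) (blinfun_apply (\<rho> a) h) = blinfun_apply (\<phi> a) h)"

definition reduces :: "'h::complex_hilbert set \<Rightarrow> ('h \<Rightarrow>\<^sub>L 'h) set \<Rightarrow> bool" where
  "reduces H S \<longleftrightarrow> (\<forall>s\<in>S. \<forall>h\<in>H. blinfun_apply s h \<in> H \<and> blinfun_apply (adj s) h \<in> H)"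

text \<open>
  In the next two definitions the dilation spaces \<open>K\<close> (and with them \<open>H\<close>) range over the closed
  subspaces of the type \<open>'h\<close>. HOL cannot quantify over all Hilbert spaces inside a formula; the
  unrestricted notion of hyperrigidity is \<open>hyperrigid TYPE('h) C A\<close> for every \<open>'h\<close>, i.e. with \<open>'h\<close> a
  free type variable of a theorem, since \<open>'h\<close> can then be taken to be any given \<open>K\<close>.
\<close>

definition maximal_representation ::
    "('a, 'm) cstar_alg_scheme \<Rightarrow> 'a set \<Rightarrow> 'h::complex_hilbert set \<Rightarrow> ('a \<Rightarrow> 'h \<Rightarrow>\<^sub>L 'h) \<Rightarrow> bool" where
  "maximal_representation C A H \<phi> \<longleftrightarrow>
     representation C A H \<phi> \<and> (\<forall>K \<rho>. dilation C A H \<phi> K \<rho> \<longrightarrow> reduces H (\<rho> ` A))"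

definition hyperrigid ::
    "'h::complex_hilbert itself \<Rightarrow> ('a, 'm) cstar_alg_scheme \<Rightarrow> 'a set \<Rightarrow> bool" where
  "hyperrigid _ C A \<longleftrightarrow>
     generated_cstar C A = carrier C \<and>
     (\<forall>(H :: 'h set) \<pi>.
        closed_csubspace H \<and> star_hom C (bounded_operators H) \<pi> \<and> \<pi> \<one>\<^bsub>C\<^esub> = proj H \<and>
        inj_on \<pi> (carrier C) \<longrightarrow> maximal_representation C A H \<pi>)"

text \<open>
  Covers of unital operator algebras: \<open>B\<close> is unital, and \<open>j\<close> then automatically preserves the unit,
  because the generated C*-algebra is not assumed to contain the unit of \<open>B\<close>.
\<close>

definition cstar_cover ::
    "('a, 'm) cstar_alg_scheme \<Rightarrow> 'a set \<Rightarrow> ('b, 'n) cstar_alg_scheme \<Rightarrow> ('a \<Rightarrow> 'b) \<Rightarrow> bool" where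
  "cstar_cover C A B j \<longleftrightarrow>
     cstar_algebra B \<and> algebra_hom C A B j \<and> completely_isometric C A B j \<and>
     generated_cstar B (j ` A) = carrier B"

text \<open>
  Co-universality against all covers \<open>B\<close> with elements in \<open>'b\<close>; as above, the unrestricted notion is
  obtained with \<open>'b\<close> a free type variable of a theorem.
\<close>

definition cstar_envelope ::
    "'b itself \<Rightarrow> ('a, 'm) cstar_alg_scheme \<Rightarrow> 'a set \<Rightarrow> ('e, 'n) cstar_alg_scheme \<Rightarrow> ('a \<Rightarrow> 'e) \<Rightarrow> bool" where
  "cstar_envelope _ C A E i \<longleftrightarrow>
     cstar_cover C A E i \<and>
     (\<forall>(B :: 'b cstar_alg) j. cstar_cover C A B j \<longrightarrow>
        (\<exists>\<Phi>. star_hom B E \<Phi> \<and> \<Phi> ` carrier B = carrier E \<and> (\<forall>a\<in>A. \<Phi> (j a) = i a)))"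


section \<open>The subproduct system of a monomial ideal and its operator algebras\<close>

definition fibre :: "'d ncpoly set \<Rightarrow> nat \<Rightarrow> 'd word ell2 set" where
  "fibre I n = csubspace hull {ket w |w. w \<in> allowed_words I \<and> word_length w = n}"

definition fock :: "'d ncpoly set \<Rightarrow> 'd word ell2 set" where
  "fock I = closed_csubspace hull (\<Union>n. fibre I n)"

definition shift :: "'d ncpoly set \<Rightarrow> 'd \<Rightarrow> 'd word ell2 \<Rightarrow>\<^sub>L 'd word ell2" where
  "shift I i = (THE t. t \<in> operators_on (fock I) \<and>
     (\<forall>w\<in>allowed_words I.
        blinfun_apply t (ket w) =
          (if Word [i] + w \<in> allowed_words I then ket (Word [i] + w) else 0)))"

definition toeplitz_cstar :: "'d ncpoly set \<Rightarrow> ('d word ell2 \<Rightarrow>\<^sub>L 'd word ell2) cstar_alg" where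
  "toeplitz_cstar I =
     (bounded_operators (fock I))
       \<lparr>carrier := generated_cstar (bounded_operators (fock I)) (insert (proj (fock I)) (range (shift I)))\<rparr>"

definition tensor_algebra :: "'d ncpoly set \<Rightarrow> ('d word ell2 \<Rightarrow>\<^sub>L 'd word ell2) set" where
  "tensor_algebra I =
     generated_algebra (bounded_operators (fock I)) (insert (proj (fock I)) (range (shift I)))"

definition toeplitz_mod_compacts :: "'d ncpoly set \<Rightarrow> ('d word ell2 \<Rightarrow>\<^sub>L 'd word ell2) set cstar_alg" where
  "toeplitz_mod_compacts I = cstar_quotient (toeplitz_cstar I) (compact_operators (fock I))"

definition mod_compacts_map ::
    "'d ncpoly set \<Rightarrow> ('d word ell2 \<Rightarrow>\<^sub>L 'd word ell2) \<Rightarrow> ('d word ell2 \<Rightarrow>\<^sub>L 'd word ell2) set" where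
  "mod_compacts_map I a = compact_operators (fock I) +>\<^bsub>toeplitz_cstar I\<^esub> a"

end

theory Submission
  imports Defs
begin

text \<open>
  Modulo the compact operators the images \<open>t\<^sub>i\<close> of the shifts satisfy \<open>\<Sum>\<^sub>i t\<^sub>i t\<^sub>i* = 1\<close>, and \<open>t\<^sub>i\<close> is
  isometric on the range of each word \<open>t\<^sub>w\<close> of length \<open>k\<close> with \<open>t\<^sub>i t\<^sub>w \<noteq> 0\<close>, because whether \<open>i w v\<close> is
  allowed depends only on \<open>i w\<close> and \<open>w v\<close>.

  Hyperrigidity: in a dilation \<open>\<rho>\<close> of a representation \<open>\<pi>\<close> on \<open>H\<close>, contractivity of the row
  \<open>(\<rho>(t\<^sub>i))\<^sub>i\<close> gives \<open>\<rho>(t\<^sub>i)* = \<pi>(t\<^sub>i)*\<close> on \<open>H\<close>, since the row \<open>(\<pi>(t\<^sub>i))\<^sub>i\<close> is coisometric. On the ranges of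
  long words \<open>\<pi>(t\<^sub>w)\<close>, which span \<open>H\<close>, the operator \<open>\<pi>(t\<^sub>i)\<close> is isometric or zero, and a contraction
  cannot dilate an isometry nontrivially; so \<open>\<rho>(t\<^sub>i) = \<pi>(t\<^sub>i)\<close> on \<open>H\<close> as well.

  C*-envelope: let \<open>j\<close> embed the algebra completely isometrically in \<open>B\<close>. A *-polynomial \<open>x\<close> in the
  \<open>t\<^sub>i\<close> becomes analytic after multiplication by long words \<open>t\<^sub>w\<close>, and the norm of \<open>x\<close> is that of the row
  \<open>(x t\<^sub>w)\<^sub>w\<close>. The corresponding *-polynomial \<open>y\<close> in the \<open>j(t\<^sub>i)\<close> satisfies \<open>y j(t\<^sub>w) = j(x t\<^sub>w)\<close> up to an error
  that is dominated by the failure of certain words \<open>j(t\<^sub>v)\<close> to be isometric; appending these words to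
  the row as further rows with large weights makes the error negligible. Hence \<open>\<parallel>x\<parallel> \<le> \<parallel>y\<parallel>\<close>, and
  \<open>y \<mapsto> x\<close> extends to a *-homomorphism from \<open>B\<close> onto the quotient.
\<close>

text \<open>Covers are abstract C*-algebras, so the argument for the envelope cannot speak of
  vectors in a Hilbert space. "Vectors on which some words fail to be isometric" becomes an order
  relation: an error \<open>e\<close> is dominated by a deficiency \<open>d\<close> if
  \<open>star A e \<otimes> e\<close> is at most a multiple of \<open>d\<close>. This needs a theory
  of positive elements in abstract algebras, which is built on square roots obtained by iteration;
  its hard point is that \<open>star A z \<otimes> z\<close> is positive.

  Matrix norms are given by a definite description, so a C*-norm on matrices has to be produced and
  shown to be unique. It is read off from the cone of sums of squares in the *-algebra of matrices,
  without representing the coefficients on a Hilbert space.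

  The envelope is proved directly rather than deduced from hyperrigidity, a deduction that would
  pass through extensions of completely positive maps. The map from a cover is at first only a
  relation between values of *-polynomials. The norm inequality makes it a contraction, which by
  itself gives dense range; surjectivity comes from a separate lift that preserves norms.\<close>

abbreviation (input) sub_mult ("(_ \<otimes>\<^sub>_ _)" [70, 1000, 71] 70) where "x \<otimes>\<^sub>R y \<equiv> x \<otimes>\<^bsub>R\<^esub> y"
abbreviation (input) sub_add ("(_ \<oplus>\<^sub>_ _)" [65, 1000, 66] 65) where "x \<oplus>\<^sub>R y \<equiv> x \<oplus>\<^bsub>R\<^esub> y"
abbreviation (input) sub_minus ("(_ \<ominus>\<^sub>_ _)" [65, 1000, 66] 65) where "x \<ominus>\<^sub>R y \<equiv> x \<ominus>\<^bsub>R\<^esub> y"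
abbreviation (input) sub_uminus ("(\<ominus>\<^sub>_ _)" [1000, 81] 80) where "\<ominus>\<^sub>R x \<equiv> \<ominus>\<^bsub>R\<^esub> x"
abbreviation (input) sub_scal ("(_ \<odot>\<^sub>_ _)" [70, 1000, 71] 70) where "c \<odot>\<^sub>R x \<equiv> c \<odot>\<^bsub>R\<^esub> x"
abbreviation (input) sub_one ("\<one>\<^sub>_" [1000] 1000) where "\<one>\<^sub>R \<equiv> \<one>\<^bsub>R\<^esub>"
abbreviation (input) sub_zero ("\<zero>\<^sub>_" [1000] 1000) where "\<zero>\<^sub>R \<equiv> \<zero>\<^bsub>R\<^esub>"
abbreviation (input) bapply (infixr "\<cdot>" 85) where "a \<cdot> x \<equiv> blinfun_apply a x"

section \<open>Algebras with involution\<close>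

text \<open>There is no norm here: matrices over a C*-algebra, and quotients, are first recognised
  as *-algebras, and their norm is studied afterwards.\<close>

locale star_alg = ring A + Md: Module.module complex_ring A for A (structure) +
  assumes smult_mult_l [simp]:
      "\<lbrakk>x \<in> carrier A; y \<in> carrier A\<rbrakk> \<Longrightarrow> (c \<odot>\<^sub>A x) \<otimes>\<^sub>A y = c \<odot>\<^sub>A (x \<otimes>\<^sub>A y)"
    and smult_mult_r [simp]:
      "\<lbrakk>x \<in> carrier A; y \<in> carrier A\<rbrakk> \<Longrightarrow> x \<otimes>\<^sub>A (c \<odot>\<^sub>A y) = c \<odot>\<^sub>A (x \<otimes>\<^sub>A y)"
    and star_cl [simp, intro]: "x \<in> carrier A \<Longrightarrow> star A x \<in> carrier A"
    and star_invol [simp]: "x \<in> carrier A \<Longrightarrow> star A (star A x) = x"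
    and star_plus [simp]:
      "\<lbrakk>x \<in> carrier A; y \<in> carrier A\<rbrakk> \<Longrightarrow> star A (x \<oplus>\<^sub>A y) = star A x \<oplus>\<^sub>A star A y"
    and star_scal [simp]: "x \<in> carrier A \<Longrightarrow> star A (c \<odot>\<^sub>A x) = cnj c \<odot>\<^sub>A star A x"
    and star_times [simp]:
      "\<lbrakk>x \<in> carrier A; y \<in> carrier A\<rbrakk> \<Longrightarrow> star A (x \<otimes>\<^sub>A y) = star A y \<otimes>\<^sub>A star A x"

lemma complex_ring_simps [simp]:
  "carrier complex_ring = UNIV" "a \<oplus>\<^bsub>complex_ring\<^esub> b = a + b" "a \<otimes>\<^bsub>complex_ring\<^esub> b = a * b"
  "\<one>\<^bsub>complex_ring\<^esub> = 1" "\<zero>\<^bsub>complex_ring\<^esub> = 0"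
  by (simp_all add: complex_ring_def)

lemma cring_complex_ring: "cring complex_ring"
proof (rule cringI)
  show "abelian_group complex_ring"
    by (rule abelian_groupI) (auto simp: algebra_simps intro: exI[of _ "- _"] ab_left_minus)
  show "comm_monoid complex_ring"
    by (rule comm_monoidI) (auto simp: algebra_simps)
qed (auto simp: algebra_simps)

context star_alg
begin

lemma scal_closed [simp, intro]: "x \<in> carrier A \<Longrightarrow> c \<odot> x \<in> carrier A"
  by (rule Md.smult_closed) auto

lemma scal_add_left: "x \<in> carrier A \<Longrightarrow> (a + b) \<odot> x = a \<odot> x \<oplus> b \<odot> x"
  using Md.smult_l_distr[of a b x] by simp

lemma scal_add_right: "\<lbrakk>x \<in> carrier A; y \<in> carrier A\<rbrakk> \<Longrightarrow> a \<odot> (x \<oplus> y) = a \<odot> x \<oplus> a \<odot> y"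
  using Md.smult_r_distr[of a x y] by simp

lemma scal_scal [simp]: "x \<in> carrier A \<Longrightarrow> a \<odot> (b \<odot> x) = (a * b) \<odot> x"
  using Md.smult_assoc1[of a b x] by simp

lemma scal_1 [simp]: "x \<in> carrier A \<Longrightarrow> 1 \<odot> x = x"
  using Md.smult_one[of x] by simp

lemma scal_0_left [simp]: "x \<in> carrier A \<Longrightarrow> 0 \<odot> x = \<zero>"
  using Md.smult_l_null[of x] by simp

lemma scal_0_right [simp]: "a \<odot> \<zero> = \<zero>"
  using Md.smult_r_null[of a] by simp

lemma scal_neg1: "x \<in> carrier A \<Longrightarrow> (-1) \<odot> x = \<ominus> x"
  by (rule minus_equality[symmetric]) (use scal_add_left[of x "-1" 1] in auto)

lemma scal_uminus_left: "x \<in> carrier A \<Longrightarrow> (- a) \<odot> x = \<ominus> (a \<odot> x)"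
  using scal_neg1[of "a \<odot> x"] by simp

lemma scal_uminus_right [simp]: "x \<in> carrier A \<Longrightarrow> a \<odot> (\<ominus> x) = \<ominus> (a \<odot> x)"
  using scal_neg1[of "a \<odot> x"] by (simp flip: scal_neg1)

lemma scal_diff_right: "\<lbrakk>x \<in> carrier A; y \<in> carrier A\<rbrakk> \<Longrightarrow> a \<odot> (x \<ominus> y) = a \<odot> x \<ominus> a \<odot> y"
  by (simp add: minus_eq scal_add_right)

lemma scal_diff_left: "x \<in> carrier A \<Longrightarrow> (a - b) \<odot> x = a \<odot> x \<ominus> b \<odot> x"
  using scal_add_left[of x a "-b"] by (simp add: minus_eq scal_uminus_left)

lemma scal_2: "x \<in> carrier A \<Longrightarrow> 2 \<odot> x = x \<oplus> x"
  using scal_add_left[of x 1 1] by simp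

lemma star_zero [simp]: "star A \<zero> = \<zero>"
  using star_scal[of \<zero> 0] by simp

lemma star_uminus [simp]: "x \<in> carrier A \<Longrightarrow> star A (\<ominus> x) = \<ominus> star A x"
  using star_scal[of x "-1"] by (simp add: scal_neg1)

lemma star_minus [simp]: "\<lbrakk>x \<in> carrier A; y \<in> carrier A\<rbrakk> \<Longrightarrow> star A (x \<ominus> y) = star A x \<ominus> star A y"
  by (simp add: minus_eq)

lemma star_one [simp]: "star A \<one> = \<one>"
  using star_times[of "star A \<one>" \<one>] by simp


text \<open>Rewrite rules for the \<open>algebra\<close> method. Multiplication in \<open>A\<close>
  stays noncommutative; only the complex coefficients are normalised commutatively, which is the
  purpose of the last rules.\<close>

lemmas star_alg_simprules [algebra star_alg "zero A" "add A" "a_inv A" "a_minus A" "one A" "mult A" "smult A"] =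
  a_closed zero_closed a_inv_closed minus_closed m_closed one_closed
  a_assoc l_zero l_neg a_comm m_assoc l_one l_distr r_zero r_one r_neg r_neg2 r_neg1
  minus_eq a_lcomm r_distr l_null r_null l_minus r_minus minus_add minus_minus minus_zero
  scal_closed scal_add_right scal_scal scal_1 scal_0_left scal_0_right scal_uminus_right
  scal_add_left scal_uminus_left scal_diff_left smult_mult_l smult_mult_r
  star_cl star_invol star_plus star_scal star_times star_zero star_one star_uminus
  mult.commute[of _ "_ :: complex"] mult.assoc[of _ _ "_ :: complex"] mult.left_commute[of _ _ "_ :: complex"]
  mult_1_left[of "_ :: complex"] mult_1_right[of "_ :: complex"]

lemma minus_cancel_right: "\<lbrakk>x \<in> carrier A; y \<in> carrier A\<rbrakk> \<Longrightarrow> x \<ominus> y \<oplus> y = x"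
  by algebra

lemma minus_zero_iff: "\<lbrakk>x \<in> carrier A; y \<in> carrier A\<rbrakk> \<Longrightarrow> x \<ominus> y = \<zero> \<longleftrightarrow> x = y"
  by (metis l_zero minus_cancel_right r_neg minus_eq)

end

section \<open>Elementary theory of C*-algebras\<close>

locale cstar = star_alg A for A :: "('a, 'm) cstar_alg_scheme" (structure) +
  assumes nrm_ge0 [simp, intro]: "x \<in> carrier A \<Longrightarrow> 0 \<le> nrm A x"
    and nrm_0_iff: "x \<in> carrier A \<Longrightarrow> nrm A x = 0 \<longleftrightarrow> x = \<zero>"
    and nrm_plus: "\<lbrakk>x \<in> carrier A; y \<in> carrier A\<rbrakk> \<Longrightarrow> nrm A (x \<oplus> y) \<le> nrm A x + nrm A y"
    and nrm_scal [simp]: "x \<in> carrier A \<Longrightarrow> nrm A (c \<odot>\<^sub>A x) = cmod c * nrm A x"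
    and nrm_times: "\<lbrakk>x \<in> carrier A; y \<in> carrier A\<rbrakk> \<Longrightarrow> nrm A (x \<otimes> y) \<le> nrm A x * nrm A y"
    and nrm_cstar: "x \<in> carrier A \<Longrightarrow> nrm A (star A x \<otimes> x) = (nrm A x)\<^sup>2"
    and nrm_cauchy:
      "\<lbrakk>\<And>n. f n \<in> carrier A;
        \<And>e. 0 < e \<Longrightarrow> \<exists>N. \<forall>m\<ge>N. \<forall>n\<ge>N. nrm A (f m \<ominus> f n) < e\<rbrakk>
       \<Longrightarrow> \<exists>x\<in>carrier A. (\<lambda>n. nrm A (f n \<ominus> x)) \<longlonglongrightarrow> 0"

lemma cstar_iff: "cstar_algebra A \<longleftrightarrow> cstar A"
proof
  assume "cstar_algebra A"
  then interpret C: cstar_algebra A .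
  show "cstar A"
    by unfold_locales
      (simp_all add: C.smult_mult_left C.smult_mult_right C.star_closed C.star_star C.star_add
        C.star_smult C.star_mult C.nrm_nonneg C.nrm_eq_0_iff C.nrm_triangle C.nrm_smult C.nrm_mult
        C.cstar_identity C.nrm_complete)
next
  assume "cstar A"
  then interpret C: cstar A .
  show "cstar_algebra A"
    by unfold_locales
      (simp_all add: C.nrm_0_iff C.nrm_plus C.nrm_times C.nrm_cstar C.nrm_cauchy)
qed

context cstar
begin

lemma nrm_zero [simp]: "nrm A \<zero> = 0"
  by (simp add: nrm_0_iff)

lemma nrm_uminus [simp]: "x \<in> carrier A \<Longrightarrow> nrm A (\<ominus> x) = nrm A x"
  using nrm_scal[of x "-1"] by (simp add: scal_neg1 del: nrm_scal)

lemma nrm_minus: "\<lbrakk>x \<in> carrier A; y \<in> carrier A\<rbrakk> \<Longrightarrow> nrm A (x \<ominus> y) \<le> nrm A x + nrm A y"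
  using nrm_plus[of x "\<ominus> y"] by (simp add: minus_eq)

lemma nrm_minus_commute: "\<lbrakk>x \<in> carrier A; y \<in> carrier A\<rbrakk> \<Longrightarrow> nrm A (x \<ominus> y) = nrm A (y \<ominus> x)"
proof -
  assume "x \<in> carrier A" "y \<in> carrier A"
  moreover from this have "x \<ominus> y = \<ominus> (y \<ominus> x)" by algebra
  ultimately show ?thesis by simp
qed

lemma nrm_minus_trans:
  "\<lbrakk>x \<in> carrier A; y \<in> carrier A; z \<in> carrier A\<rbrakk> \<Longrightarrow> nrm A (x \<ominus> z) \<le> nrm A (x \<ominus> y) + nrm A (y \<ominus> z)"
proof -
  assume *: "x \<in> carrier A" "y \<in> carrier A" "z \<in> carrier A"
  then have "x \<ominus> z = (x \<ominus> y) \<oplus> (y \<ominus> z)" by algebra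
  then show ?thesis using nrm_plus[of "x \<ominus> y" "y \<ominus> z"] * by simp
qed

lemma nrm_le_minus: "\<lbrakk>x \<in> carrier A; y \<in> carrier A\<rbrakk> \<Longrightarrow> nrm A x \<le> nrm A (x \<ominus> y) + nrm A y"
  using nrm_plus[of "x \<ominus> y" y] by (simp add: minus_cancel_right)

text \<open>The C*-identity and submultiplicativity give one inequality between an element and its
  adjoint; applied to the adjoint it gives the other.\<close>

lemma nrm_star [simp]:
  assumes "x \<in> carrier A" shows "nrm A (star A x) = nrm A x"
proof -
  have le: "nrm A y \<le> nrm A (star A y)" if "y \<in> carrier A" for y
  proof (cases "nrm A y = 0")
    case False
    have "nrm A y * nrm A y \<le> nrm A (star A y) * nrm A y"
      using nrm_cstar[OF that] nrm_times[of "star A y" y] that by (simp add: power2_eq_square)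
    then show ?thesis using False nrm_ge0[OF that] by simp
  qed (use that in auto)
  from le[of x] le[of "star A x"] assms show ?thesis by simp
qed

text \<open>Only an inequality, because in the zero algebra the unit has norm 0.\<close>

lemma nrm_one_le: "nrm A \<one> \<le> 1"
proof -
  have "nrm A \<one> = nrm A \<one> * nrm A \<one>" using nrm_cstar[of \<one>] by (simp add: power2_eq_square)
  then have "nrm A \<one> = 0 \<or> nrm A \<one> = 1" by simp
  then show ?thesis by auto
qed

lemma nrm_selfadj_sq: "s \<in> carrier A \<Longrightarrow> star A s = s \<Longrightarrow> nrm A (s \<otimes> s) = (nrm A s)\<^sup>2"
  using nrm_cstar[of s] by simp

lemma nrm_eq_cstar': "x \<in> carrier A \<Longrightarrow> nrm A (x \<otimes> star A x) = (nrm A x)\<^sup>2"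
  using nrm_cstar[of "star A x"] by simp

section \<open>Norm convergence of sequences\<close>

definition cvg :: "(nat \<Rightarrow> 'a) \<Rightarrow> 'a \<Rightarrow> bool" where
  "cvg f x \<longleftrightarrow> (\<lambda>n. nrm A (f n \<ominus> x)) \<longlonglongrightarrow> 0"

lemma cvg_le:
  assumes "g \<longlonglongrightarrow> 0" "\<And>n. f n \<in> carrier A" "x \<in> carrier A" "\<And>n. nrm A (f n \<ominus> x) \<le> g n"
  shows "cvg f x"
  unfolding cvg_def
  by (rule tendsto_sandwich[OF _ _ tendsto_const assms(1)]) (use assms in auto)

lemma cvg_const: "x \<in> carrier A \<Longrightarrow> cvg (\<lambda>_. x) x"
  by (simp add: cvg_def minus_eq r_neg)

lemma cvg_add:
  assumes "\<And>n. f n \<in> carrier A" "\<And>n. g n \<in> carrier A" "x \<in> carrier A" "y \<in> carrier A" "cvg f x" "cvg g y"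
  shows "cvg (\<lambda>n. f n \<oplus> g n) (x \<oplus> y)"
proof (rule cvg_le)
  show "(\<lambda>n. nrm A (f n \<ominus> x) + nrm A (g n \<ominus> y)) \<longlonglongrightarrow> 0"
    using tendsto_add[OF assms(5,6)[unfolded cvg_def]] by simp
  fix n
  have "(f n \<oplus> g n) \<ominus> (x \<oplus> y) = (f n \<ominus> x) \<oplus> (g n \<ominus> y)"
    using assms(1-4) assms(1)[of n] assms(2)[of n] by algebra
  then show "nrm A ((f n \<oplus> g n) \<ominus> (x \<oplus> y)) \<le> nrm A (f n \<ominus> x) + nrm A (g n \<ominus> y)"
    using nrm_plus[of "f n \<ominus> x" "g n \<ominus> y"] assms(1-4) by simp
qed (use assms in auto)

lemma cvg_scal:
  assumes "\<And>n. f n \<in> carrier A" "x \<in> carrier A" "cvg f x"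
  shows "cvg (\<lambda>n. c \<odot> f n) (c \<odot> x)"
  using tendsto_mult_left[OF assms(3)[unfolded cvg_def], of "cmod c"] assms(1,2)
  by (simp add: cvg_def flip: scal_diff_right)

lemma cvg_star:
  assumes "\<And>n. f n \<in> carrier A" "x \<in> carrier A" "cvg f x"
  shows "cvg (\<lambda>n. star A (f n)) (star A x)"
  using assms by (simp add: cvg_def flip: star_minus)

lemma cvg_nrm:
  assumes "\<And>n. f n \<in> carrier A" "x \<in> carrier A" "cvg f x"
  shows "(\<lambda>n. nrm A (f n)) \<longlonglongrightarrow> nrm A x"
proof (rule LIM_zero_cancel)
  show "(\<lambda>n. nrm A (f n) - nrm A x) \<longlonglongrightarrow> 0"
  proof (rule tendsto_0_le[OF assms(3)[unfolded cvg_def], of _ 1])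
    show "\<forall>\<^sub>F n in sequentially. norm (nrm A (f n) - nrm A x) \<le> norm (nrm A (f n \<ominus> x)) * 1"
      using assms(1,2) nrm_le_minus[of "f _" x] nrm_le_minus[of x "f _"]
        nrm_minus_commute[of "f _" x]
      by (intro always_eventually allI) (smt (verit) nrm_ge0 minus_closed real_norm_def)
  qed
qed

lemma cvg_mult:
  assumes "\<And>n. f n \<in> carrier A" "\<And>n. g n \<in> carrier A" "x \<in> carrier A" "y \<in> carrier A" "cvg f x" "cvg g y"
  shows "cvg (\<lambda>n. f n \<otimes> g n) (x \<otimes> y)"
proof (rule cvg_le)
  show "(\<lambda>n. nrm A (f n \<ominus> x) * nrm A (g n) + nrm A x * nrm A (g n \<ominus> y)) \<longlonglongrightarrow> 0"
    using tendsto_add[OF tendsto_mult[OF assms(5)[unfolded cvg_def] cvg_nrm[OF assms(2,4,6)]]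
        tendsto_mult_left[OF assms(6)[unfolded cvg_def], of "nrm A x"]] by simp
  fix n
  have "f n \<otimes> g n \<ominus> x \<otimes> y = (f n \<ominus> x) \<otimes> g n \<oplus> x \<otimes> (g n \<ominus> y)"
    using assms(1-4) assms(1)[of n] assms(2)[of n] by algebra
  then show "nrm A (f n \<otimes> g n \<ominus> x \<otimes> y) \<le> nrm A (f n \<ominus> x) * nrm A (g n) + nrm A x * nrm A (g n \<ominus> y)"
    using nrm_plus[of "(f n \<ominus> x) \<otimes> g n" "x \<otimes> (g n \<ominus> y)"] nrm_times[of "f n \<ominus> x" "g n"]
      nrm_times[of x "g n \<ominus> y"] assms(1-4) by simp
qed (use assms in auto)

lemma cvg_unique:
  assumes "\<And>n. f n \<in> carrier A" "x \<in> carrier A" "y \<in> carrier A" "cvg f x" "cvg f y"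
  shows "x = y"
proof -
  have "(\<lambda>n. nrm A (f n \<ominus> x) + nrm A (f n \<ominus> y)) \<longlonglongrightarrow> 0"
    using tendsto_add[OF assms(4,5)[unfolded cvg_def]] by simp
  moreover have "nrm A (x \<ominus> y) \<le> nrm A (f n \<ominus> x) + nrm A (f n \<ominus> y)" for n
    using nrm_minus_trans[of x "f n" y] nrm_minus_commute[of x "f n"] assms(1-3) by simp
  ultimately have "nrm A (x \<ominus> y) \<le> 0"
    by (intro LIMSEQ_le_const) auto
  then show ?thesis
    using assms(2,3) nrm_ge0[of "x \<ominus> y"] nrm_0_iff[of "x \<ominus> y"]
    by (metis antisym minus_closed minus_zero_iff)
qed

lemma cvg_Suc: "cvg f x \<Longrightarrow> cvg (\<lambda>n. f (Suc n)) x"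
  unfolding cvg_def by (rule LIMSEQ_Suc)

text \<open>\<open>h\<close> is a scalar majorant: the increments of \<open>f\<close> are bounded by
  those of a convergent real sequence. It is used with the scalar square root iteration and with a
  geometric series.\<close>

lemma cvg_ex:
  assumes "\<And>n. f n \<in> carrier A" "\<And>m n. m \<le> n \<Longrightarrow> nrm A (f n \<ominus> f m) \<le> h n - h m" "convergent h"
  shows "\<exists>x\<in>carrier A. cvg f x"
  unfolding cvg_def
proof (rule nrm_cauchy[OF assms(1)])
  fix e :: real assume "0 < e"
  have "Cauchy h" using assms(3) by (simp add: Cauchy_convergent_iff)
  then obtain N where N: "\<And>m n. m \<ge> N \<Longrightarrow> n \<ge> N \<Longrightarrow> dist (h m) (h n) < e"
    using metric_CauchyD[OF _ \<open>0 < e\<close>] by blast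
  have "nrm A (f m \<ominus> f n) < e" if "m \<ge> N" "n \<ge> N" for m n
  proof (cases "n \<le> m")
    case True
    then show ?thesis using assms(2)[of n m] N[OF that] by (simp add: dist_real_def)
  next
    case False
    then show ?thesis using assms(2)[of m n] N[OF that] nrm_minus_commute[OF assms(1) assms(1), of m n]
      by (simp add: dist_real_def)
  qed
  then show "\<exists>N. \<forall>m\<ge>N. \<forall>n\<ge>N. nrm A (f m \<ominus> f n) < e" by blast
qed

lemma cvg_ex_geometric:
  assumes f: "\<And>n. f n \<in> carrier A" and step: "\<And>n. nrm A (f (Suc n) \<ominus> f n) \<le> c * (1/2)^n"
  shows "\<exists>x\<in>carrier A. cvg f x"
proof (rule cvg_ex[OF f])
  fix m n :: nat assume "m \<le> n"
  \<comment> \<open>The majorant is minus the sum of all step bounds from the given index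
    on.\<close>
  then show "nrm A (f n \<ominus> f m) \<le> - (2 * c) * (1/2)^n - - (2 * c) * (1/2)^m"
  proof (induction n rule: dec_induct)
    case base
    then show ?case using f by (simp add: minus_eq r_neg)
  next
    case (step n)
    then show ?case
      using nrm_minus_trans[OF f[of "Suc n"] f[of n] f[of m]] assms(2)[of n] by simp
  qed
next
  have "(\<lambda>n. (1/2) ^ n :: real) \<longlonglongrightarrow> 0" by (rule LIMSEQ_realpow_zero) auto
  from tendsto_mult_left[OF this, of "- (2 * c)"] show "convergent (\<lambda>n. - (2 * c) * (1/2)^n)" by (rule convergentI)
qed

end

subsection \<open>Square roots\<close>

text \<open>The iteration \<open>y \<mapsto> (x + y\<^sup>2) / 2\<close> for the number
  \<open>x = 1\<close>. Its coefficients are nonnegative, so it majorises the same iteration for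
  every algebra element \<open>x\<close> of norm at most 1.\<close>

primrec sqrt_majorant :: "nat \<Rightarrow> real" where
  "sqrt_majorant 0 = 0"
| "sqrt_majorant (Suc n) = (1 + (sqrt_majorant n)\<^sup>2) / 2"

lemma sqrt_majorant_bounds: "0 \<le> sqrt_majorant n \<and> sqrt_majorant n \<le> 1"
proof (induction n)
  case (Suc n)
  then have "(sqrt_majorant n)\<^sup>2 \<le> 1" by (simp add: power_le_one)
  then show ?case by simp
qed simp

lemma sqrt_majorant_mono: "sqrt_majorant n \<le> sqrt_majorant (Suc n)"
  using sum_squares_bound[of "sqrt_majorant n" 1] by simp

lemma convergent_sqrt_majorant: "convergent sqrt_majorant"
proof -
  have "incseq sqrt_majorant" by (rule incseq_SucI) (rule sqrt_majorant_mono)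
  moreover have "Bseq sqrt_majorant"
    by (rule BseqI'[of _ 1]) (use sqrt_majorant_bounds in auto)
  ultimately show ?thesis by (simp add: Bseq_monoseq_convergent monoseq_Suc incseq_Suc_iff)
qed

context cstar
begin

primrec sqrt_iter :: "'a \<Rightarrow> nat \<Rightarrow> 'a" where
  "sqrt_iter x 0 = \<zero>"
| "sqrt_iter x (Suc n) = (1/2) \<odot> (x \<oplus> sqrt_iter x n \<otimes> sqrt_iter x n)"

lemma sqrt_iter_closed [simp, intro]: "x \<in> carrier A \<Longrightarrow> sqrt_iter x n \<in> carrier A"
  by (induction n) auto

lemma nrm_sqrt_iter:
  assumes "x \<in> carrier A" "nrm A x \<le> 1"
  shows "nrm A (sqrt_iter x n) \<le> sqrt_majorant n"
proof (induction n)
  case (Suc n)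
  let ?y = "sqrt_iter x n"
  have "nrm A (x \<oplus> ?y \<otimes> ?y) \<le> nrm A x + nrm A ?y * nrm A ?y"
    using nrm_plus[of x "?y \<otimes> ?y"] nrm_times[of ?y ?y] assms by simp
  also have "\<dots> \<le> 1 + (sqrt_majorant n)\<^sup>2"
    using assms Suc by (intro add_mono) (auto simp: power2_eq_square intro!: mult_mono order.trans[OF nrm_ge0 Suc])
  finally show ?case using assms by simp
qed simp

text \<open>The difference of squares \<open>a \<otimes> a \<ominus> b \<otimes> b\<close> equals
  \<open>(a \<ominus> b) \<otimes> a \<oplus> b \<otimes> (a \<ominus> b)\<close> even without
  commutativity. For the majorant the corresponding estimate is an equality, so the induction
  closes.\<close>

lemma nrm_sqrt_iter_Suc:
  assumes "x \<in> carrier A" "nrm A x \<le> 1"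
  shows "nrm A (sqrt_iter x (Suc n) \<ominus> sqrt_iter x n) \<le> sqrt_majorant (Suc n) - sqrt_majorant n"
proof (induction n)
  case 0
  then show ?case using assms by (simp add: minus_eq)
next
  case (Suc n)
  define a b where "a = sqrt_iter x (Suc n)" and "b = sqrt_iter x n"
  have ab: "a \<in> carrier A" "b \<in> carrier A" using assms by (auto simp: a_def b_def)
  have "sqrt_iter x (Suc (Suc n)) \<ominus> a = (1/2) \<odot> (x \<oplus> a \<otimes> a) \<ominus> (1/2) \<odot> (x \<oplus> b \<otimes> b)"
    by (simp add: a_def b_def)
  also have "\<dots> = (1/2) \<odot> ((a \<ominus> b) \<otimes> a \<oplus> b \<otimes> (a \<ominus> b))"
    using ab assms by algebra
  finally have "nrm A (sqrt_iter x (Suc (Suc n)) \<ominus> a) = nrm A ((a \<ominus> b) \<otimes> a \<oplus> b \<otimes> (a \<ominus> b)) / 2"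
    using ab assms by simp
  also have "nrm A ((a \<ominus> b) \<otimes> a \<oplus> b \<otimes> (a \<ominus> b)) \<le> nrm A (a \<ominus> b) * nrm A a + nrm A b * nrm A (a \<ominus> b)"
    using nrm_plus[of "(a \<ominus> b) \<otimes> a" "b \<otimes> (a \<ominus> b)"] nrm_times[of "a \<ominus> b" a] nrm_times[of b "a \<ominus> b"] ab
    by simp
  also have "\<dots> = nrm A (a \<ominus> b) * (nrm A a + nrm A b)" by (simp add: algebra_simps)
  also have "\<dots> \<le> (sqrt_majorant (Suc n) - sqrt_majorant n) * (sqrt_majorant (Suc n) + sqrt_majorant n)"
    using Suc nrm_sqrt_iter[OF assms, of n] nrm_sqrt_iter[OF assms, of "Suc n"] ab sqrt_majorant_mono[of n]
    unfolding a_def[symmetric] b_def[symmetric]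
    by (intro mult_mono add_mono) (auto simp del: sqrt_majorant.simps)
  also have "\<dots> / 2 = sqrt_majorant (Suc (Suc n)) - sqrt_majorant (Suc n)"
    by (simp add: field_simps power2_eq_square)
  finally show ?case by (simp add: a_def divide_right_mono del: sqrt_iter.simps sqrt_majorant.simps)
qed

text \<open>The iteration \<open>y \<mapsto> (x + y\<^sup>2) / 2\<close> produces \<open>1 - sqrt (1 - x)\<close>.\<close>

lemma sqrt_one_minus:
  assumes x: "x \<in> carrier A" "nrm A x \<le> 1"
  obtains y where "y \<in> carrier A" "nrm A y \<le> 1" "y \<oplus> y = x \<oplus> y \<otimes> y"
    "star A x = x \<Longrightarrow> star A y = y"
    "\<And>z. z \<in> carrier A \<Longrightarrow> z \<otimes> x = x \<otimes> z \<Longrightarrow> z \<otimes> y = y \<otimes> z"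
proof -
  let ?Y = "sqrt_iter x"
  have mono: "nrm A (?Y n \<ominus> ?Y m) \<le> sqrt_majorant n - sqrt_majorant m" if "m \<le> n" for m n
    using that
  proof (induction n rule: dec_induct)
    case base
    then show ?case using x by (simp add: minus_eq r_neg)
  next
    case (step n)
    then show ?case
      using nrm_minus_trans[of "?Y (Suc n)" "?Y n" "?Y m"] nrm_sqrt_iter_Suc[OF x, of n] x
      by (simp del: sqrt_iter.simps sqrt_majorant.simps)
  qed
  then obtain y where y: "y \<in> carrier A" "cvg ?Y y"
    using cvg_ex[of ?Y sqrt_majorant] convergent_sqrt_majorant x by auto
  have "cvg (\<lambda>n. (1/2) \<odot> (x \<oplus> ?Y n \<otimes> ?Y n)) ((1/2) \<odot> (x \<oplus> y \<otimes> y))"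
    by (intro cvg_scal cvg_add cvg_mult cvg_const) (use x y in auto)
  moreover have "cvg (\<lambda>n. ?Y (Suc n)) y" using y by (intro cvg_Suc)
  ultimately have "y = (1/2) \<odot> (x \<oplus> y \<otimes> y)"
    by (intro cvg_unique[of "\<lambda>n. ?Y (Suc n)"]) (use x y in auto)
  then have "2 \<odot> y = 2 \<odot> ((1/2) \<odot> (x \<oplus> y \<otimes> y))" by simp
  then have eq: "y \<oplus> y = x \<oplus> y \<otimes> y" using x y by (simp add: scal_2)
  have "nrm A y \<le> 1"
    by (rule LIMSEQ_le_const2[OF cvg_nrm[OF _ y]])
      (use x nrm_sqrt_iter[OF x] sqrt_majorant_bounds in \<open>auto intro!: exI[of _ 0] intro: order.trans\<close>)
  moreover have "star A y = y" if "star A x = x"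
  proof -
    have "star A (?Y n) = ?Y n" for n
      by (induction n) (use x that in auto)
    then show ?thesis
      using cvg_unique[of ?Y "star A y" y] cvg_star[OF _ y] x y by simp
  qed
  moreover have "z \<otimes> y = y \<otimes> z" if z: "z \<in> carrier A" "z \<otimes> x = x \<otimes> z" for z
  proof -
    have "z \<otimes> ?Y n = ?Y n \<otimes> z" for n
    proof (induction n)
      case (Suc n)
      have "z \<otimes> (?Y n \<otimes> ?Y n) = (z \<otimes> ?Y n) \<otimes> ?Y n" using x z by (simp add: m_assoc)
      also have "\<dots> = ?Y n \<otimes> (z \<otimes> ?Y n)" using x z Suc by (simp add: m_assoc)
      also have "\<dots> = (?Y n \<otimes> ?Y n) \<otimes> z" using x z Suc by (simp add: m_assoc)
      finally show ?case using x z by (simp add: r_distr l_distr)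
    qed (use z in auto)
    then show ?thesis
      using cvg_unique[of "\<lambda>n. z \<otimes> ?Y n" "z \<otimes> y" "y \<otimes> z"]
        cvg_mult[of "\<lambda>_. z" ?Y z y] cvg_mult[of ?Y "\<lambda>_. z" y z] cvg_const[of z] x y z by simp
  qed
  ultimately show ?thesis using that y eq by blast
qed

end

context cstar
begin

lemma nrm_le_0: "x \<in> carrier A \<Longrightarrow> nrm A x \<le> 0 \<Longrightarrow> x = \<zero>"
  using nrm_0_iff[of x] nrm_ge0[of x] by linarith

subsection \<open>Positive elements\<close>

text \<open>Positivity is measured by the norm; no spectra are needed.\<close>

definition Pos :: "'a \<Rightarrow> bool" where
  "Pos b \<longleftrightarrow> b \<in> carrier A \<and> star A b = b \<and>
     (\<exists>t\<ge>0. nrm A (of_real t \<odot> \<one> \<ominus> b) \<le> t)"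

lemma Pos_bound: "Pos b \<Longrightarrow> \<exists>t\<ge>0. nrm A (of_real t \<odot> \<one> \<ominus> b) \<le> t"
  by (simp add: Pos_def)

lemma Pos_closed [simp]: "Pos b \<Longrightarrow> b \<in> carrier A"
  and Pos_star [simp]: "Pos b \<Longrightarrow> star A b = b"
  by (auto simp: Pos_def)

lemma PosI:
  "\<lbrakk>b \<in> carrier A; star A b = b; 0 \<le> t; nrm A (of_real t \<odot> \<one> \<ominus> b) \<le> t\<rbrakk> \<Longrightarrow> Pos b"
  by (auto simp: Pos_def)

text \<open>Allows the radius in the definition of \<open>Pos\<close> to be enlarged, in particular
  to be made strictly positive before dividing by it.\<close>

lemma Pos_bound_mono:
  assumes "b \<in> carrier A" "nrm A (of_real t \<odot> \<one> \<ominus> b) \<le> t" "t \<le> u"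
  shows "nrm A (of_real u \<odot> \<one> \<ominus> b) \<le> u"
proof -
  have "of_real u \<odot> \<one> \<ominus> b = of_real (u - t) \<odot> \<one> \<oplus> (of_real t \<odot> \<one> \<ominus> b)"
    unfolding of_real_diff using assms(1) by algebra
  then have "nrm A (of_real u \<odot> \<one> \<ominus> b) \<le> (u - t) * nrm A \<one> + t"
    using nrm_plus[of "of_real (u - t) \<odot> \<one>" "of_real t \<odot> \<one> \<ominus> b"] assms
    by (simp flip: of_real_diff)
  also have "\<dots> \<le> (u - t) * 1 + t"
    using assms nrm_one_le by (intro add_mono mult_left_mono) auto
  finally show ?thesis by simp
qed

lemma Pos_zero [simp]: "Pos \<zero>"
  by (rule PosI[of _ 0]) (auto simp: minus_eq)

lemma Pos_add: assumes "Pos a" "Pos b" shows "Pos (a \<oplus> b)"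
proof -
  obtain t u where tu: "t \<ge> 0" "nrm A (of_real t \<odot> \<one> \<ominus> a) \<le> t"
      "u \<ge> 0" "nrm A (of_real u \<odot> \<one> \<ominus> b) \<le> u"
    using assms Pos_bound by meson
  have "of_real (t + u) \<odot> \<one> \<ominus> (a \<oplus> b)
      = (of_real t \<odot> \<one> \<ominus> a) \<oplus> (of_real u \<odot> \<one> \<ominus> b)"
    unfolding of_real_add using Pos_closed[OF assms(1)] Pos_closed[OF assms(2)] by algebra
  then show ?thesis
    using nrm_plus[of "of_real t \<odot> \<one> \<ominus> a" "of_real u \<odot> \<one> \<ominus> b"] assms tu
    by (intro PosI[of _ "t + u"]) auto
qed

lemma Pos_scal: assumes "Pos a" "0 \<le> r" shows "Pos (of_real r \<odot> a)"
proof -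
  obtain t where t: "t \<ge> 0" "nrm A (of_real t \<odot> \<one> \<ominus> a) \<le> t"
    using assms Pos_bound by meson
  have "of_real (r * t) \<odot> \<one> \<ominus> of_real r \<odot> a = of_real r \<odot> (of_real t \<odot> \<one> \<ominus> a)"
    using Pos_closed[OF assms(1)] by (simp add: scal_diff_right)
  then show ?thesis
    using assms t by (intro PosI[of _ "r * t"]) (auto intro: mult_left_mono)
qed

lemma Pos_finsum: "finite F \<Longrightarrow> (\<And>i. i \<in> F \<Longrightarrow> Pos (f i)) \<Longrightarrow> Pos (finsum A f F)"
proof (induction F rule: finite_induct)
  case (insert i F)
  then have "finsum A f (insert i F) = f i \<oplus> finsum A f F"
    by (intro finsum_insert) auto
  then show ?case using insert by (simp add: Pos_add)
qed simp

lemma Pos_const_minus: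
  assumes "a \<in> carrier A" "star A a = a" "nrm A a \<le> t"
  shows "Pos (of_real t \<odot> \<one> \<ominus> a)"
proof (rule PosI)
  have "of_real t \<odot> \<one> \<ominus> (of_real t \<odot> \<one> \<ominus> a) = a" using assms by algebra
  then show "nrm A (of_real t \<odot> \<one> \<ominus> (of_real t \<odot> \<one> \<ominus> a)) \<le> t"
    using assms by simp
  show "0 \<le> t" using assms(3) nrm_ge0[OF assms(1)] by linarith
qed (use assms in auto)

text \<open>For a radius \<open>t\<close> of \<open>b\<close> the element
  \<open>x = \<one> \<ominus> b / t\<close> has norm at most 1, and the \<open>y\<close> of
  \<open>sqrt_one_minus\<close> satisfies
  \<open>(\<one> \<ominus> y)\<^sup>2 = \<one> \<ominus> x = b / t\<close>. The commutation clause
  does the work of functional calculus: roots of commuting elements can be chosen to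
  commute.\<close>

lemma Pos_sqrt:
  assumes "Pos b"
  obtains s where "Pos s" "s \<otimes> s = b"
    "\<And>z. z \<in> carrier A \<Longrightarrow> z \<otimes> b = b \<otimes> z \<Longrightarrow> z \<otimes> s = s \<otimes> z"
proof -
  obtain t0 where t0: "t0 \<ge> 0" "nrm A (of_real t0 \<odot> \<one> \<ominus> b) \<le> t0"
    using assms Pos_bound by meson
  \<comment> \<open>The radius 0 is allowed in \<open>Pos\<close>, but the rescaling divides by
    \<open>t\<close>.\<close>
  define t where "t = t0 + 1"
  have t: "t > 0" "nrm A (of_real t \<odot> \<one> \<ominus> b) \<le> t"
    using t0 Pos_bound_mono[of b t0 t] assms by (auto simp: t_def)
  note b [simp] = Pos_closed[OF assms]
  define x where "x = of_real (1/t) \<odot> (of_real t \<odot> \<one> \<ominus> b)"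
  have x [simp]: "x \<in> carrier A" "star A x = x" using assms by (auto simp: x_def)
  have xe: "x = \<one> \<ominus> of_real (1/t) \<odot> b"
    using t by (simp add: x_def scal_diff_right)
  have "nrm A x = nrm A (of_real t \<odot> \<one> \<ominus> b) / t" using t by (simp add: x_def norm_divide)
  then have "nrm A x \<le> 1" using t by simp
  then obtain y where y: "y \<in> carrier A" "nrm A y \<le> 1" "y \<oplus> y = x \<oplus> y \<otimes> y" "star A y = y"
    "\<And>z. z \<in> carrier A \<Longrightarrow> z \<otimes> x = x \<otimes> z \<Longrightarrow> z \<otimes> y = y \<otimes> z"
    using sqrt_one_minus[of x] x by metis
  define s where "s = of_real (sqrt t) \<odot> (\<one> \<ominus> y)"
  have "(\<one> \<ominus> y) \<otimes> (\<one> \<ominus> y) = \<one> \<ominus> (y \<oplus> y) \<oplus> y \<otimes> y" using y(1) by algebra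
  also have "\<dots> = \<one> \<ominus> x" unfolding y(3) using y(1) x(1) by algebra
  also have "\<dots> = of_real (1/t) \<odot> b" unfolding xe using b by algebra
  finally have "s \<otimes> s = of_real (sqrt t * sqrt t * (1/t)) \<odot> b"
    using y(1) by (simp add: s_def del: real_sqrt_mult_self)
  also have "sqrt t * sqrt t * (1/t) = 1" using t by simp
  finally have ss: "s \<otimes> s = b" by simp
  have "of_real (sqrt t) \<odot> \<one> \<ominus> s = of_real (sqrt t) \<odot> y"
    unfolding s_def using y(1) by algebra
  then have "Pos s"
    using y(1,2,4) t by (intro PosI[of _ "sqrt t"]) (auto simp: s_def mult_left_le)
  moreover have "z \<otimes> s = s \<otimes> z" if z: "z \<in> carrier A" "z \<otimes> b = b \<otimes> z" for z
  proof -
    have "z \<otimes> x = x \<otimes> z" unfolding xe using z b by algebra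
    then have "z \<otimes> y = y \<otimes> z" using y z by blast
    then show ?thesis unfolding s_def using z(1) y(1) by algebra
  qed
  ultimately show ?thesis using that ss by blast
qed

text \<open>Here \<open>s + ir\<close> is a multiple of a unitary.\<close>

lemma nrm_commuting_squares:
  assumes s: "s \<in> carrier A" "star A s = s" and r: "r \<in> carrier A" "star A r = r"
    and comm: "s \<otimes> r = r \<otimes> s" and sum: "s \<otimes> s \<oplus> r \<otimes> r = of_real t \<odot> \<one>" and "0 \<le> t"
  shows "(nrm A s)\<^sup>2 \<le> t"
proof -
  define u where "u = s \<oplus> \<i> \<odot> r"
  have u: "u \<in> carrier A" "star A u = s \<ominus> \<i> \<odot> r"
    using s r by (auto simp: u_def scal_uminus_left minus_eq)
  have "star A u \<otimes> u = (s \<ominus> \<i> \<odot> r) \<otimes> (s \<oplus> \<i> \<odot> r)" using u by (simp add: u_def)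
  also have "\<dots> = s \<otimes> s \<ominus> (\<i> * \<i>) \<odot> (r \<otimes> r)"
    using s(1) r(1) comm by algebra
  also have "\<dots> = s \<otimes> s \<oplus> r \<otimes> r" using s r by (simp add: scal_uminus_left minus_eq)
  finally have "(nrm A u)\<^sup>2 = t * nrm A \<one>"
    using nrm_cstar[OF u(1)] sum \<open>0 \<le> t\<close> by simp
  also have "\<dots> \<le> t * 1" by (intro mult_left_mono nrm_one_le \<open>0 \<le> t\<close>)
  finally have nu: "(nrm A u)\<^sup>2 \<le> t" by simp
  have "s \<oplus> s = u \<oplus> star A u" unfolding u(2) unfolding u_def using s(1) r(1) by algebra
  moreover have "nrm A (s \<oplus> s) = 2 * nrm A s" using s(1) by (simp flip: scal_2)
  ultimately have "2 * nrm A s \<le> nrm A u + nrm A u"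
    using nrm_plus[of u "star A u"] nrm_star[OF u(1)] star_cl[OF u(1)] u(1) by simp
  then have "(nrm A s)\<^sup>2 \<le> (nrm A u)\<^sup>2" using s by (intro power_mono) auto
  then show ?thesis using nu by simp
qed

text \<open>With \<open>t\<close> the norm of \<open>s \<otimes> s\<close>, the element
  \<open>of_real t \<odot> \<one> \<ominus> s \<otimes> s\<close> is positive and has a root
  \<open>r\<close> commuting with \<open>s\<close>. Then \<open>nrm_commuting_squares\<close> bounds
  \<open>r\<close>, and the bound for \<open>r \<otimes> r\<close> is exactly the inequality that
  \<open>Pos\<close> asks for.\<close>

lemma Pos_square:
  assumes s: "s \<in> carrier A" "star A s = s"
  shows "Pos (s \<otimes> s)"
proof -
  define t where "t = nrm A (s \<otimes> s)"
  have "Pos (of_real t \<odot> \<one> \<ominus> s \<otimes> s)"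
    using s by (intro Pos_const_minus) (auto simp: t_def)
  then obtain r where r: "Pos r" "r \<otimes> r = of_real t \<odot> \<one> \<ominus> s \<otimes> s"
      "\<And>z. z \<in> carrier A \<Longrightarrow> z \<otimes> (of_real t \<odot> \<one> \<ominus> s \<otimes> s) = (of_real t \<odot> \<one> \<ominus> s \<otimes> s) \<otimes> z
        \<Longrightarrow> z \<otimes> r = r \<otimes> z"
    using Pos_sqrt by blast
  note rc = Pos_closed[OF r(1)]
  have "s \<otimes> (of_real t \<odot> \<one> \<ominus> s \<otimes> s) = (of_real t \<odot> \<one> \<ominus> s \<otimes> s) \<otimes> s"
    using s(1) by algebra
  then have "s \<otimes> r = r \<otimes> s" using r(3) s by blast
  moreover have "r \<otimes> r \<oplus> s \<otimes> s = of_real t \<odot> \<one>" unfolding r(2) using s(1) by algebra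
  ultimately have "(nrm A r)\<^sup>2 \<le> t"
    using nrm_commuting_squares[of r s t] r(1) rc s by (simp add: t_def)
  then have "nrm A (of_real t \<odot> \<one> \<ominus> s \<otimes> s) \<le> t"
    using nrm_selfadj_sq[of r] r(1,2) rc by simp
  then show ?thesis using s by (intro PosI[of _ t]) (auto simp: t_def)
qed

lemma Pos_one [simp]: "Pos \<one>"
  using Pos_square[of \<one>] by simp

text \<open>Both \<open>p\<close> and its complement have roots, and these commute because the
  complement is a polynomial in \<open>p\<close>; so again two commuting squares add up to a
  constant.\<close>

lemma Pos_le_const_nrm:
  assumes "Pos p" "Pos (of_real t \<odot> \<one> \<ominus> p)" "0 \<le> t"
  shows "nrm A p \<le> t"
proof -
  note pc = Pos_closed[OF assms(1)]
  obtain s where s: "Pos s" "s \<otimes> s = p"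
      "\<And>z. z \<in> carrier A \<Longrightarrow> z \<otimes> p = p \<otimes> z \<Longrightarrow> z \<otimes> s = s \<otimes> z"
    using Pos_sqrt[OF assms(1)] by blast
  let ?q = "of_real t \<odot> \<one> \<ominus> p"
  obtain r where r: "Pos r" "r \<otimes> r = ?q" "\<And>z. z \<in> carrier A \<Longrightarrow> z \<otimes> ?q = ?q \<otimes> z \<Longrightarrow> z \<otimes> r = r \<otimes> z"
    using Pos_sqrt[OF assms(2)] by blast
  note sc = Pos_closed[OF s(1)] and rc = Pos_closed[OF r(1)]
  have "s \<otimes> p = p \<otimes> s" using s(2) sc by (metis m_assoc)
  then have "s \<otimes> ?q = ?q \<otimes> s" using sc pc by algebra
  then have "s \<otimes> r = r \<otimes> s" using r(3) sc by blast
  moreover have "s \<otimes> s \<oplus> r \<otimes> r = of_real t \<odot> \<one>" unfolding r(2) s(2) using pc by algebra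
  ultimately have "(nrm A s)\<^sup>2 \<le> t"
    using nrm_commuting_squares[of s r t] r(1) s(1) sc rc assms by simp
  then show ?thesis using nrm_selfadj_sq[of s] s(1,2) sc by simp
qed

text \<open>Commuting roots \<open>s\<close> and \<open>r\<close> exhibit
  \<open>p \<otimes> q\<close> as the square of the selfadjoint element
  \<open>s \<otimes> r\<close>.\<close>

lemma Pos_mult:
  assumes "Pos p" "Pos q" "p \<otimes> q = q \<otimes> p"
  shows "Pos (p \<otimes> q)"
proof -
  note pc = Pos_closed[OF assms(1)] and qc = Pos_closed[OF assms(2)]
  obtain s where s: "Pos s" "s \<otimes> s = p"
      "\<And>z. z \<in> carrier A \<Longrightarrow> z \<otimes> p = p \<otimes> z \<Longrightarrow> z \<otimes> s = s \<otimes> z"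
    using Pos_sqrt[OF assms(1)] by blast
  note sc = Pos_closed[OF s(1)]
  have qs: "q \<otimes> s = s \<otimes> q" using s(3) assms(3) qc by simp
  obtain r where r: "Pos r" "r \<otimes> r = q" "\<And>z. z \<in> carrier A \<Longrightarrow> z \<otimes> q = q \<otimes> z \<Longrightarrow> z \<otimes> r = r \<otimes> z"
    using Pos_sqrt[OF assms(2)] by blast
  note rc = Pos_closed[OF r(1)]
  have sr: "s \<otimes> r = r \<otimes> s" using r(3) qs sc by simp
  have "p \<otimes> q = (s \<otimes> s) \<otimes> (r \<otimes> r)" using s(2) r(2) by simp
  also have "\<dots> = s \<otimes> (s \<otimes> r) \<otimes> r" using sc rc by (simp add: m_assoc)
  also have "\<dots> = s \<otimes> (r \<otimes> s) \<otimes> r" using sr by simp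
  also have "\<dots> = (s \<otimes> r) \<otimes> (s \<otimes> r)" using sc rc by (simp add: m_assoc)
  finally show ?thesis using Pos_square[of "s \<otimes> r"] s(1) r(1) sc rc sr by simp
qed

lemma nrm_Pos_mono:
  assumes "Pos p" "Pos (q \<ominus> p)" "q \<in> carrier A"
  shows "nrm A p \<le> nrm A q"
proof -
  note pc = Pos_closed[OF assms(1)]
  have "q = (q \<ominus> p) \<oplus> p" using assms(3) pc by algebra
  then have "Pos q" using Pos_add[OF assms(2,1)] by simp
  then have "Pos (of_real (nrm A q) \<odot> \<one> \<ominus> q)"
    using Pos_const_minus[of q "nrm A q"] by simp
  then have "Pos ((of_real (nrm A q) \<odot> \<one> \<ominus> q) \<oplus> (q \<ominus> p))" using assms Pos_add by blast
  also have "(of_real (nrm A q) \<odot> \<one> \<ominus> q) \<oplus> (q \<ominus> p) = of_real (nrm A q) \<odot> \<one> \<ominus> p"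
    using assms(3) pc by algebra
  finally show ?thesis using Pos_le_const_nrm assms by simp
qed

lemma nrm_sq_eq_0: "x \<in> carrier A \<Longrightarrow> star A x \<otimes> x = \<zero> \<Longrightarrow> x = \<zero>"
  using nrm_cstar[of x] nrm_0_iff[of x] by simp

lemma selfadj_sq_eq_0: "x \<in> carrier A \<Longrightarrow> star A x = x \<Longrightarrow> x \<otimes> x = \<zero> \<Longrightarrow> x = \<zero>"
  using nrm_sq_eq_0[of x] by simp

text \<open>Bernoulli's inequality in the operator order. The second conjunct is carried along
  because the induction step multiplies the inequality by \<open>p\<close>, which preserves
  positivity only for commuting factors.\<close>

lemma Pos_bernoulli:
  assumes "Pos p"
  shows "Pos ((\<one> \<oplus> p) [^] n \<ominus> \<one> \<ominus> of_real (real n) \<odot> p) \<and> (\<one> \<oplus> p) [^] n \<otimes> p = p \<otimes> (\<one> \<oplus> p) [^] n"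
proof (induction n)
  case 0
  then show ?case using assms by (simp add: minus_eq r_neg)
next
  case (Suc n)
  note p = Pos_closed[OF assms]
  define g where "g = (\<one> \<oplus> p) [^] n"
  have g: "g \<in> carrier A" using p by (simp add: g_def)
  define b where "b = g \<ominus> \<one> \<ominus> of_real (real n) \<odot> p"
  have b: "Pos b" and gp: "g \<otimes> p = p \<otimes> g" using Suc by (auto simp: b_def g_def)
  note bc = Pos_closed[OF b]
  have gb: "g = b \<oplus> \<one> \<oplus> of_real (real n) \<odot> p" unfolding b_def using g p by algebra
  have "b \<otimes> p = p \<otimes> b" unfolding b_def using g p gp by algebra
  then have "Pos (b \<otimes> p)" using b assms Pos_mult by blast
  moreover have "Pos (of_real (real n) \<odot> (p \<otimes> p))"
    using Pos_scal[OF Pos_square[OF p Pos_star[OF assms]], of "real n"] by simp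
  ultimately have "Pos (b \<oplus> b \<otimes> p \<oplus> of_real (real n) \<odot> (p \<otimes> p))" using b Pos_add by blast
  also have "b \<oplus> b \<otimes> p \<oplus> of_real (real n) \<odot> (p \<otimes> p) = g \<otimes> (\<one> \<oplus> p) \<ominus> \<one> \<ominus> (complex_of_real (real n) + 1) \<odot> p"
    unfolding gb using bc p by algebra
  finally have "Pos (g \<otimes> (\<one> \<oplus> p) \<ominus> \<one> \<ominus> of_real (real (Suc n)) \<odot> p)"
    by (simp add: add.commute)
  moreover have "g \<otimes> (\<one> \<oplus> p) \<otimes> p = p \<otimes> (g \<otimes> (\<one> \<oplus> p))" using g p gp by algebra
  ultimately show ?case by (simp add: g_def)
qed

text \<open>
  The main point of the positivity of \<open>z\<^sup>* z\<close>: from \<open>(1 - b) w = w (1 + p)\<close> the powers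
  \<open>w (1 + p)\<^sup>n\<close> stay bounded, whereas \<open>p (1 + p)\<^sup>n\<close> grows at least like \<open>n p\<^sup>2\<close>.
\<close>

lemma no_negative_square_aux:
  assumes w: "w \<in> carrier A" and p: "Pos p" "star A w \<otimes> w = \<ominus> p"
    and b: "nrm A (\<one> \<ominus> w \<otimes> star A w) \<le> 1"
  shows "p = \<zero>"
proof -
  note pc = Pos_closed[OF p(1)]
  have step: "(\<one> \<ominus> w \<otimes> star A w) \<otimes> w = w \<otimes> (\<one> \<oplus> p)"
  proof -
    have "(\<one> \<ominus> w \<otimes> star A w) \<otimes> w = w \<ominus> w \<otimes> (star A w \<otimes> w)" using w by algebra
    also have "\<dots> = w \<otimes> (\<one> \<oplus> p)" unfolding p(2) using w pc by algebra
    finally show ?thesis .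
  qed
  have bound: "nrm A (w \<otimes> (\<one> \<oplus> p) [^] n) \<le> nrm A w" for n :: nat
  proof (induction n)
    case 0 then show ?case using w by simp
  next
    case (Suc n)
    let ?g = "(\<one> \<oplus> p) [^] n"
    have "(\<one> \<oplus> p) [^] Suc n = (\<one> \<oplus> p) \<otimes> ?g" using pc by (intro nat_pow_Suc2) auto
    then have "w \<otimes> (\<one> \<oplus> p) [^] Suc n = (w \<otimes> (\<one> \<oplus> p)) \<otimes> ?g"
      using w pc by (simp add: m_assoc del: nat_pow_Suc)
    also have "\<dots> = (\<one> \<ominus> w \<otimes> star A w) \<otimes> (w \<otimes> ?g)"
      unfolding step[symmetric] using w pc by (simp add: m_assoc)
    finally have "nrm A (w \<otimes> (\<one> \<oplus> p) [^] Suc n) \<le> nrm A (\<one> \<ominus> w \<otimes> star A w) * nrm A (w \<otimes> ?g)"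
      using nrm_times[of "\<one> \<ominus> w \<otimes> star A w" "w \<otimes> ?g"] w pc by simp
    also have "\<dots> \<le> 1 * nrm A (w \<otimes> ?g)" using b w pc by (intro mult_right_mono) auto
    finally show ?case using Suc by simp
  qed
  have "nrm A (p \<otimes> p) * real n \<le> (nrm A w)\<^sup>2" for n :: nat
  proof -
    let ?g = "(\<one> \<oplus> p) [^] n"
    let ?b = "?g \<ominus> \<one> \<ominus> of_real (real n) \<odot> p"
    have g: "?g \<in> carrier A" and bp: "Pos ?b" "?g \<otimes> p = p \<otimes> ?g"
      using pc Pos_bernoulli[OF p(1), of n] by auto
    have "p \<otimes> ?b = ?b \<otimes> p" using g pc bp(2) by algebra
    then have "Pos (p \<otimes> ?b)" using p bp Pos_mult by blast
    then have "Pos (p \<otimes> ?b \<oplus> p)" using p Pos_add by blast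
    also have "p \<otimes> ?b \<oplus> p = p \<otimes> ?g \<ominus> of_real (real n) \<odot> (p \<otimes> p)"
      using g pc by algebra
    finally have "nrm A (of_real (real n) \<odot> (p \<otimes> p)) \<le> nrm A (p \<otimes> ?g)"
      using pc g p by (intro nrm_Pos_mono Pos_scal Pos_square) auto
    also have "p \<otimes> ?g = \<ominus> (star A w \<otimes> (w \<otimes> ?g))"
    proof -
      have "p \<otimes> ?g = \<ominus> (\<ominus> p \<otimes> ?g)" using pc g by algebra
      then show ?thesis unfolding p(2)[symmetric] using w g by (simp add: m_assoc)
    qed
    also have "nrm A \<dots> \<le> nrm A w * nrm A (w \<otimes> ?g)"
      using nrm_times[of "star A w" "w \<otimes> ?g"] w g by simp
    also have "\<dots> \<le> nrm A w * nrm A w" using bound w by (intro mult_left_mono) auto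
    finally show ?thesis using pc by (simp add: power2_eq_square mult.commute)
  qed
  then have "nrm A (p \<otimes> p) \<le> 0"
  proof (rule_tac ccontr, goal_cases)
    case 1
    then obtain n where "(nrm A w)\<^sup>2 < real n * nrm A (p \<otimes> p)"
      using reals_Archimedean3[of "nrm A (p \<otimes> p)"] by force
    then show False using 1(1)[of n] by (simp add: mult.commute)
  qed
  then have "p \<otimes> p = \<zero>" using nrm_le_0[of "p \<otimes> p"] pc by simp
  then show ?thesis using selfadj_sq_eq_0[of p] pc p(1) by simp
qed

text \<open>The squares of the real and imaginary parts of \<open>w\<close> add up, up to a factor,
  to \<open>w \<otimes> star A w \<oplus> star A w \<otimes> w\<close>. As the second summand is
  \<open>\<ominus> p\<close>, the first is positive, and a rescaling brings its complement into the
  unit ball, as the auxiliary lemma demands.\<close>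

lemma no_negative_square:
  assumes w: "w \<in> carrier A" and p: "Pos p" "star A w \<otimes> w = \<ominus> p"
  shows "p = \<zero>"
proof -
  note pc = Pos_closed[OF p(1)]
  let ?u = "w \<oplus> star A w" and ?v = "\<i> \<odot> (w \<ominus> star A w)"
  have "star A ?u = ?u" using w by (simp add: a_comm)
  moreover have "star A ?v = ?v"
  proof -
    have "star A ?v = \<ominus> (\<i> \<odot> (star A w \<ominus> w))" using w by (simp add: scal_uminus_left)
    also have "\<dots> = ?v" using w by algebra
    finally show ?thesis .
  qed
  ultimately have "Pos (?u \<otimes> ?u \<oplus> ?v \<otimes> ?v)"
    using w by (intro Pos_add Pos_square) auto
  moreover have "?u \<otimes> ?u \<oplus> ?v \<otimes> ?v = ?u \<otimes> ?u \<ominus> (w \<ominus> star A w) \<otimes> (w \<ominus> star A w)"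
    using w by (simp add: scal_uminus_left minus_eq)
  moreover have "\<dots> = (w \<otimes> star A w \<oplus> star A w \<otimes> w) \<oplus> (w \<otimes> star A w \<oplus> star A w \<otimes> w)"
    using w by algebra
  ultimately have "Pos ((w \<otimes> star A w \<oplus> star A w \<otimes> w) \<oplus> (w \<otimes> star A w \<oplus> star A w \<otimes> w))" by metis
  then have "Pos ((w \<otimes> star A w \<oplus> \<ominus> p) \<oplus> (w \<otimes> star A w \<oplus> \<ominus> p) \<oplus> (p \<oplus> p))"
    unfolding p(2) by (rule Pos_add[OF _ Pos_add[OF p(1) p(1)]])
  also have "(w \<otimes> star A w \<oplus> \<ominus> p) \<oplus> (w \<otimes> star A w \<oplus> \<ominus> p) \<oplus> (p \<oplus> p) = w \<otimes> star A w \<oplus> w \<otimes> star A w"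
    using w pc by algebra
  finally have "Pos (of_real (1/2) \<odot> (w \<otimes> star A w \<oplus> w \<otimes> star A w))"
    by (intro Pos_scal) auto
  then have "Pos (w \<otimes> star A w)" using w by (simp flip: scal_2)
  then obtain t0 where t0: "t0 \<ge> 0" "nrm A (of_real t0 \<odot> \<one> \<ominus> w \<otimes> star A w) \<le> t0"
    using Pos_bound by meson
  define t where "t = t0 + 1"
  have t: "t > 0" "nrm A (of_real t \<odot> \<one> \<ominus> w \<otimes> star A w) \<le> t"
    using t0 Pos_bound_mono[of "w \<otimes> star A w" t0 t] w by (auto simp: t_def)
  \<comment> \<open>After scaling \<open>w\<close> by this real factor,
    \<open>w \<otimes> star A w\<close> has radius 1.\<close>
  define c where "c = complex_of_real (1 / sqrt t)"
  have cc: "cnj c * c = complex_of_real (1/t)" "c * cnj c = complex_of_real (1/t)"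
    using t by (auto simp: c_def simp flip: of_real_mult real_sqrt_mult)
  have "of_real (1/t) \<odot> p = \<zero>"
  proof (rule no_negative_square_aux)
    show "c \<odot> w \<in> carrier A" using w by simp
    show "Pos (of_real (1/t) \<odot> p)" using p t by (intro Pos_scal) auto
    show "star A (c \<odot> w) \<otimes> (c \<odot> w) = \<ominus> (of_real (1/t) \<odot> p)"
      using w p pc cc by (simp add: mult.commute)
    have "\<one> \<ominus> (c \<odot> w) \<otimes> star A (c \<odot> w) = of_real (1/t) \<odot> (of_real t \<odot> \<one> \<ominus> w \<otimes> star A w)"
      using w t cc by (simp add: scal_diff_right mult.commute)
    then show "nrm A (\<one> \<ominus> (c \<odot> w) \<otimes> star A (c \<odot> w)) \<le> 1"
      using t w by (simp add: norm_divide)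
  qed
  then have "of_real t \<odot> (of_real (1/t) \<odot> p) = \<zero>" by simp
  then show ?thesis using t pc by (simp flip: of_real_mult)
qed

text \<open>Let \<open>m\<close> be the absolute value of \<open>a\<close>, the root of
  \<open>a \<otimes> a\<close>. The element \<open>v = m \<ominus> a\<close> is twice the negative
  part of \<open>a\<close>, and \<open>w = z \<otimes> v\<close> satisfies
  \<open>star A w \<otimes> w = \<ominus> (v \<otimes> m \<otimes> v)\<close>, the negative of a
  square. By \<open>no_negative_square\<close> this vanishes; together with
  \<open>v \<otimes> v = m \<otimes> v \<oplus> m \<otimes> v\<close> it forces
  \<open>v = \<zero>\<close>, that is, \<open>a = m\<close>.\<close>

theorem Pos_star_mult:
  assumes z: "z \<in> carrier A"
  shows "Pos (star A z \<otimes> z)"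
proof -
  define a where "a = star A z \<otimes> z"
  have a: "a \<in> carrier A" "star A a = a" using z by (auto simp: a_def)
  obtain m where m: "Pos m" "m \<otimes> m = a \<otimes> a"
      "\<And>x. x \<in> carrier A \<Longrightarrow> x \<otimes> (a \<otimes> a) = (a \<otimes> a) \<otimes> x \<Longrightarrow> x \<otimes> m = m \<otimes> x"
    using Pos_sqrt[OF Pos_square[OF a]] by blast
  note mc = Pos_closed[OF m(1)]
  have am: "a \<otimes> m = m \<otimes> a" using m(3) a by (simp add: m_assoc)
  define v where "v = m \<ominus> a"
  have v: "v \<in> carrier A" "star A v = v" using a m(1) mc by (auto simp: v_def)
  have mv: "m \<otimes> v = v \<otimes> m" unfolding v_def using a(1) mc am by algebra
  have av: "a \<otimes> v = \<ominus> (m \<otimes> v)"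
  proof -
    have "a \<otimes> v = a \<otimes> m \<ominus> a \<otimes> a" unfolding v_def using a mc by algebra
    also have "\<dots> = \<ominus> (m \<otimes> v)" unfolding v_def am m(2)[symmetric] using a(1) mc by algebra
    finally show ?thesis .
  qed
  obtain n where n: "Pos n" "n \<otimes> n = m" "\<And>x. x \<in> carrier A \<Longrightarrow> x \<otimes> m = m \<otimes> x \<Longrightarrow> x \<otimes> n = n \<otimes> x"
    using Pos_sqrt[OF m(1)] by blast
  note nc = Pos_closed[OF n(1)]
  have nv: "n \<otimes> v = v \<otimes> n" using n(3) v mv by simp
  define s where "s = n \<otimes> v"
  have s: "s \<in> carrier A" "star A s = s" using nc n(1) v nv by (auto simp: s_def)
  have ss: "s \<otimes> s = m \<otimes> v \<otimes> v"
  proof -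
    have "s \<otimes> s = (n \<otimes> v) \<otimes> (n \<otimes> v)" by (simp add: s_def)
    also have "\<dots> = n \<otimes> (v \<otimes> n) \<otimes> v" using nc v by (simp add: m_assoc)
    also have "\<dots> = (n \<otimes> n) \<otimes> v \<otimes> v" unfolding nv[symmetric] using nc v by (simp add: m_assoc)
    finally show ?thesis using n(2) by simp
  qed
  define w where "w = z \<otimes> v"
  have w: "w \<in> carrier A" using z v by (simp add: w_def)
  have "star A w \<otimes> w = v \<otimes> (a \<otimes> v)" using z v by (simp add: w_def a_def m_assoc)
  also have "\<dots> = \<ominus> (v \<otimes> m \<otimes> v)" unfolding av using v mc by algebra
  also have "\<dots> = \<ominus> (s \<otimes> s)" unfolding ss mv[symmetric] by simp
  finally have "s \<otimes> s = \<zero>"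
    using no_negative_square[OF w, of "s \<otimes> s"] Pos_square[OF s] by blast
  then have mvv: "m \<otimes> v \<otimes> v = \<zero>" using ss by simp
  have "v \<otimes> v = m \<otimes> m \<ominus> m \<otimes> a \<ominus> a \<otimes> m \<oplus> a \<otimes> a" unfolding v_def using a mc by algebra
  also have "\<dots> = m \<otimes> v \<oplus> m \<otimes> v" unfolding am m(2)[symmetric] v_def using a mc by algebra
  finally have "(v \<otimes> v) \<otimes> v = m \<otimes> v \<otimes> v \<oplus> m \<otimes> v \<otimes> v" using v mc by (simp add: l_distr)
  then have "(v \<otimes> v) \<otimes> v = \<zero>" using mvv by simp
  moreover have "(v \<otimes> v) \<otimes> (v \<otimes> v) = (v \<otimes> v) \<otimes> v \<otimes> v" using v(1) by (simp add: m_assoc)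
  ultimately have "(v \<otimes> v) \<otimes> (v \<otimes> v) = \<zero>" using v(1) by simp
  then have "v \<otimes> v = \<zero>" using selfadj_sq_eq_0[of "v \<otimes> v"] v by simp
  then have "v = \<zero>" using selfadj_sq_eq_0[of v] v by simp
  then have "a = m" using minus_zero_iff[of m a] a mc by (simp add: v_def)
  then show ?thesis using m(1) by (simp add: a_def)
qed

lemma Pos_mult_star: "z \<in> carrier A \<Longrightarrow> Pos (z \<otimes> star A z)"
  using Pos_star_mult[of "star A z"] by simp

lemma Pos_conj:
  assumes "Pos b" "x \<in> carrier A"
  shows "Pos (star A x \<otimes> b \<otimes> x)"
proof -
  obtain s where s: "Pos s" "s \<otimes> s = b" using Pos_sqrt[OF assms(1)] by blast
  note sc = Pos_closed[OF s(1)]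
  have "star A x \<otimes> b \<otimes> x = star A (s \<otimes> x) \<otimes> (s \<otimes> x)"
    unfolding s(2)[symmetric] using s(1) sc assms(2) by (simp add: m_assoc)
  then show ?thesis using Pos_star_mult[of "s \<otimes> x"] sc assms by simp
qed

lemma Pos_nrm_sq_minus:
  assumes "x \<in> carrier A" "nrm A x \<le> t"
  shows "Pos (of_real (t\<^sup>2) \<odot> \<one> \<ominus> star A x \<otimes> x)"
proof (rule Pos_const_minus)
  show "nrm A (star A x \<otimes> x) \<le> t\<^sup>2"
    unfolding nrm_cstar[OF assms(1)] using assms by (intro power_mono) auto
qed (use assms in auto)

lemma nrm_le_if_Pos:
  assumes "x \<in> carrier A" "Pos (of_real (t\<^sup>2) \<odot> \<one> \<ominus> star A x \<otimes> x)" "0 \<le> t"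
  shows "nrm A x \<le> t"
proof -
  have "(nrm A x)\<^sup>2 \<le> t\<^sup>2"
    using Pos_le_const_nrm[OF Pos_star_mult[OF assms(1)] assms(2)] nrm_cstar[OF assms(1)] by simp
  then show ?thesis using assms(3) by (rule power2_le_imp_le)
qed

end

subsection \<open>Contractivity of *-homomorphisms\<close>

lemma star_homD:
  assumes "star_hom C B \<pi>"
  shows "x \<in> carrier C \<Longrightarrow> \<pi> x \<in> carrier B"
    and "x \<in> carrier C \<Longrightarrow> y \<in> carrier C \<Longrightarrow> \<pi> (x \<oplus>\<^sub>C y) = \<pi> x \<oplus>\<^sub>B \<pi> y"
    and "x \<in> carrier C \<Longrightarrow> y \<in> carrier C \<Longrightarrow> \<pi> (x \<otimes>\<^sub>C y) = \<pi> x \<otimes>\<^sub>B \<pi> y"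
    and "x \<in> carrier C \<Longrightarrow> \<pi> (c \<odot>\<^sub>C x) = c \<odot>\<^sub>B \<pi> x"
    and "x \<in> carrier C \<Longrightarrow> \<pi> (star C x) = star B (\<pi> x)"
  using assms by (auto simp: star_hom_def algebra_hom_def)

text \<open>The image of a square is a square, so a root of \<open>d\<close> transports positivity
  from \<open>C\<close> to \<open>B\<close>.\<close>

lemma star_hom_contractive:
  assumes "cstar C" "cstar B" "star_hom C B \<pi>" "x \<in> carrier C"
  shows "nrm B (\<pi> x) \<le> nrm C x"
proof -
  interpret C: cstar C by fact
  interpret B: cstar B by fact
  note hom = star_homD[OF assms(3)]
  let ?t = "nrm C x" and ?one = "\<pi> \<one>\<^sub>C"
  define d where "d = of_real (?t\<^sup>2) \<odot>\<^sub>C \<one>\<^sub>C \<ominus>\<^sub>C star C x \<otimes>\<^sub>C x"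
  have "C.Pos d" unfolding d_def using assms(4) by (intro C.Pos_nrm_sq_minus) auto
  then obtain s where s: "C.Pos s" "s \<otimes>\<^sub>C s = d" using C.Pos_sqrt by blast
  then have sB: "\<pi> s \<in> carrier B" "star B (\<pi> s) = \<pi> s" using hom(1,5)[of s] by auto
  have "\<pi> d = \<pi> s \<otimes>\<^sub>B \<pi> s" using hom(3)[of s s] s by simp
  then have P1: "B.Pos (\<pi> d)" using B.Pos_square[OF sB] by simp
  have one: "?one \<in> carrier B" "star B ?one = ?one" "?one \<otimes>\<^sub>B ?one = ?one"
    using hom(1,5)[of "\<one>\<^sub>C"] hom(3)[of "\<one>\<^sub>C" "\<one>\<^sub>C"] by auto
  \<comment> \<open>The homomorphism may fail to be unital. Then \<open>?one\<close> is a
    projection, and its complement supplies the part of the unit of \<open>B\<close> that the image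
    lacks.\<close>
  let ?e = "\<one>\<^sub>B \<ominus>\<^sub>B ?one"
  have "?e \<otimes>\<^sub>B ?e = \<one>\<^sub>B \<ominus>\<^sub>B ?one \<ominus>\<^sub>B ?one \<oplus>\<^sub>B ?one \<otimes>\<^sub>B ?one" using one(1) by algebra
  also have "\<dots> = ?e" unfolding one(3) using one(1) by algebra
  finally have "?e \<otimes>\<^sub>B ?e = ?e" .
  then have P2: "B.Pos (of_real (?t\<^sup>2) \<odot>\<^sub>B ?e)"
    using B.Pos_square[of ?e] one by (intro B.Pos_scal) auto
  have xB: "\<pi> x \<in> carrier B" and xs: "\<pi> (star C x \<otimes>\<^sub>C x) = star B (\<pi> x) \<otimes>\<^sub>B \<pi> x"
    using hom assms(4) by auto
  have "of_real (?t\<^sup>2) \<odot>\<^sub>C \<one>\<^sub>C = d \<oplus>\<^sub>C star C x \<otimes>\<^sub>C x"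
    unfolding d_def using assms(4) by (simp add: C.minus_cancel_right)
  then have "of_real (?t\<^sup>2) \<odot>\<^sub>B ?one = \<pi> d \<oplus>\<^sub>B star B (\<pi> x) \<otimes>\<^sub>B \<pi> x"
    using hom(2)[of d "star C x \<otimes>\<^sub>C x"] hom(4)[of "\<one>\<^sub>C"] xs assms(4) s C.Pos_closed[OF s(1)]
    by (metis C.Pos_closed C.m_closed C.one_closed C.star_cl \<open>C.Pos d\<close>)
  then have eq: "\<pi> d = of_real (?t\<^sup>2) \<odot>\<^sub>B ?one \<ominus>\<^sub>B star B (\<pi> x) \<otimes>\<^sub>B \<pi> x"
    using B.Pos_closed[OF P1] xB by (simp add: B.minus_eq B.a_assoc B.r_neg)
  have "\<pi> d \<oplus>\<^sub>B of_real (?t\<^sup>2) \<odot>\<^sub>B ?e = of_real (?t\<^sup>2) \<odot>\<^sub>B \<one>\<^sub>B \<ominus>\<^sub>B star B (\<pi> x) \<otimes>\<^sub>B \<pi> x"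
    unfolding eq using xB one(1) by algebra
  then have "B.Pos (of_real (?t\<^sup>2) \<odot>\<^sub>B \<one>\<^sub>B \<ominus>\<^sub>B star B (\<pi> x) \<otimes>\<^sub>B \<pi> x)"
    using B.Pos_add[OF P1 P2] by simp
  then show ?thesis using B.nrm_le_if_Pos xB assms(4) by simp
qed

section \<open>Matrices over a C*-algebra\<close>

subsection \<open>The C*-seminorm of a cone of squares\<close>

lemma le_mult_if_le_mult_above:
  fixes a b c :: real
  assumes "\<And>u v. a < u \<Longrightarrow> b < v \<Longrightarrow> c \<le> u * v"
  shows "c \<le> a * b"
proof (rule LIMSEQ_le_const)
  show "(\<lambda>n. (a + 1 / real (Suc n)) * (b + 1 / real (Suc n))) \<longlonglongrightarrow> a * b"
  proof -
    have "(\<lambda>n. (a + 1 / real (Suc n)) * (b + 1 / real (Suc n))) \<longlonglongrightarrow> (a + 0) * (b + 0)"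
      by (intro tendsto_intros LIMSEQ_Suc[OF lim_1_over_n])
    then show ?thesis by simp
  qed
qed (use assms in auto)

lemma le_square_if_le_square_above:
  fixes a c :: real
  assumes "\<And>u. a < u \<Longrightarrow> c \<le> u\<^sup>2"
  shows "c \<le> a\<^sup>2"
proof (rule LIMSEQ_le_const)
  show "(\<lambda>n. (a + 1 / real (Suc n))\<^sup>2) \<longlonglongrightarrow> a\<^sup>2"
  proof -
    have "(\<lambda>n. (a + 1 / real (Suc n))\<^sup>2) \<longlonglongrightarrow> (a + 0)\<^sup>2"
      by (intro tendsto_intros LIMSEQ_Suc[OF lim_1_over_n])
    then show ?thesis by simp
  qed
qed (use assms in auto)

context star_alg
begin

text \<open>An algebraic substitute for positivity, available in a *-algebra that has no norm
  yet.\<close>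

inductive_set cone :: "'a set" where
  cone_sq: "x \<in> carrier A \<Longrightarrow> star A x \<otimes> x \<in> cone"
| cone_add: "p \<in> cone \<Longrightarrow> q \<in> cone \<Longrightarrow> p \<oplus> q \<in> cone"

lemma cone_closed [simp]: "p \<in> cone \<Longrightarrow> p \<in> carrier A"
  by (induction rule: cone.induct) auto

lemma cone_one: "\<one> \<in> cone"
  using cone_sq[of \<one>] by simp

lemma cone_selfadj_sq: "x \<in> carrier A \<Longrightarrow> star A x = x \<Longrightarrow> x \<otimes> x \<in> cone"
  using cone_sq[of x] by simp

lemma cone_scal:
  assumes "p \<in> cone" "0 \<le> r"
  shows "of_real r \<odot> p \<in> cone"
  using assms(1)
proof induction
  case (cone_sq x)
  let ?c = "complex_of_real (sqrt r)"
  have "of_real r \<odot> (star A x \<otimes> x) = star A (?c \<odot> x) \<otimes> (?c \<odot> x)"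
    using cone_sq assms(2) by (simp flip: of_real_mult)
  then show ?case using cone.cone_sq[of "?c \<odot> x"] cone_sq by simp
next
  case (cone_add p q)
  then show ?case by (simp add: scal_add_right cone.cone_add)
qed

lemma cone_conj: "p \<in> cone \<Longrightarrow> y \<in> carrier A \<Longrightarrow> star A y \<otimes> p \<otimes> y \<in> cone"
proof (induction rule: cone.induct)
  case (cone_sq x)
  then show ?case using cone.cone_sq[of "x \<otimes> y"] by (simp add: m_assoc)
next
  case (cone_add p q)
  then show ?case by (simp add: r_distr l_distr cone.cone_add)
qed

text \<open>To be read as: the norm of \<open>x\<close> is at most \<open>u\<close>. Strict
  positivity of \<open>u\<close> makes quotients of bounds available in
  \<open>dominated_add\<close>.\<close>

definition dominated :: "real \<Rightarrow> 'a \<Rightarrow> bool" where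
  "dominated u x \<longleftrightarrow> 0 < u \<and> of_real (u\<^sup>2) \<odot> \<one> \<ominus> star A x \<otimes> x \<in> cone"

lemma dominated_mono:
  assumes "dominated u x" "u \<le> v" "x \<in> carrier A"
  shows "dominated v x"
proof -
  have "u\<^sup>2 \<le> v\<^sup>2" using assms by (auto simp: dominated_def intro: power_mono)
  then have "of_real (v\<^sup>2 - u\<^sup>2) \<odot> \<one> \<oplus> (of_real (u\<^sup>2) \<odot> \<one> \<ominus> star A x \<otimes> x) \<in> cone"
    using assms by (intro cone_add cone_scal cone_one) (auto simp: dominated_def)
  also have "of_real (v\<^sup>2 - u\<^sup>2) \<odot> \<one> \<oplus> (of_real (u\<^sup>2) \<odot> \<one> \<ominus> star A x \<otimes> x)
      = of_real (v\<^sup>2) \<odot> \<one> \<ominus> star A x \<otimes> x"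
    unfolding of_real_diff using assms(3) by algebra
  finally show ?thesis using assms by (auto simp: dominated_def)
qed

lemma dominated_zero: "0 < u \<Longrightarrow> dominated u \<zero>"
  using cone_scal[OF cone_one, of "u\<^sup>2"] by (simp add: dominated_def minus_eq)

text \<open>\<open>?Z\<close> is a difference of multiples of \<open>x\<close> and \<open>y\<close>
  whose cross terms cancel those of \<open>x \<oplus> y\<close>. The weights
  \<open>a = v / u\<close> and \<open>b = u / v\<close> have product 1 and make
  \<open>(1 + a) * u\<^sup>2 + (1 + b) * v\<^sup>2\<close> collapse to
  \<open>(u + v)\<^sup>2\<close>.\<close>

lemma dominated_add:
  assumes "dominated u x" "dominated v y" and x: "x \<in> carrier A" and y: "y \<in> carrier A"
  shows "dominated (u + v) (x \<oplus> y)"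
proof -
  have u: "0 < u" and v: "0 < v" using assms by (auto simp: dominated_def)
  define a b where "a = v / u" and "b = u / v"
  have ab: "0 < a" "0 < b" "sqrt a * sqrt b = 1" using u v by (auto simp: a_def b_def simp flip: real_sqrt_mult)
  let ?c = "complex_of_real"
  let ?X = "star A x \<otimes> x" and ?Y = "star A y \<otimes> y" and ?Z = "?c (sqrt a) \<odot> x \<ominus> ?c (sqrt b) \<odot> y"
  have "star A ?Z \<otimes> ?Z = (?c (sqrt a) * ?c (sqrt a)) \<odot> ?X
      \<ominus> (?c (sqrt a) * ?c (sqrt b)) \<odot> (star A x \<otimes> y \<oplus> star A y \<otimes> x) \<oplus> (?c (sqrt b) * ?c (sqrt b)) \<odot> ?Y"
  proof -
    have "star A ?Z = ?c (sqrt a) \<odot> star A x \<ominus> ?c (sqrt b) \<odot> star A y" using x y by simp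
    then show ?thesis using x y by algebra
  qed
  then have Z: "star A ?Z \<otimes> ?Z = ?c a \<odot> ?X \<ominus> (star A x \<otimes> y \<oplus> star A y \<otimes> x) \<oplus> ?c b \<odot> ?Y"
    using ab x y by (simp flip: of_real_mult)
  let ?s = "?c (1 + a) \<odot> (?c (u\<^sup>2) \<odot> \<one> \<ominus> ?X) \<oplus> ?c (1 + b) \<odot> (?c (v\<^sup>2) \<odot> \<one> \<ominus> ?Y) \<oplus> star A ?Z \<otimes> ?Z"
  have "?s \<in> cone"
    using assms ab by (intro cone_add cone_scal cone_sq) (auto simp: dominated_def)
  also have "?s = (?c (1 + a) * ?c (u\<^sup>2) + ?c (1 + b) * ?c (v\<^sup>2)) \<odot> \<one> \<ominus> star A (x \<oplus> y) \<otimes> (x \<oplus> y)"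
    unfolding Z of_real_add of_real_1 using x y by algebra
  also have "?c (1 + a) * ?c (u\<^sup>2) + ?c (1 + b) * ?c (v\<^sup>2) = ?c ((u + v)\<^sup>2)"
  proof -
    have "(1 + a) * u\<^sup>2 + (1 + b) * v\<^sup>2 = (u + v)\<^sup>2"
      using u v by (simp add: a_def b_def power2_eq_square algebra_simps)
    from arg_cong[OF this, of ?c] show ?thesis by simp
  qed
  finally show ?thesis using u v by (simp add: dominated_def)
qed

lemma dominated_mult:
  assumes "dominated u x" "dominated v y" and x: "x \<in> carrier A" and y: "y \<in> carrier A"
  shows "dominated (u * v) (x \<otimes> y)"
proof -
  let ?c = "complex_of_real"
  let ?s = "star A y \<otimes> (?c (u\<^sup>2) \<odot> \<one> \<ominus> star A x \<otimes> x) \<otimes> y \<oplus> ?c (u\<^sup>2) \<odot> (?c (v\<^sup>2) \<odot> \<one> \<ominus> star A y \<otimes> y)"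
  have "?s \<in> cone"
    using assms by (intro cone_add cone_scal cone_conj) (auto simp: dominated_def)
  also have "?s = (?c (u\<^sup>2) * ?c (v\<^sup>2)) \<odot> \<one> \<ominus> star A (x \<otimes> y) \<otimes> (x \<otimes> y)"
    using x y by algebra
  finally show ?thesis using assms by (simp add: dominated_def power_mult_distrib)
qed

lemma dominated_scal:
  assumes "dominated u x" "x \<in> carrier A" "c \<noteq> 0"
  shows "dominated (cmod c * u) (c \<odot> x)"
proof -
  have "of_real ((cmod c)\<^sup>2) \<odot> (of_real (u\<^sup>2) \<odot> \<one> \<ominus> star A x \<otimes> x) \<in> cone"
    using assms by (intro cone_scal) (auto simp: dominated_def)
  also have "of_real ((cmod c)\<^sup>2) \<odot> (of_real (u\<^sup>2) \<odot> \<one> \<ominus> star A x \<otimes> x)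
      = of_real ((cmod c * u)\<^sup>2) \<odot> \<one> \<ominus> star A (c \<odot> x) \<otimes> (c \<odot> x)"
    using assms(2) complex_norm_square[of c]
    by (simp add: scal_diff_right power_mult_distrib mult.commute)
  finally show ?thesis using assms by (simp add: dominated_def)
qed

text \<open>A product of commuting members of the cone is not visibly a sum of squares. Here
  \<open>p \<otimes> d \<otimes> p \<oplus> d \<otimes> p \<otimes> d\<close> is in the cone, and it
  is \<open>u\<^sup>2\<close> times \<open>p \<otimes> d\<close> because \<open>p \<oplus> d\<close>
  is the constant \<open>u\<^sup>2\<close>. Adding \<open>u\<^sup>2\<close> times \<open>d\<close>
  to \<open>p \<otimes> d\<close> gives the required difference.\<close>

lemma dominated_star_mult:
  assumes "dominated u x" and x: "x \<in> carrier A"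
  shows "dominated (u\<^sup>2) (star A x \<otimes> x)"
proof -
  let ?c = "complex_of_real"
  define p where "p = star A x \<otimes> x"
  have p: "p \<in> carrier A" "star A p = p" "p \<in> cone" using x by (auto simp: p_def intro: cone_sq)
  have u: "0 < u" using assms by (simp add: dominated_def)
  define d where "d = ?c (u\<^sup>2) \<odot> \<one> \<ominus> p"
  have d: "d \<in> cone" "star A d = d" "d \<in> carrier A"
    using assms p by (auto simp: d_def dominated_def p_def)
  let ?s = "?c (1 / u\<^sup>2) \<odot> (star A p \<otimes> d \<otimes> p \<oplus> star A d \<otimes> p \<otimes> d) \<oplus> ?c (u\<^sup>2) \<odot> d"
  have "?s \<in> cone" using d p by (intro cone_add cone_scal cone_conj) auto
  also have "star A p \<otimes> d \<otimes> p \<oplus> star A d \<otimes> p \<otimes> d = ?c (u\<^sup>2) \<odot> (?c (u\<^sup>2) \<odot> p \<ominus> p \<otimes> p)"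
    unfolding p(2) d(2) unfolding d_def using p(1) by algebra
  also have "?c (1 / u\<^sup>2) \<odot> (?c (u\<^sup>2) \<odot> (?c (u\<^sup>2) \<odot> p \<ominus> p \<otimes> p)) = ?c (u\<^sup>2) \<odot> p \<ominus> p \<otimes> p"
    using p u by simp
  also have "?c (u\<^sup>2) \<odot> p \<ominus> p \<otimes> p \<oplus> ?c (u\<^sup>2) \<odot> d = (?c (u\<^sup>2) * ?c (u\<^sup>2)) \<odot> \<one> \<ominus> p \<otimes> p"
    unfolding d_def using p(1) by algebra
  finally show ?thesis
    using u p by (simp add: dominated_def p_def[symmetric] power2_eq_square)
qed

text \<open>The identity \<open>u\<^sup>2 - p\<^sup>2 + (u - p)\<^sup>2 = 2 * u * (u - p)\<close>
  exhibits \<open>u - p\<close> as a member of the cone.\<close>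

lemma dominated_star_multD:
  assumes "dominated u (star A x \<otimes> x)" and x: "x \<in> carrier A"
  shows "dominated (sqrt u) x"
proof -
  let ?c = "complex_of_real"
  define p where "p = star A x \<otimes> x"
  have p: "p \<in> carrier A" "star A p = p" using x by (auto simp: p_def)
  have u: "0 < u" using assms by (simp add: dominated_def)
  define d where "d = ?c u \<odot> \<one> \<ominus> p"
  have d: "star A d = d" "d \<in> carrier A" using p by (auto simp: d_def)
  have "?c (1 / (2 * u)) \<odot> ((?c (u\<^sup>2) \<odot> \<one> \<ominus> p \<otimes> p) \<oplus> d \<otimes> d) \<in> cone"
    using assms d p u by (intro cone_scal cone_add cone_selfadj_sq) (auto simp: dominated_def p_def)
  also have "(?c (u\<^sup>2) \<odot> \<one> \<ominus> p \<otimes> p) \<oplus> d \<otimes> d = ?c u \<odot> d \<oplus> ?c u \<odot> d"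
    unfolding d_def power2_eq_square of_real_mult using p(1) by algebra
  also have "?c (1 / (2 * u)) \<odot> (?c u \<odot> d \<oplus> ?c u \<odot> d) = (?c (1 / (2 * u)) * (2 * ?c u)) \<odot> d"
    using d by (simp flip: scal_2)
  also have "?c (1 / (2 * u)) * (2 * ?c u) = 1" using u by simp
  finally show ?thesis using u d by (simp add: dominated_def d_def p_def)
qed

definition cone_norm :: "'a \<Rightarrow> real" where
  "cone_norm x = Inf {u. dominated u x}"

lemma cone_norm_le: "dominated u x \<Longrightarrow> cone_norm x \<le> u"
  unfolding cone_norm_def by (rule cInf_lower) (auto simp: dominated_def intro!: bdd_belowI[of _ 0])

end

text \<open>The assumption keeps \<open>cone_norm\<close> from being an infimum over the empty
  set.\<close>

locale bounded_star_alg = star_alg +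
  assumes ex_dominated: "x \<in> carrier A \<Longrightarrow> \<exists>u. dominated u x"
begin

lemma dominated_if_cone_norm_less:
  assumes "cone_norm x < u" "x \<in> carrier A"
  shows "dominated u x"
proof -
  obtain v where "dominated v x" "v < u"
    using assms ex_dominated cInf_lessD[of "{u. dominated u x}" u] by (auto simp: cone_norm_def)
  then show ?thesis using dominated_mono assms by auto
qed

lemma cone_norm_ge_0: "x \<in> carrier A \<Longrightarrow> 0 \<le> cone_norm x"
  unfolding cone_norm_def using ex_dominated by (intro cInf_greatest) (auto simp: dominated_def)

lemma cone_norm_plus:
  assumes "x \<in> carrier A" "y \<in> carrier A"
  shows "cone_norm (x \<oplus> y) \<le> cone_norm x + cone_norm y"
proof (rule field_le_epsilon)
  fix e :: real assume "0 < e"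
  then have "dominated ((cone_norm x + e/2) + (cone_norm y + e/2)) (x \<oplus> y)"
    using assms by (intro dominated_add dominated_if_cone_norm_less) auto
  then show "cone_norm (x \<oplus> y) \<le> cone_norm x + cone_norm y + e"
    using cone_norm_le by fastforce
qed

lemma cone_norm_times:
  assumes "x \<in> carrier A" "y \<in> carrier A"
  shows "cone_norm (x \<otimes> y) \<le> cone_norm x * cone_norm y"
proof (rule le_mult_if_le_mult_above)
  fix u v assume "cone_norm x < u" "cone_norm y < v"
  then show "cone_norm (x \<otimes> y) \<le> u * v"
    using assms by (intro cone_norm_le dominated_mult dominated_if_cone_norm_less)
qed

lemma cone_norm_zero: "cone_norm \<zero> = 0"
proof (rule antisym)
  show "cone_norm \<zero> \<le> 0"
    by (rule dense_ge) (auto intro: cone_norm_le dominated_zero)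
qed (simp add: cone_norm_ge_0)

lemma cone_norm_scal:
  assumes "x \<in> carrier A"
  shows "cone_norm (c \<odot> x) = cmod c * cone_norm x"
proof (cases "c = 0")
  case True
  then show ?thesis using assms cone_norm_zero by simp
next
  case False
  have le: "cone_norm (c \<odot> x) \<le> cmod c * cone_norm x" if "x \<in> carrier A" "c \<noteq> 0" for c x
  proof -
    have "cone_norm (c \<odot> x) / cmod c \<le> cone_norm x"
    proof (rule dense_ge)
      fix u assume "cone_norm x < u"
      then have "cone_norm (c \<odot> x) \<le> cmod c * u"
        using that by (intro cone_norm_le dominated_scal dominated_if_cone_norm_less)
      then show "cone_norm (c \<odot> x) / cmod c \<le> u" using that by (simp add: field_simps)
    qed
    then show ?thesis using that by (simp add: field_simps)
  qed
  have "cone_norm (inverse c \<odot> (c \<odot> x)) \<le> cmod (inverse c) * cone_norm (c \<odot> x)"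
    using False assms by (intro le) auto
  then have "cmod c * cone_norm x \<le> cone_norm (c \<odot> x)"
    using False assms by (simp add: norm_divide field_simps)
  then show ?thesis using le[of x c] False assms by simp
qed

lemma cone_norm_cstar:
  assumes "x \<in> carrier A"
  shows "cone_norm (star A x \<otimes> x) = (cone_norm x)\<^sup>2"
proof (rule antisym)
  show "cone_norm (star A x \<otimes> x) \<le> (cone_norm x)\<^sup>2"
  proof (rule le_square_if_le_square_above)
    fix u assume "cone_norm x < u"
    then show "cone_norm (star A x \<otimes> x) \<le> u\<^sup>2"
      using assms by (intro cone_norm_le dominated_star_mult dominated_if_cone_norm_less)
  qed
  show "(cone_norm x)\<^sup>2 \<le> cone_norm (star A x \<otimes> x)"
  proof (rule dense_ge)
    fix u assume "cone_norm (star A x \<otimes> x) < u"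
    then have "dominated u (star A x \<otimes> x)" using assms by (intro dominated_if_cone_norm_less) auto
    moreover from this have "0 < u" by (simp add: dominated_def)
    ultimately have "cone_norm x \<le> sqrt u"
      using assms by (intro cone_norm_le dominated_star_multD) auto
    then have "(cone_norm x)\<^sup>2 \<le> (sqrt u)\<^sup>2" using assms cone_norm_ge_0 by (intro power_mono) auto
    then show "(cone_norm x)\<^sup>2 \<le> u" using \<open>0 < u\<close> by simp
  qed
qed

end

subsection \<open>The *-algebra of matrices\<close>

lemma matrix_algebra_simps [simp]:
  "carrier (matrix_algebra A n N) = matrices_over A n (carrier A)"
  "L \<otimes>\<^bsub>matrix_algebra A n N\<^esub> M = (\<lambda>i j. \<Oplus>\<^bsub>A\<^esub>k\<in>{..<n}. L i k \<otimes>\<^sub>A M k j)"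
  "\<one>\<^bsub>matrix_algebra A n N\<^esub> = (\<lambda>i j. if i = j \<and> i < n then \<one>\<^sub>A else \<zero>\<^sub>A)"
  "\<zero>\<^bsub>matrix_algebra A n N\<^esub> = (\<lambda>i j. \<zero>\<^sub>A)"
  "L \<oplus>\<^bsub>matrix_algebra A n N\<^esub> M = (\<lambda>i j. L i j \<oplus>\<^sub>A M i j)"
  "c \<odot>\<^bsub>matrix_algebra A n N\<^esub> M = (\<lambda>i j. c \<odot>\<^sub>A M i j)"
  "star (matrix_algebra A n N) M = (\<lambda>i j. star A (M j i))"
  "nrm (matrix_algebra A n N) M = N M"
  by (simp_all add: matrix_algebra_def)

lemma matrices_overD:
  "M \<in> matrices_over A n S \<Longrightarrow> i < n \<Longrightarrow> j < n \<Longrightarrow> M i j \<in> S"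
  "M \<in> matrices_over A n S \<Longrightarrow> \<not> (i < n \<and> j < n) \<Longrightarrow> M i j = \<zero>\<^sub>A"
  "M \<in> matrices_over A n S \<Longrightarrow> \<not> i < n \<Longrightarrow> M i j = \<zero>\<^sub>A"
  "M \<in> matrices_over A n S \<Longrightarrow> \<not> j < n \<Longrightarrow> M i j = \<zero>\<^sub>A"
  unfolding matrices_over_def by force+

lemma matrices_overI:
  "\<lbrakk>\<And>i j. i < n \<Longrightarrow> j < n \<Longrightarrow> M i j \<in> S; \<And>i j. \<not> i < n \<Longrightarrow> M i j = \<zero>\<^sub>A;
    \<And>i j. \<not> j < n \<Longrightarrow> M i j = \<zero>\<^sub>A\<rbrakk>
   \<Longrightarrow> M \<in> matrices_over A n S"
  by (auto simp: matrices_over_def)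

context star_alg
begin

lemma matrix_entry_closed [simp]: "M \<in> matrices_over A n (carrier A) \<Longrightarrow> M i j \<in> carrier A"
  by (cases "i < n \<and> j < n") (simp_all add: matrices_overD)

lemma finsum_swap:
  assumes "finite F" "finite G" "\<And>k l. k \<in> F \<Longrightarrow> l \<in> G \<Longrightarrow> f k l \<in> carrier A"
  shows "(\<Oplus>k\<in>F. \<Oplus>l\<in>G. f k l) = (\<Oplus>l\<in>G. \<Oplus>k\<in>F. f k l)"
  using assms(1,3)
proof (induction F rule: finite_induct)
  case (insert x F)
  have "(\<Oplus>k\<in>insert x F. \<Oplus>l\<in>G. f k l) = (\<Oplus>l\<in>G. f x l) \<oplus> (\<Oplus>k\<in>F. \<Oplus>l\<in>G. f k l)"
    using insert by (intro finsum_insert) (auto intro!: finsum_closed)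
  also have "\<dots> = (\<Oplus>l\<in>G. f x l) \<oplus> (\<Oplus>l\<in>G. \<Oplus>k\<in>F. f k l)" using insert by simp
  also have "\<dots> = (\<Oplus>l\<in>G. f x l \<oplus> (\<Oplus>k\<in>F. f k l))"
    using insert by (intro finsum_addf[symmetric]) (auto intro!: finsum_closed)
  also have "\<dots> = (\<Oplus>l\<in>G. \<Oplus>k\<in>insert x F. f k l)"
    using insert by (intro finsum_cong') (auto intro!: finsum_closed finsum_insert[symmetric])
  finally show ?case .
qed simp

lemma star_finsum:
  "finite F \<Longrightarrow> f \<in> F \<rightarrow> carrier A \<Longrightarrow> star A (finsum A f F) = (\<Oplus>k\<in>F. star A (f k))"
proof (induction F rule: finite_induct)
  case (insert x F)
  have "finsum A f (insert x F) = f x \<oplus> finsum A f F"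
    "(\<Oplus>k\<in>insert x F. star A (f k)) = star A (f x) \<oplus> (\<Oplus>k\<in>F. star A (f k))"
    using insert by (auto intro!: finsum_insert)
  then show ?case using insert by (auto intro!: finsum_closed)
qed simp

lemma scal_finsum:
  "finite F \<Longrightarrow> f \<in> F \<rightarrow> carrier A \<Longrightarrow> c \<odot> finsum A f F = (\<Oplus>k\<in>F. c \<odot> f k)"
proof (induction F rule: finite_induct)
  case (insert x F)
  have "finsum A f (insert x F) = f x \<oplus> finsum A f F"
    "(\<Oplus>k\<in>insert x F. c \<odot> f k) = c \<odot> f x \<oplus> (\<Oplus>k\<in>F. c \<odot> f k)"
    using insert by (auto intro!: finsum_insert)
  then show ?case using insert scal_add_right[of "f x" "finsum A f F" c] by (auto intro!: finsum_closed)
qed simp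

lemma finsum_single:
  assumes "finite F" "i \<in> F" "f i \<in> carrier A" "\<And>k. k \<in> F \<Longrightarrow> k \<noteq> i \<Longrightarrow> f k = \<zero>"
  shows "finsum A f F = f i"
proof -
  have "finsum A f F = (\<Oplus>k\<in>F. if i = k then f i else \<zero>)"
    using assms by (intro finsum_cong') auto
  also have "\<dots> = f i" using assms add.finprod_singleton[of i F "\<lambda>_. f i"] by auto
  finally show ?thesis .
qed

lemma matrix_mult_closed:
  assumes "L \<in> matrices_over A n (carrier A)" "M \<in> matrices_over A n (carrier A)"
  shows "(\<lambda>i j. \<Oplus>k\<in>{..<n}. L i k \<otimes> M k j) \<in> matrices_over A n (carrier A)"
proof (rule matrices_overI)
qed (use assms in \<open>simp_all add: matrices_overD\<close>)

text \<open>Stated for every function \<open>N\<close> in the norm slot, so that the *-algebra of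
  matrices is at hand before a norm on it is known.\<close>

lemma matrix_star_alg: "star_alg (matrix_algebra A n N)"
proof -
  let ?D = "matrix_algebra A n N"
  let ?M = "matrices_over A n (carrier A)"
  have cl: "(\<lambda>i j. L i j \<oplus> M i j) \<in> ?M" "(\<lambda>i j. \<ominus> M i j) \<in> ?M" "(\<lambda>i j. c \<odot> M i j) \<in> ?M"
    "(\<lambda>i j. star A (M j i)) \<in> ?M"
    if "L \<in> ?M" "M \<in> ?M" for L M c
    using that by (intro matrices_overI; simp add: matrices_overD)+
  have cl0: "(\<lambda>i j. \<zero>) \<in> ?M" "(\<lambda>i j. if i = j \<and> i < n then \<one> else \<zero>) \<in> ?M"
    by (auto intro!: matrices_overI)
  have ag: "abelian_group ?D"
  proof (rule abelian_groupI)
    fix L assume L: "L \<in> carrier ?D"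
    show "\<exists>M\<in>carrier ?D. M \<oplus>\<^sub>?D L = \<zero>\<^sub>?D"
      using L cl by (intro bexI[of _ "\<lambda>i j. \<ominus> L i j"]) (auto simp: l_neg)
  qed (auto simp: cl cl0 a_ac)
  have mon: "Group.monoid ?D"
  proof (rule monoidI)
    fix L M P assume "L \<in> carrier ?D" "M \<in> carrier ?D" "P \<in> carrier ?D"
    then have m: "L \<in> ?M" "M \<in> ?M" "P \<in> ?M" by auto
    show "L \<otimes>\<^sub>?D M \<otimes>\<^sub>?D P = L \<otimes>\<^sub>?D (M \<otimes>\<^sub>?D P)"
    proof (simp, intro ext)
      fix i j
      have "(\<Oplus>k\<in>{..<n}. (\<Oplus>l\<in>{..<n}. L i l \<otimes> M l k) \<otimes> P k j)
          = (\<Oplus>k\<in>{..<n}. \<Oplus>l\<in>{..<n}. L i l \<otimes> M l k \<otimes> P k j)"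
        using m by (intro finsum_cong' finsum_ldistr) (auto intro!: finsum_closed)
      also have "\<dots> = (\<Oplus>l\<in>{..<n}. \<Oplus>k\<in>{..<n}. L i l \<otimes> M l k \<otimes> P k j)"
        using m by (intro finsum_swap) auto
      also have "\<dots> = (\<Oplus>l\<in>{..<n}. \<Oplus>k\<in>{..<n}. L i l \<otimes> (M l k \<otimes> P k j))"
        using m by (simp add: m_assoc)
      also have "\<dots> = (\<Oplus>l\<in>{..<n}. L i l \<otimes> (\<Oplus>k\<in>{..<n}. M l k \<otimes> P k j))"
        using m by (intro finsum_cong' finsum_rdistr[symmetric]) (auto intro!: finsum_closed)
      finally show "(\<Oplus>k\<in>{..<n}. (\<Oplus>l\<in>{..<n}. L i l \<otimes> M l k) \<otimes> P k j)
          = (\<Oplus>k\<in>{..<n}. L i k \<otimes> (\<Oplus>l\<in>{..<n}. M k l \<otimes> P l j))" .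
    qed
  next
    fix M assume "M \<in> carrier ?D"
    then have m: "M \<in> ?M" by simp
    show "\<one>\<^sub>?D \<otimes>\<^sub>?D M = M"
    proof (simp, intro ext)
      fix i j
      show "(\<Oplus>k\<in>{..<n}. (if i = k \<and> i < n then \<one> else \<zero>) \<otimes> M k j) = M i j"
      proof (cases "i < n")
        case True
        then show ?thesis
          using m finsum_single[of "{..<n}" i "\<lambda>k. (if i = k \<and> i < n then \<one> else \<zero>) \<otimes> M k j"] by auto
      qed (use m in \<open>simp add: matrices_overD\<close>)
    qed
    show "M \<otimes>\<^sub>?D \<one>\<^sub>?D = M"
    proof (simp, intro ext)
      fix i j
      show "(\<Oplus>k\<in>{..<n}. M i k \<otimes> (if k = j \<and> k < n then \<one> else \<zero>)) = M i j"
      proof (cases "j < n")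
        case True
        then show ?thesis
          using m finsum_single[of "{..<n}" j "\<lambda>k. M i k \<otimes> (if k = j \<and> k < n then \<one> else \<zero>)"] by auto
      next
        case False
        then have "M i k \<otimes> (if k = j \<and> k < n then \<one> else \<zero>) = \<zero>" for k using m by auto
        then show ?thesis using False m by (simp add: matrices_overD)
      qed
    qed
  qed (use cl0 in \<open>auto intro: matrix_mult_closed\<close>)
  have rng: "ring ?D"
  proof (rule ringI[OF ag mon])
    fix L M P assume "L \<in> carrier ?D" "M \<in> carrier ?D" "P \<in> carrier ?D"
    then have m: "L \<in> ?M" "M \<in> ?M" "P \<in> ?M" by auto
    then show "(L \<oplus>\<^sub>?D M) \<otimes>\<^sub>?D P = L \<otimes>\<^sub>?D P \<oplus>\<^sub>?D M \<otimes>\<^sub>?D P"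
      by (intro ext) (simp add: l_distr finsum_addf Pi_def)
    show "P \<otimes>\<^sub>?D (L \<oplus>\<^sub>?D M) = P \<otimes>\<^sub>?D L \<oplus>\<^sub>?D P \<otimes>\<^sub>?D M"
      using m by (intro ext) (simp add: r_distr finsum_addf Pi_def)
  qed
  have modl: "Module.module complex_ring ?D"
    by (rule moduleI[OF cring_complex_ring ag]) (auto simp: cl scal_add_left scal_add_right)
  show ?thesis
  proof (rule star_alg.intro[OF rng modl], rule star_alg_axioms.intro)
    fix x y :: "nat \<Rightarrow> nat \<Rightarrow> 'a" and c
    assume "x \<in> carrier ?D" "y \<in> carrier ?D"
    then have m: "x \<in> ?M" "y \<in> ?M" by auto
    show "(c \<odot>\<^sub>?D x) \<otimes>\<^sub>?D y = c \<odot>\<^sub>?D (x \<otimes>\<^sub>?D y)"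
      using m by (intro ext) (simp add: scal_finsum Pi_def)
    show "x \<otimes>\<^sub>?D (c \<odot>\<^sub>?D y) = c \<odot>\<^sub>?D (x \<otimes>\<^sub>?D y)"
      using m by (intro ext) (simp add: scal_finsum Pi_def)
    show "star ?D (x \<oplus>\<^sub>?D y) = star ?D x \<oplus>\<^sub>?D star ?D y"
      using m by (intro ext) simp
    show "star ?D (x \<otimes>\<^sub>?D y) = star ?D y \<otimes>\<^sub>?D star ?D x"
      using m by (intro ext) (simp add: star_finsum Pi_def)
  next
    fix x assume "x \<in> carrier ?D"
    then have m: "x \<in> ?M" by auto
    then show "star ?D x \<in> carrier ?D" by (simp add: cl)
    show "star ?D (star ?D x) = x" using m by (intro ext) simp
    show "star ?D (c \<odot>\<^sub>?D x) = cnj c \<odot>\<^sub>?D star ?D x" for c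
      using m by (intro ext) simp
  qed
qed

lemma matrix_uminus:
  assumes "M \<in> matrices_over A n (carrier A)"
  shows "\<ominus>\<^bsub>matrix_algebra A n N\<^esub> M = (\<lambda>i j. \<ominus> M i j)"
proof -
  interpret D: star_alg "matrix_algebra A n N" by (rule matrix_star_alg)
  show ?thesis using D.scal_neg1[of M] assms by (simp add: scal_neg1)
qed

lemma matrix_minus [simp]:
  assumes "M \<in> matrices_over A n (carrier A)"
  shows "L \<ominus>\<^bsub>matrix_algebra A n N\<^esub> M = (\<lambda>i j. L i j \<ominus> M i j)"
  using assms by (simp add: a_minus_def matrix_uminus)

text \<open>The entry is an arbitrary element of \<open>A\<close>, so that rows, columns and whole
  matrices become sums of such matrices.\<close>

definition matrix_unit :: "nat \<Rightarrow> nat \<Rightarrow> 'a \<Rightarrow> nat \<Rightarrow> nat \<Rightarrow> 'a" where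
  "matrix_unit i j a = (\<lambda>i' j'. if i' = i \<and> j' = j then a else \<zero>)"

lemma matrix_unit_closed [simp]:
  "\<lbrakk>i < n; j < n; a \<in> carrier A\<rbrakk> \<Longrightarrow> matrix_unit i j a \<in> matrices_over A n (carrier A)"
  by (intro matrices_overI) (auto simp: matrix_unit_def)

end

subsection \<open>The C*-norm on matrices\<close>

context cstar
begin

text \<open>The diagonal entries of a square of matrices are sums of elements
  \<open>star A x \<otimes> x\<close>, positive by \<open>Pos_star_mult\<close>. This ties the
  algebraic cone to the order of \<open>A\<close> and keeps the cone norm from degenerating.\<close>

lemma matrix_cone_diag_Pos:
  assumes "p \<in> star_alg.cone (matrix_algebra A n N)"
  shows "Pos (p i i)"
proof -
  interpret D: star_alg "matrix_algebra A n N" by (rule matrix_star_alg)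
  from assms show ?thesis
    by (induction rule: D.cone.induct) (auto intro!: Pos_finsum Pos_star_mult Pos_add)
qed

lemma matrix_dominated_entry:
  assumes "star_alg.dominated (matrix_algebra A n N) u M" "M \<in> matrices_over A n (carrier A)"
  shows "nrm A (M i j) \<le> u"
proof -
  interpret D: star_alg "matrix_algebra A n N" by (rule matrix_star_alg)
  have u: "0 < u" using assms by (simp add: D.dominated_def)
  let ?s = "\<lambda>k. star A (M k j) \<otimes> M k j"
  have sM: "(\<lambda>i j. \<Oplus>k\<in>{..<n}. star A (M k i) \<otimes> M k j) \<in> matrices_over A n (carrier A)"
    using matrix_mult_closed[of "\<lambda>i j. star A (M j i)"] assms D.star_cl[of M] by simp
  show ?thesis
  proof (cases "i < n \<and> j < n")
    case True
    have "(\<lambda>i j. of_real (u\<^sup>2) \<odot> (if i = j \<and> i < n then \<one> else \<zero>) \<ominus> (\<Oplus>k\<in>{..<n}. star A (M k i) \<otimes> M k j))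
        \<in> D.cone"
      using assms sM by (simp add: D.dominated_def)
    from matrix_cone_diag_Pos[OF this, of j] True
    have P: "Pos (of_real (u\<^sup>2) \<odot> \<one> \<ominus> finsum A ?s {..<n})" by simp
    have Q: "Pos (finsum A ?s ({..<n} - {i}))" using assms by (intro Pos_finsum Pos_star_mult) auto
    have "{..<n} = insert i ({..<n} - {i})" using True by auto
    then have "finsum A ?s {..<n} = finsum A ?s (insert i ({..<n} - {i}))" by simp
    also have "\<dots> = ?s i \<oplus> finsum A ?s ({..<n} - {i})"
      using assms True by (intro finsum_insert) auto
    finally have eq: "finsum A ?s {..<n} = ?s i \<oplus> finsum A ?s ({..<n} - {i})" .
    have "Pos ((of_real (u\<^sup>2) \<odot> \<one> \<ominus> finsum A ?s {..<n}) \<oplus> finsum A ?s ({..<n} - {i}))"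
      using P Q by (rule Pos_add)
    also have "(of_real (u\<^sup>2) \<odot> \<one> \<ominus> finsum A ?s {..<n}) \<oplus> finsum A ?s ({..<n} - {i})
        = of_real (u\<^sup>2) \<odot> \<one> \<ominus> ?s i"
    proof -
      have "t \<odot> \<one> \<ominus> (a \<oplus> b) \<oplus> b = t \<odot> \<one> \<ominus> a" if "a \<in> carrier A" "b \<in> carrier A" for a b t
        using that by algebra
      then show ?thesis unfolding eq using assms Pos_closed[OF Q] by simp
    qed
    finally show ?thesis using nrm_le_if_Pos[of "M i j" u] assms u by simp
  next
    case False
    then show ?thesis using assms u by (simp add: matrices_overD)
  qed
qed

text \<open>The required difference is the square of the diagonal matrix \<open>Y\<close> that
  carries a root of \<open>u\<^sup>2 - star A a \<otimes> a\<close> at position \<open>j\<close> and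
  the constant \<open>u\<close> elsewhere.\<close>

lemma matrix_unit_dominated:
  assumes "i < n" "j < n" "a \<in> carrier A" "nrm A a < u"
  shows "star_alg.dominated (matrix_algebra A n N) u (matrix_unit i j a)"
proof -
  interpret D: star_alg "matrix_algebra A n N" by (rule matrix_star_alg)
  have u: "0 < u" using assms nrm_ge0[of a] by linarith
  obtain s where s: "Pos s" "s \<otimes> s = of_real (u\<^sup>2) \<odot> \<one> \<ominus> star A a \<otimes> a"
    using Pos_sqrt[OF Pos_nrm_sq_minus[OF assms(3) order_less_imp_le[OF assms(4)]]] by blast
  define Y where "Y = (\<lambda>p q. if p = q \<and> p < n then (if p = j then s else of_real u \<odot> \<one>) else \<zero>)"
  have Y: "Y \<in> matrices_over A n (carrier A)"
    using s by (auto simp: Y_def intro!: matrices_overI)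
  let ?E = "matrix_unit i j a"
  have E: "?E \<in> matrices_over A n (carrier A)" using assms by simp
  have EE: "star (matrix_algebra A n N) ?E \<otimes>\<^bsub>matrix_algebra A n N\<^esub> ?E = matrix_unit j j (star A a \<otimes> a)"
  proof (simp, intro ext)
    fix p q
    show "(\<Oplus>k\<in>{..<n}. star A (?E k p) \<otimes> ?E k q) = matrix_unit j j (star A a \<otimes> a) p q"
      using assms by (subst finsum_single[of _ i]) (auto simp: matrix_unit_def)
  qed
  have YY: "star (matrix_algebra A n N) Y \<otimes>\<^bsub>matrix_algebra A n N\<^esub> Y =
    (\<lambda>p q. if p = q \<and> p < n then (if p = j then s \<otimes> s else of_real (u\<^sup>2) \<odot> \<one>) else \<zero>)" (is "_ = ?R")
  proof (simp, intro ext)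
    fix p q
    show "(\<Oplus>k\<in>{..<n}. star A (Y k p) \<otimes> Y k q) = ?R p q"
    proof (cases "p < n")
      case True
      then show ?thesis
        using s(1) by (subst finsum_single[of _ p]) (auto simp: Y_def power2_eq_square)
    next
      case False
      then have "star A (Y k p) \<otimes> Y k q = \<zero>" for k using s(1) by (auto simp: Y_def)
      then show ?thesis using False by simp
    qed
  qed
  have "of_real (u\<^sup>2) \<odot>\<^bsub>matrix_algebra A n N\<^esub> \<one>\<^bsub>matrix_algebra A n N\<^esub> \<ominus>\<^bsub>matrix_algebra A n N\<^esub>
      star (matrix_algebra A n N) ?E \<otimes>\<^bsub>matrix_algebra A n N\<^esub> ?E
    = star (matrix_algebra A n N) Y \<otimes>\<^bsub>matrix_algebra A n N\<^esub> Y"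
    unfolding EE YY using assms s(2)
    by (subst matrix_minus[OF matrix_unit_closed]) (auto simp: matrix_unit_def fun_eq_iff minus_eq)
  then show ?thesis
    using u Y D.cone_sq[of Y] by (simp add: D.dominated_def)
qed

text \<open>A matrix is a sum of matrix units, each dominated by any bound strictly above the norm
  of its entry. That accounts for one \<open>e\<close> per entry; the leading \<open>e\<close>
  bounds the empty sum, because \<open>dominated\<close> requires a positive bound.\<close>

lemma matrix_dominated:
  assumes M: "M \<in> matrices_over A n (carrier A)" and "0 < e"
  shows "star_alg.dominated (matrix_algebra A n N)
           (e + (\<Sum>(i, j)\<in>{..<n} \<times> {..<n}. nrm A (M i j) + e)) M"
proof -
  interpret D: star_alg "matrix_algebra A n N" by (rule matrix_star_alg)
  let ?R = "\<lambda>S i j. if (i, j) \<in> S then M i j else \<zero>"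
  have R: "?R S \<in> matrices_over A n (carrier A)" for S
    using M by (auto intro!: matrices_overI simp: matrices_overD)
  have "D.dominated (e + (\<Sum>(i, j)\<in>S. nrm A (M i j) + e)) (?R S)"
    if "finite S" "S \<subseteq> {..<n} \<times> {..<n}" for S
    using that
  proof (induction S rule: finite_induct)
    case empty
    then show ?case using D.dominated_zero[OF \<open>0 < e\<close>] by simp
  next
    case (insert x S)
    obtain i j where x: "x = (i, j)" "i < n" "j < n" using insert by (cases x) auto
    have "D.dominated ((nrm A (M i j) + e) + (e + (\<Sum>(i, j)\<in>S. nrm A (M i j) + e)))
        (matrix_unit i j (M i j) \<oplus>\<^bsub>matrix_algebra A n N\<^esub> ?R S)"
      using insert x M R \<open>0 < e\<close> by (intro D.dominated_add matrix_unit_dominated) auto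
    also have "matrix_unit i j (M i j) \<oplus>\<^bsub>matrix_algebra A n N\<^esub> ?R S = ?R (insert x S)"
      using M x insert by (auto simp: fun_eq_iff matrix_unit_def)
    finally show ?case using insert x by (simp add: add_ac)
  qed
  from this[of "{..<n} \<times> {..<n}"]
  have "D.dominated (e + (\<Sum>(i, j)\<in>{..<n} \<times> {..<n}. nrm A (M i j) + e)) (?R ({..<n} \<times> {..<n}))" by simp
  also have "?R ({..<n} \<times> {..<n}) = M" using M by (auto simp: fun_eq_iff matrices_overD)
  finally show ?thesis .
qed

lemma bounded_star_alg_matrix: "bounded_star_alg (matrix_algebra A n N)"
proof -
  interpret D: star_alg "matrix_algebra A n N" by (rule matrix_star_alg)
  show ?thesis
    by unfold_locales (use matrix_dominated[of _ n 1 N] in auto)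
qed

text \<open>The constant function only fills the norm slot while the cone is formed. The value 0 off
  the matrices is the normalisation made in \<open>matrix_norm\<close>.\<close>

definition matrix_cone_norm :: "nat \<Rightarrow> (nat \<Rightarrow> nat \<Rightarrow> 'a) \<Rightarrow> real" where
  "matrix_cone_norm n M =
     (if M \<in> matrices_over A n (carrier A) then star_alg.cone_norm (matrix_algebra A n (\<lambda>_. 0)) M else 0)"

lemma matrix_cone_norm_entry:
  assumes "M \<in> matrices_over A n (carrier A)"
  shows "nrm A (M i j) \<le> matrix_cone_norm n M"
proof -
  interpret D: bounded_star_alg "matrix_algebra A n (\<lambda>_. 0)" by (rule bounded_star_alg_matrix)
  have "nrm A (M i j) \<le> D.cone_norm M"
  proof (rule dense_ge)
    fix u assume "D.cone_norm M < u"
    then have "D.dominated u M" using assms by (intro D.dominated_if_cone_norm_less) auto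
    then show "nrm A (M i j) \<le> u" using assms by (rule matrix_dominated_entry)
  qed
  then show ?thesis using assms by (simp add: matrix_cone_norm_def)
qed

lemma matrix_cone_norm_le_sum:
  assumes "M \<in> matrices_over A n (carrier A)"
  shows "matrix_cone_norm n M \<le> (\<Sum>(i, j)\<in>{..<n} \<times> {..<n}. nrm A (M i j))"
proof (rule field_le_epsilon)
  interpret D: star_alg "matrix_algebra A n (\<lambda>_. 0)" by (rule matrix_star_alg)
  fix e :: real assume "0 < e"
  \<comment> \<open>One share for each of the \<open>n * n\<close> entries and one for the leading
    summand.\<close>
  define d where "d = e / (1 + real n * real n)"
  have "0 < d" using \<open>0 < e\<close> by (auto simp: d_def intro!: divide_pos_pos add_pos_nonneg)
  have "matrix_cone_norm n M \<le> d + (\<Sum>(i, j)\<in>{..<n} \<times> {..<n}. nrm A (M i j) + d)"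
    using assms D.cone_norm_le[OF matrix_dominated[OF assms \<open>0 < d\<close>]] by (simp add: matrix_cone_norm_def)
  also have "\<dots> = (\<Sum>(i, j)\<in>{..<n} \<times> {..<n}. nrm A (M i j)) + d * (1 + real n * real n)"
    by (simp add: case_prod_unfold sum.distrib algebra_simps)
  also have "d * (1 + real n * real n) = e"
    by (simp add: d_def add_nonneg_eq_0_iff)
  finally show "matrix_cone_norm n M \<le> (\<Sum>(i, j)\<in>{..<n} \<times> {..<n}. nrm A (M i j)) + e" .
qed

lemma matrix_cone_norm_unit:
  assumes "i < n" "j < n" "a \<in> carrier A"
  shows "matrix_cone_norm n (matrix_unit i j a) \<le> nrm A a"
proof (rule dense_ge)
  interpret D: star_alg "matrix_algebra A n (\<lambda>_. 0)" by (rule matrix_star_alg)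
  fix u assume "nrm A a < u"
  then show "matrix_cone_norm n (matrix_unit i j a) \<le> u"
    using D.cone_norm_le[OF matrix_unit_dominated[OF assms]] assms by (simp add: matrix_cone_norm_def)
qed

text \<open>Completeness holds because the cone norm lies between the norms of the single entries
  and their sum, so that convergence is entrywise.\<close>

lemma cstar_matrix_cone_norm: "cstar (matrix_algebra A n (matrix_cone_norm n))"
proof -
  let ?D = "matrix_algebra A n (matrix_cone_norm n)" and ?N = "matrix_cone_norm n"
  let ?M = "matrices_over A n (carrier A)"
  interpret D0: bounded_star_alg "matrix_algebra A n (\<lambda>_. 0)" by (rule bounded_star_alg_matrix)
  interpret D: star_alg ?D by (rule matrix_star_alg)
  note [simp] = matrix_cone_norm_def
  show ?thesis
  proof
    fix x assume "x \<in> carrier ?D"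
    then have x: "x \<in> ?M" by simp
    then show "0 \<le> nrm ?D x" using D0.cone_norm_ge_0[of x] by simp
    show "nrm ?D x = 0 \<longleftrightarrow> x = \<zero>\<^sub>?D"
    proof
      assume "nrm ?D x = 0"
      then have "nrm A (x i j) \<le> 0" for i j using matrix_cone_norm_entry[OF x, of i j] by simp
      then show "x = \<zero>\<^sub>?D" using x nrm_le_0 by (auto simp: fun_eq_iff)
    next
      assume "x = \<zero>\<^sub>?D"
      then show "nrm ?D x = 0" using D0.cone_norm_zero x by simp
    qed
    show "nrm ?D (c \<odot>\<^sub>?D x) = cmod c * nrm ?D x" for c
      using D0.cone_norm_scal[of x c] x D.scal_closed[of x c] by simp
    show "nrm ?D (star ?D x \<otimes>\<^sub>?D x) = (nrm ?D x)\<^sup>2"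
      using D0.cone_norm_cstar[of x] x D.m_closed[of "star ?D x" x] D.star_cl[of x] by simp
    fix y assume "y \<in> carrier ?D"
    then have y: "y \<in> ?M" by simp
    show "nrm ?D (x \<oplus>\<^sub>?D y) \<le> nrm ?D x + nrm ?D y"
      using D0.cone_norm_plus[of x y] x y D.a_closed[of x y] by simp
    show "nrm ?D (x \<otimes>\<^sub>?D y) \<le> nrm ?D x * nrm ?D y"
      using D0.cone_norm_times[of x y] x y D.m_closed[of x y] by simp
  next
    fix f :: "nat \<Rightarrow> nat \<Rightarrow> nat \<Rightarrow> 'a"
    assume "\<And>k. f k \<in> carrier ?D" and C: "\<And>e. 0 < e \<Longrightarrow> \<exists>K. \<forall>m\<ge>K. \<forall>k\<ge>K. nrm ?D (f m \<ominus>\<^sub>?D f k) < e"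
    then have f: "\<And>k. f k \<in> ?M" by simp
    have fm: "(\<lambda>i j. f m i j \<ominus> g i j) \<in> ?M" if "g \<in> ?M" for m g
      using f[of m] that D.minus_closed[of "f m" g] by simp
    have "\<exists>x\<in>carrier A. (\<lambda>k. nrm A (f k i j \<ominus> x)) \<longlonglongrightarrow> 0" for i j
    proof (rule nrm_cauchy)
      show "f k i j \<in> carrier A" for k by (rule matrix_entry_closed[OF f])
      fix e :: real assume "0 < e"
      then obtain K where K: "\<And>m k. m \<ge> K \<Longrightarrow> k \<ge> K \<Longrightarrow> nrm ?D (f m \<ominus>\<^sub>?D f k) < e" using C by blast
      have "nrm A (f m i j \<ominus> f k i j) < e" if "m \<ge> K" "k \<ge> K" for m k
        using K[OF that] matrix_cone_norm_entry[OF fm[OF f, of m k], of i j] f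
        by (simp del: matrix_cone_norm_def)
      then show "\<exists>N. \<forall>m\<ge>N. \<forall>k\<ge>N. nrm A (f m i j \<ominus> f k i j) < e" by blast
    qed
    then obtain g where g: "\<And>i j. g i j \<in> carrier A" "\<And>i j. (\<lambda>k. nrm A (f k i j \<ominus> g i j)) \<longlonglongrightarrow> 0"
      by metis
    define h where "h = (\<lambda>i j. if i < n \<and> j < n then g i j else \<zero>)"
    have h: "h \<in> ?M" using g by (auto simp: h_def intro!: matrices_overI)
    have "(\<lambda>k. \<Sum>(i, j)\<in>{..<n} \<times> {..<n}. nrm A (f k i j \<ominus> h i j)) \<longlonglongrightarrow> (\<Sum>(i, j)\<in>{..<n} \<times> {..<n}. 0)"
      unfolding case_prod_unfold by (intro tendsto_sum) (auto simp: h_def g)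
    then have lim: "(\<lambda>k. \<Sum>(i, j)\<in>{..<n} \<times> {..<n}. nrm A (f k i j \<ominus> h i j)) \<longlonglongrightarrow> 0" by simp
    have "(\<lambda>k. nrm ?D (f k \<ominus>\<^sub>?D h)) \<longlonglongrightarrow> 0"
    proof (rule tendsto_sandwich[OF _ _ tendsto_const lim])
      have "0 \<le> nrm A (f k 0 0 \<ominus> h 0 0)" for k using f[of k] h by simp
      then have "0 \<le> ?N (\<lambda>i j. f k i j \<ominus> h i j)" for k
        using matrix_cone_norm_entry[OF fm[OF h], of k 0 0] by (rule order.trans)
      then show "\<forall>\<^sub>F k in sequentially. 0 \<le> nrm ?D (f k \<ominus>\<^sub>?D h)"
        using h by (simp del: matrix_cone_norm_def)
      show "\<forall>\<^sub>F k in sequentially. nrm ?D (f k \<ominus>\<^sub>?D h) \<le> (\<Sum>(i, j)\<in>{..<n} \<times> {..<n}. nrm A (f k i j \<ominus> h i j))"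
        using h matrix_cone_norm_le_sum[OF fm[OF h]] by (simp del: matrix_cone_norm_def)
    qed
    then show "\<exists>x\<in>carrier ?D. (\<lambda>k. nrm ?D (f k \<ominus>\<^sub>?D x)) \<longlonglongrightarrow> 0" using h by auto
  qed
qed

end

text \<open>The identity is a *-homomorphism between the two C*-algebras, hence contractive in both
  directions.\<close>

lemma matrix_norm_unique:
  assumes "cstar (matrix_algebra A n N)" "cstar (matrix_algebra A n N')"
    "M \<in> matrices_over A n (carrier A)"
  shows "N M = N' M"
proof -
  have "star_hom (matrix_algebra A n P) (matrix_algebra A n Q) (\<lambda>x. x)" for P Q
    by (simp add: star_hom_def algebra_hom_def)
  from star_hom_contractive[OF assms(1,2) this, of M] star_hom_contractive[OF assms(2,1) this, of M]
  show ?thesis using assms(3) by simp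
qed

context cstar
begin

lemma matrix_norm_eq: "matrix_norm A n = matrix_cone_norm n"
  unfolding matrix_norm_def cstar_iff
proof (rule the_equality)
  show "cstar (matrix_algebra A n (matrix_cone_norm n)) \<and>
    (\<forall>M. M \<notin> matrices_over A n (carrier A) \<longrightarrow> matrix_cone_norm n M = 0)"
    using cstar_matrix_cone_norm by (simp add: matrix_cone_norm_def)
  fix N assume "cstar (matrix_algebra A n N) \<and> (\<forall>M. M \<notin> matrices_over A n (carrier A) \<longrightarrow> N M = 0)"
  then show "N = matrix_cone_norm n"
    using matrix_norm_unique[OF _ cstar_matrix_cone_norm, of n N]
    by (force simp: matrix_cone_norm_def[of n "_ :: nat \<Rightarrow> nat \<Rightarrow> 'a"] fun_eq_iff)
qed

lemma cstar_matrix_algebra: "cstar (matrix_algebra A n (matrix_norm A n))"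
  unfolding matrix_norm_eq by (rule cstar_matrix_cone_norm)

lemma nrm_entry_le_matrix_norm:
  "M \<in> matrices_over A n (carrier A) \<Longrightarrow> nrm A (M i j) \<le> matrix_norm A n M"
  unfolding matrix_norm_eq by (rule matrix_cone_norm_entry)

lemma matrix_norm_unit:
  assumes "i < n" "j < n" "a \<in> carrier A"
  shows "matrix_norm A n (matrix_unit i j a) = nrm A a"
proof (rule antisym)
  show "matrix_norm A n (matrix_unit i j a) \<le> nrm A a"
    using matrix_cone_norm_unit[OF assms] by (simp add: matrix_norm_eq)
  have "nrm A (matrix_unit i j a i j) \<le> matrix_norm A n (matrix_unit i j a)"
    using assms by (intro nrm_entry_le_matrix_norm) simp
  then show "nrm A a \<le> matrix_norm A n (matrix_unit i j a)" by (simp add: matrix_unit_def)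
qed

end

section \<open>Complete contractivity of *-homomorphisms\<close>

lemma star_hom_zero:
  assumes "cstar C" "cstar B" "star_hom C B \<pi>"
  shows "\<pi> \<zero>\<^sub>C = \<zero>\<^sub>B"
proof -
  interpret C: cstar C by fact
  interpret B: cstar B by fact
  show ?thesis
    using star_homD(4)[OF assms(3), of "\<zero>\<^sub>C" 0] star_homD(1)[OF assms(3), of "\<zero>\<^sub>C"] by simp
qed

lemma star_hom_finsum:
  assumes "cstar C" "cstar B" "star_hom C B \<pi>" "finite F" "f \<in> F \<rightarrow> carrier C"
  shows "\<pi> (finsum C f F) = finsum B (\<lambda>i. \<pi> (f i)) F"
proof -
  interpret C: cstar C by fact
  interpret B: cstar B by fact
  note hom = star_homD[OF assms(3)]
  from assms(4,5) show ?thesis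
  proof (induction F rule: finite_induct)
    case empty
    then show ?case using star_hom_zero assms by simp
  next
    case (insert x F)
    then have f: "f x \<in> carrier C" "\<And>i. i \<in> F \<Longrightarrow> f i \<in> carrier C" by auto
    then have "finsum C f (insert x F) = f x \<oplus>\<^sub>C finsum C f F"
      "finsum B (\<lambda>i. \<pi> (f i)) (insert x F) = \<pi> (f x) \<oplus>\<^sub>B finsum B (\<lambda>i. \<pi> (f i)) F"
      using insert.hyps hom(1) by (auto intro!: C.finsum_insert B.finsum_insert)
    then show ?case using insert f hom(2)[of "f x" "finsum C f F"] by (auto simp: Pi_def)
  qed
qed

text \<open>Applied entrywise, a *-homomorphism is a *-homomorphism of the matrix algebras, so
  ordinary contractivity is enough.\<close>

lemma star_hom_completely_contractive:
  assumes "cstar C" "cstar B" "star_hom C B \<pi>" "S \<subseteq> carrier C"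
  shows "completely_contractive C S B \<pi>"
  unfolding completely_contractive_def
proof (intro allI ballI)
  interpret C: cstar C by fact
  interpret B: cstar B by fact
  note hom = star_homD[OF assms(3)]
  fix n M assume "M \<in> matrices_over C n S"
  then have M: "M \<in> matrices_over C n (carrier C)" using assms(4) by (auto simp: matrices_over_def)
  let ?CM = "matrix_algebra C n (matrix_norm C n)" and ?BM = "matrix_algebra B n (matrix_norm B n)"
  let ?m = "matrix_map B n \<pi>"
  have mm: "?m L = (\<lambda>i j. \<pi> (L i j))" if "L \<in> matrices_over C n (carrier C)" for L
    using that star_hom_zero[OF assms(1-3)] by (auto simp: matrix_map_def fun_eq_iff matrices_overD)
  have "star_hom ?CM ?BM ?m"
    unfolding star_hom_def algebra_hom_def
  proof (intro conjI ballI allI)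
    fix L c assume "L \<in> carrier ?CM"
    then have L: "L \<in> matrices_over C n (carrier C)" by simp
    show "?m L \<in> carrier ?BM"
      using L hom(1) by (auto simp: matrix_map_def intro!: matrices_overI)
    show "?m (c \<odot>\<^sub>?CM L) = c \<odot>\<^sub>?BM ?m L"
      using L hom(4) by (auto simp: matrix_map_def fun_eq_iff)
    show "?m (star ?CM L) = star ?BM (?m L)"
      using L hom(5) by (auto simp: matrix_map_def fun_eq_iff)
    fix P assume "P \<in> carrier ?CM"
    then have P: "P \<in> matrices_over C n (carrier C)" by simp
    show "?m (L \<oplus>\<^sub>?CM P) = ?m L \<oplus>\<^sub>?BM ?m P"
      using L P hom(2) by (auto simp: matrix_map_def fun_eq_iff)
    show "?m (L \<otimes>\<^sub>?CM P) = ?m L \<otimes>\<^sub>?BM ?m P"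
      using C.matrix_mult_closed[OF L P] L P hom(3)
      by (simp add: mm fun_eq_iff star_hom_finsum[OF assms(1-3)])
  qed
  from star_hom_contractive[OF C.cstar_matrix_algebra B.cstar_matrix_algebra this, of M] M
  show "matrix_norm B n (?m M) \<le> matrix_norm C n M" by simp
qed

section \<open>Hilbert spaces\<close>

lemma scaleC_zero_right [simp]: "c *\<^sub>C (0 :: 'h::complex_hilbert) = 0"
  using scaleC_add_right[of c "0::'h" 0] by simp

lemma scaleC_zero_left [simp]: "0 *\<^sub>C (x :: 'h::complex_hilbert) = 0"
  using scaleC_of_real[of 0 x] by simp

lemma scaleC_one [simp]: "1 *\<^sub>C (x :: 'h::complex_hilbert) = x"
  using scaleC_of_real[of 1 x] by simp

lemma scaleC_minus1 [simp]: "(-1) *\<^sub>C (x :: 'h::complex_hilbert) = - x"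
  using scaleC_of_real[of "-1" x] by simp

lemma scaleC_minus_right [simp]: "c *\<^sub>C (- x :: 'h::complex_hilbert) = - (c *\<^sub>C x)"
  using scaleC_add_right[of c x "- x"] by (simp add: eq_neg_iff_add_eq_0 add.commute)

lemma scaleC_diff_right: "c *\<^sub>C (x - y :: 'h::complex_hilbert) = c *\<^sub>C x - c *\<^sub>C y"
  using scaleC_add_right[of c x "- y"] by simp

lemma scaleC_scaleR_commute: "c *\<^sub>C (r *\<^sub>R x :: 'h::complex_hilbert) = r *\<^sub>R (c *\<^sub>C x)"
  by (simp add: scaleC_scaleC mult.commute flip: scaleC_of_real)

lemma cinner_add_right: "cinner x (y + z) = cinner x y + cinner x z"
  by (metis cinner_commute cinner_add_left complex_cnj_add)

lemma cinner_scaleC_right: "cinner x (c *\<^sub>C y) = cnj c * cinner x y"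
  by (metis cinner_commute cinner_scaleC_left complex_cnj_mult)

lemma cinner_zero_left [simp]: "cinner 0 x = 0"
  using cinner_add_left[of 0 0 x] by simp

lemma cinner_zero_right [simp]: "cinner x 0 = 0"
  using cinner_add_right[of x 0 0] by simp

lemma cinner_minus_left [simp]: "cinner (- x) y = - cinner x y"
  using cinner_add_left[of x "-x" y] by (simp add: eq_neg_iff_add_eq_0 add.commute)

lemma cinner_minus_right [simp]: "cinner x (- y) = - cinner x y"
  using cinner_add_right[of x y "-y"] by (simp add: eq_neg_iff_add_eq_0 add.commute)

lemma cinner_diff_left: "cinner (x - y) z = cinner x z - cinner y z"
  using cinner_add_left[of x "- y" z] by simp

lemma cinner_diff_right: "cinner x (y - z) = cinner x y - cinner x z"
  using cinner_add_right[of x y "- z"] by simp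

lemma cinner_self: "cinner x x = complex_of_real ((norm x)\<^sup>2)"
proof (rule complex_eqI)
  show "Re (cinner x x) = Re (complex_of_real ((norm x)\<^sup>2))"
    by (simp add: power2_norm_eq_inner inner_eq_Re_cinner)
  have "Im (cinner x x) = - Im (cinner x x)" by (subst cinner_commute) simp
  then show "Im (cinner x x) = Im (complex_of_real ((norm x)\<^sup>2))" by simp
qed

lemma cinner_self_eq_0 [simp]: "cinner x x = 0 \<longleftrightarrow> x = 0"
  by (simp add: cinner_self)

lemma cinner_0_commute: "cinner x y = 0 \<longleftrightarrow> cinner y x = 0"
  by (metis cinner_commute complex_cnj_zero)

lemma cinner_sum_left: "cinner (sum f F) y = (\<Sum>i\<in>F. cinner (f i) y)"
  by (induction F rule: infinite_finite_induct) (simp_all add: cinner_add_left)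

lemma norm_scaleC [simp]: "norm (c *\<^sub>C x) = cmod c * norm (x :: 'h::complex_hilbert)"
proof -
  have "complex_of_real ((norm (c *\<^sub>C x))\<^sup>2) = (c * cnj c) * cinner x x"
    unfolding cinner_self[symmetric] cinner_scaleC_left cinner_scaleC_right by simp
  also have "\<dots> = complex_of_real ((cmod c * norm x)\<^sup>2)"
    unfolding cinner_self complex_norm_square[symmetric] by (simp add: power_mult_distrib)
  finally have "complex_of_real ((norm (c *\<^sub>C x))\<^sup>2) = complex_of_real ((cmod c * norm x)\<^sup>2)" .
  then have "(norm (c *\<^sub>C x))\<^sup>2 = (cmod c * norm x)\<^sup>2" by (simp only: of_real_eq_iff)
  then show ?thesis by (simp add: power2_eq_imp_eq)
qed

lemma cmod_cinner_le: "cmod (cinner x y) \<le> norm x * norm y"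
proof (cases "cinner x y = 0")
  case False
  define c where "c = cnj (cinner x y) / complex_of_real (cmod (cinner x y))"
  have c: "cmod c = 1" using False by (simp add: c_def norm_divide)
  have "c * cinner x y = complex_of_real (cmod (cinner x y))"
    using False complex_norm_square[of "cinner x y"]
    by (simp add: c_def power2_eq_square mult.commute field_simps)
  then have "cmod (cinner x y) = inner (c *\<^sub>C x) y"
    by (simp add: inner_eq_Re_cinner cinner_scaleC_left)
  also have "\<dots> \<le> norm (c *\<^sub>C x) * norm y" by (rule norm_cauchy_schwarz)
  finally show ?thesis using c by simp
qed simp

lemma bounded_linear_scaleC: "bounded_linear (\<lambda>x :: 'h::complex_hilbert. c *\<^sub>C x)"
  by (rule bounded_linear_intro[of _ "cmod c"])
    (simp_all add: scaleC_add_right scaleC_scaleR_commute mult.commute)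

lemma bounded_linear_cinner_left: "bounded_linear (\<lambda>x. cinner x y)"
proof (rule bounded_linear_intro[of _ "norm y"])
  show "cinner (r *\<^sub>R x) y = r *\<^sub>R cinner x y" for r x
    using cinner_scaleC_left[of "complex_of_real r" x y] by (simp add: scaleC_of_real scaleR_conv_of_real)
qed (simp_all add: cinner_add_left cmod_cinner_le)

lemma tendsto_scaleC: "(f \<longlongrightarrow> x) F \<Longrightarrow> ((\<lambda>n. c *\<^sub>C f n) \<longlongrightarrow> c *\<^sub>C (x :: 'h::complex_hilbert)) F"
  by (rule bounded_linear.tendsto[OF bounded_linear_scaleC])

subsection \<open>Orthogonal projections and the Riesz representation theorem\<close>

lemma csubspaceD:
  assumes "csubspace V"
  shows "0 \<in> V" "x \<in> V \<Longrightarrow> y \<in> V \<Longrightarrow> x + y \<in> V" "x \<in> V \<Longrightarrow> c *\<^sub>C x \<in> V"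
    "x \<in> V \<Longrightarrow> - x \<in> V" "x \<in> V \<Longrightarrow> y \<in> V \<Longrightarrow> x - y \<in> V" "x \<in> V \<Longrightarrow> r *\<^sub>R x \<in> V"
proof -
  show 1: "0 \<in> V" "x \<in> V \<Longrightarrow> y \<in> V \<Longrightarrow> x + y \<in> V" for x y using assms by (auto simp: csubspace_def)
  show 2: "x \<in> V \<Longrightarrow> c *\<^sub>C x \<in> V" for c x using assms by (auto simp: csubspace_def)
  show 3: "x \<in> V \<Longrightarrow> - x \<in> V" for x using 2[of x "-1"] by simp
  show "x \<in> V \<Longrightarrow> y \<in> V \<Longrightarrow> x - y \<in> V" using 1(2)[of x "- y"] 3[of y] by simp
  show "x \<in> V \<Longrightarrow> r *\<^sub>R x \<in> V" using 2[of x "complex_of_real r"] by (simp add: scaleC_of_real)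
qed

lemma nonneg_quadratic_imp_0:
  fixes b c :: real
  assumes "\<And>t. 0 \<le> c * t\<^sup>2 - 2 * b * t"
  shows "b = 0"
proof (rule ccontr)
  assume "b \<noteq> 0"
  have "0 \<le> c" using assms[of 1] assms[of "-1"] by simp
  \<comment> \<open>The quadratic is smallest at \<open>b / c\<close>; adding 1 to the denominator
    avoids a division by 0.\<close>
  have "0 \<le> c * (b / (c + 1))\<^sup>2 - 2 * b * (b / (c + 1))" by (rule assms)
  also have "\<dots> = (b\<^sup>2 / (c + 1)) * (c / (c + 1) - 2)"
    by (simp add: power_divide power2_eq_square algebra_simps)
  also have "\<dots> < 0"
    using \<open>b \<noteq> 0\<close> \<open>0 \<le> c\<close> by (intro mult_pos_neg) (auto simp: field_simps)
  finally show False by simp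
qed

text \<open>A minimising sequence for the distance from \<open>x\<close> is Cauchy by the
  parallelogram law, and its limit is the nearest point of \<open>H\<close>.\<close>

lemma ex_orthogonal_decomposition:
  fixes H :: "'h::complex_hilbert set"
  assumes "closed_csubspace H"
  shows "\<exists>y\<in>H. \<forall>h\<in>H. cinner (x - y) h = 0"
proof -
  note H = csubspaceD[of H] assms[unfolded closed_csubspace_def]
  define d where "d = (INF h\<in>H. (norm (x - h))\<^sup>2)"
  have bdd: "bdd_below ((\<lambda>h. (norm (x - h))\<^sup>2) ` H)" by (rule bdd_belowI[of _ 0]) auto
  have d: "d \<le> (norm (x - h))\<^sup>2" if "h \<in> H" for h
    unfolding d_def using that bdd by (intro cINF_lower)
  have "\<exists>h\<in>H. (norm (x - h))\<^sup>2 < d + 1 / real (Suc n)" for n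
  proof -
    have "(INF h\<in>H. (norm (x - h))\<^sup>2) < d + 1 / real (Suc n)" by (simp add: d_def)
    then show ?thesis using H by (subst (asm) cINF_less_iff[OF _ bdd]) auto
  qed
  then obtain f where f: "\<And>n. f n \<in> H" "\<And>n. (norm (x - f n))\<^sup>2 < d + 1 / real (Suc n)" by metis
  have par: "(norm (f m - f n))\<^sup>2 \<le> 2 / real (Suc m) + 2 / real (Suc n)" for m n
  proof -
    let ?a = "x - f m" and ?b = "x - f n"
    have "(1/2) *\<^sub>R (f m + f n) \<in> H" using f H by auto
    then have "4 * d \<le> 4 * (norm (x - (1/2) *\<^sub>R (f m + f n)))\<^sup>2" using d by simp
    also have "\<dots> = (norm (2 *\<^sub>R (x - (1/2) *\<^sub>R (f m + f n))))\<^sup>2" by (simp only: norm_scaleR) (simp add: power_mult_distrib)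
    also have "2 *\<^sub>R (x - (1/2) *\<^sub>R (f m + f n)) = ?a + ?b" by (simp add: algebra_simps scaleR_2)
    finally have "4 * d \<le> (norm (?a + ?b))\<^sup>2" .
    moreover have "(norm (f m - f n))\<^sup>2 + (norm (?a + ?b))\<^sup>2 = 2 * (norm ?a)\<^sup>2 + 2 * (norm ?b)\<^sup>2"
    proof -
      have "f m - f n = ?b - ?a" by simp
      then show ?thesis
        by (simp only: power2_norm_eq_inner) (simp add: inner_diff inner_add inner_commute algebra_simps)
    qed
    ultimately have "(norm (f m - f n))\<^sup>2 \<le> 2 * (1 / real (Suc m)) + 2 * (1 / real (Suc n))"
      using f(2)[of m] f(2)[of n] by linarith
    then show ?thesis by simp
  qed
  have "Cauchy f"
  proof (rule metric_CauchyI)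
    fix e :: real assume "0 < e"
    then obtain N where N: "4 / e\<^sup>2 < real N" using reals_Archimedean2 by blast
    have "dist (f m) (f n) < e" if "m \<ge> N" "n \<ge> N" for m n
    proof -
      have Np: "0 < real N" using N \<open>0 < e\<close> by (intro order.strict_trans[OF _ N]) simp
      have "2 / real (Suc m) < 2 / real N" "2 / real (Suc n) < 2 / real N"
        using that Np by (auto intro!: divide_strict_left_mono mult_pos_pos)
      then have "(norm (f m - f n))\<^sup>2 < 4 / real N" using par[of m n] by simp
      also have "\<dots> < e\<^sup>2" using N Np \<open>0 < e\<close> by (simp add: field_simps)
      finally show ?thesis using \<open>0 < e\<close> by (simp add: dist_norm power_less_imp_less_base)
    qed
    then show "\<exists>N. \<forall>m\<ge>N. \<forall>n\<ge>N. dist (f m) (f n) < e" by blast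
  qed
  then obtain y where y: "f \<longlonglongrightarrow> y" using Cauchy_convergent by (auto simp: convergent_def)
  have "y \<in> H" using assms closed_sequentially[of H f y] f(1) y by (auto simp: closed_csubspace_def)
  have min: "(norm (x - y))\<^sup>2 \<le> d"
  proof (rule LIMSEQ_le)
    show "(\<lambda>n. (norm (x - f n))\<^sup>2) \<longlonglongrightarrow> (norm (x - y))\<^sup>2" by (intro tendsto_intros y)
    show "(\<lambda>n. d + 1 / real (Suc n)) \<longlonglongrightarrow> d"
      using tendsto_add[OF tendsto_const LIMSEQ_Suc[OF lim_1_over_n], of d] by simp
  qed (use f(2) in \<open>auto intro: less_imp_le\<close>)
  have inner0: "inner (x - y) h = 0" if h: "h \<in> H" for h
  proof (rule nonneg_quadratic_imp_0)
    fix t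
    have "y + t *\<^sub>R h \<in> H" using \<open>y \<in> H\<close> h H by auto
    then have "(norm (x - y))\<^sup>2 \<le> (norm ((x - y) - t *\<^sub>R h))\<^sup>2" using order_trans[OF min d[of "y + t *\<^sub>R h"]] unfolding diff_diff_eq by blast
    also have "(norm (u - t *\<^sub>R h))\<^sup>2 = (norm u)\<^sup>2 - 2 * inner u h * t + (norm h)\<^sup>2 * t\<^sup>2" for u
      by (simp only: power2_norm_eq_inner inner_diff_left inner_diff_right inner_scaleR_left inner_scaleR_right)
        (simp add: inner_commute power2_eq_square algebra_simps)
    finally show "0 \<le> (norm h)\<^sup>2 * t\<^sup>2 - 2 * inner (x - y) h * t" by simp
  qed
  have "cinner (x - y) h = 0" if h: "h \<in> H" for h
  proof (rule complex_eqI)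
    show "Re (cinner (x - y) h) = Re 0" using inner0[OF h] by (simp add: inner_eq_Re_cinner)
    \<comment> \<open>Real orthogonality to the multiple of \<open>h\<close> by \<open>\<i>\<close>
      is the vanishing of the imaginary part.\<close>
    have "inner (x - y) (\<i> *\<^sub>C h) = 0" using inner0 h H by auto
    then show "Im (cinner (x - y) h) = Im 0" by (simp add: inner_eq_Re_cinner cinner_scaleC_right)
  qed
  then show ?thesis using \<open>y \<in> H\<close> by blast
qed

lemma riesz_representation:
  fixes f :: "'h::complex_hilbert \<Rightarrow> complex"
  assumes "bounded_linear f" "\<And>c x. f (c *\<^sub>C x) = c * f x"
  shows "\<exists>z. \<forall>x. f x = cinner x z"
proof (cases "\<forall>x. f x = 0")
  case True
  then show ?thesis by (intro exI[of _ 0]) simp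
next
  case False
  interpret f: bounded_linear f by fact
  obtain x1 where x1: "f x1 \<noteq> 0" using False by blast
  have "closed (f -` {0})" by (intro closed_vimage f.continuous_on closed_singleton) auto
  then have "closed_csubspace (f -` {0})"
    by (auto simp: closed_csubspace_def csubspace_def f.add assms(2) f.zero)
  from ex_orthogonal_decomposition[OF this, of x1]
  obtain y where y: "f y = 0" "\<And>h. f h = 0 \<Longrightarrow> cinner (x1 - y) h = 0" by auto
  \<comment> \<open>\<open>u\<close> spans the orthogonal complement of the kernel of
    \<open>f\<close>.\<close>
  define u where "u = x1 - y"
  have u: "f u \<noteq> 0" using x1 y by (simp add: u_def f.diff)
  then have "u \<noteq> 0" using f.zero by auto
  have "f x = cinner x ((cnj (f u) / cinner u u) *\<^sub>C u)" for x
  proof -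
    have "f (x - (f x / f u) *\<^sub>C u) = 0" using u by (simp add: f.diff assms(2))
    then have "cinner u (x - (f x / f u) *\<^sub>C u) = 0" using y by (simp add: u_def)
    then have "cinner (x - (f x / f u) *\<^sub>C u) u = 0" by (subst cinner_0_commute)
    then have "cinner x u = (f x / f u) * cinner u u" by (simp add: cinner_diff_left cinner_scaleC_left)
    moreover have "cnj (cinner u u) = cinner u u" using cinner_commute[of u u] by simp
    ultimately show ?thesis using u \<open>u \<noteq> 0\<close> by (simp add: cinner_scaleC_right)
  qed
  then show ?thesis by blast
qed

subsection \<open>Adjoints\<close>

text \<open>Bounded operators as a type are only real-linear; complex linearity is recorded
  separately.\<close>

definition clin :: "('h::complex_hilbert \<Rightarrow>\<^sub>L 'h) \<Rightarrow> bool" where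
  "clin a \<longleftrightarrow> (\<forall>c x. a \<cdot> (c *\<^sub>C x) = c *\<^sub>C a \<cdot> x)"

lemma clinD: "clin a \<Longrightarrow> a \<cdot> (c *\<^sub>C x) = c *\<^sub>C a \<cdot> x"
  by (simp add: clin_def)

lemma cinner_ext: "(\<And>x. cinner x y = cinner x z) \<Longrightarrow> y = z"
  using cinner_diff_right[of "y - z" y z] by (metis cinner_self_eq_0 eq_iff_diff_eq_0)

lemma cinner_adj:
  assumes "clin a"
  shows "cinner (a \<cdot> x) y = cinner x (adj a \<cdot> y)"
proof -
  have "\<exists>z. \<forall>x. cinner (a \<cdot> x) y = cinner x z" for y
    by (rule riesz_representation)
      (auto simp: clinD[OF assms] cinner_scaleC_left
        intro: bounded_linear_compose[OF bounded_linear_cinner_left blinfun.bounded_linear_right])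
  then obtain b where b: "\<And>x y. cinner (a \<cdot> x) y = cinner x (b y)" by metis
  have "bounded_linear b"
  proof (rule bounded_linear_intro[of _ "norm a"])
    show "b (x + y) = b x + b y" for x y
      by (rule cinner_ext) (simp add: cinner_add_right flip: b)
    show "b (r *\<^sub>R x) = r *\<^sub>R b x" for r x
      by (rule cinner_ext) (simp add: cinner_scaleC_right flip: b scaleC_of_real)
    show "norm (b y) \<le> norm y * norm a" for y
    proof (cases "b y = 0")
      case False
      have "(norm (b y))\<^sup>2 = cmod (cinner (b y) (b y))" by (simp add: cinner_self norm_power)
      also have "\<dots> = cmod (cinner (a \<cdot> b y) y)" by (simp add: b)
      also have "\<dots> \<le> norm (a \<cdot> b y) * norm y" by (rule cmod_cinner_le)
      also have "\<dots> \<le> norm a * norm (b y) * norm y" by (intro mult_right_mono norm_blinfun) auto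
      finally show ?thesis using False by (simp add: power2_eq_square mult_ac)
    qed simp
  qed
  then have ex: "\<forall>x y. cinner (a \<cdot> x) y = cinner x (Blinfun b \<cdot> y)"
    by (simp add: bounded_linear_Blinfun_apply b)
  have "\<forall>x y. cinner (a \<cdot> x) y = cinner x (adj a \<cdot> y)"
    unfolding adj_def
  proof (rule theI[where a = "Blinfun b"])
    fix c assume "\<forall>x y. cinner (a \<cdot> x) y = cinner x (c \<cdot> y)"
    then show "c = Blinfun b" using ex by (intro blinfun_eqI cinner_ext) metis
  qed (rule ex)
  then show ?thesis by blast
qed

lemma cinner_adj': "clin a \<Longrightarrow> cinner (adj a \<cdot> x) y = cinner x (a \<cdot> y)"
  by (metis cinner_adj cinner_commute)

lemma adj_eqI:
  assumes "clin a" "\<And>x y. cinner (a \<cdot> x) y = cinner x (b \<cdot> y)"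
  shows "adj a = b"
  by (intro blinfun_eqI cinner_ext) (simp flip: cinner_adj[OF assms(1)] assms(2))

lemma clin_adj: "clin a \<Longrightarrow> clin (adj a)"
  unfolding clin_def[of "adj a"]
  by (intro allI cinner_ext) (simp add: cinner_scaleC_right flip: cinner_adj)

lemma adj_adj: "clin a \<Longrightarrow> adj (adj a) = a"
  by (rule adj_eqI) (auto intro: clin_adj cinner_adj')

text \<open>The scalar multiplication of \<open>bounded_operators\<close> under a name of its
  own.\<close>

definition cscale :: "complex \<Rightarrow> ('h::complex_hilbert \<Rightarrow>\<^sub>L 'h) \<Rightarrow> 'h \<Rightarrow>\<^sub>L 'h" where
  "cscale c a = Blinfun (\<lambda>x. c *\<^sub>C a \<cdot> x)"

lemma cscale_apply [simp]: "cscale c a \<cdot> x = c *\<^sub>C a \<cdot> x"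
  unfolding cscale_def
  by (subst bounded_linear_Blinfun_apply)
    (auto intro: bounded_linear_compose[OF bounded_linear_scaleC blinfun.bounded_linear_right])

lemma clin_add: "clin a \<Longrightarrow> clin b \<Longrightarrow> clin (a + b)"
  and clin_compose: "clin a \<Longrightarrow> clin b \<Longrightarrow> clin (a o\<^sub>L b)"
  and clin_cscale: "clin a \<Longrightarrow> clin (cscale c a)"
  and clin_zero: "clin 0"
  and clin_minus: "clin a \<Longrightarrow> clin b \<Longrightarrow> clin (a - b)"
  by (auto simp: clin_def plus_blinfun.rep_eq minus_blinfun.rep_eq scaleC_add_right scaleC_diff_right scaleC_scaleC mult.commute)

lemma adj_add: "clin a \<Longrightarrow> clin b \<Longrightarrow> adj (a + b) = adj a + adj b"
  by (rule adj_eqI) (auto simp: clin_add plus_blinfun.rep_eq cinner_add_left cinner_add_right cinner_adj)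

lemma adj_compose: "clin a \<Longrightarrow> clin b \<Longrightarrow> adj (a o\<^sub>L b) = adj b o\<^sub>L adj a"
  by (rule adj_eqI) (auto simp: clin_compose cinner_adj)

lemma adj_cscale: "clin a \<Longrightarrow> adj (cscale c a) = cscale (cnj c) (adj a)"
  by (rule adj_eqI) (auto simp: clin_cscale cinner_scaleC_left cinner_scaleC_right cinner_adj)

lemma norm_cscale: "norm (cscale c a) = cmod c * norm a"
proof (rule antisym)
  have le: "norm (cscale c a) \<le> cmod c * norm a" for c and a :: "'a \<Rightarrow>\<^sub>L 'a"
    by (rule norm_blinfun_bound) (auto simp: mult.assoc intro: mult_left_mono norm_blinfun)
  show "norm (cscale c a) \<le> cmod c * norm a" by (rule le)
  show "cmod c * norm a \<le> norm (cscale c a)"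
  proof (cases "c = 0")
    case False
    have "cscale (inverse c) (cscale c a) = a"
      using False by (intro blinfun_eqI) (simp add: scaleC_scaleC)
    then have "norm a \<le> cmod (inverse c) * norm (cscale c a)" using le[of "inverse c" "cscale c a"] by simp
    then show ?thesis using False by (simp add: norm_divide field_simps)
  qed simp
qed

lemma norm_le_adj_compose:
  assumes "clin b" shows "(norm b)\<^sup>2 \<le> norm (adj b o\<^sub>L b)"
proof -
  have "norm b \<le> sqrt (norm (adj b o\<^sub>L b))"
  proof (rule norm_blinfun_bound)
    fix x
    have "(norm (b \<cdot> x))\<^sup>2 = cmod (cinner (b \<cdot> x) (b \<cdot> x))"
      by (simp add: cinner_self norm_power)
    also have "\<dots> = cmod (cinner x ((adj b o\<^sub>L b) \<cdot> x))" using assms by (simp add: cinner_adj)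
    also have "\<dots> \<le> norm x * norm ((adj b o\<^sub>L b) \<cdot> x)" by (rule cmod_cinner_le)
    also have "\<dots> \<le> norm x * (norm (adj b o\<^sub>L b) * norm x)" by (intro mult_left_mono norm_blinfun) auto
    also have "\<dots> = (sqrt (norm (adj b o\<^sub>L b)) * norm x)\<^sup>2" by (simp add: power_mult_distrib power2_eq_square mult_ac)
    finally show "norm (b \<cdot> x) \<le> sqrt (norm (adj b o\<^sub>L b)) * norm x"
      by (rule power2_le_imp_le) auto
  qed simp
  then have "(norm b)\<^sup>2 \<le> (sqrt (norm (adj b o\<^sub>L b)))\<^sup>2" by (intro power_mono) auto
  then show ?thesis by simp
qed

lemma norm_adj:
  assumes "clin a" shows "norm (adj a) = norm a"
proof -
  have "norm b \<le> norm (adj b)" if "clin b" for b :: "'a \<Rightarrow>\<^sub>L 'a"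
  proof (cases "b = 0")
    case False
    have "norm b * norm b \<le> norm (adj b) * norm b"
      using norm_le_adj_compose[OF that] norm_blinfun_compose[of "adj b" b] by (simp add: power2_eq_square)
    then show ?thesis using False by simp
  qed simp
  from this[OF assms] this[OF clin_adj[OF assms]] show ?thesis by (simp add: adj_adj assms)
qed

lemma norm_adj_compose: "clin a \<Longrightarrow> norm (adj a o\<^sub>L a) = (norm a)\<^sup>2"
  using norm_le_adj_compose[of a] norm_blinfun_compose[of "adj a" a]
  by (simp add: power2_eq_square norm_adj)

subsection \<open>The C*-algebra of bounded operators\<close>

lemma operators_onD:
  assumes "a \<in> operators_on H"
  shows "clin a" "a \<cdot> x \<in> H" "(\<And>h. h \<in> H \<Longrightarrow> cinner x h = 0) \<Longrightarrow> a \<cdot> x = 0"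
  using assms by (auto simp: operators_on_def clin_def)

lemma operators_onI:
  "\<lbrakk>clin a; \<And>x. a \<cdot> x \<in> H; \<And>x. (\<And>h. h \<in> H \<Longrightarrow> cinner x h = 0) \<Longrightarrow> a \<cdot> x = 0\<rbrakk>
   \<Longrightarrow> a \<in> operators_on H"
  by (auto simp: operators_on_def clin_def)

lemma in_csubspace_if_orthogonal_to_complement:
  assumes "closed_csubspace H" "\<And>q. (\<And>h. h \<in> H \<Longrightarrow> cinner q h = 0) \<Longrightarrow> cinner q y = 0"
  shows "y \<in> H"
proof -
  obtain p where p: "p \<in> H" "\<And>h. h \<in> H \<Longrightarrow> cinner (y - p) h = 0"
    using ex_orthogonal_decomposition[OF assms(1), of y] by blast
  have "cinner (y - p) (y - p) = 0" using assms(2)[of "y - p"] p by (simp add: cinner_diff_right)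
  then have "y = p" by simp
  then show ?thesis using p by simp
qed

lemma proj_props:
  fixes H :: "'h::complex_hilbert set"
  assumes H: "closed_csubspace H"
  shows "proj H \<in> operators_on H" and "h \<in> H \<Longrightarrow> proj H \<cdot> h = h"
    and "h \<in> H \<Longrightarrow> cinner (x - proj H \<cdot> x) h = 0"
proof -
  have cs: "csubspace H" using H by (simp add: closed_csubspace_def)
  obtain p where p: "\<And>x. p x \<in> H" "\<And>x h. h \<in> H \<Longrightarrow> cinner (x - p x) h = 0"
    using ex_orthogonal_decomposition[OF H] by metis
  have uniq: "p x = y" if "y \<in> H" "\<And>h. h \<in> H \<Longrightarrow> cinner (x - y) h = 0" for x y
  proof -
    have m: "p x - y \<in> H" using that p csubspaceD[OF cs] by auto
    have "cinner (p x - y) (p x - y) = cinner (x - y) (p x - y) - cinner (x - p x) (p x - y)"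
      by (simp flip: cinner_diff_left)
    then show ?thesis using that(2)[OF m] p(2)[OF m, of x] by simp
  qed
  have "bounded_linear p"
  proof (rule bounded_linear_intro[of _ 1])
    show "p (x + y) = p x + p y" for x y
    proof (rule uniq)
      fix h assume "h \<in> H"
      then show "cinner (x + y - (p x + p y)) h = 0"
        using p(2)[of h x] p(2)[of h y] by (simp add: cinner_diff_left cinner_add_left)
    qed (use p csubspaceD[OF cs] in auto)
    show "p (r *\<^sub>R x) = r *\<^sub>R p x" for r x
    proof (rule uniq)
      fix h assume "h \<in> H"
      then have "cinner (complex_of_real r *\<^sub>C (x - p x)) h = 0"
        using p(2)[of h x] by (simp add: cinner_scaleC_left)
      then show "cinner (r *\<^sub>R x - r *\<^sub>R p x) h = 0" by (simp add: scaleC_of_real algebra_simps)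
    qed (use p csubspaceD[OF cs] in auto)
    show "norm (p x) \<le> norm x * 1" for x
    proof (cases "p x = 0")
      case False
      have "cinner (p x) (p x) = cinner x (p x)"
        using p(2)[OF p(1), of x x] by (simp add: cinner_diff_left)
      then have "(norm (p x))\<^sup>2 = cmod (cinner x (p x))"
        by (metis cinner_self norm_of_real abs_power2)
      also have "\<dots> \<le> norm x * norm (p x)" by (rule cmod_cinner_le)
      finally show ?thesis using False by (simp add: power2_eq_square)
    qed simp
  qed
  then have ap: "blinfun_apply (Blinfun p) = p" by (rule bounded_linear_Blinfun_apply)
  have px: "p x = x" if "x \<in> H" for x using that by (intro uniq) auto
  have clin: "clin (Blinfun p)"
    unfolding clin_def ap
  proof (intro allI uniq)
    fix c x h assume "h \<in> H"
    then have "cinner (c *\<^sub>C (x - p x)) h = 0" using p(2)[of h x] by (simp add: cinner_scaleC_left)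
    then show "cinner (c *\<^sub>C x - c *\<^sub>C p x) h = 0" by (simp add: scaleC_diff_right)
  qed (use p csubspaceD[OF cs] in auto)
  have op: "Blinfun p \<in> operators_on H"
  proof (rule operators_onI)
    fix x assume "\<And>h. h \<in> H \<Longrightarrow> cinner x h = 0"
    then show "Blinfun p \<cdot> x = 0"
      unfolding ap using csubspaceD[OF cs] by (intro uniq) auto
  qed (use clin ap p in auto)
  have "proj H = Blinfun p"
    unfolding proj_def
  proof (rule the_equality)
    show "Blinfun p \<in> operators_on H \<and> (\<forall>x\<in>H. Blinfun p \<cdot> x = x)"
      using op ap px by simp
    fix q assume q: "q \<in> operators_on H \<and> (\<forall>x\<in>H. q \<cdot> x = x)"
    show "q = Blinfun p"
    proof (rule blinfun_eqI)
      fix x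
      have "q \<cdot> (x - p x) = 0" using q p(2) operators_onD(3)[of q H "x - p x"] by blast
      then show "q \<cdot> x = Blinfun p \<cdot> x"
        using q p(1) ap by (simp add: blinfun.diff_right)
    qed
  qed
  then show "proj H \<in> operators_on H" and "h \<in> H \<Longrightarrow> proj H \<cdot> h = h"
    and "h \<in> H \<Longrightarrow> cinner (x - proj H \<cdot> x) h = 0"
    using op ap px p by auto
qed

lemma bounded_operators_simps [simp]:
  "carrier (bounded_operators H) = operators_on H"
  "a \<otimes>\<^bsub>bounded_operators H\<^esub> b = a o\<^sub>L b"
  "\<one>\<^bsub>bounded_operators H\<^esub> = proj H"
  "\<zero>\<^bsub>bounded_operators H\<^esub> = 0"
  "a \<oplus>\<^bsub>bounded_operators H\<^esub> b = a + b"
  "c \<odot>\<^bsub>bounded_operators H\<^esub> a = cscale c a"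
  "star (bounded_operators H) = adj"
  "nrm (bounded_operators H) = norm"
  by (simp_all add: bounded_operators_def cscale_def)

lemma operators_on_closed:
  assumes "closed_csubspace H"
  shows "0 \<in> operators_on H"
    "a \<in> operators_on H \<Longrightarrow> b \<in> operators_on H \<Longrightarrow> a + b \<in> operators_on H"
    "a \<in> operators_on H \<Longrightarrow> b \<in> operators_on H \<Longrightarrow> a - b \<in> operators_on H"
    "a \<in> operators_on H \<Longrightarrow> b \<in> operators_on H \<Longrightarrow> a o\<^sub>L b \<in> operators_on H"
    "a \<in> operators_on H \<Longrightarrow> cscale c a \<in> operators_on H"
    "a \<in> operators_on H \<Longrightarrow> adj a \<in> operators_on H"
proof -
  have cs: "csubspace H" using assms by (simp add: closed_csubspace_def)
  note csD = csubspaceD[OF cs]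
  show "0 \<in> operators_on H" by (rule operators_onI) (auto simp: clin_zero csD)
  assume a: "a \<in> operators_on H"
  note aD = operators_onD[OF a]
  show "cscale c a \<in> operators_on H" by (rule operators_onI) (auto simp: clin_cscale csD aD)
  show "adj a \<in> operators_on H"
  proof (rule operators_onI)
    show "adj a \<cdot> x \<in> H" for x
      by (rule in_csubspace_if_orthogonal_to_complement[OF assms])
        (use aD in \<open>simp flip: cinner_adj\<close>)
    fix x assume x: "\<And>h. h \<in> H \<Longrightarrow> cinner x h = 0"
    show "adj a \<cdot> x = 0"
    proof (rule cinner_ext)
      fix y
      show "cinner y (adj a \<cdot> x) = cinner y 0"
        using x[of "a \<cdot> y"] cinner_0_commute[of x "a \<cdot> y"] aD
        by (simp flip: cinner_adj)
    qed
  qed (simp add: clin_adj aD)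
  assume b: "b \<in> operators_on H"
  note bD = operators_onD[OF b]
  show "a + b \<in> operators_on H"
    by (rule operators_onI) (auto simp: clin_add csD aD bD plus_blinfun.rep_eq)
  show "a - b \<in> operators_on H"
    by (rule operators_onI) (auto simp: clin_minus csD aD bD minus_blinfun.rep_eq)
  show "a o\<^sub>L b \<in> operators_on H"
    by (rule operators_onI) (auto simp: clin_compose csD aD bD)
qed

lemma operators_on_proj:
  assumes "closed_csubspace H" "a \<in> operators_on H"
  shows "proj H o\<^sub>L a = a" "a o\<^sub>L proj H = a"
proof -
  show "proj H o\<^sub>L a = a"
    by (rule blinfun_eqI) (simp add: proj_props(2)[OF assms(1)] operators_onD[OF assms(2)])
  show "a o\<^sub>L proj H = a"
  proof (rule blinfun_eqI)
    fix x
    have "a \<cdot> (x - proj H \<cdot> x) = 0"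
      using proj_props(3)[OF assms(1)] by (intro operators_onD(3)[OF assms(2)])
    then show "(a o\<^sub>L proj H) \<cdot> x = a \<cdot> x" by (simp add: blinfun.diff_right)
  qed
qed

lemma star_alg_bounded_operators:
  fixes H :: "'h::complex_hilbert set"
  assumes H: "closed_csubspace H"
  shows "star_alg (bounded_operators H)"
proof -
  let ?B = "bounded_operators H"
  note cl = operators_on_closed[OF H] and pr = operators_on_proj[OF H]
  have ag: "abelian_group ?B"
  proof (rule abelian_groupI)
    fix x assume "x \<in> carrier ?B"
    then show "\<exists>y\<in>carrier ?B. y \<oplus>\<^sub>?B x = \<zero>\<^sub>?B"
      using cl(3)[OF cl(1), of x] by (intro bexI[of _ "- x"]) auto
  qed (auto simp: cl)
  have mon: "Group.monoid ?B"
    by (rule monoidI) (auto intro!: blinfun_eqI simp: cl pr proj_props[OF H])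
  have rng: "ring ?B"
    by (rule ringI[OF ag mon])
      (auto intro!: blinfun_eqI simp: plus_blinfun.rep_eq blinfun.add_right)
  have modl: "Module.module complex_ring ?B"
    by (rule moduleI[OF cring_complex_ring ag])
      (auto intro!: blinfun_eqI simp: cl plus_blinfun.rep_eq scaleC_add_left scaleC_add_right scaleC_scaleC)
  show ?thesis
    by (rule star_alg.intro[OF rng modl], rule star_alg_axioms.intro)
      (auto intro!: blinfun_eqI simp: cl operators_onD clinD[OF operators_onD(1)] adj_adj adj_add adj_compose adj_cscale)
qed

lemma bounded_operators_minus [simp]:
  assumes "closed_csubspace H" "b \<in> operators_on H"
  shows "a \<ominus>\<^bsub>bounded_operators H\<^esub> b = a - b"
proof -
  interpret B: star_alg "bounded_operators H" by (rule star_alg_bounded_operators[OF assms(1)])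
  have "\<ominus>\<^bsub>bounded_operators H\<^esub> b = cscale (-1) b" using B.scal_neg1[of b] assms by simp
  also have "\<dots> = - b" by (rule blinfun_eqI) (simp add: uminus_blinfun.rep_eq)
  finally show ?thesis by (simp add: a_minus_def)
qed

lemma operators_on_limit:
  assumes H: "closed_csubspace H" and "\<And>n. f n \<in> operators_on H" "f \<longlonglongrightarrow> a"
  shows "a \<in> operators_on H"
proof -
  have lim: "(\<lambda>n. f n \<cdot> x) \<longlonglongrightarrow> a \<cdot> x" for x
    by (intro tendsto_intros assms)
  note fD = operators_onD[OF assms(2)]
  show ?thesis
  proof (rule operators_onI)
    show "clin a"
      unfolding clin_def
    proof (intro allI)
      fix c x
      have "(\<lambda>n. f n \<cdot> (c *\<^sub>C x)) \<longlonglongrightarrow> c *\<^sub>C a \<cdot> x"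
        using tendsto_scaleC[OF lim[of x], of c] by (simp add: clinD[OF fD(1)])
      then show "a \<cdot> (c *\<^sub>C x) = c *\<^sub>C a \<cdot> x"
        using lim[of "c *\<^sub>C x"] LIMSEQ_unique by blast
    qed
    show "a \<cdot> x \<in> H" for x
      using H closed_sequentially[of H "\<lambda>n. f n \<cdot> x"] fD(2) lim
      by (auto simp: closed_csubspace_def)
    fix x assume "\<And>h. h \<in> H \<Longrightarrow> cinner x h = 0"
    then have "(\<lambda>n. f n \<cdot> x) = (\<lambda>n. 0)" using fD(3) by auto
    then show "a \<cdot> x = 0" using lim[of x] LIMSEQ_unique[OF _ tendsto_const] by metis
  qed
qed

lemma cstar_bounded_operators:
  fixes H :: "'h::complex_hilbert set"
  assumes H: "closed_csubspace H"
  shows "cstar (bounded_operators H)"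
proof -
  let ?B = "bounded_operators H"
  interpret B: star_alg ?B by (rule star_alg_bounded_operators[OF H])
  show ?thesis
  proof
    fix f :: "nat \<Rightarrow> 'h \<Rightarrow>\<^sub>L 'h"
    assume "\<And>n. f n \<in> carrier ?B" and C: "\<And>e. 0 < e \<Longrightarrow> \<exists>N. \<forall>m\<ge>N. \<forall>n\<ge>N. nrm ?B (f m \<ominus>\<^sub>?B f n) < e"
    then have f: "\<And>n. f n \<in> operators_on H" by simp
    have "Cauchy f"
      by (rule metric_CauchyI) (use C f H in \<open>simp add: dist_norm\<close>)
    then obtain a where a: "f \<longlonglongrightarrow> a" using Cauchy_convergent by (auto simp: convergent_def)
    have "a \<in> operators_on H" by (rule operators_on_limit[OF H f a])
    moreover have "(\<lambda>n. norm (f n - a)) \<longlonglongrightarrow> 0" using a tendsto_norm_zero LIM_zero by blast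
    ultimately show "\<exists>x\<in>carrier ?B. (\<lambda>n. nrm ?B (f n \<ominus>\<^sub>?B x)) \<longlonglongrightarrow> 0"
      using H by (intro bexI[of _ a]) simp_all
  qed (auto simp: norm_triangle_ineq norm_cscale norm_blinfun_compose norm_adj_compose operators_onD)
qed

section \<open>Subalgebras and quotients of C*-algebras\<close>

context cstar
begin

lemma closed_subalgebraD:
  assumes "closed_subalgebra A S"
  shows "S \<subseteq> carrier A" "\<zero> \<in> S" "x \<in> S \<Longrightarrow> y \<in> S \<Longrightarrow> x \<oplus> y \<in> S" "x \<in> S \<Longrightarrow> y \<in> S \<Longrightarrow> x \<otimes> y \<in> S"
    "x \<in> S \<Longrightarrow> c \<odot> x \<in> S" "x \<in> S \<Longrightarrow> \<ominus> x \<in> S" "x \<in> S \<Longrightarrow> y \<in> S \<Longrightarrow> x \<ominus> y \<in> S"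
    "(\<And>n. f n \<in> S) \<Longrightarrow> x \<in> carrier A \<Longrightarrow> cvg f x \<Longrightarrow> x \<in> S"
proof -
  note d = assms[unfolded closed_subalgebra_def nrm_closed_def]
  show sub: "S \<subseteq> carrier A" "\<zero> \<in> S" using d by auto
  show add: "x \<in> S \<Longrightarrow> y \<in> S \<Longrightarrow> x \<oplus> y \<in> S" for x y using d by auto
  show "x \<in> S \<Longrightarrow> y \<in> S \<Longrightarrow> x \<otimes> y \<in> S" using d by auto
  show scal: "x \<in> S \<Longrightarrow> c \<odot> x \<in> S" for c x using d by auto
  show um: "x \<in> S \<Longrightarrow> \<ominus> x \<in> S" for x using scal[of x "-1"] sub by (auto simp: scal_neg1)
  show "x \<in> S \<Longrightarrow> y \<in> S \<Longrightarrow> x \<ominus> y \<in> S" using add[of x "\<ominus> y"] um[of y] by (simp add: minus_eq)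
  show "(\<And>n. f n \<in> S) \<Longrightarrow> x \<in> carrier A \<Longrightarrow> cvg f x \<Longrightarrow> x \<in> S" unfolding cvg_def using d by blast
qed

lemma cstar_subalgebraD:
  "cstar_subalgebra A S \<Longrightarrow> closed_subalgebra A S" "cstar_subalgebra A S \<Longrightarrow> x \<in> S \<Longrightarrow> star A x \<in> S"
  by (auto simp: cstar_subalgebra_def)

lemma closed_subalgebra_Inter:
  assumes "\<T> \<noteq> {}" "\<And>S. S \<in> \<T> \<Longrightarrow> closed_subalgebra A S"
  shows "closed_subalgebra A (\<Inter>\<T>)"
proof -
  note D = closed_subalgebraD[OF assms(2)]
  show ?thesis
    unfolding closed_subalgebra_def[of A "\<Inter>\<T>"] nrm_closed_def
  proof (intro conjI ballI allI impI)
    show "\<Inter>\<T> \<subseteq> carrier A" using assms(1) D(1) by blast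
    fix f x assume "(\<forall>n::nat. f n \<in> \<Inter>\<T>) \<and> x \<in> carrier A \<and> (\<lambda>n. nrm A (f n \<ominus> x)) \<longlonglongrightarrow> 0"
    then show "x \<in> \<Inter>\<T>" using D(8)[of _ f x] by (auto simp: cvg_def)
  qed (use D(2-5) in auto)
qed

lemma closed_subalgebra_carrier: "closed_subalgebra A (carrier A)"
  by (auto simp: closed_subalgebra_def nrm_closed_def)

lemma closed_subalgebra_hull:
  assumes "S \<subseteq> carrier A"
  shows "closed_subalgebra A (generated_algebra A S)"
  unfolding generated_algebra_def hull_def
  by (rule closed_subalgebra_Inter) (use assms closed_subalgebra_carrier in auto)

lemma cstar_subalgebra_hull:
  assumes "S \<subseteq> carrier A"
  shows "cstar_subalgebra A (generated_cstar A S)"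
proof -
  have "cstar_subalgebra A (carrier A)"
    using closed_subalgebra_carrier by (auto simp: cstar_subalgebra_def)
  then have "closed_subalgebra A (generated_cstar A S)"
    unfolding generated_cstar_def hull_def using assms
    by (intro closed_subalgebra_Inter) (auto simp: cstar_subalgebra_def)
  then show ?thesis
    unfolding cstar_subalgebra_def[of A "generated_cstar A S"]
    by (auto simp: generated_cstar_def hull_def cstar_subalgebra_def)
qed

text \<open>Subtraction refers to the additive inverse within the carrier, so it has to be
  identified again when the carrier is restricted.\<close>

lemma cstar_subalgebra_minus:
  assumes "cstar_subalgebra A S" "x \<in> S" "y \<in> S"
  shows "x \<ominus>\<^bsub>A\<lparr>carrier := S\<rparr>\<^esub> y = x \<ominus> y"
proof -
  note S = closed_subalgebraD[OF cstar_subalgebraD(1)[OF assms(1)]]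
  have "abelian_group (A\<lparr>carrier := S\<rparr>)"
  proof (rule abelian_groupI)
    fix x assume "x \<in> carrier (A\<lparr>carrier := S\<rparr>)"
    then show "\<exists>y\<in>carrier (A\<lparr>carrier := S\<rparr>). y \<oplus>\<^bsub>A\<lparr>carrier := S\<rparr>\<^esub> x = \<zero>\<^bsub>A\<lparr>carrier := S\<rparr>\<^esub>"
      using S(1) S(6)[of x] by (intro bexI[of _ "\<ominus> x"]) (auto simp: l_neg)
  qed (use S(1-3) in \<open>auto intro: a_ac\<close>)
  then interpret D: abelian_group "A\<lparr>carrier := S\<rparr>" .
  have "\<ominus>\<^bsub>A\<lparr>carrier := S\<rparr>\<^esub> y = \<ominus> y"
    by (rule D.minus_equality) (use S(1,6) assms in \<open>auto simp: l_neg\<close>)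
  then show ?thesis by (simp add: a_minus_def)
qed

lemma cstar_subalgebra_cstar:
  assumes sub: "cstar_subalgebra A S" and one: "\<one> \<in> S"
  shows "cstar (A\<lparr>carrier := S\<rparr>)"
proof -
  let ?D = "A\<lparr>carrier := S\<rparr>"
  note S = closed_subalgebraD[OF cstar_subalgebraD(1)[OF sub]]
  have inA: "x \<in> carrier A" if "x \<in> S" for x using S(1) that by auto
  have ag: "abelian_group ?D"
  proof (rule abelian_groupI)
    fix x assume "x \<in> carrier ?D"
    then show "\<exists>y\<in>carrier ?D. y \<oplus>\<^sub>?D x = \<zero>\<^sub>?D"
      using S(1) S(6)[of x] by (intro bexI[of _ "\<ominus> x"]) (auto simp: l_neg)
  qed (use S(1-3) in \<open>auto intro: a_ac\<close>)
  have mon: "Group.monoid ?D"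
    by (rule monoidI) (auto simp: S(4) one inA m_assoc)
  have rng: "ring ?D"
    by (rule ringI[OF ag mon]) (auto simp: inA l_distr r_distr)
  have modl: "Module.module complex_ring ?D"
    by (rule moduleI[OF cring_complex_ring ag]) (auto simp: S(5) inA scal_add_left scal_add_right)
  have "star_alg ?D"
    by (rule star_alg.intro[OF rng modl], rule star_alg_axioms.intro)
      (auto simp: inA cstar_subalgebraD(2)[OF sub])
  then interpret D: star_alg ?D .
  show ?thesis
  proof
    fix f :: "nat \<Rightarrow> 'a" assume "\<And>n. f n \<in> carrier ?D"
      and C: "\<And>e. 0 < e \<Longrightarrow> \<exists>N. \<forall>m\<ge>N. \<forall>n\<ge>N. nrm ?D (f m \<ominus>\<^sub>?D f n) < e"
    then have f: "f n \<in> S" for n by simp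
    obtain x where x: "x \<in> carrier A" "(\<lambda>n. nrm A (f n \<ominus> x)) \<longlonglongrightarrow> 0"
      using nrm_cauchy[of f] C f inA by (auto simp: cstar_subalgebra_minus[OF sub])
    then have "x \<in> S" using S(8)[of f x] f by (simp add: cvg_def)
    then show "\<exists>x\<in>carrier ?D. (\<lambda>n. nrm ?D (f n \<ominus>\<^sub>?D x)) \<longlonglongrightarrow> 0"
      using x f by (intro bexI[of _ x]) (simp_all add: cstar_subalgebra_minus[OF sub])
  qed (auto simp: inA nrm_0_iff nrm_plus nrm_times nrm_cstar)
qed

end

section \<open>Quotients by closed ideals\<close>

locale cstar_ideal = cstar A for A :: "('a, 'm) cstar_alg_scheme" (structure) +
  fixes J :: "'a set"
  assumes J_ideal: "ideal J A"
    and J_star: "x \<in> J \<Longrightarrow> star A x \<in> J"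
    and J_closed: "nrm_closed A J"
    and J_approximate_unit: "k \<in> J \<Longrightarrow> 0 < e \<Longrightarrow>
      \<exists>p\<in>J. star A p = p \<and> nrm A (\<one> \<ominus> p) \<le> 1 \<and> nrm A (k \<otimes> (\<one> \<ominus> p)) < e"
begin

sublocale J: ideal J A by (rule J_ideal)

abbreviation Q :: "'a set cstar_alg" where
  "Q \<equiv> cstar_quotient A J"

abbreviation q :: "'a \<Rightarrow> 'a set" where
  "q a \<equiv> J +> a"

lemma J_carrier [simp]: "j \<in> J \<Longrightarrow> j \<in> carrier A"
  using J.a_Hcarr by blast

lemma J_scal: assumes "j \<in> J" shows "c \<odot> j \<in> J"
proof -
  have "(c \<odot> \<one>) \<otimes> j \<in> J" using assms by (intro J.I_l_closed) auto
  then show ?thesis using assms by simp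
qed

lemma mem_q: "x \<in> q a \<longleftrightarrow> (\<exists>j\<in>J. x = j \<oplus> a)"
  by (auto simp: a_r_coset_def r_coset_def)

lemma q_eq_iff:
  assumes "a \<in> carrier A" "b \<in> carrier A"
  shows "q a = q b \<longleftrightarrow> a \<ominus> b \<in> J"
proof
  assume "q a = q b"
  then have "a \<in> q b" using J.a_rcos_self[OF assms(1)] by simp
  then obtain j where "j \<in> J" "a = j \<oplus> b" by (auto simp: mem_q)
  moreover have "(j \<oplus> b) \<ominus> b = j" if "j \<in> carrier A" for j using assms that by algebra
  ultimately show "a \<ominus> b \<in> J" by simp
next
  have sub: "q a \<subseteq> q b" if "a \<ominus> b \<in> J" "a \<in> carrier A" "b \<in> carrier A" for a b
  proof
    fix x assume "x \<in> q a"
    then obtain j where j: "j \<in> J" "x = j \<oplus> a" by (auto simp: mem_q)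
    have "i \<oplus> a = (i \<oplus> (a \<ominus> b)) \<oplus> b" if "i \<in> carrier A" for i
      using that \<open>a \<in> carrier A\<close> \<open>b \<in> carrier A\<close> by algebra
    then show "x \<in> q b"
      using j that J.a_closed[of j "a \<ominus> b"] by (auto simp: mem_q intro!: bexI[of _ "j \<oplus> (a \<ominus> b)"])
  qed
  assume "a \<ominus> b \<in> J"
  moreover have "b \<ominus> a = \<ominus> (a \<ominus> b)" using assms by algebra
  ultimately have "b \<ominus> a \<in> J" using J.a_inv_closed by simp
  then show "q a = q b" using sub[of a b] sub[of b a] \<open>a \<ominus> b \<in> J\<close> assms by blast
qed

lemma Q_carrier: "carrier Q = q ` carrier A"
  by (auto simp: cstar_quotient_def FactRing_def A_RCOSETS_def RCOSETS_def a_r_coset_def r_coset_def)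

lemma Q_one: "\<one>\<^sub>Q = q \<one>"
  by (simp add: cstar_quotient_def FactRing_def)

lemma Q_zero: "\<zero>\<^sub>Q = q \<zero>"
  by (auto simp: cstar_quotient_def FactRing_def mem_q)

lemma Q_add: "a \<in> carrier A \<Longrightarrow> b \<in> carrier A \<Longrightarrow> q a \<oplus>\<^sub>Q q b = q (a \<oplus> b)"
  by (simp add: cstar_quotient_def FactRing_def J.a_rcos_sum)

lemma Q_mult: "a \<in> carrier A \<Longrightarrow> b \<in> carrier A \<Longrightarrow> q a \<otimes>\<^sub>Q q b = q (a \<otimes> b)"
  by (simp add: cstar_quotient_def FactRing_def J.rcoset_mult_add)

text \<open>The operations \<open>smult\<close> and \<open>star\<close> of
  \<open>cstar_quotient\<close> are unions over all representatives of a coset; this reduces them to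
  a single representative.\<close>

lemma Q_UN:
  assumes "a \<in> carrier A" "\<And>x. x \<in> carrier A \<Longrightarrow> f x \<in> carrier A"
    "\<And>j. j \<in> J \<Longrightarrow> f (j \<oplus> a) \<ominus> f a \<in> J"
  shows "(\<Union>x\<in>q a. q (f x)) = q (f a)"
proof -
  have "q (f x) = q (f a)" if "x \<in> q a" for x
    using that assms q_eq_iff[of "f x" "f a"] by (auto simp: mem_q)
  moreover have "a \<in> q a" using J.a_rcos_self[OF assms(1)] .
  ultimately show ?thesis by blast
qed

lemma Q_scal: assumes "a \<in> carrier A" shows "c \<odot>\<^sub>Q q a = q (c \<odot> a)"
proof -
  have "c \<odot> (j \<oplus> a) \<ominus> c \<odot> a = c \<odot> j" if "j \<in> carrier A" for j using that assms by algebra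
  then have "(\<Union>x\<in>q a. q (c \<odot> x)) = q (c \<odot> a)" using assms J_scal by (intro Q_UN) auto
  then show ?thesis by (simp add: cstar_quotient_def)
qed

lemma Q_star: assumes "a \<in> carrier A" shows "star Q (q a) = q (star A a)"
proof -
  have "star A (j \<oplus> a) \<ominus> star A a = star A j" if "j \<in> carrier A" for j using that assms by algebra
  then have "(\<Union>x\<in>q a. q (star A x)) = q (star A a)" using assms J_star by (intro Q_UN) auto
  then show ?thesis by (simp add: cstar_quotient_def)
qed

lemma bdd_below_nrm_q: "a \<in> carrier A \<Longrightarrow> bdd_below (nrm A ` q a)"
  by (rule bdd_belowI[of _ 0]) (auto simp: mem_q)

lemma Q_nrm_le:
  assumes "a \<in> carrier A" "j \<in> J" shows "nrm Q (q a) \<le> nrm A (j \<oplus> a)"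
  using assms cINF_lower[OF bdd_below_nrm_q[OF assms(1)], of "j \<oplus> a"] by (auto simp: cstar_quotient_def mem_q)

lemma Q_nrm_le': "a \<in> carrier A \<Longrightarrow> nrm Q (q a) \<le> nrm A a"
  using Q_nrm_le[of a \<zero>] J.zero_closed by simp

lemma Q_nrm_less:
  assumes "a \<in> carrier A" "nrm Q (q a) < u"
  obtains j where "j \<in> J" "nrm A (j \<oplus> a) < u"
proof -
  have "q a \<noteq> {}" using J.a_rcos_self[OF assms(1)] by blast
  then obtain x where "x \<in> q a" "nrm A x < u"
    using assms cINF_less_iff[OF _ bdd_below_nrm_q[OF assms(1)], of u] by (auto simp: cstar_quotient_def)
  then show ?thesis using that by (auto simp: mem_q)
qed

lemma Q_nrm_nonneg:
  assumes "a \<in> carrier A" shows "0 \<le> nrm Q (q a)"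
proof -
  have "q a \<noteq> {}" using J.a_rcos_self[OF assms] by blast
  then show ?thesis using assms by (auto simp: cstar_quotient_def mem_q intro!: cINF_greatest)
qed

lemma star_alg_Q: "star_alg Q"
proof -
  note Q = Q_carrier Q_one Q_zero Q_add Q_mult Q_scal Q_star
  have ag: "abelian_group Q"
  proof (rule abelian_groupI)
    fix X assume "X \<in> carrier Q"
    then obtain a where a: "a \<in> carrier A" "X = q a" by (auto simp: Q)
    then show "\<exists>Y\<in>carrier Q. Y \<oplus>\<^sub>Q X = \<zero>\<^sub>Q"
      by (intro bexI[of _ "q (\<ominus> a)"]) (auto simp: Q l_neg)
  qed (auto simp: Q a_assoc, auto simp: a_comm)
  have mon: "Group.monoid Q" by (rule monoidI) (auto simp: Q m_assoc)
  have rng: "ring Q" by (rule ringI[OF ag mon]) (auto simp: Q l_distr r_distr)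
  have modl: "Module.module complex_ring Q"
    by (rule moduleI[OF cring_complex_ring ag]) (auto simp: Q scal_add_left scal_add_right)
  show ?thesis
    by (rule star_alg.intro[OF rng modl], rule star_alg_axioms.intro) (auto simp: Q)
qed

lemma Q_minus: "a \<in> carrier A \<Longrightarrow> b \<in> carrier A \<Longrightarrow> q a \<ominus>\<^sub>Q q b = q (a \<ominus> b)"
proof -
  assume ab: "a \<in> carrier A" "b \<in> carrier A"
  interpret Q: star_alg Q by (rule star_alg_Q)
  have "\<ominus>\<^sub>Q q b = q (\<ominus> b)" using Q.scal_neg1[of "q b"] ab by (simp add: Q_scal Q_carrier scal_neg1)
  then show ?thesis using ab by (simp add: a_minus_def Q_add)
qed

text \<open>Multiplying by \<open>r = \<one> \<ominus> p\<close> does not change the coset of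
  \<open>a\<close> and nearly annihilates the ideal element \<open>j\<close>, so the C*-identity of
  \<open>A\<close> for \<open>a \<otimes> r\<close> yields the estimate up to \<open>e\<close>. The
  approximate unit is an assumption of the locale, to be met by finite coordinate projections in the
  case of the compact operators.\<close>

lemma Q_nrm_cstar_le:
  assumes a: "a \<in> carrier A"
  shows "(nrm Q (q a))\<^sup>2 \<le> nrm Q (q (star A a \<otimes> a))"
proof (rule dense_ge)
  fix u assume "nrm Q (q (star A a \<otimes> a)) < u"
  then obtain j where j: "j \<in> J" "nrm A (j \<oplus> star A a \<otimes> a) < u"
    using Q_nrm_less[of "star A a \<otimes> a" u] a by auto
  show "(nrm Q (q a))\<^sup>2 \<le> u"
  proof (rule field_le_epsilon)
    fix e :: real assume "0 < e"
    then obtain p where p: "p \<in> J" "star A p = p" "nrm A (\<one> \<ominus> p) \<le> 1" "nrm A (j \<otimes> (\<one> \<ominus> p)) < e"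
      using J_approximate_unit[OF j(1)] by blast
    define r where "r = \<one> \<ominus> p"
    have r: "r \<in> carrier A" "star A r = r" "nrm A r \<le> 1" using p by (auto simp: r_def)
    note [simp] = J_carrier[OF j(1)] J_carrier[OF p(1)]
    have "a \<otimes> r = \<ominus> (a \<otimes> p) \<oplus> a" unfolding r_def using a J_carrier[OF p(1)] by algebra
    moreover have "\<ominus> (a \<otimes> p) \<in> J" using a p by (intro J.a_inv_closed J.I_l_closed)
    ultimately have "nrm Q (q a) \<le> nrm A (a \<otimes> r)" using Q_nrm_le[OF a] by metis
    then have "(nrm Q (q a))\<^sup>2 \<le> (nrm A (a \<otimes> r))\<^sup>2"
      using Q_nrm_nonneg[OF a] by (intro power_mono)
    also have "\<dots> = nrm A (star A (a \<otimes> r) \<otimes> (a \<otimes> r))" using a r by (intro nrm_cstar[symmetric]) auto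
    also have "star A (a \<otimes> r) \<otimes> (a \<otimes> r) = r \<otimes> (j \<oplus> star A a \<otimes> a) \<otimes> r \<ominus> r \<otimes> (j \<otimes> r)"
    proof -
      have "star A (a \<otimes> r) \<otimes> (a \<otimes> r) = r \<otimes> (star A a \<otimes> a) \<otimes> r" using a r by (simp add: m_assoc)
      also have "\<dots> = r \<otimes> (j \<oplus> star A a \<otimes> a) \<otimes> r \<ominus> r \<otimes> (j \<otimes> r)"
        using a r(1) J_carrier[OF j(1)] by algebra
      finally show ?thesis .
    qed
    also have "nrm A \<dots> \<le> nrm A (r \<otimes> (j \<oplus> star A a \<otimes> a) \<otimes> r) + nrm A (r \<otimes> (j \<otimes> r))"
      using a r by (intro nrm_minus) auto
    also have "nrm A (r \<otimes> (j \<oplus> star A a \<otimes> a) \<otimes> r) \<le> (nrm A r * nrm A (j \<oplus> star A a \<otimes> a)) * nrm A r"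
      using a r by (intro order.trans[OF nrm_times] mult_right_mono nrm_times) auto
    also have "\<dots> \<le> (1 * nrm A (j \<oplus> star A a \<otimes> a)) * 1"
      using a r by (intro mult_mono) auto
    also have "nrm A (r \<otimes> (j \<otimes> r)) \<le> nrm A r * nrm A (j \<otimes> r)" using r by (intro nrm_times) auto
    also have "\<dots> \<le> 1 * nrm A (j \<otimes> r)" using r by (intro mult_right_mono) auto
    finally show "(nrm Q (q a))\<^sup>2 \<le> u + e" using j(2) p(4) by (simp add: r_def)
  qed
qed

lemma cstar_Q: "cstar Q"
proof -
  interpret Q: star_alg Q by (rule star_alg_Q)
  have plus: "nrm Q (q (a \<oplus> b)) \<le> nrm Q (q a) + nrm Q (q b)" if ab: "a \<in> carrier A" "b \<in> carrier A" for a b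
  proof (rule field_le_epsilon)
    fix e :: real assume e: "0 < e"
    obtain i j where ij: "i \<in> J" "nrm A (i \<oplus> a) < nrm Q (q a) + e/2" "j \<in> J" "nrm A (j \<oplus> b) < nrm Q (q b) + e/2"
      using Q_nrm_less[OF ab(1), of "nrm Q (q a) + e/2"] Q_nrm_less[OF ab(2), of "nrm Q (q b) + e/2"] e
      by (metis less_add_same_cancel1 half_gt_zero)
    note c = J_carrier[OF ij(1)] J_carrier[OF ij(3)]
    have "(i \<oplus> j) \<oplus> (a \<oplus> b) = (i \<oplus> a) \<oplus> (j \<oplus> b)" using c ab by algebra
    then have "nrm Q (q (a \<oplus> b)) \<le> nrm A ((i \<oplus> a) \<oplus> (j \<oplus> b))"
      using Q_nrm_le[of "a \<oplus> b" "i \<oplus> j"] ab ij J.a_closed by auto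
    also have "\<dots> \<le> nrm A (i \<oplus> a) + nrm A (j \<oplus> b)" using ab c by (intro nrm_plus) auto
    finally show "nrm Q (q (a \<oplus> b)) \<le> nrm Q (q a) + nrm Q (q b) + e" using ij by simp
  qed
  have times: "nrm Q (q (a \<otimes> b)) \<le> nrm Q (q a) * nrm Q (q b)" if ab: "a \<in> carrier A" "b \<in> carrier A" for a b
  proof (rule le_mult_if_le_mult_above)
    fix u v assume "nrm Q (q a) < u" "nrm Q (q b) < v"
    then obtain i j where ij: "i \<in> J" "nrm A (i \<oplus> a) < u" "j \<in> J" "nrm A (j \<oplus> b) < v"
      using Q_nrm_less[OF ab(1), of u] Q_nrm_less[OF ab(2), of v] by metis
    note c = J_carrier[OF ij(1)] J_carrier[OF ij(3)]
    have m: "i \<otimes> (j \<oplus> b) \<oplus> a \<otimes> j \<in> J"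
      using ij ab c by (intro J.a_closed J.I_l_closed J.I_r_closed) auto
    have "(i \<otimes> (j \<oplus> b) \<oplus> a \<otimes> j) \<oplus> a \<otimes> b = (i \<oplus> a) \<otimes> (j \<oplus> b)" using c ab by algebra
    then have "nrm Q (q (a \<otimes> b)) \<le> nrm A ((i \<oplus> a) \<otimes> (j \<oplus> b))"
      using Q_nrm_le[of "a \<otimes> b", OF _ m] ab by auto
    also have "\<dots> \<le> nrm A (i \<oplus> a) * nrm A (j \<oplus> b)" using ab c by (intro nrm_times) auto
    also have "\<dots> \<le> u * v"
    proof (intro mult_mono)
      show "0 \<le> u" using ij(2) nrm_ge0[OF a_closed[OF c(1) ab(1)]] by linarith
    qed (use ij ab c in auto)
    finally show "nrm Q (q (a \<otimes> b)) \<le> u * v" .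
  qed
  have scal_le: "nrm Q (q (c \<odot> a)) \<le> cmod c * nrm Q (q a)" if a: "a \<in> carrier A" and "c \<noteq> 0" for a c
  proof -
    have "nrm Q (q (c \<odot> a)) / cmod c \<le> nrm Q (q a)"
    proof (rule dense_ge)
      fix u assume "nrm Q (q a) < u"
      then obtain i where i: "i \<in> J" "nrm A (i \<oplus> a) < u" using Q_nrm_less[OF a] by metis
      note c = J_carrier[OF i(1)]
      have "nrm Q (q (c \<odot> a)) \<le> nrm A (c \<odot> i \<oplus> c \<odot> a)" using a i J_scal by (intro Q_nrm_le) auto
      also have "\<dots> = cmod c * nrm A (i \<oplus> a)" using a c by (simp flip: scal_add_right)
      also have "\<dots> \<le> cmod c * u" using i by (intro mult_left_mono) auto
      finally show "nrm Q (q (c \<odot> a)) / cmod c \<le> u" using \<open>c \<noteq> 0\<close> by (simp add: field_simps)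
    qed
    then show ?thesis using \<open>c \<noteq> 0\<close> by (simp add: field_simps)
  qed
  have zero: "nrm Q (q \<zero>) = 0" using Q_nrm_le'[of \<zero>] Q_nrm_nonneg[of \<zero>] by simp
  have star_le: "nrm Q (q (star A a)) \<le> nrm Q (q a)" if a: "a \<in> carrier A" for a
  proof (rule dense_ge)
    fix u assume "nrm Q (q a) < u"
    then obtain i where i: "i \<in> J" "nrm A (i \<oplus> a) < u" using Q_nrm_less[OF a] by metis
    have "nrm Q (q (star A a)) \<le> nrm A (star A i \<oplus> star A a)"
      using a i J_star by (intro Q_nrm_le) auto
    also have "\<dots> = nrm A (star A (i \<oplus> a))" using a i by simp
    also have "\<dots> = nrm A (i \<oplus> a)" using a i by (intro nrm_star) auto
    finally show "nrm Q (q (star A a)) \<le> u" using i by simp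
  qed
  show ?thesis
  proof
    fix X assume "X \<in> carrier Q"
    then obtain a where a [simp]: "a \<in> carrier A" and X: "X = q a" by (auto simp: Q_carrier)
    show "0 \<le> nrm Q X" by (simp add: X Q_nrm_nonneg)
    show "nrm Q X = 0 \<longleftrightarrow> X = \<zero>\<^sub>Q"
    proof
      assume "nrm Q X = 0"
      then have "\<exists>j\<in>J. nrm A (j \<oplus> a) < 1 / real (Suc n)" for n
        using Q_nrm_less[of a "1 / real (Suc n)"] by (auto simp: X)
      then obtain g where g: "\<And>n. g n \<in> J" "\<And>n. nrm A (g n \<oplus> a) < 1 / real (Suc n)" by metis
      have "(\<lambda>n. nrm A (\<ominus> g n \<ominus> a)) \<longlonglongrightarrow> 0"
      proof (rule tendsto_sandwich[OF _ _ tendsto_const LIMSEQ_Suc[OF lim_1_over_n]])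
        have "\<ominus> j \<ominus> a = \<ominus> (j \<oplus> a)" if "j \<in> carrier A" for j using that a by algebra
        then show "\<forall>\<^sub>F n in sequentially. nrm A (\<ominus> g n \<ominus> a) \<le> 1 / real (Suc n)"
          using g by (auto intro!: always_eventually less_imp_le)
      qed (use g in auto)
      moreover have "\<forall>n. \<ominus> g n \<in> J" using g J.a_inv_closed by simp
      ultimately have "(\<forall>n. \<ominus> g n \<in> J) \<and> a \<in> carrier A \<and> (\<lambda>n. nrm A (\<ominus> g n \<ominus> a)) \<longlonglongrightarrow> 0"
        using a by (intro conjI)
      then have "a \<in> J" by (rule J_closed[unfolded nrm_closed_def, THEN spec, THEN spec, THEN mp])
      then show "X = \<zero>\<^sub>Q" using q_eq_iff[of a \<zero>] by (simp add: X Q_zero minus_eq)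
    qed (simp add: Q_zero zero)
    show "nrm Q (c \<odot>\<^sub>Q X) = cmod c * nrm Q X" for c
    proof (cases "c = 0")
      case False
      have "cmod c * nrm Q (q a) = cmod c * nrm Q (q ((1 / c) \<odot> (c \<odot> a)))" using False by simp
      also have "\<dots> \<le> cmod c * (cmod (1 / c) * nrm Q (q (c \<odot> a)))"
        using False by (intro mult_left_mono scal_le) auto
      also have "\<dots> = nrm Q (q (c \<odot> a))" using False by (simp add: norm_divide)
      finally show ?thesis using scal_le[of a c] False by (simp add: X Q_scal)
    qed (simp add: X Q_scal zero)
    show "nrm Q (star Q X \<otimes>\<^sub>Q X) = (nrm Q X)\<^sup>2"
    proof (rule antisym)
      have "nrm Q (q (star A a \<otimes> a)) \<le> nrm Q (q (star A a)) * nrm Q (q a)" by (rule times) auto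
      also have "\<dots> \<le> nrm Q (q a) * nrm Q (q a)"
        by (intro mult_right_mono star_le Q_nrm_nonneg) auto
      finally show "nrm Q (star Q X \<otimes>\<^sub>Q X) \<le> (nrm Q X)\<^sup>2"
        by (simp add: X Q_star Q_mult power2_eq_square)
      show "(nrm Q X)\<^sup>2 \<le> nrm Q (star Q X \<otimes>\<^sub>Q X)"
        using Q_nrm_cstar_le[of a] by (simp add: X Q_star Q_mult)
    qed
    fix Y assume "Y \<in> carrier Q"
    then obtain b where b [simp]: "b \<in> carrier A" and Y: "Y = q b" by (auto simp: Q_carrier)
    show "nrm Q (X \<oplus>\<^sub>Q Y) \<le> nrm Q X + nrm Q Y" by (simp add: X Y Q_add plus)
    show "nrm Q (X \<otimes>\<^sub>Q Y) \<le> nrm Q X * nrm Q Y" by (simp add: X Y Q_mult times)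
  next
    fix f :: "nat \<Rightarrow> 'a set" assume f: "\<And>n. f n \<in> carrier Q"
      and C: "\<And>e. 0 < e \<Longrightarrow> \<exists>N. \<forall>m\<ge>N. \<forall>n\<ge>N. nrm Q (f m \<ominus>\<^sub>Q f n) < e"
    have "\<exists>N. \<forall>m\<ge>N. \<forall>n\<ge>N. nrm Q (f m \<ominus>\<^sub>Q f n) < (1/2)^k" for k by (rule C) simp
    then obtain r0 where r0: "\<And>k m n. m \<ge> r0 k \<Longrightarrow> n \<ge> r0 k \<Longrightarrow> nrm Q (f m \<ominus>\<^sub>Q f n) < (1/2)^k" by metis
    \<comment> \<open>Partial sums turn the chosen thresholds into a nondecreasing sequence of
      indices.\<close>
    define r where "r k = (\<Sum>i\<le>k. r0 i)" for k
    have rr: "r0 k \<le> r k" "r k \<le> r (Suc k)" for k by (auto simp: r_def intro: member_le_sum)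
    \<comment> \<open>Representatives are chosen one after the other, each corrected by an element
      of the ideal so that its distance from the previous one obeys the bound known for the cosets.
      They then converge in \<open>A\<close>.\<close>
    have "\<exists>a. \<forall>k. (a k \<in> carrier A \<and> q (a k) = f (r k)) \<and> nrm A (a (Suc k) \<ominus> a k) < (1/2)^k"
    proof (rule dependent_nat_choice)
      show "\<exists>x. x \<in> carrier A \<and> q x = f (r 0)" using f[of "r 0"] by (auto simp: Q_carrier)
      fix x k assume x: "x \<in> carrier A \<and> q x = f (r k)"
      obtain b where b: "b \<in> carrier A" "q b = f (r (Suc k))" using f[of "r (Suc k)"] by (auto simp: Q_carrier)
      have "nrm Q (q (b \<ominus> x)) < (1/2)^k"
        using r0[of k "r (Suc k)" "r k"] rr[of k] x b by (simp flip: Q_minus)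
      then obtain j where j: "j \<in> J" "nrm A (j \<oplus> (b \<ominus> x)) < (1/2)^k"
        using Q_nrm_less[of "b \<ominus> x"] x b by auto
      have jc: "j \<in> carrier A" using j by simp
      have xc: "x \<in> carrier A" using x by simp
      have "(j \<oplus> b) \<ominus> x = j \<oplus> (b \<ominus> x)" "(j \<oplus> b) \<ominus> b = j" using jc xc b(1) by algebra+
      then show "\<exists>y. (y \<in> carrier A \<and> q y = f (r (Suc k))) \<and> nrm A (y \<ominus> x) < (1/2)^k"
        using j b x q_eq_iff[of "j \<oplus> b" b] jc by (intro exI[of _ "j \<oplus> b"]) auto
    qed
    then obtain a where a: "\<And>k. a k \<in> carrier A" "\<And>k. q (a k) = f (r k)"
        "\<And>k. nrm A (a (Suc k) \<ominus> a k) < (1/2)^k" by auto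
    obtain x where x: "x \<in> carrier A" "cvg a x"
      using cvg_ex_geometric[of a 1] a less_imp_le[OF a(3)] by auto
    have "(\<lambda>n. nrm Q (f n \<ominus>\<^sub>Q q x)) \<longlonglongrightarrow> 0"
    proof (rule LIMSEQ_I)
      fix e :: real assume e: "0 < e"
      obtain N1 where N1: "\<And>k. k \<ge> N1 \<Longrightarrow> nrm A (a k \<ominus> x) < e/2"
        using LIMSEQ_D[OF x(2)[unfolded cvg_def], of "e/2"] e a x by auto
      obtain N2 where N2: "(1/2::real)^N2 < e/2" using real_arch_pow_inv[of "e/2" "1/2"] e by auto
      define k where "k = max N1 N2"
      have "(1/2::real)^k \<le> (1/2)^N2" by (rule power_decreasing) (auto simp: k_def)
      then have k: "(1/2::real)^k < e/2" using N2 by linarith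
      have "norm (nrm Q (f n \<ominus>\<^sub>Q q x) - 0) < e" if "n \<ge> r k" for n
      proof -
        obtain b where b: "b \<in> carrier A" "f n = q b" using f[of n] by (auto simp: Q_carrier)
        have "nrm Q (q (b \<ominus> a k)) < (1/2)^k"
          using r0[of k n "r k"] rr(1)[of k] that a b by (simp flip: Q_minus)
        moreover have "nrm Q (q (a k \<ominus> x)) < e/2"
          using Q_nrm_le'[of "a k \<ominus> x"] N1[of k] a x by (simp add: k_def)
        moreover have "b \<ominus> x = (b \<ominus> a k) \<oplus> (a k \<ominus> x)" using b(1) a(1)[of k] x(1) by algebra
        ultimately have "nrm Q (q (b \<ominus> x)) < e" using plus[of "b \<ominus> a k" "a k \<ominus> x"] a b x k by simp
        then show ?thesis using b x Q_nrm_nonneg[of "b \<ominus> x"] by (simp add: Q_minus)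
      qed
      then show "\<exists>N. \<forall>n\<ge>N. norm (nrm Q (f n \<ominus>\<^sub>Q q x) - 0) < e" by blast
    qed
    then show "\<exists>X\<in>carrier Q. (\<lambda>n. nrm Q (f n \<ominus>\<^sub>Q X)) \<longlonglongrightarrow> 0"
      using x by (auto simp: Q_carrier)
  qed
qed

lemma star_hom_q: "star_hom A Q q"
  by (auto simp: star_hom_def algebra_hom_def Q_carrier Q_add Q_mult Q_scal Q_star)

end

section \<open>The language of a monomial ideal\<close>

lemma letters_simps [simp]: "letters 0 = []" "letters (u + v) = letters u @ letters v"
  by (simp_all add: zero_word_def plus_word_def)

lemma word_eq_iff: "u = v \<longleftrightarrow> letters u = letters v"
  by (cases u; cases v) simp

lemma nc_monomial_mult: "nc_monomial u * nc_monomial v = nc_monomial (u + v)"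
  by (simp add: nc_monomial_def mult_single)

lemma two_sided_ideal_hull: "two_sided_ideal (two_sided_ideal hull X)"
  by (rule hull_in) (auto simp: two_sided_ideal_def)

text \<open>For the nontrivial direction, the polynomials all of whose monomials contain a member of
  \<open>S\<close> as a factor form a two-sided ideal.\<close>

lemma nc_monomial_in_ideal_of_words:
  "nc_monomial w \<in> ideal_of_words S \<longleftrightarrow> (\<exists>s\<in>S. \<exists>u v. w = u + s + v)"
proof
  assume w: "nc_monomial w \<in> ideal_of_words S"
  define J :: "'a ncpoly set" where "J = {p. \<forall>w\<in>Poly_Mapping.keys p. \<exists>s\<in>S. \<exists>u v. w = u + s + v}"
  have "\<exists>s\<in>S. \<exists>u v. w = u + s + v" if "w \<in> S" for w
    using that by (intro bexI[of _ w] exI[of _ 0]) auto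
  then have "nc_monomial ` S \<subseteq> J"
    by (auto simp: J_def nc_monomial_def)
  moreover have "two_sided_ideal J"
    unfolding two_sided_ideal_def
  proof (intro conjI ballI allI)
    show "0 \<in> J" by (simp add: J_def)
    fix p assume p: "p \<in> J"
    show "p + r \<in> J" if "r \<in> J" for r
      using p that keys_add[of p r] by (auto simp: J_def)
    fix a
    have "\<exists>s\<in>S. \<exists>u v. x + y = u + s + v" if y: "y \<in> Poly_Mapping.keys p" for x y
    proof -
      obtain s u v where "s \<in> S" "y = u + s + v" using p y by (auto simp: J_def)
      then have "x + y = (x + u) + s + v" by (simp add: add.assoc)
      then show ?thesis using \<open>s \<in> S\<close> by blast
    qed
    then show "a * p \<in> J" using keys_mult[of a p] by (fastforce simp: J_def)
    have "\<exists>s\<in>S. \<exists>u v. y + x = u + s + v" if y: "y \<in> Poly_Mapping.keys p" for x y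
    proof -
      obtain s u v where "s \<in> S" "y = u + s + v" using p y by (auto simp: J_def)
      then have "y + x = u + s + (v + x)" by (simp add: add.assoc)
      then show ?thesis using \<open>s \<in> S\<close> by blast
    qed
    then show "p * a \<in> J" using keys_mult[of p a] by (fastforce simp: J_def)
  qed
  ultimately have "ideal_of_words S \<subseteq> J" unfolding ideal_of_words_def by (rule hull_minimal)
  then have "nc_monomial w \<in> J" using w by blast
  then show "\<exists>s\<in>S. \<exists>u v. w = u + s + v" by (simp add: J_def nc_monomial_def)
next
  assume "\<exists>s\<in>S. \<exists>u v. w = u + s + v"
  then obtain s u v where s: "s \<in> S" "w = u + s + v" by blast
  have I: "two_sided_ideal (ideal_of_words S)" unfolding ideal_of_words_def by (rule two_sided_ideal_hull)
  have "nc_monomial s \<in> ideal_of_words S"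
    unfolding ideal_of_words_def using s by (intro hull_inc) auto
  then have "nc_monomial u * nc_monomial s * nc_monomial v \<in> ideal_of_words S"
    using I by (auto simp: two_sided_ideal_def)
  then show "nc_monomial w \<in> ideal_of_words S" by (simp add: nc_monomial_mult s)
qed

text \<open>Isolates the combinatorics of the ideal. The overlap condition is where finite type
  enters: a forbidden word of length at most \<open>k + 1\<close> cannot reach from the letter
  \<open>i\<close> across \<open>w\<close> into \<open>v\<close>.\<close>

locale finite_type_language =
  fixes I :: "'d::finite ncpoly set" and k :: nat
  assumes empty_allowed: "0 \<in> allowed_words I"
    and allowed_left: "u + v \<in> allowed_words I \<Longrightarrow> u \<in> allowed_words I"
    and allowed_right: "u + v \<in> allowed_words I \<Longrightarrow> v \<in> allowed_words I"
    and allowed_overlap: "\<lbrakk>word_length w = k; Word [i] + w \<in> allowed_words I; w + v \<in> allowed_words I\<rbrakk>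
      \<Longrightarrow> Word [i] + (w + v) \<in> allowed_words I"

lemma finite_type_language:
  fixes I :: "'d::finite ncpoly set"
  assumes "monomial_ideal I" "finite_type I k"
  shows "finite_type_language I k"
proof -
  obtain S' where S': "\<And>w. w \<in> S' \<Longrightarrow> 2 \<le> word_length w" "I = ideal_of_words S'"
    using assms(1) by (auto simp: monomial_ideal_def)
  obtain S where S: "I = ideal_of_words S" "max_degree S = enat (k + 1)"
    using assms(2) by (auto simp: finite_type_def)
  have deg: "word_length s \<le> k + 1" if "s \<in> S" for s
  proof -
    have "enat (word_length s) \<le> max_degree S"
      unfolding max_degree_def using that by (intro Sup_upper) auto
    then show ?thesis using S by simp
  qed
  have allowed: "w \<in> allowed_words I \<longleftrightarrow> (\<forall>s\<in>S. \<forall>u v. w \<noteq> u + s + v)" for w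
    unfolding allowed_words_def S(1) by (auto simp: nc_monomial_in_ideal_of_words)
  show ?thesis
  proof
    \<comment> \<open>All generators have degree at least 2, so none of them divides the empty
      word.\<close>
    show "0 \<in> allowed_words I"
      unfolding allowed_words_def S'(2) using S'(1)
      by (fastforce simp: nc_monomial_in_ideal_of_words word_eq_iff word_length_def)
    show "u \<in> allowed_words I" if "u + v \<in> allowed_words I" for u v
    proof -
      have "u \<noteq> x + s + y" if "s \<in> S" for s x y
        using \<open>u + v \<in> allowed_words I\<close> that allowed[of "u + v"] by (metis add.assoc)
      then show ?thesis using allowed by blast
    qed
    show "v \<in> allowed_words I" if "u + v \<in> allowed_words I" for u v
    proof -
      have "v \<noteq> x + s + y" if "s \<in> S" for s x y
        using \<open>u + v \<in> allowed_words I\<close> that allowed[of "u + v"] by (metis add.assoc)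
      then show ?thesis using allowed by blast
    qed
    fix w v :: "'d word" and i
    assume w: "word_length w = k" "Word [i] + w \<in> allowed_words I" "w + v \<in> allowed_words I"
    show "Word [i] + (w + v) \<in> allowed_words I"
      unfolding allowed
    proof (intro ballI allI notI)
      fix s x y assume s: "s \<in> S" "Word [i] + (w + v) = x + s + y"
      have eq: "i # letters w @ letters v = letters x @ letters s @ letters y"
        using s(2) by (simp add: word_eq_iff)
      show False
      \<comment> \<open>A forbidden factor at the very beginning has at most \<open>k + 1\<close>
        letters and so lies in \<open>i w\<close>; any other lies in \<open>w v\<close>.\<close>
      proof (cases "letters x")
        case Nil
        have "length (letters s) \<le> length (i # letters w)"
          using deg[OF s(1)] w(1) by (simp add: word_length_def)
        moreover have "(i # letters w) @ letters v = letters s @ letters y" using eq Nil by simp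
        ultimately have "letters s = take (length (letters s)) (i # letters w)"
          by (metis append_eq_conv_conj take_append diff_is_0_eq take_0 append_Nil2)
        then obtain t where "i # letters w = letters s @ t" by (metis append_take_drop_id)
        then have "Word [i] + w = 0 + s + Word t" by (simp add: word_eq_iff)
        then show False using w(2) s(1) allowed by blast
      next
        case (Cons j x')
        then have "w + v = Word x' + s + y" using eq by (simp add: word_eq_iff)
        then show False using w(3) s(1) allowed by blast
      qed
    qed
  qed
qed

section \<open>Operators on square-summable families\<close>

lemma ell2_eqI: "(\<And>w. ell2_apply f w = ell2_apply g w) \<Longrightarrow> f = g"
  by (simp add: ell2_apply_inject[symmetric] fun_eq_iff)

lemmas ell2_rep = plus_ell2.rep_eq minus_ell2.rep_eq scaleC_ell2.rep_eq scaleR_ell2.rep_eq zero_ell2.rep_eq ket.rep_eq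

lemma ell2_apply_sum: "ell2_apply (sum f F) w = (\<Sum>i\<in>F. ell2_apply (f i) w)"
  by (induction F rule: infinite_finite_induct) (simp_all add: ell2_rep)

lemma cinner_ket: "cinner f (ket w) = ell2_apply f w"
proof -
  have "cinner f (ket w) = (\<Sum>\<^sub>\<infinity>x\<in>{w}. ell2_apply f x)"
    unfolding cinner_ell2_def by (rule infsum_cong_neutral) (auto simp: ell2_rep)
  then show ?thesis by simp
qed

lemma cinner_ket_ket: "cinner (ket v) (ket w) = (if v = w then 1 else 0)"
  by (simp add: cinner_ket ell2_rep)

lemma ell2_norm_mono:
  assumes "\<And>w. cmod (ell2_apply f w) \<le> cmod (ell2_apply g w)"
  shows "norm f \<le> norm g"
proof -
  have "(norm f)\<^sup>2 \<le> (norm g)\<^sup>2"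
    unfolding ell2_norm_sq
    by (intro infsum_mono ell2_apply_summable power_mono assms) auto
  then show ?thesis by (rule power2_le_imp_le) simp
qed

lemma norm_ket [simp]: "norm (ket w) = 1"
proof -
  have "complex_of_real ((norm (ket w))\<^sup>2) = 1" using cinner_ket_ket[of w w] by (simp add: cinner_self)
  then have "(norm (ket w))\<^sup>2 = 1" by (simp only: of_real_eq_1_iff)
  then show ?thesis by (simp add: power2_eq_1_iff) (metis norm_ge_zero not_one_le_zero neg_0_le_iff_le order_trans zero_le_one)
qed

definition rank_one :: "'a \<Rightarrow> 'a \<Rightarrow> 'a ell2 \<Rightarrow>\<^sub>L 'a ell2" where
  "rank_one u v = Blinfun (\<lambda>x. cinner x (ket v) *\<^sub>C ket u)"

lemma rank_one_apply [simp]: "rank_one u v \<cdot> x = cinner x (ket v) *\<^sub>C ket u"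
proof -
  have "bounded_linear (\<lambda>x. cinner x (ket v) *\<^sub>C ket u)"
  proof (rule bounded_linear_intro[of _ 1])
    show "cinner (r *\<^sub>R x) (ket v) *\<^sub>C ket u = r *\<^sub>R (cinner x (ket v) *\<^sub>C ket u)" for r x
      by (simp add: cinner_scaleC_left scaleC_scaleC flip: scaleC_of_real)
    show "norm (cinner x (ket v) *\<^sub>C ket u) \<le> norm x * 1" for x
      using cmod_cinner_le[of x "ket v"] by simp
  qed (simp add: cinner_add_left scaleC_add_left)
  then show ?thesis unfolding rank_one_def by (simp add: bounded_linear_Blinfun_apply)
qed

lemma clin_rank_one: "clin (rank_one u v)"
  by (simp add: clin_def cinner_scaleC_left scaleC_scaleC)

definition trunc :: "'a set \<Rightarrow> 'a ell2 \<Rightarrow>\<^sub>L 'a ell2" where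
  "trunc G = (\<Sum>w\<in>G. rank_one w w)"

lemma trunc_apply:
  assumes "finite G"
  shows "ell2_apply (trunc G \<cdot> x) w = (if w \<in> G then ell2_apply x w else 0)"
proof -
  have "ell2_apply (trunc G \<cdot> x) w = (\<Sum>v\<in>G. if v = w then ell2_apply x w else 0)"
    unfolding trunc_def blinfun.sum_left ell2_apply_sum
    by (intro sum.cong) (auto simp: ell2_rep cinner_ket)
  then show ?thesis using assms by simp
qed

lemma clin_sum: "(\<And>i. i \<in> F \<Longrightarrow> clin (f i)) \<Longrightarrow> clin (sum f F)"
  by (induction F rule: infinite_finite_induct) (simp_all add: clin_zero clin_add)

lemma clin_trunc: "clin (trunc G)"
  unfolding trunc_def by (intro clin_sum clin_rank_one)

lemma norm_trunc_le: "finite G \<Longrightarrow> norm (trunc G \<cdot> x) \<le> norm x"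
  by (rule ell2_norm_mono) (simp add: trunc_apply)

lemma norm_minus_trunc_le: "finite G \<Longrightarrow> norm (x - trunc G \<cdot> x) \<le> norm x"
  by (rule ell2_norm_mono) (simp add: trunc_apply ell2_rep)

lemma norm_minus_trunc_mono:
  "finite G' \<Longrightarrow> G \<subseteq> G' \<Longrightarrow> norm (x - trunc G' \<cdot> x) \<le> norm (x - trunc G \<cdot> x)"
  by (rule ell2_norm_mono) (auto simp: trunc_apply ell2_rep finite_subset)

lemma ex_trunc_close:
  fixes x :: "'a ell2"
  assumes "0 < e"
  shows "\<exists>G. finite G \<and> norm (x - trunc G \<cdot> x) < e"
proof -
  let ?f = "\<lambda>w. (cmod (ell2_apply x w))\<^sup>2"
  have hs: "(?f has_sum infsum ?f UNIV) UNIV"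
    using ell2_apply_summable by (rule has_sum_infsum)
  have "\<forall>\<^sub>F G in finite_subsets_at_top UNIV. dist (sum ?f G) (infsum ?f UNIV) < e\<^sup>2"
    using hs assms unfolding has_sum_def by (intro tendstoD) auto
  then obtain G where G: "finite G" "dist (sum ?f G) (infsum ?f UNIV) < e\<^sup>2"
    by (auto simp: eventually_finite_subsets_at_top)
  have "(norm (x - trunc G \<cdot> x))\<^sup>2 = (\<Sum>\<^sub>\<infinity>w\<in>UNIV - G. ?f w)"
    unfolding ell2_norm_sq using G(1)
    by (intro infsum_cong_neutral) (auto simp: trunc_apply ell2_rep)
  also have "\<dots> = infsum ?f UNIV - sum ?f G"
    using G(1) ell2_apply_summable[of x] by (subst infsum_Diff) auto
  also have "\<dots> < e\<^sup>2" using G(2) by (simp add: dist_real_def)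
  finally have "norm (x - trunc G \<cdot> x) < e"
    using assms by (simp add: power_less_imp_less_base)
  then show ?thesis using G(1) by blast
qed

lemma ell2_clin_eqI:
  assumes "clin a" "clin b" "\<And>w. a \<cdot> ket w = b \<cdot> ket w"
  shows "a = b"
proof (rule blinfun_eqI)
  fix x
  have tr: "(a - b) \<cdot> trunc G \<cdot> x = 0" for G
    unfolding trunc_def blinfun.sum_left blinfun.sum_right
    by (intro sum.neutral ballI) (simp add: minus_blinfun.rep_eq clinD[OF assms(1)] clinD[OF assms(2)] assms(3))
  have "norm ((a - b) \<cdot> x) \<le> 0"
  proof (rule field_le_epsilon)
    fix e :: real assume "0 < e"
    define d where "d = e / (norm (a - b) + 1)"
    have d: "0 < d" using \<open>0 < e\<close> by (simp add: d_def add_nonneg_pos)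
    then obtain G where G: "norm (x - trunc G \<cdot> x) < d" using ex_trunc_close by blast
    have "(a - b) \<cdot> x = (a - b) \<cdot> (x - trunc G \<cdot> x)"
      using tr by (simp add: blinfun.diff_right)
    also have "norm \<dots> \<le> norm (a - b) * norm (x - trunc G \<cdot> x)" by (rule norm_blinfun)
    also have "\<dots> \<le> (norm (a - b) + 1) * d" using G d by (intro mult_mono) auto
    also have "\<dots> = e" by (simp add: d_def add_nonneg_eq_0_iff)
    finally show "norm ((a - b) \<cdot> x) \<le> 0 + e" by simp
  qed
  then show "a \<cdot> x = b \<cdot> x" by (simp add: minus_blinfun.rep_eq)
qed

text \<open>Injectivity of \<open>g\<close> makes the substitution of \<open>g\<close> into
  \<open>f\<close> contractive. The creation operators arise from it with \<open>g\<close> removing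
  the first letter.\<close>

lemma ex_partial_shift:
  fixes g :: "'a \<Rightarrow> 'a"
  assumes "inj_on g D"
  shows "\<exists>t. clin t \<and> (\<forall>f w. ell2_apply (t \<cdot> f) w = (if w \<in> D then ell2_apply f (g w) else 0))"
proof -
  define t0 where "t0 f w = (if w \<in> D then ell2_apply f (g w) else 0)" for f :: "'a ell2" and w
  have sm: "(\<lambda>w. (cmod (t0 f w))\<^sup>2) summable_on UNIV"
    and le: "(\<Sum>\<^sub>\<infinity>w. (cmod (t0 f w))\<^sup>2) \<le> (norm f)\<^sup>2" for f
  proof -
    have img: "(\<lambda>v. (cmod (ell2_apply f v))\<^sup>2) summable_on g ` D"
      by (rule summable_on_subset_banach[OF ell2_apply_summable]) simp
    then have "((\<lambda>v. (cmod (ell2_apply f v))\<^sup>2) \<circ> g) summable_on D"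
      using summable_on_reindex[OF assms] by blast
    moreover have "(\<lambda>w. (cmod (t0 f w))\<^sup>2) summable_on UNIV \<longleftrightarrow>
        ((\<lambda>v. (cmod (ell2_apply f v))\<^sup>2) \<circ> g) summable_on D"
      by (rule summable_on_cong_neutral) (auto simp: t0_def)
    ultimately show "(\<lambda>w. (cmod (t0 f w))\<^sup>2) summable_on UNIV" by blast
    have "(\<Sum>\<^sub>\<infinity>w. (cmod (t0 f w))\<^sup>2) = infsum ((\<lambda>v. (cmod (ell2_apply f v))\<^sup>2) \<circ> g) D"
      by (rule infsum_cong_neutral) (auto simp: t0_def)
    also have "\<dots> = infsum (\<lambda>v. (cmod (ell2_apply f v))\<^sup>2) (g ` D)"
      by (rule infsum_reindex[OF assms, symmetric])
    also have "\<dots> \<le> (norm f)\<^sup>2"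
      unfolding ell2_norm_sq by (rule infsum_mono_neutral[OF img ell2_apply_summable]) auto
    finally show "(\<Sum>\<^sub>\<infinity>w. (cmod (t0 f w))\<^sup>2) \<le> (norm f)\<^sup>2" .
  qed
  define t where "t f = Abs_ell2 (t0 f)" for f
  have ap: "ell2_apply (t f) = t0 f" for f
    unfolding t_def using sm by (simp add: Abs_ell2_inverse)
  have bl: "bounded_linear t"
  proof (rule bounded_linear_intro[of _ 1])
    show "norm (t f) \<le> norm f * 1" for f
    proof -
      have "(norm (t f))\<^sup>2 \<le> (norm f)\<^sup>2" using le[of f] by (simp add: ell2_norm_sq[of "t f"] ap)
      then show ?thesis using power2_le_imp_le[of "norm (t f)" "norm f"] by simp
    qed
  qed (rule ell2_eqI, simp add: ap ell2_rep t0_def)+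
  show ?thesis
  proof (intro exI[of _ "Blinfun t"] conjI allI)
    show "clin (Blinfun t)"
      unfolding clin_def bounded_linear_Blinfun_apply[OF bl]
      by (intro allI ell2_eqI) (simp add: ap ell2_rep t0_def)
  qed (simp add: bounded_linear_Blinfun_apply[OF bl] ap t0_def)
qed

section \<open>Compact operators\<close>

definition totally_bounded_op :: "('h::real_normed_vector \<Rightarrow>\<^sub>L 'h) \<Rightarrow> bool" where
  "totally_bounded_op a \<longleftrightarrow> (\<forall>e>0. \<exists>k. finite k \<and> blinfun_apply a ` cball 0 1 \<subseteq> (\<Union>x\<in>k. ball x e))"

lemma totally_bounded_opD:
  assumes "totally_bounded_op a" "0 < e"
  obtains k where "finite k" "\<And>x. norm x \<le> 1 \<Longrightarrow> \<exists>y\<in>k. norm (a \<cdot> x - y) < e"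
proof -
  obtain k where k: "finite k" "blinfun_apply a ` cball 0 1 \<subseteq> (\<Union>x\<in>k. ball x e)"
    using assms by (auto simp: totally_bounded_op_def)
  show ?thesis
  proof (rule that[OF k(1)])
    fix x :: 'a assume "norm x \<le> 1"
    then have "a \<cdot> x \<in> (\<Union>x\<in>k. ball x e)" using k(2) by (intro subsetD[OF k(2)]) auto
    then show "\<exists>y\<in>k. norm (a \<cdot> x - y) < e" by (auto simp: dist_norm norm_minus_commute)
  qed
qed

lemma totally_bounded_opI:
  assumes "\<And>e. 0 < e \<Longrightarrow> \<exists>k. finite k \<and> (\<forall>x. norm x \<le> 1 \<longrightarrow> (\<exists>y\<in>k. norm (a \<cdot> x - y) < e))"
  shows "totally_bounded_op a"
  unfolding totally_bounded_op_def
proof (intro allI impI)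
  fix e :: real assume "0 < e"
  then obtain k where "finite k" "\<forall>x. norm x \<le> 1 \<longrightarrow> (\<exists>y\<in>k. norm (a \<cdot> x - y) < e)"
    using assms by blast
  then show "\<exists>k. finite k \<and> blinfun_apply a ` cball 0 1 \<subseteq> (\<Union>x\<in>k. ball x e)"
    by (intro exI[of _ k]) (auto simp: dist_norm norm_minus_commute)
qed

text \<open>Replaces compactness by the existence of finite nets, which are easy to follow through
  sums, products and norm limits.\<close>

lemma compact_closure_image_iff:
  fixes a :: "'h::banach \<Rightarrow>\<^sub>L 'h"
  shows "compact (closure (blinfun_apply a ` cball 0 1)) \<longleftrightarrow> totally_bounded_op a"
proof
  assume "compact (closure (blinfun_apply a ` cball 0 1))"
  then show "totally_bounded_op a"
    unfolding compact_eq_totally_bounded totally_bounded_op_def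
    using closure_subset[of "blinfun_apply a ` cball 0 1"] by (meson order_trans)
next
  assume tb: "totally_bounded_op a"
  have "\<exists>k. finite k \<and> closure (blinfun_apply a ` cball 0 1) \<subseteq> (\<Union>x\<in>k. ball x e)" if e: "0 < e" for e :: real
  proof -
    obtain k where k: "finite k" "blinfun_apply a ` cball 0 1 \<subseteq> (\<Union>x\<in>k. ball x (e/2))"
      using tb[unfolded totally_bounded_op_def, rule_format, of "e/2"] half_gt_zero[OF e] by meson
    have "(\<Union>x\<in>k. ball x (e/2)) \<subseteq> (\<Union>x\<in>k. cball x (e/2))" by (intro UN_mono) auto
    then have "closure (blinfun_apply a ` cball 0 1) \<subseteq> (\<Union>x\<in>k. cball x (e/2))"
      using k by (intro closure_minimal closed_UN) (auto intro: order_trans[OF k(2)])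
    also have "\<dots> \<subseteq> (\<Union>x\<in>k. ball x e)" using e by auto
    finally show ?thesis using k(1) by blast
  qed
  then show "compact (closure (blinfun_apply a ` cball 0 1))"
    unfolding compact_eq_totally_bounded by (auto simp: complete_eq_closed)
qed

lemma totally_bounded_op_zero: "totally_bounded_op 0"
  by (rule totally_bounded_opI) (auto intro!: exI[of _ "{0}"])

lemma totally_bounded_op_add:
  assumes "totally_bounded_op a" "totally_bounded_op b"
  shows "totally_bounded_op (a + b)"
proof (rule totally_bounded_opI)
  fix e :: real assume "0 < e"
  obtain k where k: "finite k" "\<And>x. norm x \<le> 1 \<Longrightarrow> \<exists>y\<in>k. norm (a \<cdot> x - y) < e/2"
    using totally_bounded_opD[OF assms(1), of "e/2"] \<open>0 < e\<close> by auto
  obtain l where l: "finite l" "\<And>x. norm x \<le> 1 \<Longrightarrow> \<exists>y\<in>l. norm (b \<cdot> x - y) < e/2"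
    using totally_bounded_opD[OF assms(2), of "e/2"] \<open>0 < e\<close> by auto
  have "\<exists>y\<in>(\<lambda>(y, z). y + z) ` (k \<times> l). norm ((a + b) \<cdot> x - y) < e" if x: "norm x \<le> 1" for x
  proof -
    obtain y z where yz: "y \<in> k" "norm (a \<cdot> x - y) < e/2" "z \<in> l" "norm (b \<cdot> x - z) < e/2"
      using k(2)[OF x] l(2)[OF x] by blast
    have "norm ((a \<cdot> x - y) + (b \<cdot> x - z)) < e"
      using norm_triangle_ineq[of "a \<cdot> x - y" "b \<cdot> x - z"] yz by linarith
    then have "norm ((a + b) \<cdot> x - (y + z)) < e"
      by (simp add: plus_blinfun.rep_eq algebra_simps)
    then show ?thesis using yz by force
  qed
  then show "\<exists>k. finite k \<and> (\<forall>x. norm x \<le> 1 \<longrightarrow> (\<exists>y\<in>k. norm ((a + b) \<cdot> x - y) < e))"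
    using k(1) l(1) by (intro exI[of _ "(\<lambda>(y, z). y + z) ` (k \<times> l)"]) auto
qed

lemma totally_bounded_op_compose_left:
  assumes "totally_bounded_op a"
  shows "totally_bounded_op (b o\<^sub>L a)"
proof (rule totally_bounded_opI)
  fix e :: real assume "0 < e"
  define d where "d = e / (norm b + 1)"
  have "0 < d" using \<open>0 < e\<close> by (simp add: d_def add_nonneg_pos)
  then obtain k where k: "finite k" "\<And>x. norm x \<le> 1 \<Longrightarrow> \<exists>y\<in>k. norm (a \<cdot> x - y) < d"
    using totally_bounded_opD[OF assms, of d] by auto
  have "\<exists>y\<in>blinfun_apply b ` k. norm ((b o\<^sub>L a) \<cdot> x - y) < e" if x: "norm x \<le> 1" for x
  proof -
    obtain y where y: "y \<in> k" "norm (a \<cdot> x - y) < d" using k(2)[OF x] by blast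
    have "norm (b \<cdot> (a \<cdot> x - y)) \<le> norm b * norm (a \<cdot> x - y)"
      by (rule norm_blinfun)
    also have "\<dots> \<le> norm b * d" using y by (intro mult_left_mono) auto
    also have "\<dots> < (norm b + 1) * d" using \<open>0 < d\<close> by (simp add: algebra_simps)
    also have "\<dots> = e" by (simp add: d_def add_nonneg_eq_0_iff)
    finally show ?thesis using y by (auto simp: blinfun.diff_right)
  qed
  then show "\<exists>k. finite k \<and> (\<forall>x. norm x \<le> 1 \<longrightarrow> (\<exists>y\<in>k. norm ((b o\<^sub>L a) \<cdot> x - y) < e))"
    using k(1) by (intro exI[of _ "blinfun_apply b ` k"]) auto
qed

lemma totally_bounded_op_compose_right:
  assumes "totally_bounded_op a"
  shows "totally_bounded_op (a o\<^sub>L b)"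
proof (rule totally_bounded_opI)
  fix e :: real assume "0 < e"
  define c where "c = norm b + 1"
  have c: "0 < c" by (simp add: c_def add_nonneg_pos)
  then obtain k where k: "finite k" "\<And>x. norm x \<le> 1 \<Longrightarrow> \<exists>y\<in>k. norm (a \<cdot> x - y) < e / c"
    using totally_bounded_opD[OF assms, of "e / c"] \<open>0 < e\<close> by auto
  have "\<exists>y\<in>(*\<^sub>R) c ` k. norm ((a o\<^sub>L b) \<cdot> x - y) < e" if x: "norm x \<le> 1" for x
  proof -
    have "norm (b \<cdot> x) \<le> norm b * norm x" by (rule norm_blinfun)
    also have "\<dots> \<le> norm b * 1" using x by (intro mult_left_mono) auto
    finally have "norm ((1/c) *\<^sub>R b \<cdot> x) \<le> 1" using c by (simp add: c_def field_simps)
    then obtain y where y: "y \<in> k" "norm (a \<cdot> ((1/c) *\<^sub>R b \<cdot> x) - y) < e / c"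
      using k(2) by blast
    have "norm (c *\<^sub>R (a \<cdot> ((1/c) *\<^sub>R b \<cdot> x) - y)) < e"
      using y(2) c by (subst norm_scaleR) (simp add: field_simps)
    also have "c *\<^sub>R (a \<cdot> ((1/c) *\<^sub>R b \<cdot> x) - y) = (a o\<^sub>L b) \<cdot> x - c *\<^sub>R y"
      using c by (simp add: blinfun.scaleR_right scaleR_diff_right)
    finally show ?thesis using y by auto
  qed
  then show "\<exists>k. finite k \<and> (\<forall>x. norm x \<le> 1 \<longrightarrow> (\<exists>y\<in>k. norm ((a o\<^sub>L b) \<cdot> x - y) < e))"
    using k(1) by (intro exI[of _ "(*\<^sub>R) c ` k"]) auto
qed

lemma totally_bounded_op_limit:
  assumes "\<And>e. 0 < e \<Longrightarrow> \<exists>b. totally_bounded_op b \<and> norm (a - b) < e"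
  shows "totally_bounded_op a"
proof (rule totally_bounded_opI)
  fix e :: real assume "0 < e"
  obtain b where b: "totally_bounded_op b" "norm (a - b) < e/2" using assms[of "e/2"] \<open>0 < e\<close> by auto
  obtain k where k: "finite k" "\<And>x. norm x \<le> 1 \<Longrightarrow> \<exists>y\<in>k. norm (b \<cdot> x - y) < e/2"
    using totally_bounded_opD[OF b(1), of "e/2"] \<open>0 < e\<close> by auto
  have "\<exists>y\<in>k. norm (a \<cdot> x - y) < e" if x: "norm x \<le> 1" for x
  proof -
    obtain y where y: "y \<in> k" "norm (b \<cdot> x - y) < e/2" using k(2)[OF x] by blast
    have "norm ((a - b) \<cdot> x) \<le> norm (a - b) * norm x" by (rule norm_blinfun)
    also have "\<dots> \<le> norm (a - b) * 1" using x by (intro mult_left_mono) auto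
    finally have "norm (a \<cdot> x - b \<cdot> x) < e/2" using b by (simp add: minus_blinfun.rep_eq)
    then have "norm (a \<cdot> x - y) < e"
      using norm_triangle_ineq[of "a \<cdot> x - b \<cdot> x" "b \<cdot> x - y"] y by simp
    then show ?thesis using y by blast
  qed
  then show "\<exists>k. finite k \<and> (\<forall>x. norm x \<le> 1 \<longrightarrow> (\<exists>y\<in>k. norm (a \<cdot> x - y) < e))"
    using k(1) by blast
qed

lemma totally_bounded_op_rank_one: "totally_bounded_op (rank_one u v)"
  unfolding totally_bounded_op_def
proof (intro allI impI)
  fix e :: real assume "0 < e"
  have "bounded_linear (\<lambda>c. c *\<^sub>C ket u)"
  proof (rule bounded_linear_intro[of _ 1])
    show "(r *\<^sub>R c) *\<^sub>C ket u = r *\<^sub>R c *\<^sub>C ket u" for r c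
      by (simp add: scaleR_conv_of_real scaleC_scaleC flip: scaleC_of_real)
  qed (simp_all add: scaleC_add_left)
  then have "compact ((\<lambda>c. c *\<^sub>C ket u) ` cball 0 1)"
    by (intro compact_continuous_image linear_continuous_on) auto
  then obtain k where k: "finite k" "(\<lambda>c. c *\<^sub>C ket u) ` cball 0 1 \<subseteq> (\<Union>x\<in>k. ball x e)"
    unfolding compact_eq_totally_bounded using \<open>0 < e\<close> by meson
  have "blinfun_apply (rank_one u v) ` cball 0 1 \<subseteq> (\<lambda>c. c *\<^sub>C ket u) ` cball 0 1"
  proof (rule image_subsetI)
    fix x :: "'a ell2" assume "x \<in> cball 0 1"
    then have "cmod (cinner x (ket v)) \<le> 1" using cmod_cinner_le[of x "ket v"] by simp
    then show "rank_one u v \<cdot> x \<in> (\<lambda>c. c *\<^sub>C ket u) ` cball 0 1" by simp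
  qed
  then have "blinfun_apply (rank_one u v) ` cball 0 1 \<subseteq> (\<Union>x\<in>k. ball x e)"
    using k(2) by (rule order_trans)
  then show "\<exists>k. finite k \<and> blinfun_apply (rank_one u v) ` cball 0 1 \<subseteq> (\<Union>x\<in>k. ball x e)"
    using k(1) by (intro exI conjI)
qed

lemma totally_bounded_op_trunc: "totally_bounded_op (trunc G)"
  unfolding trunc_def
  by (induction G rule: infinite_finite_induct)
    (simp_all add: totally_bounded_op_zero totally_bounded_op_add totally_bounded_op_rank_one)

lemma norm_blinfun_le_unit:
  fixes a :: "'h::real_normed_vector \<Rightarrow>\<^sub>L 'h"
  assumes "\<And>x. norm x \<le> 1 \<Longrightarrow> norm (a \<cdot> x) \<le> c" "0 \<le> c"
  shows "norm a \<le> c"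
proof (rule norm_blinfun_bound[OF assms(2)])
  fix x
  show "norm (a \<cdot> x) \<le> c * norm x"
  proof (cases "x = 0")
    case False
    have "norm (a \<cdot> ((1 / norm x) *\<^sub>R x)) \<le> c" using False by (intro assms) simp
    then show ?thesis using False by (simp add: blinfun.scaleR_right field_simps)
  qed simp
qed

text \<open>One finite set of coordinates serves a whole finite net of the image of the unit
  ball.\<close>

lemma ex_trunc_compose_close:
  fixes a :: "'a ell2 \<Rightarrow>\<^sub>L 'a ell2"
  assumes "totally_bounded_op a" "0 < e"
  shows "\<exists>G. finite G \<and> norm (a - (trunc G o\<^sub>L a)) < e"
proof -
  obtain k where k: "finite k" "\<And>x. norm x \<le> 1 \<Longrightarrow> \<exists>y\<in>k. norm (a \<cdot> x - y) < e/4"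
    using totally_bounded_opD[OF assms(1), of "e/4"] assms by auto
  obtain F where F: "\<And>y :: 'a ell2. finite (F y) \<and> norm (y - trunc (F y) \<cdot> y) < e/4"
    using ex_trunc_close[of "e/4"] assms by (metis zero_less_divide_iff zero_less_numeral)
  define G where "G = (\<Union>y\<in>k. F y)"
  have G: "finite G" using k F by (auto simp: G_def)
  have "norm (a - (trunc G o\<^sub>L a)) \<le> e/2"
  proof (rule norm_blinfun_le_unit)
    fix x :: "'a ell2" assume "norm x \<le> 1"
    then obtain y where y: "y \<in> k" "norm (a \<cdot> x - y) < e/4" using k(2) by blast
    define z where "z = a \<cdot> x - y"
    have "norm (y - trunc G \<cdot> y) \<le> norm (y - trunc (F y) \<cdot> y)"
      using y G by (intro norm_minus_trunc_mono) (auto simp: G_def)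
    also have "\<dots> < e/4" using F by blast
    finally have 1: "norm (y - trunc G \<cdot> y) < e/4" .
    have 2: "norm (z - trunc G \<cdot> z) < e/4"
      using norm_minus_trunc_le[OF G, of z] y by (simp add: z_def)
    have "(a - (trunc G o\<^sub>L a)) \<cdot> x = (z - trunc G \<cdot> z) + (y - trunc G \<cdot> y)"
      by (simp add: z_def minus_blinfun.rep_eq blinfun.diff_right)
    then show "norm ((a - (trunc G o\<^sub>L a)) \<cdot> x) \<le> e/2"
      using norm_triangle_ineq[of "z - trunc G \<cdot> z" "y - trunc G \<cdot> y"] 1 2 by simp
  qed (use assms in simp)
  then show ?thesis using G assms by (intro exI[of _ G]) auto
qed

lemma adj_rank_one: "adj (rank_one u v) = rank_one v u"
  by (rule adj_eqI[OF clin_rank_one])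
    (simp add: cinner_scaleC_left cinner_scaleC_right mult.commute cinner_commute[of "ket u"])

lemma adj_sum: "finite F \<Longrightarrow> (\<And>i. i \<in> F \<Longrightarrow> clin (f i)) \<Longrightarrow> adj (sum f F) = (\<Sum>i\<in>F. adj (f i))"
proof (induction F rule: finite_induct)
  case empty
  show ?case by (simp, rule adj_eqI) (auto simp: clin_zero)
next
  case (insert x F)
  then show ?case by (simp add: adj_add clin_sum)
qed

lemma adj_trunc: "finite G \<Longrightarrow> adj (trunc G) = trunc G"
  unfolding trunc_def by (simp add: adj_sum clin_rank_one adj_rank_one)

section \<open>The Toeplitz algebra of a language of finite type\<close>

primrec word_prod :: "('a, 'm) cstar_alg_scheme \<Rightarrow> ('d \<Rightarrow> 'a) \<Rightarrow> 'd list \<Rightarrow> 'a" where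
  "word_prod A t [] = \<one>\<^sub>A"
| "word_prod A t (i # w) = t i \<otimes>\<^sub>A word_prod A t w"

context finite_type_language
begin

abbreviation L :: "'d word set" where "L \<equiv> allowed_words I"
abbreviation F :: "'d word ell2 set" where "F \<equiv> fock I"

lemma fock_eq: "F = {f. \<forall>w. w \<notin> L \<longrightarrow> ell2_apply f w = 0}" (is "_ = ?R")
proof
  have cs: "csubspace ?R" by (auto simp: csubspace_def ell2_rep)
  have "closed ?R"
  proof (rule closed_sequential_limits[THEN iffD2], intro allI impI)
    fix f x assume fx: "(\<forall>n::nat. f n \<in> ?R) \<and> f \<longlonglongrightarrow> x"
    have "ell2_apply x w = 0" if "w \<notin> L" for w
    proof -
      have "cmod (ell2_apply x w) \<le> e" if "0 < e" for e
      proof -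
        obtain n where "norm (f n - x) < e" using fx LIMSEQ_D[of f x e] \<open>0 < e\<close> by (metis order_refl)
        then have "cmod (ell2_apply (f n - x) w) < e" using ell2_apply_le_norm[of "f n - x" w] by simp
        then show ?thesis using fx \<open>w \<notin> L\<close> by (simp add: ell2_rep)
      qed
      then have "cmod (ell2_apply x w) \<le> 0" by (rule dense_ge)
      then show ?thesis by simp
    qed
    then show "x \<in> ?R" by simp
  qed
  then have "closed_csubspace ?R" using cs by (simp add: closed_csubspace_def)
  moreover have "fibre I n \<subseteq> ?R" for n
    unfolding fibre_def using cs by (intro hull_minimal) (auto simp: ell2_rep)
  ultimately show "F \<subseteq> ?R"
    unfolding fock_def by (intro hull_minimal) auto
  show "?R \<subseteq> F"
  proof
    fix f assume f: "f \<in> ?R"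
    have F: "closed_csubspace F"
      unfolding fock_def by (rule hull_in) (auto simp: closed_csubspace_def csubspace_def intro: closed_Inter)
    then have csF: "csubspace F" and clF: "closed F" by (auto simp: closed_csubspace_def)
    have ket: "ket w \<in> F" if "w \<in> L" for w
      unfolding fock_def using that
      by (intro hull_inc UN_I[of "word_length w"]) (auto simp: fibre_def intro!: hull_inc)
    have sumF: "sum g G \<in> F" if "\<And>w. w \<in> G \<Longrightarrow> g w \<in> F" for g :: "'d word \<Rightarrow> 'd word ell2" and G
      using that by (induction G rule: infinite_finite_induct) (auto simp: csubspaceD[OF csF])
    have tr: "trunc G \<cdot> f \<in> F" for G
      unfolding trunc_def blinfun.sum_left
    proof (rule sumF)
      fix w
      show "rank_one w w \<cdot> f \<in> F"
        using f ket[of w] csubspaceD[OF csF] by (cases "w \<in> L") (auto simp: cinner_ket)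
    qed
    have "\<exists>G. dist (trunc G \<cdot> f) f < e" if "0 < e" for e
      using ex_trunc_close[OF that, of f] by (auto simp: dist_norm norm_minus_commute)
    then show "f \<in> F"
      using closed_approachable[OF clF, of f] tr by blast
  qed
qed

lemma closed_csubspace_fock: "closed_csubspace F"
  unfolding fock_def by (rule hull_in) (auto simp: closed_csubspace_def csubspace_def intro: closed_Inter)

lemma ket_in_fock [simp]: "ket w \<in> F \<longleftrightarrow> w \<in> L"
  by (auto simp: fock_eq ell2_rep)

lemma ket_orthogonal_fock: "w \<notin> L \<Longrightarrow> h \<in> F \<Longrightarrow> cinner (ket w) h = 0"
  using cinner_0_commute[of "ket w" h] by (simp add: cinner_ket fock_eq)

lemma operators_on_fock_eqI:
  assumes "a \<in> operators_on F" "b \<in> operators_on F"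
    "\<And>w. w \<in> L \<Longrightarrow> a \<cdot> ket w = b \<cdot> ket w"
  shows "a = b"
proof (rule ell2_clin_eqI)
  show "clin a" "clin b" using assms operators_onD by auto
  fix w
  show "a \<cdot> ket w = b \<cdot> ket w"
  proof (cases "w \<in> L")
    case False
    then have "\<And>h. h \<in> F \<Longrightarrow> cinner (ket w) h = 0" by (rule ket_orthogonal_fock)
    then show ?thesis using operators_onD(3)[OF assms(1)] operators_onD(3)[OF assms(2)] by simp
  qed (simp add: assms)
qed

lemma proj_fock_apply: "ell2_apply (proj F \<cdot> x) w = (if w \<in> L then ell2_apply x w else 0)"
proof -
  have "proj F \<cdot> x \<in> F"
    using proj_props(1)[OF closed_csubspace_fock] operators_onD by blast
  then show ?thesis
    using proj_props(3)[OF closed_csubspace_fock, of "ket w" x]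
    by (auto simp: fock_eq ell2_rep cinner_diff_left cinner_ket)
qed

abbreviation BF :: "('d word ell2 \<Rightarrow>\<^sub>L 'd word ell2) cstar_alg" where
  "BF \<equiv> bounded_operators F"

sublocale BF: cstar BF
  by (rule cstar_bounded_operators[OF closed_csubspace_fock])

abbreviation T :: "'d \<Rightarrow> 'd word ell2 \<Rightarrow>\<^sub>L 'd word ell2" where "T \<equiv> shift I"

lemma shift_props:
  "T i \<in> operators_on F"
  "w \<in> L \<Longrightarrow> T i \<cdot> ket w = (if Word [i] + w \<in> L then ket (Word [i] + w) else 0)"
proof -
  \<comment> \<open>On coordinates the operator reads off the value at the word without its first
    letter, at allowed words that begin with \<open>i\<close>.\<close>
  define D where "D = {w \<in> L. \<exists>v. w = Word [i] + v}"
  define g where "g w = Word (tl (letters w))" for w :: "'d word"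
  have g: "g (Word [i] + v) = v" for v by (simp add: g_def word_eq_iff)
  have "inj_on g D" by (auto simp: inj_on_def D_def g)
  then obtain t where t: "clin t"
      "\<And>f w. ell2_apply (t \<cdot> f) w = (if w \<in> D then ell2_apply f (g w) else 0)"
    using ex_partial_shift by blast
  have tket: "t \<cdot> ket w = (if Word [i] + w \<in> L then ket (Word [i] + w) else 0)" for w
    by (rule ell2_eqI) (auto simp: t ell2_rep D_def g)
  have top: "t \<in> operators_on F"
  proof (rule operators_onI[OF t(1)])
    show "t \<cdot> x \<in> F" for x by (auto simp: fock_eq t D_def)
    fix x assume x: "\<And>h. h \<in> F \<Longrightarrow> cinner x h = 0"
    show "t \<cdot> x = 0"
    proof (rule ell2_eqI)
      fix w
      have "ell2_apply x (g w) = 0" if "w \<in> D"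
      proof -
        have "g w \<in> L" using that allowed_right by (auto simp: D_def g)
        then show ?thesis using x[of "ket (g w)"] by (simp add: cinner_ket)
      qed
      then show "ell2_apply (t \<cdot> x) w = ell2_apply 0 w" by (simp add: t ell2_rep)
    qed
  qed
  have "T i = t"
    unfolding shift_def
  proof (rule the_equality)
    fix s assume "s \<in> operators_on F \<and> (\<forall>w\<in>L. s \<cdot> ket w = (if Word [i] + w \<in> L then ket (Word [i] + w) else 0))"
    then show "s = t" using top tket by (intro operators_on_fock_eqI) auto
  qed (use top tket in auto)
  then show "T i \<in> operators_on F"
    "w \<in> L \<Longrightarrow> T i \<cdot> ket w = (if Word [i] + w \<in> L then ket (Word [i] + w) else 0)"
    using top tket by auto
qed

lemma adj_shift_ket:
  assumes "w \<in> L"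
  shows "adj (T i) \<cdot> ket w =
    (case letters w of [] \<Rightarrow> 0 | j # v \<Rightarrow> if j = i then ket (Word v) else 0)" (is "_ = ?r")
proof (rule ell2_eqI)
  fix v
  have aF: "adj (T i) \<cdot> ket w \<in> F"
    using operators_on_closed(6)[OF closed_csubspace_fock shift_props(1)] operators_onD(2) by blast
  show "ell2_apply (adj (T i) \<cdot> ket w) v = ell2_apply ?r v"
  proof (cases "v \<in> L")
    case True
    have "ell2_apply (adj (T i) \<cdot> ket w) v = cinner (ket w) (T i \<cdot> ket v)"
      by (simp add: cinner_adj'[OF operators_onD(1)[OF shift_props(1)]] flip: cinner_ket)
    also have "\<dots> = (if w = Word [i] + v then 1 else 0)"
      using True assms by (auto simp: shift_props(2) cinner_ket_ket)
    also have "\<dots> = ell2_apply ?r v"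
      by (auto simp: word_eq_iff ell2_rep split: list.split)
    finally show ?thesis .
  next
    case False
    have "ell2_apply ?r v = 0"
    proof (cases "letters w")
      case (Cons j u)
      then have "w = Word [j] + Word u" by (simp add: word_eq_iff)
      then have "Word u \<in> L" using assms allowed_right by blast
      then show ?thesis using False Cons by (auto simp: ell2_rep)
    qed (simp add: ell2_rep)
    then show ?thesis using aF False by (simp add: fock_eq)
  qed
qed

section \<open>Words in the shifts and their relations\<close>

definition toeplitz_gens :: "('d word ell2 \<Rightarrow>\<^sub>L 'd word ell2) set" where
  "toeplitz_gens = insert (proj F) (range T)"

abbreviation TC :: "('d word ell2 \<Rightarrow>\<^sub>L 'd word ell2) cstar_alg" where "TC \<equiv> toeplitz_cstar I"

lemma gens_subset: "toeplitz_gens \<subseteq> operators_on F"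
  using proj_props(1)[OF closed_csubspace_fock] shift_props(1) by (auto simp: toeplitz_gens_def)

lemma carrier_TC: "carrier TC = generated_cstar BF toeplitz_gens"
  by (simp add: toeplitz_cstar_def toeplitz_gens_def)

lemma TC_simps [simp]:
  "a \<otimes>\<^sub>TC b = a o\<^sub>L b" "\<one>\<^sub>TC = proj F" "\<zero>\<^sub>TC = 0" "a \<oplus>\<^sub>TC b = a + b"
  "c \<odot>\<^sub>TC a = cscale c a" "star TC = adj" "nrm TC = norm"
  by (simp_all add: toeplitz_cstar_def)

lemma cstar_subalgebra_TC: "cstar_subalgebra BF (carrier TC)"
  unfolding carrier_TC by (rule BF.cstar_subalgebra_hull) (use gens_subset in simp)

lemma gens_in_TC: "a \<in> toeplitz_gens \<Longrightarrow> a \<in> carrier TC"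
  unfolding carrier_TC generated_cstar_def by (rule hull_inc)

lemma shift_in_TC [simp]: "T i \<in> carrier TC" and proj_in_TC [simp]: "proj F \<in> carrier TC"
  by (auto intro!: gens_in_TC simp: toeplitz_gens_def)

lemma TC_eq: "TC = BF\<lparr>carrier := carrier TC\<rparr>"
  by (simp add: toeplitz_cstar_def)

sublocale TC: cstar TC
  by (subst TC_eq, rule BF.cstar_subalgebra_cstar[OF cstar_subalgebra_TC]) simp

lemmas TC_sub = BF.closed_subalgebraD[OF BF.cstar_subalgebraD(1)[OF cstar_subalgebra_TC]]

lemma TC_operators: "a \<in> carrier TC \<Longrightarrow> a \<in> operators_on F"
  using TC_sub(1) by auto

lemma TC_minus:
  assumes "a \<in> carrier TC" "b \<in> carrier TC"
  shows "a \<ominus>\<^sub>TC b = a - b"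
proof -
  have "a \<ominus>\<^sub>TC b = a \<ominus>\<^bsub>BF\<lparr>carrier := carrier TC\<rparr>\<^esub> b" using TC_eq by simp
  then show ?thesis
    using BF.cstar_subalgebra_minus[OF cstar_subalgebra_TC assms] TC_operators[OF assms(2)]
    by (simp add: bounded_operators_minus[OF closed_csubspace_fock])
qed

lemma sum_in_TC: "(\<And>i. i \<in> G \<Longrightarrow> f i \<in> carrier TC) \<Longrightarrow> sum f G \<in> carrier TC"
  using TC.a_closed TC.zero_closed by (induction G rule: infinite_finite_induct) auto

lemma finsum_TC: "finite G \<Longrightarrow> (\<And>i. i \<in> G \<Longrightarrow> f i \<in> carrier TC) \<Longrightarrow> finsum TC f G = sum f G"
proof (induction G rule: finite_induct)
  case (insert x G)
  then have "finsum TC f (insert x G) = f x \<oplus>\<^sub>TC finsum TC f G" by (intro TC.finsum_insert) auto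
  then show ?case using insert by simp
qed (use TC.finsum_empty in simp)

lemma word_prod_shift_closed: "word_prod TC T w \<in> carrier TC"
  by (induction w) (use TC.m_closed in auto)

lemma word_prod_shift_ket:
  "v \<in> L \<Longrightarrow> word_prod TC T w \<cdot> ket v = (if Word w + v \<in> L then ket (Word w + v) else 0)"
proof (induction w)
  case Nil
  have "Word [] + v = v" by (simp add: word_eq_iff)
  then show ?case using Nil proj_props(2)[OF closed_csubspace_fock, of "ket v"] by simp
next
  case (Cons i w)
  have eq: "Word (i # w) + v = Word [i] + (Word w + v)" by (simp add: word_eq_iff)
  then have "Word (i # w) + v \<in> L \<Longrightarrow> Word w + v \<in> L" using allowed_right[of "Word [i]" "Word w + v"] by simp
  then show ?case using Cons by (auto simp: eq shift_props(2))
qed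

lemma adj_shift_shift: "i \<noteq> j \<Longrightarrow> adj (T i) o\<^sub>L T j = 0"
proof (rule operators_on_fock_eqI)
  assume "i \<noteq> j"
  note cl = operators_on_closed[OF closed_csubspace_fock]
  show "adj (T i) o\<^sub>L T j \<in> operators_on F" "0 \<in> operators_on F" by (auto intro!: cl shift_props)
  fix w assume "w \<in> L"
  then show "(adj (T i) o\<^sub>L T j) \<cdot> ket w = 0 \<cdot> ket w"
    using \<open>i \<noteq> j\<close> by (auto simp: shift_props(2) adj_shift_ket)
qed

text \<open>An exact identity of operators on Fock space. In contrast, the ranges of the
  \<open>T i\<close> add up to the identity only modulo the compact operators, by
  \<open>vacuum_projection\<close>.\<close>

lemma shift_relation:
  assumes "length w = k"
  shows "T i o\<^sub>L word_prod TC T w = 0 \<or> adj (T i) o\<^sub>L (T i o\<^sub>L word_prod TC T w) = word_prod TC T w"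
proof (cases "Word (i # w) \<in> L")
  case True
  note cl = operators_on_closed[OF closed_csubspace_fock] TC_operators[OF word_prod_shift_closed]
  have "adj (T i) o\<^sub>L (T i o\<^sub>L word_prod TC T w) = word_prod TC T w"
  proof (rule operators_on_fock_eqI)
    show "adj (T i) o\<^sub>L (T i o\<^sub>L word_prod TC T w) \<in> operators_on F" "word_prod TC T w \<in> operators_on F"
      by (auto intro!: cl shift_props)
    fix v assume v: "v \<in> L"
    show "(adj (T i) o\<^sub>L (T i o\<^sub>L word_prod TC T w)) \<cdot> ket v = word_prod TC T w \<cdot> ket v"
    proof (cases "Word w + v \<in> L")
      case wv: True
      have "Word [i] + Word w = Word (i # w)" by (simp add: word_eq_iff)
      \<comment> \<open>Here finite type enters the operator theory.\<close>
      then have "Word [i] + (Word w + v) \<in> L"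
        using allowed_overlap[of "Word w" i v] assms True wv by (simp add: word_length_def)
      moreover have "Word (w @ letters v) = Word w + v" by (simp add: word_eq_iff)
      ultimately show ?thesis
        using v wv by (simp add: word_prod_shift_ket shift_props(2) adj_shift_ket)
    qed (use v in \<open>simp add: word_prod_shift_ket\<close>)
  qed
  then show ?thesis by blast
next
  case False
  note cl = operators_on_closed[OF closed_csubspace_fock] TC_operators[OF word_prod_shift_closed]
  have "T i o\<^sub>L word_prod TC T w = 0"
  proof (rule operators_on_fock_eqI)
    show "T i o\<^sub>L word_prod TC T w \<in> operators_on F" "0 \<in> operators_on F"
      by (auto intro!: cl shift_props)
    fix v assume v: "v \<in> L"
    have eq: "Word [i] + (Word w + v) = Word (i # w) + v" by (simp add: word_eq_iff)
    have "Word [i] + (Word w + v) \<notin> L" unfolding eq using False allowed_left by blast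
    then show "(T i o\<^sub>L word_prod TC T w) \<cdot> ket v = 0 \<cdot> ket v"
      using v by (auto simp: word_prod_shift_ket shift_props(2))
  qed
  then show ?thesis by blast
qed

subsection \<open>The compact operators\<close>

abbreviation K :: "('d word ell2 \<Rightarrow>\<^sub>L 'd word ell2) set" where "K \<equiv> compact_operators F"

lemma rank_one_operators:
  assumes "u \<in> L" "v \<in> L"
  shows "rank_one u v \<in> operators_on F"
proof (rule operators_onI[OF clin_rank_one])
  show "rank_one u v \<cdot> x \<in> F" for x
    using assms closed_csubspace_fock csubspaceD(3)[of F "ket u"] by (simp add: closed_csubspace_def)
  fix x assume "\<And>h. h \<in> F \<Longrightarrow> cinner x h = 0"
  then have "cinner x (ket v) = 0" using assms by simp
  then show "rank_one u v \<cdot> x = 0" by simp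
qed

text \<open>Every nonempty allowed word begins with exactly one letter, so only the empty word is
  missed by the ranges of the \<open>T i\<close>. The identity serves twice: it puts a rank one
  operator into the Toeplitz algebra, and it makes the ranges add up to the unit in the
  quotient.\<close>

lemma vacuum_projection: "rank_one 0 0 = proj F - (\<Sum>i\<in>UNIV. T i o\<^sub>L adj (T i))"
proof (rule operators_on_fock_eqI)
  note cl = operators_on_closed[OF closed_csubspace_fock]
  have sumcl: "(\<Sum>i\<in>G. T i o\<^sub>L adj (T i)) \<in> operators_on F" for G :: "'d set"
    by (induction G rule: infinite_finite_induct) (auto intro!: cl shift_props)
  then show "proj F - (\<Sum>i\<in>UNIV. T i o\<^sub>L adj (T i)) \<in> operators_on F"
    by (intro cl proj_props closed_csubspace_fock)
  show "rank_one 0 0 \<in> operators_on F" by (intro rank_one_operators empty_allowed)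
  fix w assume w: "w \<in> L"
  have pw: "proj F \<cdot> ket w = ket w"
    using w proj_props(2)[OF closed_csubspace_fock] by simp
  show "rank_one 0 0 \<cdot> ket w = (proj F - (\<Sum>i\<in>UNIV. T i o\<^sub>L adj (T i))) \<cdot> ket w"
  proof (cases "letters w")
    case Nil
    then have "w = 0" by (simp add: word_eq_iff)
    then show ?thesis
      using w pw by (simp add: minus_blinfun.rep_eq blinfun.sum_left adj_shift_ket cinner_ket_ket)
  next
    case (Cons j v)
    then have wv: "w = Word [j] + Word v" and ne: "w \<noteq> 0" by (auto simp: word_eq_iff)
    have "Word v \<in> L" using w wv allowed_right by blast
    then have "(T i o\<^sub>L adj (T i)) \<cdot> ket w = (if i = j then ket w else 0)" for i
      using w Cons wv by (auto simp: adj_shift_ket shift_props(2))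
    then show ?thesis
      using w pw ne by (simp add: minus_blinfun.rep_eq blinfun.sum_left cinner_ket_ket)
  qed
qed

lemma vacuum_in_TC: "rank_one 0 0 \<in> carrier TC"
proof -
  have "T i o\<^sub>L adj (T i) \<in> carrier TC" for i
    using TC.m_closed[of "T i" "adj (T i)"] TC.star_cl[of "T i"] by simp
  then have "(\<Sum>i\<in>UNIV. T i o\<^sub>L adj (T i)) \<in> carrier TC" by (intro sum_in_TC)
  then show ?thesis
    unfolding vacuum_projection using TC.minus_closed[of "proj F"] by (simp add: TC_minus[symmetric])
qed

text \<open>Word operators move the empty word to \<open>u\<close> and to \<open>v\<close>, so
  multiplying the vacuum projection by them on the two sides gives every rank one operator between
  allowed basis vectors.\<close>

lemma rank_one_in_TC:
  assumes "u \<in> L" "v \<in> L"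
  shows "rank_one u v \<in> carrier TC"
proof -
  let ?U = "word_prod TC T (letters u)" and ?V = "word_prod TC T (letters v)"
  have U: "word_prod TC T (letters u) \<cdot> ket 0 = ket u" if "u \<in> L" for u
  proof -
    have "Word (letters u) + 0 = u" by simp
    then show ?thesis using word_prod_shift_ket[OF empty_allowed, of "letters u"] that by simp
  qed
  have cV: "clin ?V" using operators_onD(1) TC_operators word_prod_shift_closed by blast
  have cU: "clin ?U" using operators_onD(1) TC_operators word_prod_shift_closed by blast
  have "rank_one u v = ?U o\<^sub>L (rank_one 0 0 o\<^sub>L adj ?V)"
    by (rule blinfun_eqI) (simp add: clinD[OF cU] U assms cinner_adj'[OF cV])
  moreover have "?U o\<^sub>L (rank_one 0 0 o\<^sub>L adj ?V) \<in> carrier TC"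
    using TC.m_closed[of ?U "rank_one 0 0 o\<^sub>L adj ?V"] TC.m_closed[of "rank_one 0 0" "adj ?V"]
      TC.star_cl[of ?V] word_prod_shift_closed vacuum_in_TC by simp
  ultimately show ?thesis by simp
qed

lemma trunc_in_TC: "G \<subseteq> L \<Longrightarrow> trunc G \<in> carrier TC"
  unfolding trunc_def by (intro sum_in_TC rank_one_in_TC) auto

lemma compact_iff: "a \<in> K \<longleftrightarrow> a \<in> operators_on F \<and> totally_bounded_op a"
  by (simp add: compact_operators_def compact_closure_image_iff)

lemma trunc_compact: "G \<subseteq> L \<Longrightarrow> trunc G \<in> K"
  using trunc_in_TC TC_operators totally_bounded_op_trunc by (auto simp: compact_iff)

lemma compact_trunc_left:
  assumes "a \<in> K" "0 < e"
  shows "\<exists>G\<subseteq>L. finite G \<and> norm (a - (trunc G o\<^sub>L a)) < e"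
proof -
  obtain G where G: "finite G" "norm (a - (trunc G o\<^sub>L a)) < e"
    using ex_trunc_compose_close assms by (auto simp: compact_iff)
  have aF: "a \<cdot> x \<in> F" for x using assms operators_onD(2) by (auto simp: compact_iff)
  \<comment> \<open>The range of \<open>a\<close> lies in Fock space, so coordinates outside the
    language may be dropped.\<close>
  have "trunc (G \<inter> L) o\<^sub>L a = trunc G o\<^sub>L a"
    by (intro blinfun_eqI ell2_eqI) (use G aF in \<open>auto simp: trunc_apply fock_eq\<close>)
  then show ?thesis using G by (intro exI[of _ "G \<inter> L"]) auto
qed

lemma clin_compact: "a \<in> K \<Longrightarrow> clin a"
  by (auto simp: compact_iff operators_onD)

text \<open>Norm approximation by operators \<open>trunc G o\<^sub>L a\<close> passes to adjoints,
  and the adjoint of such an operator again factors through a finite coordinate projection.\<close>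

lemma adj_compact:
  assumes "a \<in> K" shows "adj a \<in> K"
proof -
  have "totally_bounded_op (adj a)"
  proof (rule totally_bounded_op_limit)
    fix e :: real assume "0 < e"
    then obtain G where G: "G \<subseteq> L" "finite G" "norm (a - (trunc G o\<^sub>L a)) < e" using compact_trunc_left assms by blast
    note c = clin_compact[OF assms] clin_trunc[of G]
    have "adj (a - (trunc G o\<^sub>L a)) = adj a - (adj a o\<^sub>L trunc G)"
      using c G(2) by (intro adj_eqI clin_minus clin_compose)
        (auto simp: minus_blinfun.rep_eq cinner_diff_left cinner_diff_right cinner_adj adj_trunc)
    then have "norm (adj a - (adj a o\<^sub>L trunc G)) < e"
      using G(3) norm_adj[of "a - (trunc G o\<^sub>L a)"] c by (simp add: clin_minus clin_compose)
    then show "\<exists>b. totally_bounded_op b \<and> norm (adj a - b) < e"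
      using totally_bounded_op_compose_left[OF totally_bounded_op_trunc] by blast
  qed
  then show ?thesis
    using assms operators_on_closed(6)[OF closed_csubspace_fock] by (auto simp: compact_iff)
qed

lemma compact_trunc_right:
  assumes "a \<in> K" "0 < e"
  shows "\<exists>G\<subseteq>L. finite G \<and> norm (a - (a o\<^sub>L trunc G)) < e"
proof -
  obtain G where G: "G \<subseteq> L" "finite G" "norm (adj a - (trunc G o\<^sub>L adj a)) < e"
    using compact_trunc_left[OF adj_compact[OF assms(1)] assms(2)] by blast
  note c = clin_compact[OF assms(1)] clin_trunc[of G]
  have "adj (a - (a o\<^sub>L trunc G)) = adj a - (trunc G o\<^sub>L adj a)"
    using c G(2) by (intro adj_eqI clin_minus clin_compose)
      (auto simp: minus_blinfun.rep_eq cinner_diff_left cinner_diff_right cinner_adj adj_trunc)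
  then have "norm (a - (a o\<^sub>L trunc G)) < e"
    using G(3) norm_adj[of "a - (a o\<^sub>L trunc G)"] c by (simp add: clin_minus clin_compose)
  then show ?thesis using G by blast
qed

text \<open>Truncation on both sides leaves a finite linear combination of rank one operators, which
  lies in the Toeplitz algebra by \<open>rank_one_in_TC\<close>; these truncations approximate
  \<open>a\<close> in norm.\<close>

lemma compact_subset_TC: "K \<subseteq> carrier TC"
proof
  fix a assume a: "a \<in> K"
  have cl: "clin a" by (rule clin_compact[OF a])
  have fin: "trunc G o\<^sub>L (a o\<^sub>L trunc G') \<in> carrier TC" if GG: "G \<subseteq> L" "G' \<subseteq> L" for G G'
  proof -
    have "trunc G o\<^sub>L (a o\<^sub>L trunc G') = (\<Sum>u\<in>G. \<Sum>v\<in>G'. cscale (cinner (a \<cdot> ket v) (ket u)) (rank_one u v))"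
    proof (rule blinfun_eqI)
      fix x
      have "rank_one u u \<cdot> a \<cdot> trunc G' \<cdot> x
          = (\<Sum>v\<in>G'. cscale (cinner (a \<cdot> ket v) (ket u)) (rank_one u v) \<cdot> x)" for u
        unfolding trunc_def blinfun.sum_left blinfun.sum_right
        by (intro sum.cong refl) (simp add: clinD[OF cl] cinner_scaleC_left scaleC_scaleC mult.commute)
      then show "(trunc G o\<^sub>L (a o\<^sub>L trunc G')) \<cdot> x
          = (\<Sum>u\<in>G. \<Sum>v\<in>G'. cscale (cinner (a \<cdot> ket v) (ket u)) (rank_one u v)) \<cdot> x"
        by (simp add: trunc_def[of G] blinfun.sum_left)
    qed
    also have "\<dots> \<in> carrier TC"
    proof -
      have cs: "cscale c x \<in> carrier TC" if "x \<in> carrier TC" for c x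
        using TC.scal_closed[OF that] by simp
      show ?thesis using GG by (intro sum_in_TC cs rank_one_in_TC) auto
    qed
    finally show ?thesis .
  qed
  have "\<exists>b. b \<in> carrier TC \<and> norm (b - a) < e" if "0 < e" for e
  proof -
    obtain G where G: "G \<subseteq> L" "finite G" "norm (a - (trunc G o\<^sub>L a)) < e/2"
      using compact_trunc_left[OF a, of "e/2"] \<open>0 < e\<close> by auto
    obtain G' where G': "G' \<subseteq> L" "finite G'" "norm (a - (a o\<^sub>L trunc G')) < e/2"
      using compact_trunc_right[OF a, of "e/2"] \<open>0 < e\<close> by auto
    have "norm (trunc G) \<le> 1" using norm_trunc_le[OF G(2)] by (intro norm_blinfun_bound) auto
    then have N: "norm (trunc G o\<^sub>L (a - (a o\<^sub>L trunc G'))) \<le> 1 * norm (a - (a o\<^sub>L trunc G'))"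
      by (intro order_trans[OF norm_blinfun_compose] mult_right_mono) auto
    have E: "a - (trunc G o\<^sub>L (a o\<^sub>L trunc G')) = (a - (trunc G o\<^sub>L a)) + (trunc G o\<^sub>L (a - (a o\<^sub>L trunc G')))"
      by (rule blinfun_eqI) (simp add: minus_blinfun.rep_eq plus_blinfun.rep_eq blinfun.diff_right)
    have "norm (a - (trunc G o\<^sub>L (a o\<^sub>L trunc G')))
        \<le> norm (a - (trunc G o\<^sub>L a)) + norm (trunc G o\<^sub>L (a - (a o\<^sub>L trunc G')))"
      unfolding E by (rule norm_triangle_ineq)
    then have "norm (a - (trunc G o\<^sub>L (a o\<^sub>L trunc G'))) < e" using N G(3) G'(3) by linarith
    then show ?thesis using fin[OF G(1) G'(1)] by (metis norm_minus_commute)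
  qed
  then have "\<exists>b. b \<in> carrier TC \<and> norm (b - a) < 1 / real (Suc n)" for n by simp
  then obtain f where f: "\<And>n. f n \<in> carrier TC" "\<And>n. norm (f n - a) < 1 / real (Suc n)" by metis
  have aop: "a \<in> operators_on F" using a by (simp add: compact_iff)
  have "BF.cvg f a"
    by (rule BF.cvg_le[OF LIMSEQ_Suc[OF lim_1_over_n]])
      (use f aop TC_operators in \<open>auto simp: bounded_operators_minus[OF closed_csubspace_fock] intro: less_imp_le\<close>)
  then show "a \<in> carrier TC" using TC_sub(8)[of f a] f(1) aop by simp
qed

lemma compact_closed:
  assumes "\<And>n. f n \<in> K" "x \<in> operators_on F" "(\<lambda>n. norm (f n - x)) \<longlonglongrightarrow> 0"
  shows "x \<in> K"
proof -
  have "totally_bounded_op x"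
  proof (rule totally_bounded_op_limit)
    fix e :: real assume "0 < e"
    then obtain n where "norm (f n - x) < e" using LIMSEQ_D[OF assms(3)] by fastforce
    then show "\<exists>b. totally_bounded_op b \<and> norm (x - b) < e"
      using assms(1)[of n] by (intro exI[of _ "f n"]) (simp add: compact_iff norm_minus_commute)
  qed
  then show ?thesis using assms by (simp add: compact_iff)
qed

lemma ideal_compact: "ideal K TC"
proof (rule idealI[OF TC.ring_axioms])
  note cl = operators_on_closed[OF closed_csubspace_fock]
  have KTC: "x \<in> carrier TC" if "x \<in> K" for x using compact_subset_TC that by auto
  have l: "x o\<^sub>L a \<in> K" if "a \<in> K" "x \<in> carrier TC" for a x
    using that TC_operators by (auto simp: compact_iff intro!: cl totally_bounded_op_compose_left)
  have add: "a + b \<in> K" if "a \<in> K" "b \<in> K" for a b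
    using that by (auto simp: compact_iff intro!: cl totally_bounded_op_add)
  show "subgroup K (add_monoid TC)"
  proof (rule subgroup.intro)
    show "\<one>\<^bsub>add_monoid TC\<^esub> \<in> K" by (simp add: compact_iff totally_bounded_op_zero cl)
    fix x assume x: "x \<in> K"
    have "\<ominus>\<^sub>TC x = cscale (-1) (proj F) o\<^sub>L x"
    proof -
      have "\<ominus>\<^sub>TC x = \<ominus>\<^sub>TC (\<one>\<^sub>TC \<otimes>\<^sub>TC x)" using KTC[OF x] by (subst TC.l_one) auto
      also have "\<dots> = ((-1) \<odot>\<^sub>TC \<one>\<^sub>TC) \<otimes>\<^sub>TC x"
        using KTC[OF x] by (simp add: TC.scal_neg1 TC.l_minus del: TC_simps)
      finally show ?thesis by simp
    qed
    moreover have "cscale (-1) (proj F) \<in> carrier TC" using TC.scal_closed[of "proj F" "-1"] by simp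
    ultimately have "\<ominus>\<^sub>TC x \<in> K" using l[OF x] by simp
    then show "inv\<^bsub>add_monoid TC\<^esub> x \<in> K" by (simp add: a_inv_def)
  qed (use KTC add in auto)
  fix a x assume "a \<in> K" "x \<in> carrier TC"
  then show "x \<otimes>\<^sub>TC a \<in> K" "a \<otimes>\<^sub>TC x \<in> K"
    using l TC_operators by (auto simp: compact_iff intro!: cl totally_bounded_op_compose_right)
qed

text \<open>The approximate unit required for the quotient consists of the finite coordinate
  projections; their complements are projections and have norm at most 1.\<close>

sublocale Cal: cstar_ideal TC K
proof (rule cstar_ideal.intro[OF TC.cstar_axioms], rule cstar_ideal_axioms.intro)
  show "ideal K TC" by (rule ideal_compact)
  show "star TC x \<in> K" if "x \<in> K" for x using adj_compact[OF that] by simp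
  have KTC: "x \<in> carrier TC" if "x \<in> K" for x using compact_subset_TC that by auto
  show "nrm_closed TC K"
    unfolding nrm_closed_def
  proof (intro allI impI)
    fix f x assume *: "(\<forall>n::nat. f n \<in> K) \<and> x \<in> carrier TC \<and> (\<lambda>n. nrm TC (f n \<ominus>\<^sub>TC x)) \<longlonglongrightarrow> 0"
    then have "f n \<in> carrier TC" "x \<in> carrier TC" for n using KTC by blast+
    then have "(\<lambda>n. norm (f n - x)) \<longlonglongrightarrow> 0"
      using conjunct2[OF conjunct2[OF *]] by (simp add: TC_minus)
    then show "x \<in> K" using * by (intro compact_closed[of f x]) (auto intro: TC_operators)
  qed
  fix a and e :: real assume a: "a \<in> K" "0 < e"
  obtain G where G: "G \<subseteq> L" "finite G" "norm (a - (a o\<^sub>L trunc G)) < e"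
    using compact_trunc_right[OF a] by blast
  have tr: "trunc G \<in> carrier TC" by (rule trunc_in_TC[OF G(1)])
  have "norm (proj F - trunc G) \<le> 1"
  proof (rule norm_blinfun_bound)
    fix x
    have "norm ((proj F - trunc G) \<cdot> x) \<le> norm x"
      by (rule ell2_norm_mono) (auto simp: minus_blinfun.rep_eq ell2_rep proj_fock_apply trunc_apply[OF G(2)])
    then show "norm ((proj F - trunc G) \<cdot> x) \<le> 1 * norm x" by simp
  qed simp
  moreover have "a o\<^sub>L (proj F - trunc G) = a - (a o\<^sub>L trunc G)"
  proof -
    have "a o\<^sub>L proj F = a" using operators_on_proj(2)[OF closed_csubspace_fock] a by (auto simp: compact_iff)
    then have "a \<cdot> proj F \<cdot> x = a \<cdot> x" for x
      by (metis blinfun_apply_blinfun_compose)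
    then show ?thesis by (intro blinfun_eqI) (simp add: minus_blinfun.rep_eq blinfun.diff_right)
  qed
  ultimately show "\<exists>p\<in>K. star TC p = p \<and> nrm TC (\<one>\<^sub>TC \<ominus>\<^sub>TC p) \<le> 1 \<and> nrm TC (a \<otimes>\<^sub>TC (\<one>\<^sub>TC \<ominus>\<^sub>TC p)) < e"
    using trunc_compact[OF G(1)] G tr by (intro bexI[of _ "trunc G"]) (auto simp: TC_minus adj_trunc)
qed

end

section \<open>Matrix units\<close>

context star_alg
begin

lemma finsum_times:
  assumes "finite F" "finite G" "\<And>k l. k \<in> F \<Longrightarrow> l \<in> G \<Longrightarrow> f (k, l) \<in> carrier A"
  shows "(\<Oplus>p\<in>F \<times> G. f p) = (\<Oplus>k\<in>F. \<Oplus>l\<in>G. f (k, l))"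
  using assms(1,3)
proof (induction F rule: finite_induct)
  case (insert k F)
  have closed: "f (k', l) \<in> carrier A" if "k' = k \<or> k' \<in> F" "l \<in> G" for k' l using insert.prems that by auto
  have split: "insert k F \<times> G = Pair k ` G \<union> F \<times> G" by auto
  have "(\<Oplus>p\<in>insert k F \<times> G. f p) = (\<Oplus>p\<in>Pair k ` G. f p) \<oplus> (\<Oplus>p\<in>F \<times> G. f p)"
    unfolding split using insert.hyps assms(2) closed by (intro finsum_Un_disjoint) auto
  also have "(\<Oplus>p\<in>Pair k ` G. f p) = (\<Oplus>l\<in>G. f (k, l))"
    using closed by (intro finsum_reindex) (auto intro: inj_onI)
  also have "(\<Oplus>p\<in>F \<times> G. f p) = (\<Oplus>k\<in>F. \<Oplus>l\<in>G. f (k, l))" using insert.IH closed by simp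
  also have "(\<Oplus>l\<in>G. f (k, l)) \<oplus> \<dots> = (\<Oplus>k\<in>insert k F. \<Oplus>l\<in>G. f (k, l))"
    using insert.hyps closed by (intro finsum_insert[symmetric]) auto
  finally show ?case .
qed simp

lemma finsum_constant: "finite F \<Longrightarrow> a \<in> carrier A \<Longrightarrow> (\<Oplus>i\<in>F. a) = of_nat (card F) \<odot> a"
proof (induction F rule: finite_induct)
  case (insert x F)
  then show ?case using scal_add_left[of a 1 "of_nat (card F)"] by simp
qed simp

text \<open>Pythagoras for elements with orthogonal ranges, such as matrix units in different
  rows.\<close>

lemma star_mult_finsum_orthogonal:
  assumes "finite F" "\<And>i. i \<in> F \<Longrightarrow> f i \<in> carrier A"
    "\<And>i j. i \<in> F \<Longrightarrow> j \<in> F \<Longrightarrow> i \<noteq> j \<Longrightarrow> star A (f i) \<otimes> f j = \<zero>"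
  shows "star A (\<Oplus>i\<in>F. f i) \<otimes> (\<Oplus>i\<in>F. f i) = (\<Oplus>i\<in>F. star A (f i) \<otimes> f i)"
proof -
  have f: "f \<in> F \<rightarrow> carrier A" using assms(2) by blast
  have "star A (\<Oplus>i\<in>F. f i) \<otimes> (\<Oplus>i\<in>F. f i) = (\<Oplus>i\<in>F. star A (f i)) \<otimes> (\<Oplus>j\<in>F. f j)"
    using assms(1) f by (simp add: star_finsum)
  also have "\<dots> = (\<Oplus>i\<in>F. star A (f i) \<otimes> (\<Oplus>j\<in>F. f j))"
    using f assms(1) by (intro finsum_ldistr) auto
  also have "\<dots> = (\<Oplus>i\<in>F. star A (f i) \<otimes> f i)"
  proof (rule finsum_cong')
    fix i assume i: "i \<in> F"
    have "star A (f i) \<otimes> (\<Oplus>j\<in>F. f j) = (\<Oplus>j\<in>F. star A (f i) \<otimes> f j)"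
      using f i assms(1) by (intro finsum_rdistr) auto
    also have "\<dots> = star A (f i) \<otimes> f i" using assms i by (intro finsum_single) auto
    finally show "star A (f i) \<otimes> (\<Oplus>j\<in>F. f j) = star A (f i) \<otimes> f i" .
  qed (use assms in auto)
  finally show ?thesis .
qed

lemma star_mult_add_orthogonal:
  assumes x: "x \<in> carrier A" and y: "y \<in> carrier A" and o: "star A x \<otimes> y = \<zero>"
  shows "star A (x \<oplus> c \<odot> y) \<otimes> (x \<oplus> c \<odot> y) = star A x \<otimes> x \<oplus> (cnj c * c) \<odot> (star A y \<otimes> y)"
proof -
  have "star A y \<otimes> x = star A (star A x \<otimes> y)" using x y by simp
  then have o': "star A y \<otimes> x = \<zero>" unfolding o by simp
  have "star A (x \<oplus> c \<odot> y) \<otimes> (x \<oplus> c \<odot> y)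
      = star A x \<otimes> x \<oplus> (c \<odot> (star A x \<otimes> y) \<oplus> cnj c \<odot> (star A y \<otimes> x)) \<oplus> (cnj c * c) \<odot> (star A y \<otimes> y)"
    using x y by algebra
  then show ?thesis unfolding o o' using x y by simp
qed

end

section \<open>Calculus of matrix units, in place of entrywise computation\<close>

declare matrix_algebra_simps [simp del]

context star_alg
begin

declare matrix_minus [simp del]

lemma matrix_unit_carrier [simp]:
  "\<lbrakk>i < n; j < n; a \<in> carrier A\<rbrakk> \<Longrightarrow> matrix_unit i j a \<in> carrier (matrix_algebra A n N)"
  by (simp add: matrix_algebra_simps)

lemma matrix_unit_mult:
  assumes "k < n" and a: "a \<in> carrier A" and b: "b \<in> carrier A"
  shows "matrix_unit i k a \<otimes>\<^bsub>matrix_algebra A n N\<^esub> matrix_unit k' l b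
    = (if k = k' then matrix_unit i l (a \<otimes> b) else \<zero>\<^bsub>matrix_algebra A n N\<^esub>)"
  unfolding matrix_algebra_simps
proof (intro ext)
  fix i' j'
  let ?f = "\<lambda>m. matrix_unit i k a i' m \<otimes> matrix_unit k' l b m j'"
  have c: "?f m \<in> carrier A" for m using a b by (simp add: matrix_unit_def)
  have z: "m \<noteq> k \<Longrightarrow> ?f m = \<zero>" for m using b by (simp add: matrix_unit_def)
  have "(\<Oplus>m\<in>{..<n}. ?f m) = ?f k"
    using assms(1) c z by (intro finsum_single) auto
  then show "(\<Oplus>m\<in>{..<n}. ?f m) = (if k = k' then matrix_unit i l (a \<otimes> b) else (\<lambda>i j. \<zero>)) i' j'"
    using a b by (auto simp: matrix_unit_def)
qed

lemma star_matrix_unit: "star (matrix_algebra A n N) (matrix_unit i k a) = matrix_unit k i (star A a)"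
  by (auto simp: matrix_algebra_simps matrix_unit_def fun_eq_iff)

lemma matrix_unit_zero: "matrix_unit i k \<zero> = \<zero>\<^bsub>matrix_algebra A n N\<^esub>"
  by (auto simp: matrix_algebra_simps matrix_unit_def fun_eq_iff)

lemma matrix_unit_add:
  "matrix_unit i k (a \<oplus> b) = matrix_unit i k a \<oplus>\<^bsub>matrix_algebra A n N\<^esub> matrix_unit i k b"
  if "a \<in> carrier A" "b \<in> carrier A"
  using that by (auto simp: matrix_algebra_simps matrix_unit_def fun_eq_iff)

lemma matrix_unit_scal: "matrix_unit i k (c \<odot> a) = c \<odot>\<^bsub>matrix_algebra A n N\<^esub> matrix_unit i k a"
  by (auto simp: matrix_algebra_simps matrix_unit_def fun_eq_iff)

lemma matrix_unit_minus:
  "matrix_unit i k (a \<ominus> b) = matrix_unit i k a \<ominus>\<^bsub>matrix_algebra A n N\<^esub> matrix_unit i k b"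
  if "a \<in> carrier A" "b \<in> carrier A" "i < n" "k < n"
proof -
  have "matrix_unit i k b \<in> matrices_over A n (carrier A)" using that by simp
  from matrix_minus[OF this, of N "matrix_unit i k a"] show ?thesis
    using that by (auto simp: matrix_unit_def fun_eq_iff minus_eq)
qed

lemma matrix_unit_finsum:
  assumes "finite F" "\<And>x. x \<in> F \<Longrightarrow> f x \<in> carrier A" "i < n" "k < n"
  shows "matrix_unit i k (\<Oplus>x\<in>F. f x) = finsum (matrix_algebra A n N) (\<lambda>x. matrix_unit i k (f x)) F"
proof -
  interpret D: star_alg "matrix_algebra A n N" by (rule matrix_star_alg)
  from assms(1,2) show ?thesis
  proof (induction F rule: finite_induct)
    case (insert x F)
    then have "matrix_unit i k (\<Oplus>x\<in>insert x F. f x) = matrix_unit i k (f x \<oplus> (\<Oplus>x\<in>F. f x))"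
      by (subst finsum_insert) auto
    also have "\<dots> = matrix_unit i k (f x) \<oplus>\<^bsub>matrix_algebra A n N\<^esub> finsum (matrix_algebra A n N) (\<lambda>x. matrix_unit i k (f x)) F"
      using insert by (subst matrix_unit_add) (auto intro!: finsum_closed)
    also have "\<dots> = finsum (matrix_algebra A n N) (\<lambda>x. matrix_unit i k (f x)) (insert x F)"
      using insert assms(3,4) by (intro D.finsum_insert[symmetric]) auto
    finally show ?case .
  qed (simp add: matrix_unit_zero[of i k n N])
qed

end

section \<open>Norms of rows and columns\<close>

context cstar
begin

text \<open>The adjoint of a column times the column is a single matrix unit at position
  \<open>(0, 0)\<close>, whose norm is that of its entry. The injection \<open>f\<close> places the
  index set among the rows.\<close>

lemma nrm_matrix_column:
  assumes S: "finite S" "inj_on f S" "\<And>b. b \<in> S \<Longrightarrow> f b < n" "0 < n" and c: "\<And>b. b \<in> S \<Longrightarrow> c b \<in> carrier A"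
  shows "(matrix_norm A n (finsum (matrix_algebra A n (matrix_norm A n)) (\<lambda>b. matrix_unit (f b) 0 (c b)) S))\<^sup>2
    = nrm A (\<Oplus>b\<in>S. star A (c b) \<otimes> c b)"
proof -
  let ?D = "matrix_algebra A n (matrix_norm A n)"
  interpret D: cstar ?D by (rule cstar_matrix_algebra)
  let ?V = "finsum ?D (\<lambda>b. matrix_unit (f b) 0 (c b)) S"
  have V: "?V \<in> carrier ?D" using assms by (intro D.finsum_closed) auto
  have sum: "(\<Oplus>b\<in>S. star A (c b) \<otimes> c b) \<in> carrier A" using c by (intro finsum_closed) auto
  have "star ?D ?V \<otimes>\<^sub>?D ?V
      = finsum ?D (\<lambda>b. star ?D (matrix_unit (f b) 0 (c b)) \<otimes>\<^sub>?D matrix_unit (f b) 0 (c b)) S"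
    using assms by (intro D.star_mult_finsum_orthogonal)
      (auto simp: star_matrix_unit matrix_unit_mult dest: inj_onD)
  also have "\<dots> = finsum ?D (\<lambda>b. matrix_unit 0 0 (star A (c b) \<otimes> c b)) S"
    using assms by (intro D.finsum_cong') (auto simp: star_matrix_unit matrix_unit_mult)
  also have "\<dots> = matrix_unit 0 0 (\<Oplus>b\<in>S. star A (c b) \<otimes> c b)"
    using assms by (intro matrix_unit_finsum[symmetric]) auto
  finally have eq: "star ?D ?V \<otimes>\<^sub>?D ?V = matrix_unit 0 0 (\<Oplus>b\<in>S. star A (c b) \<otimes> c b)" .
  have "(nrm ?D ?V)\<^sup>2 = nrm ?D (matrix_unit 0 0 (\<Oplus>b\<in>S. star A (c b) \<otimes> c b))"
    using D.nrm_cstar[OF V] unfolding eq by simp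
  then show ?thesis using sum S(4) by (simp add: matrix_algebra_simps matrix_norm_unit)
qed

lemma nrm_matrix_row:
  assumes S: "finite S" "inj_on f S" "\<And>b. b \<in> S \<Longrightarrow> f b < n" "0 < n" and c: "\<And>b. b \<in> S \<Longrightarrow> c b \<in> carrier A"
  shows "(matrix_norm A n (finsum (matrix_algebra A n (matrix_norm A n)) (\<lambda>b. matrix_unit 0 (f b) (c b)) S))\<^sup>2
    = nrm A (\<Oplus>b\<in>S. c b \<otimes> star A (c b))"
proof -
  let ?D = "matrix_algebra A n (matrix_norm A n)"
  interpret D: cstar ?D by (rule cstar_matrix_algebra)
  let ?R = "finsum ?D (\<lambda>b. matrix_unit 0 (f b) (c b)) S"
  have R: "?R \<in> carrier ?D" using assms by (intro D.finsum_closed) auto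
  have "star ?D ?R = finsum ?D (\<lambda>b. matrix_unit (f b) 0 (star A (c b))) S"
    using D.star_finsum[OF S(1), of "\<lambda>b. matrix_unit 0 (f b) (c b)"] assms by (auto simp: star_matrix_unit)
  then have "(nrm ?D (star ?D ?R))\<^sup>2 = nrm A (\<Oplus>b\<in>S. star A (star A (c b)) \<otimes> star A (c b))"
    using nrm_matrix_column[OF S, of "\<lambda>b. star A (c b)"] c by (simp only: matrix_algebra_simps(8) star_cl)
  also have "(\<Oplus>b\<in>S. star A (star A (c b)) \<otimes> star A (c b)) = (\<Oplus>b\<in>S. c b \<otimes> star A (c b))"
    using c by (intro finsum_cong') auto
  finally show ?thesis unfolding D.nrm_star[OF R] by (simp only: matrix_algebra_simps(8))
qed

end

section \<open>Entrywise maps on matrices\<close>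

lemma matrix_map_unit:
  assumes "star_alg C" "star_alg B" "j \<zero>\<^sub>C = \<zero>\<^sub>B" "i < n" "k < n"
  shows "matrix_map B n j (star_alg.matrix_unit C i k a) = star_alg.matrix_unit B i k (j a)"
  using assms by (auto simp: matrix_map_def star_alg.matrix_unit_def fun_eq_iff)

lemma matrix_map_add_scal:
  assumes "L \<in> matrices_over C n A" "M \<in> matrices_over C n A" "star_alg B"
    "\<And>x y. x \<in> A \<Longrightarrow> y \<in> A \<Longrightarrow> j (x \<oplus>\<^sub>C y) = j x \<oplus>\<^sub>B j y"
    "\<And>c x. x \<in> A \<Longrightarrow> j (c \<odot>\<^sub>C x) = c \<odot>\<^sub>B j x"
  shows "matrix_map B n j (L \<oplus>\<^bsub>matrix_algebra C n N\<^esub> M) = matrix_map B n j L \<oplus>\<^bsub>matrix_algebra B n N'\<^esub> matrix_map B n j M"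
    and "matrix_map B n j (c \<odot>\<^bsub>matrix_algebra C n N\<^esub> M) = c \<odot>\<^bsub>matrix_algebra B n N'\<^esub> matrix_map B n j M"
proof -
  interpret B: star_alg B by fact
  show "matrix_map B n j (L \<oplus>\<^bsub>matrix_algebra C n N\<^esub> M) = matrix_map B n j L \<oplus>\<^bsub>matrix_algebra B n N'\<^esub> matrix_map B n j M"
    "matrix_map B n j (c \<odot>\<^bsub>matrix_algebra C n N\<^esub> M) = c \<odot>\<^bsub>matrix_algebra B n N'\<^esub> matrix_map B n j M"
    using matrices_overD(1)[OF assms(1)] matrices_overD(1)[OF assms(2)]
    by (auto simp: matrix_map_def matrix_algebra_simps fun_eq_iff assms(4,5))
qed

text \<open>Additivity of \<open>j\<close> is available only on \<open>A\<close>; therefore the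
  induction also carries that the partial sums stay in the matrices over \<open>A\<close>.\<close>

lemma matrix_map_finsum:
  assumes "star_alg C" "star_alg B" "A \<subseteq> carrier C" "\<zero>\<^sub>C \<in> A"
    "\<And>x y. x \<in> A \<Longrightarrow> y \<in> A \<Longrightarrow> x \<oplus>\<^sub>C y \<in> A" "j \<zero>\<^sub>C = \<zero>\<^sub>B" "\<And>x. x \<in> A \<Longrightarrow> j x \<in> carrier B"
    "\<And>x y. x \<in> A \<Longrightarrow> y \<in> A \<Longrightarrow> j (x \<oplus>\<^sub>C y) = j x \<oplus>\<^sub>B j y"
    "\<And>c x. x \<in> A \<Longrightarrow> j (c \<odot>\<^sub>C x) = c \<odot>\<^sub>B j x"
    "finite F" "\<And>i. i \<in> F \<Longrightarrow> f i \<in> matrices_over C n A"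
  shows "finsum (matrix_algebra C n N) f F \<in> matrices_over C n A \<and>
    matrix_map B n j (finsum (matrix_algebra C n N) f F) = finsum (matrix_algebra B n N') (\<lambda>i. matrix_map B n j (f i)) F"
proof -
  interpret C: star_alg C by fact
  interpret B: star_alg B by fact
  interpret DC: star_alg "matrix_algebra C n N" by (rule C.matrix_star_alg)
  interpret DB: star_alg "matrix_algebra B n N'" by (rule B.matrix_star_alg)
  have sub: "M \<in> carrier (matrix_algebra C n N)" if "M \<in> matrices_over C n A" for M
    using that assms(3) by (auto simp: matrix_algebra_simps matrices_over_def)
  have map: "matrix_map B n j M \<in> carrier (matrix_algebra B n N')" if "M \<in> matrices_over C n A" for M
    using matrices_overD(1)[OF that] assms(7)
    by (auto simp: matrix_algebra_simps matrix_map_def intro!: matrices_overI)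
  from assms(10,11) show ?thesis
  proof (induction F rule: finite_induct)
    case empty
    have "matrix_map B n j \<zero>\<^bsub>matrix_algebra C n N\<^esub> = \<zero>\<^bsub>matrix_algebra B n N'\<^esub>"
      using assms(6) by (auto simp: matrix_map_def matrix_algebra_simps fun_eq_iff)
    then show ?case using assms(4) by (auto simp: matrix_algebra_simps(4) matrices_over_def)
  next
    case (insert x F)
    let ?S = "finsum (matrix_algebra C n N) f F"
    have fx: "f x \<in> matrices_over C n A" and f: "\<And>i. i \<in> F \<Longrightarrow> f i \<in> matrices_over C n A" using insert.prems by auto
    have IH: "?S \<in> matrices_over C n A"
      "matrix_map B n j ?S = finsum (matrix_algebra B n N') (\<lambda>i. matrix_map B n j (f i)) F" using insert.IH[OF f] by auto
    have eq: "finsum (matrix_algebra C n N) f (insert x F) = f x \<oplus>\<^bsub>matrix_algebra C n N\<^esub> ?S"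
      using insert.hyps fx f by (intro DC.finsum_insert) (auto intro: sub)
    have "f x \<oplus>\<^bsub>matrix_algebra C n N\<^esub> ?S \<in> matrices_over C n A"
      using fx IH(1) assms(5) C.l_zero by (auto simp: matrices_over_def matrix_algebra_simps)
    moreover have "finsum (matrix_algebra B n N') (\<lambda>i. matrix_map B n j (f i)) (insert x F)
        = matrix_map B n j (f x) \<oplus>\<^bsub>matrix_algebra B n N'\<^esub> matrix_map B n j ?S"
      unfolding IH(2) using insert.hyps fx f by (intro DB.finsum_insert) (auto intro: map)
    ultimately show ?case
      unfolding eq using matrix_map_add_scal(1)[OF fx IH(1) assms(2,8,9), of N N'] by simp
  qed
qed

section \<open>Hyperrigidity\<close>

context cstar
begin

definition nrm_closure :: "'a set \<Rightarrow> 'a set" where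
  "nrm_closure S = {x \<in> carrier A. \<exists>f. (\<forall>n. f n \<in> S) \<and> cvg f x}"

lemma nrm_closureI:
  assumes "x \<in> carrier A" "S \<subseteq> carrier A" "\<And>e. 0 < e \<Longrightarrow> \<exists>s\<in>S. nrm A (s \<ominus> x) < e"
  shows "x \<in> nrm_closure S"
proof -
  have "\<exists>s\<in>S. nrm A (s \<ominus> x) < 1 / real (Suc n)" for n by (rule assms(3)) simp
  then obtain f where f: "\<And>n. f n \<in> S" "\<And>n. nrm A (f n \<ominus> x) < 1 / real (Suc n)" by metis
  have "cvg f x"
    by (rule cvg_le[OF LIMSEQ_Suc[OF lim_1_over_n]]) (use f assms in \<open>auto intro: less_imp_le\<close>)
  then show ?thesis using f assms by (auto simp: nrm_closure_def)
qed

lemma nrm_closureD: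
  assumes "x \<in> nrm_closure S" "S \<subseteq> carrier A" "0 < e"
  obtains s where "s \<in> S" "nrm A (s \<ominus> x) < e"
proof -
  obtain f where f: "\<And>n. f n \<in> S" "cvg f x" and x: "x \<in> carrier A" using assms by (auto simp: nrm_closure_def)
  then obtain n where "norm (nrm A (f n \<ominus> x) - 0) < e"
    using LIMSEQ_D[OF f(2)[unfolded cvg_def] assms(3)] by (metis order_refl)
  then have "nrm A (f n \<ominus> x) < e" by simp
  then show ?thesis using that f(1) by blast
qed

lemma subset_nrm_closure: "S \<subseteq> carrier A \<Longrightarrow> S \<subseteq> nrm_closure S"
  by (auto simp: nrm_closure_def intro!: exI[of _ "\<lambda>_. _"] cvg_const)

lemma closed_subalgebra_nrm_closure:
  assumes S: "S \<subseteq> carrier A" "\<zero> \<in> S"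
    and add: "\<And>x y. x \<in> S \<Longrightarrow> y \<in> S \<Longrightarrow> x \<oplus> y \<in> S"
    and mult: "\<And>x y. x \<in> S \<Longrightarrow> y \<in> S \<Longrightarrow> x \<otimes> y \<in> S"
    and scal: "\<And>c x. x \<in> S \<Longrightarrow> c \<odot> x \<in> S"
  shows "closed_subalgebra A (nrm_closure S)"
  unfolding closed_subalgebra_def nrm_closed_def
proof (intro conjI ballI allI impI)
  have inA: "x \<in> carrier A" if "x \<in> S" for x using S that by auto
  show "nrm_closure S \<subseteq> carrier A" by (auto simp: nrm_closure_def)
  show "\<zero> \<in> nrm_closure S" using S subset_nrm_closure by blast
  fix x assume "x \<in> nrm_closure S"
  then obtain f where f: "\<And>n. f n \<in> S" "cvg f x" and x: "x \<in> carrier A" by (auto simp: nrm_closure_def)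
  show "c \<odot> x \<in> nrm_closure S" for c
    using f x inA scal cvg_scal[of f x c] by (auto simp: nrm_closure_def intro!: exI[of _ "\<lambda>n. c \<odot> f n"])
  fix y assume "y \<in> nrm_closure S"
  then obtain g where g: "\<And>n. g n \<in> S" "cvg g y" and y: "y \<in> carrier A" by (auto simp: nrm_closure_def)
  show "x \<oplus> y \<in> nrm_closure S"
    using f g x y inA add cvg_add[of f g x y] by (auto simp: nrm_closure_def intro!: exI[of _ "\<lambda>n. f n \<oplus> g n"])
  show "x \<otimes> y \<in> nrm_closure S"
    using f g x y inA mult cvg_mult[of f g x y] by (auto simp: nrm_closure_def intro!: exI[of _ "\<lambda>n. f n \<otimes> g n"])
next
  fix f x assume *: "(\<forall>n::nat. f n \<in> nrm_closure S) \<and> x \<in> carrier A \<and> (\<lambda>n. nrm A (f n \<ominus> x)) \<longlonglongrightarrow> 0"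
  then have x: "x \<in> carrier A" by blast
  show "x \<in> nrm_closure S"
  proof (rule nrm_closureI[OF x S(1)])
    fix e :: real assume "0 < e"
    then obtain n where n: "norm (nrm A (f n \<ominus> x) - 0) < e/2"
      using LIMSEQ_D[of "\<lambda>n. nrm A (f n \<ominus> x)" 0 "e/2"] * by (metis half_gt_zero order_refl)
    have fn: "f n \<in> nrm_closure S" using * by blast
    then have fc: "f n \<in> carrier A" by (simp add: nrm_closure_def)
    obtain s where s: "s \<in> S" "nrm A (s \<ominus> f n) < e/2"
      using nrm_closureD[OF fn S(1), of "e/2"] \<open>0 < e\<close> by auto
    have "nrm A (s \<ominus> x) < e"
      using nrm_minus_trans[of s "f n" x] s n fc x S(1) by auto
    then show "\<exists>s\<in>S. nrm A (s \<ominus> x) < e" using s by blast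
  qed
qed

lemma cstar_subalgebra_nrm_closure:
  assumes S: "S \<subseteq> carrier A" "\<zero> \<in> S"
    and "\<And>x y. x \<in> S \<Longrightarrow> y \<in> S \<Longrightarrow> x \<oplus> y \<in> S"
    and "\<And>x y. x \<in> S \<Longrightarrow> y \<in> S \<Longrightarrow> x \<otimes> y \<in> S"
    and "\<And>c x. x \<in> S \<Longrightarrow> c \<odot> x \<in> S"
    and star: "\<And>x. x \<in> S \<Longrightarrow> star A x \<in> S"
  shows "cstar_subalgebra A (nrm_closure S)"
proof -
  have "star A x \<in> nrm_closure S" if x: "x \<in> nrm_closure S" for x
  proof -
    obtain f where f: "\<And>n. f n \<in> S" "cvg f x" and x: "x \<in> carrier A" using x by (auto simp: nrm_closure_def)
    have "cvg (\<lambda>n. star A (f n)) (star A x)" using f x S by (intro cvg_star) auto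
    then show ?thesis using f x star by (auto simp: nrm_closure_def intro!: exI[of _ "\<lambda>n. star A (f n)"])
  qed
  then show ?thesis using closed_subalgebra_nrm_closure[OF assms(1-5)] by (simp add: cstar_subalgebra_def)
qed

end

text \<open>Complete contractivity is applied to the row with entries \<open>f b\<close>; the two
  sides are the squares of the norms of this row and of its image.\<close>

lemma completely_contractive_row:
  fixes C :: "('c, 'm) cstar_alg_scheme" and B :: "('b, 'n) cstar_alg_scheme"
  assumes "cstar C" "cstar B" and cc: "completely_contractive C A B j"
    and A: "A \<subseteq> carrier C" "\<zero>\<^sub>C \<in> A" "\<And>x y. x \<in> A \<Longrightarrow> y \<in> A \<Longrightarrow> x \<oplus>\<^sub>C y \<in> A"
    and j: "j \<zero>\<^sub>C = \<zero>\<^sub>B" "\<And>x. x \<in> A \<Longrightarrow> j x \<in> carrier B"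
      "\<And>x y. x \<in> A \<Longrightarrow> y \<in> A \<Longrightarrow> j (x \<oplus>\<^sub>C y) = j x \<oplus>\<^sub>B j y"
      "\<And>c x. x \<in> A \<Longrightarrow> j (c \<odot>\<^sub>C x) = c \<odot>\<^sub>B j x"
    and F: "finite F" "\<And>b. b \<in> F \<Longrightarrow> f b \<in> A"
  shows "nrm B (\<Oplus>\<^bsub>B\<^esub>b\<in>F. j (f b) \<otimes>\<^sub>B star B (j (f b))) \<le> nrm C (\<Oplus>\<^bsub>C\<^esub>b\<in>F. f b \<otimes>\<^sub>C star C (f b))"
proof -
  interpret C: cstar C by fact
  interpret B: cstar B by fact
  obtain e m where e: "e ` F = {i::nat. i < m}" "inj_on e F" using finite_imp_inj_to_nat_seg[OF F(1)] by blast
  \<comment> \<open>One more than the number of entries, so that index 0 exists even if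
    \<open>F\<close> is empty.\<close>
  define n where "n = Suc m"
  have n: "e b < n" if "b \<in> F" for b using e(1) that by (auto simp: n_def less_Suc_eq)
  have n0: "0 < n" by (simp add: n_def)
  let ?C = "matrix_algebra C n (matrix_norm C n)" and ?B = "matrix_algebra B n (matrix_norm B n)"
  interpret DB: cstar ?B by (rule B.cstar_matrix_algebra)
  let ?R = "finsum ?C (\<lambda>b. C.matrix_unit 0 (e b) (f b)) F"
  let ?S = "finsum ?B (\<lambda>b. B.matrix_unit 0 (e b) (j (f b))) F"
  have R: "?R \<in> matrices_over C n A \<and> matrix_map B n j ?R = finsum ?B (\<lambda>b. matrix_map B n j (C.matrix_unit 0 (e b) (f b))) F"
    by (rule matrix_map_finsum[OF C.star_alg_axioms B.star_alg_axioms A j F(1)])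
      (use F n n0 A(2) in \<open>auto simp: C.matrix_unit_def intro!: matrices_overI\<close>)
  have S: "finsum ?B (\<lambda>b. matrix_map B n j (C.matrix_unit 0 (e b) (f b))) F = ?S"
    using F n n0 j(2) by (intro DB.finsum_cong')
      (auto simp: matrix_map_unit[where j = j, OF C.star_alg_axioms B.star_alg_axioms j(1)])
  have "matrix_norm B n (matrix_map B n j ?R) \<le> matrix_norm C n ?R"
    using cc R unfolding completely_contractive_def by blast
  then have "matrix_norm B n ?S \<le> matrix_norm C n ?R" unfolding conjunct2[OF R] S .
  moreover have "?S \<in> carrier ?B" using F n n0 j(2) by (intro DB.finsum_closed) auto
  then have "0 \<le> matrix_norm B n ?S" using DB.nrm_ge0[of ?S] by (simp add: matrix_algebra_simps(8))
  ultimately have "(matrix_norm B n ?S)\<^sup>2 \<le> (matrix_norm C n ?R)\<^sup>2" by (rule power_mono)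
  moreover have "(matrix_norm B n ?S)\<^sup>2 = nrm B (\<Oplus>\<^bsub>B\<^esub>b\<in>F. j (f b) \<otimes>\<^sub>B star B (j (f b)))"
    using F e(2) n n0 j(2) by (intro B.nrm_matrix_row) auto
  moreover have "(matrix_norm C n ?R)\<^sup>2 = nrm C (\<Oplus>\<^bsub>C\<^esub>b\<in>F. f b \<otimes>\<^sub>C star C (f b))"
    using F e(2) n n0 A(1) by (intro C.nrm_matrix_row) auto
  ultimately show ?thesis by simp
qed

lemma completely_contractive_nrm:
  assumes "cstar C" "cstar B" "completely_contractive C A B j" "A \<subseteq> carrier C" "\<zero>\<^sub>C \<in> A"
    "\<And>x. x \<in> A \<Longrightarrow> j x \<in> carrier B" "j \<zero>\<^sub>C = \<zero>\<^sub>B" "a \<in> A"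
  shows "nrm B (j a) \<le> nrm C a"
proof -
  interpret C: cstar C by fact
  interpret B: cstar B by fact
  have "C.matrix_unit 0 0 a \<in> matrices_over C 1 A"
    using assms by (simp add: C.matrix_unit_def matrices_over_def)
  then have "matrix_norm B 1 (matrix_map B 1 j (C.matrix_unit 0 0 a)) \<le> matrix_norm C 1 (C.matrix_unit 0 0 a)"
    using assms(3) by (simp add: completely_contractive_def)
  moreover have "matrix_map B 1 j (C.matrix_unit 0 0 a) = B.matrix_unit 0 0 (j a)"
    using assms(7) by (intro matrix_map_unit C.star_alg_axioms B.star_alg_axioms) auto
  moreover have "a \<in> carrier C" "j a \<in> carrier B" using assms by auto
  ultimately show ?thesis by (simp add: C.matrix_norm_unit B.matrix_norm_unit)
qed

text \<open>The abstract situation of both main results, with \<open>C\<close> in the role of the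
  quotient by the compact operators. Of \<open>A\<close> only the inclusion in the closed algebra
  generated by the \<open>t i\<close> is demanded, since the image of a closed algebra under a
  quotient map is merely known to be a subalgebra.\<close>

locale word_relations = cstar C for C :: "('c, 'm) cstar_alg_scheme" (structure) +
  fixes t :: "'d::finite \<Rightarrow> 'c" and k :: nat and A :: "'c set"
  assumes t_closed [simp]: "t i \<in> carrier C"
    and sum_ranges: "(\<Oplus>i\<in>UNIV. t i \<otimes> star C (t i)) = \<one>"
    and orthogonal_ranges: "i \<noteq> j \<Longrightarrow> star C (t i) \<otimes> t j = \<zero>"
    and word_relation: "length w = k \<Longrightarrow>
      t i \<otimes> word_prod C t w = \<zero> \<or> star C (t i) \<otimes> (t i \<otimes> word_prod C t w) = word_prod C t w"
    and A_carrier: "A \<subseteq> carrier C"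
    and A_one: "\<one> \<in> A" and A_t: "t i \<in> A"
    and A_add: "x \<in> A \<Longrightarrow> y \<in> A \<Longrightarrow> x \<oplus> y \<in> A"
    and A_mult: "x \<in> A \<Longrightarrow> y \<in> A \<Longrightarrow> x \<otimes> y \<in> A"
    and A_scal: "x \<in> A \<Longrightarrow> c \<odot> x \<in> A"
    and A_generated: "A \<subseteq> generated_algebra C (insert \<one> (range t))"
    and C_generated: "generated_cstar C A = carrier C"
begin

abbreviation W :: "'d list \<Rightarrow> 'c" where "W \<equiv> word_prod C t"

lemma A_closed [simp]: "x \<in> A \<Longrightarrow> x \<in> carrier C"
  using A_carrier by auto

lemma A_zero: "\<zero> \<in> A"
  using A_scal[OF A_one, of 0] by simp

lemma W_in_A: "W w \<in> A"
  by (induction w) (auto simp: A_one A_mult A_t)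

lemma W_closed [simp]: "W w \<in> carrier C"
  using W_in_A by simp

lemma W_append: "W (u @ v) = W u \<otimes> W v"
  by (induction u) (simp_all add: m_assoc)

lemma word_relation_ge:
  assumes "k \<le> length w"
  shows "t i \<otimes> W w = \<zero> \<or> star C (t i) \<otimes> (t i \<otimes> W w) = W w"
proof -
  have w: "W w = W (take k w) \<otimes> W (drop k w)" by (simp flip: W_append)
  from word_relation[of "take k w" i] assms
  have "t i \<otimes> W (take k w) = \<zero> \<or> star C (t i) \<otimes> (t i \<otimes> W (take k w)) = W (take k w)" by simp
  then show ?thesis
  proof
    assume "t i \<otimes> W (take k w) = \<zero>"
    then have "(t i \<otimes> W (take k w)) \<otimes> W (drop k w) = \<zero>" by simp
    then show ?thesis unfolding w by (simp add: m_assoc)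
  next
    assume "star C (t i) \<otimes> (t i \<otimes> W (take k w)) = W (take k w)"
    then have "(star C (t i) \<otimes> (t i \<otimes> W (take k w))) \<otimes> W (drop k w) = W w" by (simp add: w)
    then show ?thesis unfolding w by (simp add: m_assoc)
  qed
qed

text \<open>Each letter of \<open>u\<close> acts on a word that still ends in \<open>v\<close> and
  so has length at least \<open>k\<close>; hence every letter is isometric on the range in question
  or kills it.\<close>

lemma W_isometric:
  assumes "k \<le> length v"
  shows "W u \<otimes> W v = \<zero> \<or> star C (W u) \<otimes> (W u \<otimes> W v) = W v"
proof (induction u)
  case (Cons i u)
  show ?case
  proof (cases "t i \<otimes> W (u @ v) = \<zero>")
    case True
    then show ?thesis by (simp add: W_append m_assoc)
  next
    case False
    then have 1: "star C (t i) \<otimes> (t i \<otimes> (W u \<otimes> W v)) = W u \<otimes> W v"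
      using word_relation_ge[of "u @ v" i] assms by (simp add: W_append)
    have "W u \<otimes> W v \<noteq> \<zero>" using False by (auto simp: W_append)
    then have 2: "star C (W u) \<otimes> (W u \<otimes> W v) = W v" using Cons by blast
    have "star C (W (i # u)) \<otimes> (W (i # u) \<otimes> W v) = star C (W u) \<otimes> (star C (t i) \<otimes> (t i \<otimes> (W u \<otimes> W v)))"
      by (simp add: m_assoc)
    then show ?thesis unfolding 1 2 by blast
  qed
qed simp

lemma nrm_le_1_if_sum:
  assumes "finite F" "i \<in> F" "\<And>j. j \<in> F \<Longrightarrow> f j \<in> carrier C" "(\<Oplus>j\<in>F. f j \<otimes> star C (f j)) = \<one>"
  shows "nrm C (f i) \<le> 1"
proof -
  have "F = insert i (F - {i})" using assms by auto
  then have "(\<Oplus>j\<in>F. f j \<otimes> star C (f j)) = (\<Oplus>j\<in>insert i (F - {i}). f j \<otimes> star C (f j))" by simp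
  also have "\<dots> = f i \<otimes> star C (f i) \<oplus> (\<Oplus>j\<in>F - {i}. f j \<otimes> star C (f j))"
    using assms by (intro finsum_insert) auto
  finally have eq: "\<one> = f i \<otimes> star C (f i) \<oplus> (\<Oplus>j\<in>F - {i}. f j \<otimes> star C (f j))" using assms by simp
  have P: "Pos (\<Oplus>j\<in>F - {i}. f j \<otimes> star C (f j))"
    using assms by (intro Pos_finsum Pos_mult_star) auto
  have "a \<oplus> b \<ominus> a = b" if "a \<in> carrier C" "b \<in> carrier C" for a b using that by algebra
  then have "\<one> \<ominus> f i \<otimes> star C (f i) = (\<Oplus>j\<in>F - {i}. f j \<otimes> star C (f j))"
    unfolding eq using assms Pos_closed[OF P] by simp
  then have "Pos (of_real (1\<^sup>2) \<odot> \<one> \<ominus> star C (star C (f i)) \<otimes> star C (f i))"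
    using P assms by simp
  then have "nrm C (star C (f i)) \<le> 1" using assms by (intro nrm_le_if_Pos) auto
  then show ?thesis using assms by simp
qed

lemma nrm_t: "nrm C (t i) \<le> 1"
  using nrm_le_1_if_sum[of UNIV i t] sum_ranges by simp

lemma nrm_W: "nrm C (W w) \<le> 1"
proof (induction w)
  case (Cons i w)
  have "nrm C (W (i # w)) \<le> nrm C (t i) * nrm C (W w)" by (simp add: nrm_times)
  also have "\<dots> \<le> 1 * 1" using Cons nrm_t by (intro mult_mono) auto
  finally show ?case by simp
qed (simp add: nrm_one_le)

end

section \<open>Dilations of representations on Hilbert space\<close>

lemma norm_sq_projection:
  fixes u v :: "'h::complex_hilbert"
  assumes "cinner (v - u) u = 0"
  shows "(norm v)\<^sup>2 = (norm u)\<^sup>2 + (norm (v - u))\<^sup>2"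
proof -
  have 0: "cinner u (v - u) = 0" using assms(1) cinner_0_commute by blast
  have "cinner v v = cinner (u + (v - u)) (u + (v - u))" by simp
  also have "\<dots> = cinner u u + cinner (v - u) (v - u)"
    by (simp only: cinner_add_left cinner_add_right 0 assms(1) add_0_left add_0_right)
  finally have "complex_of_real ((norm v)\<^sup>2) = complex_of_real ((norm u)\<^sup>2 + (norm (v - u))\<^sup>2)"
    by (simp add: cinner_self)
  then show ?thesis by (simp only: of_real_eq_iff)
qed

text \<open>Used with \<open>u\<close> the component of \<open>v\<close> in the smaller space of a
  dilation: the norm of \<open>u\<close> leaves no room for another component. This is how a
  contraction is seen not to dilate an isometry nontrivially.\<close>

lemma eq_if_projection_norm_le:
  fixes u v :: "'h::complex_hilbert"
  assumes "cinner (v - u) u = 0" "norm v \<le> norm u"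
  shows "v = u"
proof -
  have "(norm v)\<^sup>2 \<le> (norm u)\<^sup>2" using assms(2) by (intro power_mono) auto
  then show ?thesis using norm_sq_projection[OF assms(1)] by simp
qed

lemma finsum_bounded_operators:
  assumes "closed_csubspace H" "finite F" "\<And>i. i \<in> F \<Longrightarrow> f i \<in> operators_on H"
  shows "finsum (bounded_operators H) f F = sum f F"
proof -
  interpret B: cstar "bounded_operators H" by (rule cstar_bounded_operators[OF assms(1)])
  from assms(2,3) show ?thesis
  proof (induction F rule: finite_induct)
    case (insert x F)
    then have "finsum (bounded_operators H) f (insert x F) = f x \<oplus>\<^bsub>bounded_operators H\<^esub> finsum (bounded_operators H) f F"
      by (intro B.finsum_insert) auto
    then show ?case using insert by simp
  qed (use B.finsum_empty in simp)
qed

lemma sum_norm_adj_sq: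
  fixes f :: "'i \<Rightarrow> 'h::complex_hilbert \<Rightarrow>\<^sub>L 'h"
  assumes "\<And>i. i \<in> F \<Longrightarrow> clin (f i)"
  shows "complex_of_real (\<Sum>i\<in>F. (norm (adj (f i) \<cdot> x))\<^sup>2)
    = cinner ((\<Sum>i\<in>F. f i o\<^sub>L adj (f i)) \<cdot> x) x"
  unfolding blinfun.sum_left cinner_sum_left of_real_sum
proof (rule sum.cong[OF refl])
  fix i assume "i \<in> F"
  then have "clin (f i)" by (rule assms)
  then show "complex_of_real ((norm (adj (f i) \<cdot> x))\<^sup>2) = cinner ((f i o\<^sub>L adj (f i)) \<cdot> x) x"
    by (simp add: cinner_adj cinner_self[symmetric] del: of_real_power)
qed

context word_relations
begin

lemma maximal_star_hom:
  fixes H :: "'h::complex_hilbert set"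
  assumes H: "closed_csubspace H" and \<pi>: "star_hom C (bounded_operators H) \<pi>" and one: "\<pi> \<one> = proj H"
  shows "maximal_representation C A H \<pi>"
  unfolding maximal_representation_def
proof (intro conjI allI impI)
  interpret BH: cstar "bounded_operators H" by (rule cstar_bounded_operators[OF H])
  note \<pi>D = star_homD[OF \<pi>, simplified]
  show rep: "representation C A H \<pi>"
    unfolding representation_def
    using star_hom_completely_contractive[OF cstar_axioms BH.cstar_axioms \<pi> A_carrier] \<pi>
    by (auto simp: star_hom_def algebra_hom_def)
  fix K \<rho> assume dil: "dilation C A H \<pi> K \<rho>"
  have K: "closed_csubspace K" and HK: "H \<subseteq> K" using dil by (auto simp: dilation_def)
  interpret BK: cstar "bounded_operators K" by (rule cstar_bounded_operators[OF K])
  have \<rho>hom: "algebra_hom C A (bounded_operators K) \<rho>"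
    and \<rho>cc: "completely_contractive C A (bounded_operators K) \<rho>"
    and compr: "\<And>a h. a \<in> A \<Longrightarrow> h \<in> H \<Longrightarrow> proj H \<cdot> \<rho> a \<cdot> h = \<pi> a \<cdot> h"
    using dil by (auto simp: dilation_def representation_def)
  have \<rho>op: "\<rho> a \<in> operators_on K" if "a \<in> A" for a using \<rho>hom that by (auto simp: algebra_hom_def)
  have \<rho>add: "\<rho> (a \<oplus> b) = \<rho> a + \<rho> b" and \<rho>mult: "\<rho> (a \<otimes> b) = \<rho> a o\<^sub>L \<rho> b" if "a \<in> A" "b \<in> A" for a b
    using \<rho>hom that by (auto simp: algebra_hom_def)
  have \<rho>scal: "\<rho> (c \<odot> a) = cscale c (\<rho> a)" if "a \<in> A" for a c
    using \<rho>hom that by (auto simp: algebra_hom_def)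
  have \<rho>zero: "\<rho> \<zero> = 0"
  proof -
    have "cscale 0 (\<rho> \<zero>) = 0" by (rule blinfun_eqI) simp
    then show ?thesis using \<rho>scal[OF A_zero, of 0] by simp
  qed
  have \<rho>clin: "clin (\<rho> a)" if "a \<in> A" for a using \<rho>op[OF that] operators_onD by blast
  have \<rho>norm: "norm (\<rho> a) \<le> nrm C a" if "a \<in> A" for a
    using completely_contractive_nrm[OF cstar_axioms BK.cstar_axioms \<rho>cc A_carrier A_zero] \<rho>op \<rho>zero that by simp
  have \<pi>op: "\<pi> a \<in> operators_on H" if "a \<in> carrier C" for a using \<pi>D(1) that by simp
  have \<pi>clin: "clin (\<pi> a)" if "a \<in> carrier C" for a using \<pi>op[OF that] operators_onD by blast
  have \<pi>H: "\<pi> a \<cdot> x \<in> H" if "a \<in> carrier C" for a x using \<pi>op[OF that] operators_onD by blast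
  have csH: "csubspace H" using H by (simp add: closed_csubspace_def)
  have orth: "cinner (\<rho> a \<cdot> h - \<pi> a \<cdot> h) h' = 0"
    if "a \<in> A" "h \<in> H" "h' \<in> H" for a h h'
    using proj_props(3)[OF H that(3), of "\<rho> a \<cdot> h"] compr[OF that(1,2)] by simp
  have orth_adj: "cinner (adj (\<rho> a) \<cdot> h - adj (\<pi> a) \<cdot> h) h' = 0"
    if "a \<in> A" "h \<in> H" "h' \<in> H" for a h h'
  proof -
    have "cinner (\<rho> a \<cdot> h' - \<pi> a \<cdot> h') h = 0" using orth that by blast
    then have "cinner h (\<rho> a \<cdot> h') = cinner h (\<pi> a \<cdot> h')"
      by (metis cinner_commute cinner_diff_left eq_iff_diff_eq_0)
    then show ?thesis
      using that by (simp add: cinner_diff_left cinner_adj' \<rho>clin \<pi>clin)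
  qed
  have adj\<pi>H: "adj (\<pi> a) \<cdot> h \<in> H" if "a \<in> carrier C" for a h
    using operators_on_closed(6)[OF H \<pi>op[OF that]] operators_onD(2) by blast
  have one_h: "\<pi> \<one> \<cdot> h = h" "adj (\<pi> \<one>) \<cdot> h = h" if "h \<in> H" for h
    using proj_props(2)[OF H that] \<pi>D(5)[of \<one>] by (simp_all add: one)
  have isometric: "\<rho> a \<cdot> h = \<pi> a \<cdot> h"
    if "a \<in> A" "h \<in> H" "nrm C a \<le> 1" "norm (\<pi> a \<cdot> h) = norm h" for a h
  proof (rule eq_if_projection_norm_le)
    show "cinner (\<rho> a \<cdot> h - \<pi> a \<cdot> h) (\<pi> a \<cdot> h) = 0"
      using that \<pi>H by (intro orth) auto
    have "norm (\<rho> a \<cdot> h) \<le> norm (\<rho> a) * norm h" by (rule norm_blinfun)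
    also have "\<dots> \<le> 1 * norm h" using \<rho>norm[OF that(1)] that(3) by (intro mult_right_mono) auto
    finally show "norm (\<rho> a \<cdot> h) \<le> norm (\<pi> a \<cdot> h)" using that by simp
  qed
  \<comment> \<open>A dilation need not map the unit to the identity of \<open>K\<close>; that it
    fixes \<open>H\<close> has to be derived, and for its adjoint as well.\<close>
  have \<rho>one: "\<rho> \<one> \<cdot> h = h" if "h \<in> H" for h
    using isometric[OF A_one that nrm_one_le] one_h[OF that] by simp
  have \<rho>one_adj: "adj (\<rho> \<one>) \<cdot> h = h" if "h \<in> H" for h
  proof (rule eq_if_projection_norm_le)
    show "cinner (adj (\<rho> \<one>) \<cdot> h - h) h = 0"
      using orth_adj[OF A_one that that] one_h[OF that] by simp
    have "norm (adj (\<rho> \<one>) \<cdot> h) \<le> norm (adj (\<rho> \<one>)) * norm h" by (rule norm_blinfun)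
    also have "\<dots> \<le> 1 * norm h"
      using \<rho>norm[OF A_one] nrm_one_le norm_adj[OF \<rho>clin[OF A_one]] by (intro mult_right_mono) auto
    finally show "norm (adj (\<rho> \<one>) \<cdot> h) \<le> norm h" by simp
  qed
  have sum\<pi>: "(\<Sum>i\<in>UNIV. \<pi> (t i) o\<^sub>L adj (\<pi> (t i))) = proj H"
  proof -
    have "proj H = \<pi> (\<Oplus>i\<in>UNIV. t i \<otimes> star C (t i))" using sum_ranges one by simp
    also have "\<dots> = finsum (bounded_operators H) (\<lambda>i. \<pi> (t i \<otimes> star C (t i))) UNIV"
      by (intro star_hom_finsum[OF cstar_axioms BH.cstar_axioms \<pi>]) auto
    also have "\<dots> = (\<Sum>i\<in>UNIV. \<pi> (t i \<otimes> star C (t i)))"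
      using \<pi>op by (intro finsum_bounded_operators[OF H]) auto
    finally show ?thesis using \<pi>D(3,5) by simp
  qed
  have \<rho>t_adj: "adj (\<rho> (t i)) \<cdot> h = adj (\<pi> (t i)) \<cdot> h" if h: "h \<in> H" for i h
  proof -
    have "finsum (bounded_operators K) (\<lambda>i. \<rho> (t i) o\<^sub>L adj (\<rho> (t i))) UNIV = (\<Sum>i\<in>UNIV. \<rho> (t i) o\<^sub>L adj (\<rho> (t i)))"
      by (intro finsum_bounded_operators[OF K] operators_on_closed[OF K] \<rho>op A_t) auto
    then have "norm (\<Sum>i\<in>UNIV. \<rho> (t i) o\<^sub>L adj (\<rho> (t i))) \<le> 1"
      using completely_contractive_row[OF cstar_axioms BK.cstar_axioms \<rho>cc A_carrier A_zero A_add, of UNIV t]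
        \<rho>op \<rho>zero \<rho>add \<rho>scal A_t sum_ranges nrm_one_le by simp
    then have "norm ((\<Sum>i\<in>UNIV. \<rho> (t i) o\<^sub>L adj (\<rho> (t i))) \<cdot> h) \<le> 1 * norm h"
      by (intro order_trans[OF norm_blinfun] mult_right_mono) auto
    then have "norm ((\<Sum>i\<in>UNIV. \<rho> (t i) o\<^sub>L adj (\<rho> (t i))) \<cdot> h) * norm h \<le> norm h * norm h"
      by (intro mult_right_mono) auto
    then have "cmod (cinner ((\<Sum>i\<in>UNIV. \<rho> (t i) o\<^sub>L adj (\<rho> (t i))) \<cdot> h) h) \<le> (norm h)\<^sup>2"
      using cmod_cinner_le order_trans by (fastforce simp: power2_eq_square)
    moreover have "complex_of_real (\<Sum>i\<in>UNIV. (norm (adj (\<rho> (t i)) \<cdot> h))\<^sup>2)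
        = cinner ((\<Sum>i\<in>UNIV. \<rho> (t i) o\<^sub>L adj (\<rho> (t i))) \<cdot> h) h"
      using \<rho>clin A_t by (intro sum_norm_adj_sq) auto
    ultimately have "cmod (complex_of_real (\<Sum>i\<in>UNIV. (norm (adj (\<rho> (t i)) \<cdot> h))\<^sup>2)) \<le> (norm h)\<^sup>2" by simp
    then have le: "(\<Sum>i\<in>UNIV. (norm (adj (\<rho> (t i)) \<cdot> h))\<^sup>2) \<le> (norm h)\<^sup>2"
      unfolding norm_of_real by simp
    have "complex_of_real (\<Sum>i\<in>UNIV. (norm (adj (\<pi> (t i)) \<cdot> h))\<^sup>2)
        = cinner ((\<Sum>i\<in>UNIV. \<pi> (t i) o\<^sub>L adj (\<pi> (t i))) \<cdot> h) h"
      using \<pi>clin by (intro sum_norm_adj_sq) auto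
    also have "\<dots> = complex_of_real ((norm h)\<^sup>2)"
      unfolding sum\<pi> using proj_props(2)[OF H h] by (simp add: cinner_self)
    finally have eq: "(\<Sum>i\<in>UNIV. (norm (adj (\<pi> (t i)) \<cdot> h))\<^sup>2) = (norm h)\<^sup>2" by (simp only: of_real_eq_iff)
    \<comment> \<open>Summed over all letters, the \<open>\<pi>\<close>-parts already exhaust
      \<open>(norm h)\<^sup>2\<close>, so all orthogonal remainders vanish.\<close>
    have pyth: "(norm (adj (\<rho> (t i)) \<cdot> h))\<^sup>2 = (norm (adj (\<pi> (t i)) \<cdot> h))\<^sup>2
        + (norm (adj (\<rho> (t i)) \<cdot> h - adj (\<pi> (t i)) \<cdot> h))\<^sup>2" for i
      using h A_t adj\<pi>H by (intro norm_sq_projection orth_adj) auto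
    have "(\<Sum>i\<in>UNIV. (norm (adj (\<rho> (t i)) \<cdot> h - adj (\<pi> (t i)) \<cdot> h))\<^sup>2) \<le> 0"
      using le eq unfolding pyth sum.distrib by simp
    then have "(\<Sum>i\<in>UNIV. (norm (adj (\<rho> (t i)) \<cdot> h - adj (\<pi> (t i)) \<cdot> h))\<^sup>2) = 0"
      by (intro antisym sum_nonneg) auto
    then show ?thesis by (simp add: sum_nonneg_eq_0_iff)
  qed
  \<comment> \<open>Iterates the resolution of the identity given by \<open>sum\<pi>\<close>. The
    set \<open>V\<close> is quantified and only closed under addition, because the induction applies
    the hypothesis to the preimage of \<open>V\<close> under \<open>\<pi> (t i)\<close>.\<close>
  have span: "H \<subseteq> V" if "\<And>x y. x \<in> V \<Longrightarrow> y \<in> V \<Longrightarrow> x + y \<in> V" "0 \<in> V"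
    "\<And>w g. length w = n \<Longrightarrow> g \<in> H \<Longrightarrow> \<pi> (W w) \<cdot> g \<in> V" for n V
    using that
  proof (induction n arbitrary: V)
    case 0
    show ?case
    proof
      fix h assume "h \<in> H"
      then show "h \<in> V" using 0(3)[of "[]" h] one_h by simp
    qed
  next
    case (Suc n)
    show ?case
    proof
      fix h assume h: "h \<in> H"
      have "\<pi> (t i) \<cdot> adj (\<pi> (t i)) \<cdot> h \<in> V" for i
      proof -
        have "H \<subseteq> {g. (\<pi> (t i)) \<cdot> g \<in> V}"
        proof (rule Suc.IH)
          fix w :: "'d list" and g assume "length w = n" "g \<in> H"
          then show "\<pi> (W w) \<cdot> g \<in> {g. \<pi> (t i) \<cdot> g \<in> V}"
            using Suc.prems(3)[of "i # w" g] \<pi>D(3) by simp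
        qed (use Suc.prems in \<open>auto simp: blinfun.add_right\<close>)
        then show ?thesis using adj\<pi>H[of "t i" h] by auto
      qed
      then have "(\<Sum>i\<in>G. \<pi> (t i) \<cdot> adj (\<pi> (t i)) \<cdot> h) \<in> V" for G
        using Suc.prems(1,2) by (induction G rule: infinite_finite_induct) auto
      moreover have "(\<Sum>i\<in>UNIV. \<pi> (t i) \<cdot> adj (\<pi> (t i)) \<cdot> h) = h"
        using arg_cong[OF sum\<pi>, of "\<lambda>a. a \<cdot> h"] proj_props(2)[OF H h] by (simp add: blinfun.sum_left)
      ultimately show "h \<in> V" by metis
    qed
  qed
  have \<pi>isometric: "norm (\<pi> a \<cdot> \<pi> b \<cdot> g) = norm (\<pi> b \<cdot> g)"
    if "star C a \<otimes> (a \<otimes> b) = b" "a \<in> carrier C" "b \<in> carrier C" for a b g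
  proof -
    have "adj (\<pi> a) o\<^sub>L (\<pi> a o\<^sub>L \<pi> b) = \<pi> b"
      using \<pi>D(3)[of "star C a" "a \<otimes> b"] \<pi>D(3)[of a b] \<pi>D(5)[of a] that by simp
    then have "adj (\<pi> a) \<cdot> \<pi> a \<cdot> \<pi> b \<cdot> g = \<pi> b \<cdot> g"
      by (metis blinfun_apply_blinfun_compose)
    then have "cinner (\<pi> a \<cdot> \<pi> b \<cdot> g) (\<pi> a \<cdot> \<pi> b \<cdot> g)
        = cinner (\<pi> b \<cdot> g) (\<pi> b \<cdot> g)"
      by (simp add: cinner_adj \<pi>clin that)
    then have "(norm (\<pi> a \<cdot> \<pi> b \<cdot> g))\<^sup>2 = (norm (\<pi> b \<cdot> g))\<^sup>2"
      unfolding cinner_self by (simp only: of_real_eq_iff)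
    then show ?thesis by (simp add: power2_eq_imp_eq)
  qed
  have \<rho>W: "\<rho> (W u) \<cdot> \<pi> (W v) \<cdot> g = \<pi> (W u) \<cdot> \<pi> (W v) \<cdot> g"
    if "k \<le> length v" "W u \<otimes> W v \<noteq> \<zero>" for u v g
  proof (rule isometric[OF W_in_A _ nrm_W])
    show "\<pi> (W v) \<cdot> g \<in> H" by (rule \<pi>H) simp
    show "norm (\<pi> (W u) \<cdot> \<pi> (W v) \<cdot> g) = norm (\<pi> (W v) \<cdot> g)"
      using W_isometric[OF that(1), of u] that(2) by (intro \<pi>isometric) auto
  qed
  have \<pi>zero: "\<pi> \<zero> = 0" using star_hom_zero[OF cstar_axioms BH.cstar_axioms \<pi>] by simp
  have \<rho>t: "\<rho> (t i) \<cdot> h = \<pi> (t i) \<cdot> h" if "h \<in> H" for i h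
  proof -
    have "H \<subseteq> {h. (\<rho> (t i)) \<cdot> h = \<pi> (t i) \<cdot> h}"
    \<comment> \<open>Length \<open>k\<close> would do where \<open>\<pi> (t i)\<close> is
      isometric. But \<open>\<rho> (t i)\<close> must also be shown to vanish where
      \<open>\<pi> (t i)\<close> does. A second block \<open>u\<close> of length \<open>k\<close>
      allows \<open>\<rho> (t i)\<close> and \<open>\<rho> (W u)\<close> to be multiplied inside
      \<open>A\<close>, where \<open>t i \<otimes> W u\<close> is already
      \<open>\<zero>\<close>.\<close>
    proof (rule span[of _ "k + k"])
      fix w :: "'d list" and g assume w: "length w = k + k" and g: "g \<in> H"
      define u v where "u = take k w" and "v = drop k w"
      have uv: "w = u @ v" "length u = k" "length v = k" using w by (auto simp: u_def v_def)
      have \<pi>w: "\<pi> (W w) \<cdot> g = \<pi> (W u) \<cdot> \<pi> (W v) \<cdot> g"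
        using uv \<pi>D(3) by (simp add: W_append)
      have "\<rho> (t i) \<cdot> \<pi> (W w) \<cdot> g = \<pi> (t i) \<cdot> \<pi> (W w) \<cdot> g"
      proof (cases "W w = \<zero>")
        case True
        then show ?thesis by (simp add: \<pi>zero)
      next
        case False
        then have nz: "W u \<otimes> W v \<noteq> \<zero>" using uv by (simp add: W_append)
        have "\<rho> (t i) \<cdot> \<pi> (W w) \<cdot> g
            = \<rho> (t i) \<cdot> \<rho> (W u) \<cdot> \<pi> (W v) \<cdot> g"
          unfolding \<pi>w using \<rho>W[OF _ nz] uv(3) by simp
        also have "\<dots> = \<rho> (W (i # u)) \<cdot> \<pi> (W v) \<cdot> g"
          using \<rho>mult A_t W_in_A by simp
        also have "\<dots> = \<pi> (W (i # u)) \<cdot> \<pi> (W v) \<cdot> g"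
        proof (cases "t i \<otimes> W u = \<zero>")
          case True
          then show ?thesis by (simp add: \<pi>zero \<rho>zero)
        next
          case False
          then have 1: "star C (t i) \<otimes> (t i \<otimes> W u) = W u" using word_relation uv by blast
          have "W (i # u) \<otimes> W v \<noteq> \<zero>"
          proof
            assume "W (i # u) \<otimes> W v = \<zero>"
            then have "star C (t i) \<otimes> (W (i # u) \<otimes> W v) = \<zero>" by simp
            moreover have "star C (t i) \<otimes> (W (i # u) \<otimes> W v) = (star C (t i) \<otimes> (t i \<otimes> W u)) \<otimes> W v"
              by (simp add: m_assoc)
            ultimately show False using nz 1 by simp
          qed
          then show ?thesis by (intro \<rho>W) (use uv in auto)
        qed
        also have "\<dots> = \<pi> (t i) \<cdot> \<pi> (W w) \<cdot> g"
          unfolding \<pi>w by (simp add: \<pi>D(3))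
        finally show ?thesis .
      qed
      then show "\<pi> (W w) \<cdot> g \<in> {h. \<rho> (t i) \<cdot> h = \<pi> (t i) \<cdot> h}" by simp
    qed (auto simp: blinfun.add_right)
    then show ?thesis using that by blast
  qed
  \<comment> \<open>A subalgebra containing the generators. The rest of \<open>A\<close> is reached
    by limits, which \<open>\<rho>\<close> respects because it is contractive.\<close>
  define S where "S = {a \<in> A. \<forall>h\<in>H. \<rho> a \<cdot> h \<in> H \<and> adj (\<rho> a) \<cdot> h \<in> H}"
  have SA: "S \<subseteq> A" by (auto simp: S_def)
  note csD = csubspaceD[OF csH]
  have "closed_subalgebra C (nrm_closure S)"
  proof (rule closed_subalgebra_nrm_closure)
    show "S \<subseteq> carrier C" using SA A_carrier by blast
    have "adj (0 :: 'h \<Rightarrow>\<^sub>L 'h) = 0" by (rule adj_eqI) (auto simp: clin_zero)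
    then show "\<zero> \<in> S" using A_zero \<rho>zero csD(1) by (simp add: S_def)
    show "x \<oplus> y \<in> S" if "x \<in> S" "y \<in> S" for x y
      using that csD(2) A_add by (auto simp: S_def \<rho>add \<rho>clin adj_add plus_blinfun.rep_eq)
    show "x \<otimes> y \<in> S" if "x \<in> S" "y \<in> S" for x y
      using that A_mult by (auto simp: S_def \<rho>mult \<rho>clin adj_compose)
    show "c \<odot> x \<in> S" if "x \<in> S" for c x
      using that csD(3) A_scal by (auto simp: S_def \<rho>scal \<rho>clin adj_cscale)
  qed
  moreover have "insert \<one> (range t) \<subseteq> S"
    using \<rho>one \<rho>one_adj \<rho>t \<rho>t_adj \<pi>H adj\<pi>H A_one A_t by (auto simp: S_def)
  then have "insert \<one> (range t) \<subseteq> nrm_closure S"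
    using subset_nrm_closure[of S] SA A_carrier by blast
  ultimately have gen: "A \<subseteq> nrm_closure S"
    using A_generated hull_minimal[of "insert \<one> (range t)" "nrm_closure S" "closed_subalgebra C"]
    by (auto simp: generated_algebra_def)
  have clH: "closed H" using H by (simp add: closed_csubspace_def)
  show "reduces H (\<rho> ` A)"
    unfolding reduces_def
  proof (intro ballI, elim imageE, hypsubst)
    fix h a assume h: "h \<in> H" and a: "a \<in> A"
    obtain f where f: "\<And>n. f n \<in> S" "cvg f a" using gen a by (auto simp: nrm_closure_def)
    have fA: "f n \<in> A" for n using f SA by auto
    have bound: "norm (\<rho> (f n) - \<rho> a) \<le> nrm C (f n \<ominus> a)" for n
    proof -
      have m: "f n \<ominus> a = f n \<oplus> (-1) \<odot> a" using fA[of n] a by (simp add: minus_eq scal_neg1)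
      have "\<rho> (f n \<ominus> a) = \<rho> (f n) - \<rho> a"
        unfolding m using fA[of n] a A_scal
        by (intro blinfun_eqI) (simp add: \<rho>add \<rho>scal plus_blinfun.rep_eq minus_blinfun.rep_eq)
      moreover have "f n \<ominus> a \<in> A" unfolding m using fA[of n] a by (intro A_add A_scal)
      ultimately show ?thesis using \<rho>norm[of "f n \<ominus> a"] by simp
    qed
    have lim0: "(\<lambda>n. nrm C (f n \<ominus> a)) \<longlonglongrightarrow> 0" using f(2) by (simp add: cvg_def)
    have in_H: "b \<cdot> h \<in> H" if b: "\<And>n. g n \<cdot> h \<in> H" "\<And>n. norm (g n - b) \<le> nrm C (f n \<ominus> a)" for g b
    proof -
      have "(\<lambda>n. g n - b) \<longlonglongrightarrow> 0"
        by (rule tendsto_0_le[OF lim0, of _ 1]) (use b(2) in \<open>auto intro!: always_eventually order_trans[OF b(2)]\<close>)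
      then have "g \<longlonglongrightarrow> b" by (rule LIM_zero_cancel)
      then have "(\<lambda>n. g n \<cdot> h) \<longlonglongrightarrow> b \<cdot> h" by (intro tendsto_intros)
      with clH b(1) show ?thesis by (rule closed_sequentially)
    qed
    have "\<rho> a \<cdot> h \<in> H"
      by (rule in_H[of "\<lambda>n. \<rho> (f n)"]) (use f(1) h bound in \<open>auto simp: S_def\<close>)
    moreover have "adj (\<rho> a) \<cdot> h \<in> H"
    proof (rule in_H[of "\<lambda>n. adj (\<rho> (f n))"])
      fix n
      show "adj (\<rho> (f n)) \<cdot> h \<in> H" using f(1) h by (auto simp: S_def)
      have "adj (\<rho> (f n) - \<rho> a) = adj (\<rho> (f n)) - adj (\<rho> a)"
        using \<rho>clin fA a by (intro adj_eqI clin_minus)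
          (auto simp: minus_blinfun.rep_eq cinner_diff_left cinner_diff_right cinner_adj)
      then show "norm (adj (\<rho> (f n)) - adj (\<rho> a)) \<le> nrm C (f n \<ominus> a)"
        using norm_adj[of "\<rho> (f n) - \<rho> a"] bound[of n] \<rho>clin fA a by (simp add: clin_minus)
    qed
    ultimately show "\<rho> a \<cdot> h \<in> H \<and> adj (\<rho> a) \<cdot> h \<in> H" by blast
  qed
qed

theorem hyperrigid: "hyperrigid TYPE('h::complex_hilbert) C A"
  unfolding hyperrigid_def using C_generated maximal_star_hom by blast

end

section \<open>Order and domination in a C*-algebra\<close>

context cstar
begin

definition le :: "'a \<Rightarrow> 'a \<Rightarrow> bool" where
  "le a b \<longleftrightarrow> a \<in> carrier A \<and> b \<in> carrier A \<and> Pos (b \<ominus> a)"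

lemma le_closed: "le a b \<Longrightarrow> a \<in> carrier A" "le a b \<Longrightarrow> b \<in> carrier A"
  by (auto simp: le_def)

lemma le_refl: "a \<in> carrier A \<Longrightarrow> le a a"
  by (simp add: le_def minus_eq r_neg)

lemma le_trans [trans]:
  assumes "le a b" "le b c" shows "le a c"
proof -
  have c: "a \<in> carrier A" "b \<in> carrier A" "c \<in> carrier A" using assms by (auto simp: le_def)
  have "c \<ominus> a = (c \<ominus> b) \<oplus> (b \<ominus> a)" using c by algebra
  then show ?thesis using assms by (simp add: le_def Pos_add)
qed

lemma le_add:
  assumes "le a b" "le c d" shows "le (a \<oplus> c) (b \<oplus> d)"
proof -
  have c: "a \<in> carrier A" "b \<in> carrier A" "c \<in> carrier A" "d \<in> carrier A" using assms by (auto simp: le_def)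
  have "(b \<oplus> d) \<ominus> (a \<oplus> c) = (b \<ominus> a) \<oplus> (d \<ominus> c)" using c by algebra
  then show ?thesis using assms by (simp add: le_def Pos_add)
qed

lemma le_scal:
  assumes "le a b" "0 \<le> r" shows "le (of_real r \<odot> a) (of_real r \<odot> b)"
  using assms Pos_scal[of "b \<ominus> a" r] by (simp add: le_def scal_diff_right)

lemma le_conj:
  assumes "le a b" and x: "x \<in> carrier A" shows "le (star A x \<otimes> a \<otimes> x) (star A x \<otimes> b \<otimes> x)"
proof -
  have c: "a \<in> carrier A" "b \<in> carrier A" using assms by (auto simp: le_def)
  have "star A x \<otimes> b \<otimes> x \<ominus> star A x \<otimes> a \<otimes> x = star A x \<otimes> (b \<ominus> a) \<otimes> x" using c x by algebra
  then show ?thesis using assms Pos_conj[of "b \<ominus> a" x] by (simp add: le_def)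
qed

lemma le_finsum:
  "finite F \<Longrightarrow> (\<And>i. i \<in> F \<Longrightarrow> le (f i) (g i)) \<Longrightarrow> le (\<Oplus>i\<in>F. f i) (\<Oplus>i\<in>F. g i)"
proof (induction F rule: finite_induct)
  case (insert x F)
  then have c: "f \<in> F \<rightarrow> carrier A" "g \<in> F \<rightarrow> carrier A" "f x \<in> carrier A" "g x \<in> carrier A"
    by (force dest: le_closed)+
  show ?case using insert c le_add by (simp add: finsum_insert)
qed (simp add: le_refl)

lemma le_add_Pos: "le a b \<Longrightarrow> Pos c \<Longrightarrow> le a (b \<oplus> c)"
  using le_add[of a b \<zero> c] by (auto simp: le_def minus_eq)

lemma le_finsum_single:
  assumes "finite F" "i \<in> F" "\<And>j. j \<in> F \<Longrightarrow> Pos (f j)"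
  shows "le (f i) (\<Oplus>j\<in>F. f j)"
proof -
  have "F = insert i (F - {i})" using assms by auto
  moreover have "(\<Oplus>j\<in>insert i (F - {i}). f j) = f i \<oplus> (\<Oplus>j\<in>F - {i}. f j)"
    using assms by (intro finsum_insert) (auto simp: Pi_iff)
  ultimately have "(\<Oplus>j\<in>F. f j) = f i \<oplus> (\<Oplus>j\<in>F - {i}. f j)" by simp
  moreover have "Pos (\<Oplus>j\<in>F - {i}. f j)" using assms by (intro Pos_finsum) auto
  ultimately show ?thesis using le_add_Pos[OF le_refl[of "f i"]] assms by simp
qed

lemma le_star_mult_const:
  "x \<in> carrier A \<Longrightarrow> nrm A x \<le> t \<Longrightarrow> le (star A x \<otimes> x) (of_real (t\<^sup>2) \<odot> \<one>)"
  using Pos_nrm_sq_minus by (simp add: le_def)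

lemma nrm_le_if_le:
  "x \<in> carrier A \<Longrightarrow> le (star A x \<otimes> x) (of_real t \<odot> \<one>) \<Longrightarrow> 0 \<le> t \<Longrightarrow> (nrm A x)\<^sup>2 \<le> t"
  using nrm_le_if_Pos[of x "sqrt t"] power_mono[of "nrm A x" "sqrt t" 2] by (simp add: le_def)

text \<open>Expands the positive element
  \<open>star A (u \<ominus> v) \<otimes> (u \<ominus> v)\<close>, where \<open>u\<close> and
  \<open>v\<close> are the multiples of \<open>a\<close> and \<open>b\<close> by
  \<open>sqrt r\<close> and \<open>1 / sqrt r\<close>, so that the cross terms do not depend on
  \<open>r\<close>. A small \<open>r\<close> keeps the coefficient of the first square near 1 at the
  price of the second.\<close>

lemma star_mult_add_le:
  assumes a: "a \<in> carrier A" and b: "b \<in> carrier A" and "0 < r"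
  shows "le (star A (a \<oplus> b) \<otimes> (a \<oplus> b))
    (of_real (1 + r) \<odot> (star A a \<otimes> a) \<oplus> of_real (1 + 1 / r) \<odot> (star A b \<otimes> b))"
proof -
  define c where "c = complex_of_real (sqrt r)"
  define d where "d = complex_of_real (1 / sqrt r)"
  have cd: "c * d = 1" "d * c = 1" "c * c = complex_of_real r" "d * d = complex_of_real (1 / r)" "cnj c = c" "cnj d = d"
    using assms(3) by (simp_all add: c_def d_def flip: of_real_mult of_real_divide)
  define u v where "u = c \<odot> a" and "v = d \<odot> b"
  have uv: "u \<in> carrier A" "v \<in> carrier A" "star A u \<otimes> u = of_real r \<odot> (star A a \<otimes> a)"
    "star A v \<otimes> v = of_real (1 / r) \<odot> (star A b \<otimes> b)" "star A u \<otimes> v = star A a \<otimes> b" "star A v \<otimes> u = star A b \<otimes> a"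
    using a b by (simp_all add: u_def v_def cd del: of_real_divide)
  have 1: "star A (u \<ominus> v) \<otimes> (u \<ominus> v) = star A u \<otimes> u \<ominus> star A u \<otimes> v \<ominus> star A v \<otimes> u \<oplus> star A v \<otimes> v"
    using uv(1,2) by algebra
  have 2: "(star A a \<otimes> a \<oplus> p) \<oplus> (star A b \<otimes> b \<oplus> q) \<ominus> star A (a \<oplus> b) \<otimes> (a \<oplus> b)
      = p \<ominus> star A a \<otimes> b \<ominus> star A b \<otimes> a \<oplus> q" if "p \<in> carrier A" "q \<in> carrier A" for p q
    using a b that by algebra
  have "of_real (1 + r) \<odot> (star A a \<otimes> a) \<oplus> of_real (1 + 1 / r) \<odot> (star A b \<otimes> b)
      = (star A a \<otimes> a \<oplus> star A u \<otimes> u) \<oplus> (star A b \<otimes> b \<oplus> star A v \<otimes> v)"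
    unfolding uv(3,4) of_real_add using a b by (simp add: scal_add_left del: of_real_divide)
  moreover have "\<dots> \<ominus> star A (a \<oplus> b) \<otimes> (a \<oplus> b) = star A (u \<ominus> v) \<otimes> (u \<ominus> v)"
    unfolding 1 uv(5,6) using uv(1,2) by (intro 2) auto
  ultimately show ?thesis
    using Pos_star_mult[of "u \<ominus> v"] uv(1,2) a b by (simp add: le_def del: star_minus)
qed

text \<open>In a representation this bounds the squared norm of \<open>a h\<close> by a multiple of
  the inner product of \<open>d h\<close> with \<open>h\<close>. It expresses without vectors that
  \<open>a\<close> is small wherever \<open>d\<close> is.\<close>

definition dom :: "'a \<Rightarrow> 'a \<Rightarrow> bool" where
  "dom d a \<longleftrightarrow> a \<in> carrier A \<and> (\<exists>K\<ge>0. le (star A a \<otimes> a) (of_real K \<odot> d))"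

lemma dom_closed: "dom d a \<Longrightarrow> a \<in> carrier A"
  by (simp add: dom_def)

lemma domI: "\<lbrakk>a \<in> carrier A; 0 \<le> K; le (star A a \<otimes> a) (of_real K \<odot> d)\<rbrakk> \<Longrightarrow> dom d a"
  by (auto simp: dom_def)

lemma dom_zero: "d \<in> carrier A \<Longrightarrow> dom d \<zero>"
  by (rule domI[of _ 0]) (simp_all add: le_refl)

lemma dom_mono:
  assumes "dom d a" "le d d'" shows "dom d' a"
  using assms le_scal[OF assms(2)] le_trans unfolding dom_def by blast

lemma dom_add:
  assumes "dom d a" "dom d b" and d: "d \<in> carrier A" shows "dom d (a \<oplus> b)"
proof -
  obtain K L where K: "0 \<le> K" "le (star A a \<otimes> a) (of_real K \<odot> d)"
    and L: "0 \<le> L" "le (star A b \<otimes> b) (of_real L \<odot> d)" using assms by (auto simp: dom_def)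
  have a: "a \<in> carrier A" and b: "b \<in> carrier A" using assms by (auto simp: dom_def)
  have "le (star A (a \<oplus> b) \<otimes> (a \<oplus> b))
    (of_real 2 \<odot> (star A a \<otimes> a) \<oplus> of_real 2 \<odot> (star A b \<otimes> b))"
    using star_mult_add_le[OF a b zero_less_one] by simp
  also have "le \<dots> (of_real 2 \<odot> (of_real K \<odot> d) \<oplus> of_real 2 \<odot> (of_real L \<odot> d))"
    by (intro le_add le_scal K L) auto
  also have "\<dots> = of_real (2 * K + 2 * L) \<odot> d" using d by (simp add: scal_add_left)
  finally show ?thesis using K(1) L(1) a b by (intro domI[of _ "2 * K + 2 * L"]) auto
qed

text \<open>Multiplication is allowed from the left, the side on which further letters are added to
  a *-word.\<close>

lemma dom_mult_left:
  assumes "dom d a" and s: "s \<in> carrier A" and d: "d \<in> carrier A" shows "dom d (s \<otimes> a)"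
proof -
  obtain K where K: "0 \<le> K" "le (star A a \<otimes> a) (of_real K \<odot> d)" using assms by (auto simp: dom_def)
  have a: "a \<in> carrier A" using assms by (auto simp: dom_def)
  have "star A (s \<otimes> a) \<otimes> (s \<otimes> a) = star A a \<otimes> (star A s \<otimes> s) \<otimes> a" using a s by (simp add: m_assoc)
  also have "le \<dots> (star A a \<otimes> (of_real ((nrm A s)\<^sup>2) \<odot> \<one>) \<otimes> a)"
    using a s by (intro le_conj le_star_mult_const) auto
  also have "\<dots> = of_real ((nrm A s)\<^sup>2) \<odot> (star A a \<otimes> a)" using a by simp
  also have "le \<dots> (of_real ((nrm A s)\<^sup>2) \<odot> (of_real K \<odot> d))"
    by (intro le_scal K) auto
  also have "\<dots> = of_real ((nrm A s)\<^sup>2 * K) \<odot> d" using d by simp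
  finally show ?thesis using K(1) a s by (intro domI[of _ "(nrm A s)\<^sup>2 * K"]) auto
qed

lemma dom_scal: assumes "dom d a" "d \<in> carrier A" shows "dom d (c \<odot> a)"
  using dom_mult_left[OF assms(1) _ assms(2), of "c \<odot> \<one>"] dom_closed[OF assms(1)] by simp

lemma dom_finsum:
  assumes "finite F" "d \<in> carrier A" "\<And>i. i \<in> F \<Longrightarrow> dom d (f i)"
  shows "dom d (\<Oplus>i\<in>F. f i)"
  using assms(1,3)
proof (induction F rule: finite_induct)
  case (insert x F)
  then have "f \<in> F \<rightarrow> carrier A" "f x \<in> carrier A" using dom_closed by auto
  then show ?case using insert dom_add[OF _ _ assms(2)] by (simp add: finsum_insert)
qed (simp add: dom_zero[OF assms(2)])

text \<open>The weight \<open>l\<close> is chosen so large that the deficiency of the \<open>Z p\<close> compensates the error \<open>e\<close>.\<close>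

lemma nrm_weighted_sum_le:
  assumes P: "finite P" and Z: "\<And>p. p \<in> P \<Longrightarrow> Z p \<in> carrier A" and E: "\<And>p. p \<in> P \<Longrightarrow> E p \<in> carrier A"
    and v: "v \<in> carrier A" "nrm A v \<le> Y" and e: "dom (\<Oplus>p\<in>P. E p \<ominus> star A (Z p) \<otimes> Z p) e"
    and orth: "\<And>p q. p \<in> P \<Longrightarrow> q \<in> P \<Longrightarrow> p \<noteq> q \<Longrightarrow> star A (Z p) \<otimes> Z q = \<zero>"
    and orth': "\<And>p. p \<in> P \<Longrightarrow> star A (v \<oplus> e) \<otimes> Z p = \<zero>"
    and le: "le (\<Oplus>p\<in>P. E p) (of_real m \<odot> \<one>)" and m: "0 \<le> m" and r: "0 < r"
  obtains l where "0 \<le> l"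
    "(nrm A ((v \<oplus> e) \<oplus> of_real l \<odot> (\<Oplus>p\<in>P. Z p)))\<^sup>2 \<le> (1 + r) * Y\<^sup>2 + l\<^sup>2 * m"
proof -
  let ?G = "\<Oplus>p\<in>P. E p \<ominus> star A (Z p) \<otimes> Z p" and ?S = "\<Oplus>p\<in>P. Z p"
  have ec: "e \<in> carrier A" by (rule dom_closed[OF e])
  obtain K where K: "0 \<le> K" "le (star A e \<otimes> e) (of_real K \<odot> ?G)" using e by (auto simp: dom_def)
  \<comment> \<open>\<open>(1 + 1 / r) * K\<close> is the factor with which the deficiency enters
    through \<open>star_mult_add_le\<close>. With this weight, the error bound and the weighted
    squares of the \<open>Z p\<close> add up to a multiple of the sum of the
    \<open>E p\<close>.\<close>
  define l where "l = sqrt ((1 + 1 / r) * K)"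
  have l: "0 \<le> l" "l\<^sup>2 = (1 + 1 / r) * K" "l * l = (1 + 1 / r) * K"
    using r K(1) by (simp_all add: l_def flip: power2_eq_square)
  define \<rho> where "\<rho> = v \<oplus> e"
  have \<rho>: "\<rho> \<in> carrier A" using v ec by (simp add: \<rho>_def)
  have S: "?S \<in> carrier A" and G: "?G \<in> carrier A" and ZZ: "(\<Oplus>p\<in>P. star A (Z p) \<otimes> Z p) \<in> carrier A"
    and Ec: "(\<Oplus>p\<in>P. E p) \<in> carrier A" using Z E by (auto intro!: finsum_closed)
  have "star A \<rho> \<otimes> ?S = (\<Oplus>p\<in>P. star A \<rho> \<otimes> Z p)" using P Z \<rho> by (intro finsum_rdistr) auto
  also have "\<dots> = (\<Oplus>p\<in>P. \<zero>)" using orth' by (intro finsum_cong') (auto simp: \<rho>_def)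
  finally have o1: "star A \<rho> \<otimes> ?S = \<zero>" by simp
  have SS: "star A ?S \<otimes> ?S = (\<Oplus>p\<in>P. star A (Z p) \<otimes> Z p)" using P Z orth by (intro star_mult_finsum_orthogonal) auto
  define R where "R = \<rho> \<oplus> of_real l \<odot> ?S"
  have R: "R \<in> carrier A" using \<rho> S by (simp add: R_def)
  have RR: "star A R \<otimes> R = star A \<rho> \<otimes> \<rho> \<oplus> of_real (l\<^sup>2) \<odot> (\<Oplus>p\<in>P. star A (Z p) \<otimes> Z p)"
    unfolding R_def star_mult_add_orthogonal[OF \<rho> S o1] SS by (simp add: power2_eq_square)
  have "le (star A \<rho> \<otimes> \<rho>) (of_real (1 + r) \<odot> (star A v \<otimes> v) \<oplus> of_real (1 + 1 / r) \<odot> (star A e \<otimes> e))"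
    unfolding \<rho>_def by (rule star_mult_add_le[OF v(1) ec r])
  also have "le \<dots> (of_real (1 + r) \<odot> (of_real (Y\<^sup>2) \<odot> \<one>) \<oplus> of_real (1 + 1 / r) \<odot> (of_real K \<odot> ?G))"
    using r by (intro le_add le_scal K le_star_mult_const v) auto
  finally have "le (star A R \<otimes> R) ((of_real (1 + r) \<odot> (of_real (Y\<^sup>2) \<odot> \<one>)
      \<oplus> of_real (1 + 1 / r) \<odot> (of_real K \<odot> ?G)) \<oplus> of_real (l\<^sup>2) \<odot> (\<Oplus>p\<in>P. star A (Z p) \<otimes> Z p))"
    unfolding RR using ZZ by (intro le_add le_refl) auto
  also have "\<dots> = of_real ((1 + r) * Y\<^sup>2) \<odot> \<one> \<oplus> of_real (l\<^sup>2) \<odot> (?G \<oplus> (\<Oplus>p\<in>P. star A (Z p) \<otimes> Z p))"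
    using G ZZ unfolding l(2) by (simp add: scal_add_right a_assoc del: of_real_power of_real_divide of_real_add flip: of_real_mult)
  also have "?G \<oplus> (\<Oplus>p\<in>P. star A (Z p) \<otimes> Z p) = (\<Oplus>p\<in>P. (E p \<ominus> star A (Z p) \<otimes> Z p) \<oplus> star A (Z p) \<otimes> Z p)"
    using Z E by (intro finsum_addf[symmetric]) auto
  also have "\<dots> = (\<Oplus>p\<in>P. E p)" using Z E by (intro finsum_cong') (auto simp: minus_cancel_right)
  also have "le (of_real ((1 + r) * Y\<^sup>2) \<odot> \<one> \<oplus> of_real (l\<^sup>2) \<odot> (\<Oplus>p\<in>P. E p))
      (of_real ((1 + r) * Y\<^sup>2) \<odot> \<one> \<oplus> of_real (l\<^sup>2) \<odot> (of_real m \<odot> \<one>))"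
    by (intro le_add le_refl le_scal le) auto
  also have "\<dots> = of_real ((1 + r) * Y\<^sup>2 + l\<^sup>2 * m) \<odot> \<one>"
    by (simp add: scal_add_left)
  finally have "(nrm A R)\<^sup>2 \<le> (1 + r) * Y\<^sup>2 + l\<^sup>2 * m"
    using R r m by (intro nrm_le_if_le) auto
  then show ?thesis using that l(1) by (simp add: R_def \<rho>_def)
qed

end

section \<open>Norm estimates through a completely isometric map\<close>

context cstar
begin

lemma matrix_unit_le:
  assumes "le a b" "i < n"
  shows "cstar.le (matrix_algebra A n (matrix_norm A n)) (matrix_unit i i a) (matrix_unit i i b)"
proof -
  let ?D = "matrix_algebra A n (matrix_norm A n)"
  interpret D: cstar ?D by (rule cstar_matrix_algebra)
  have c: "a \<in> carrier A" "b \<in> carrier A" "Pos (b \<ominus> a)" using assms by (auto simp: le_def)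
  obtain s where s: "Pos s" "s \<otimes> s = b \<ominus> a" using Pos_sqrt[OF c(3)] by blast
  have "star ?D (matrix_unit i i s) \<otimes>\<^sub>?D matrix_unit i i s = matrix_unit i i (b \<ominus> a)"
    using s assms(2) by (simp add: star_matrix_unit matrix_unit_mult)
  then have "D.Pos (matrix_unit i i (b \<ominus> a))"
    using D.Pos_star_mult[of "matrix_unit i i s"] s(1) assms(2) by simp
  then show ?thesis
    using c assms(2) matrix_unit_minus[of b a i n i "matrix_norm A n"] by (simp add: D.le_def)
qed

end

text \<open>
  The norm of \<open>x\<close> is attained on the column \<open>V\<close> with entries \<open>star C (W b)\<close>, and on it the extra rows
  \<open>z l b\<close> of the matrix \<open>R\<close> below are isometric. The rows are weighted so heavily that vectors on which
  the images \<open>j (z l b)\<close> fail to be isometric do not contribute to the norm of the image of \<open>R\<close>; on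
  the others the entries \<open>j (a b)\<close> of its first row are \<open>y \<otimes> s b\<close> up to a negligible error.
\<close>

lemma nrm_le_if_approximate_factorization:
  fixes C :: "('c, 'm) cstar_alg_scheme" and B :: "('b, 'n) cstar_alg_scheme" and S :: "'i set" and Ls :: "'l set"
  assumes C: "cstar C" and B: "cstar B" and hom: "algebra_hom C A B j" and ci: "completely_isometric C A B j"
    and A: "A \<subseteq> carrier C" "\<zero>\<^sub>C \<in> A" "\<And>x y. x \<in> A \<Longrightarrow> y \<in> A \<Longrightarrow> x \<oplus>\<^sub>C y \<in> A"
      "\<And>c x. x \<in> A \<Longrightarrow> c \<odot>\<^sub>C x \<in> A"
    and fin: "finite S" "finite Ls"
    and W: "\<And>b. b \<in> S \<Longrightarrow> W b \<in> carrier C" "finsum C (\<lambda>b. W b \<otimes>\<^sub>C star C (W b)) S = \<one>\<^sub>C"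
    and a: "\<And>b. b \<in> S \<Longrightarrow> a b \<in> A" "finsum C (\<lambda>b. a b \<otimes>\<^sub>C star C (W b)) S = x"
    and z: "\<And>l b. l \<in> Ls \<Longrightarrow> b \<in> S \<Longrightarrow> z l b \<in> A"
      "\<And>l b. l \<in> Ls \<Longrightarrow> b \<in> S \<Longrightarrow> star C (z l b) \<otimes>\<^sub>C (z l b \<otimes>\<^sub>C star C (W b)) = star C (W b)"
      "\<And>l b. l \<in> Ls \<Longrightarrow> b \<in> S \<Longrightarrow> nrm B (j (z l b)) \<le> 1"
    and s: "\<And>b. b \<in> S \<Longrightarrow> s b \<in> carrier B" "nrm B (finsum B (\<lambda>b. s b \<otimes>\<^sub>B star B (s b)) S) \<le> 1"
    and y: "y \<in> carrier B"
    and err: "\<And>b. b \<in> S \<Longrightarrow> cstar.dom B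
        (finsum B (\<lambda>l. \<one>\<^sub>B \<ominus>\<^sub>B star B (j (z l b)) \<otimes>\<^sub>B j (z l b)) Ls) (j (a b) \<ominus>\<^sub>B y \<otimes>\<^sub>B s b)"
  shows "nrm C x \<le> nrm B y"
proof -
  interpret C: cstar C by fact
  interpret B: cstar B by fact
  note homD = hom[unfolded algebra_hom_def]
  have j: "\<And>x. x \<in> A \<Longrightarrow> j x \<in> carrier B" "\<And>x y. x \<in> A \<Longrightarrow> y \<in> A \<Longrightarrow> j (x \<oplus>\<^sub>C y) = j x \<oplus>\<^sub>B j y"
    "\<And>c x. x \<in> A \<Longrightarrow> j (c \<odot>\<^sub>C x) = c \<odot>\<^sub>B j x" using homD by auto
  have j0: "j \<zero>\<^sub>C = \<zero>\<^sub>B" using j(3)[OF A(2), of 0] j(1)[OF A(2)] by simp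
  have Ac: "\<And>x. x \<in> A \<Longrightarrow> x \<in> carrier C" using A(1) by auto
  define P where "P = Ls \<times> S"
  have P: "finite P" using fin by (simp add: P_def)
  obtain f nf where f: "f ` S = {i::nat. i < nf}" "inj_on f S" using finite_imp_inj_to_nat_seg[OF fin(1)] by blast
  obtain e ne where e: "e ` P = {i::nat. i < ne}" "inj_on e P" using finite_imp_inj_to_nat_seg[OF P] by blast
  \<comment> \<open>Columns are indexed by \<open>f b\<close>. Row 0 holds the main row, and the
    extra row of a pair \<open>p\<close> is row \<open>Suc (e p)\<close>, which keeps it apart from
    row 0.\<close>
  define M where "M = Suc (nf + ne)"
  have M: "0 < M" "\<And>b. b \<in> S \<Longrightarrow> f b < M" "\<And>p. p \<in> P \<Longrightarrow> Suc (e p) < M"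
  proof -
    show "0 < M" by (simp add: M_def)
    fix b assume "b \<in> S"
    then have "f b < nf" using f(1) by blast
    then show "f b < M" by (simp add: M_def)
  next
    fix p assume "p \<in> P"
    then have "e p < ne" using e(1) by blast
    then show "Suc (e p) < M" by (simp add: M_def)
  qed
  define DC where "DC = matrix_algebra C M (matrix_norm C M)"
  define DB where "DB = matrix_algebra B M (matrix_norm B M)"
  interpret DC: cstar DC unfolding DC_def by (rule C.cstar_matrix_algebra)
  interpret DB: cstar DB unfolding DB_def by (rule B.cstar_matrix_algebra)
  let ?c = "C.matrix_unit" and ?b = "B.matrix_unit"
  have cu: "\<And>i k a. i < M \<Longrightarrow> k < M \<Longrightarrow> a \<in> carrier C \<Longrightarrow> ?c i k a \<in> carrier DC" by (simp add: DC_def)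
  have bu: "\<And>i k a. i < M \<Longrightarrow> k < M \<Longrightarrow> a \<in> carrier B \<Longrightarrow> ?b i k a \<in> carrier DB" by (simp add: DB_def)
  note cmult = C.matrix_unit_mult[where n = M and N = "matrix_norm C M", folded DC_def]
  note bmult = B.matrix_unit_mult[where n = M and N = "matrix_norm B M", folded DB_def]
  note cstar = C.star_matrix_unit[where n = M and N = "matrix_norm C M", folded DC_def]
  note bstar = B.star_matrix_unit[where n = M and N = "matrix_norm B M", folded DB_def]
  note cfinsum = C.matrix_unit_finsum[where n = M and N = "matrix_norm C M", folded DC_def]
  note bfinsum = B.matrix_unit_finsum[where n = M and N = "matrix_norm B M", folded DB_def]
  have cnrm: "nrm DC = matrix_norm C M" and bnrm: "nrm DB = matrix_norm B M"
    by (simp_all add: DC_def DB_def matrix_algebra_def)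
  have f_eq: "f b = f b' \<longleftrightarrow> b = b'" if "b \<in> S" "b' \<in> S" for b b' using f(2) that by (auto dest: inj_onD)
  have e_eq: "e p = e p' \<longleftrightarrow> p = p'" if "p \<in> P" "p' \<in> P" for p p' using e(2) that by (auto dest: inj_onD)
  define Y where "Y = nrm B y"
  define m where "m = real (card Ls)"
  \<comment> \<open>The factorised row \<open>v\<close> has norm at most that of \<open>y\<close>,
    and \<open>er\<close> collects the errors. Their sum \<open>\<rho>B\<close> is the row of the
    \<open>j (a b)\<close>, the image of the first row of \<open>R\<close>.\<close>
  define \<sigma> where "\<sigma> = finsum DB (\<lambda>b. ?b 0 (f b) (s b)) S"
  define v where "v = ?b 0 0 y \<otimes>\<^sub>DB \<sigma>"
  define \<epsilon> where "\<epsilon> b = j (a b) \<ominus>\<^sub>B y \<otimes>\<^sub>B s b" for b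
  define er where "er = finsum DB (\<lambda>b. ?b 0 (f b) (\<epsilon> b)) S"
  define ZB where "ZB p = ?b (Suc (e p)) (f (snd p)) (j (z (fst p) (snd p)))" for p
  define E where "E p = ?b (f (snd p)) (f (snd p)) \<one>\<^sub>B" for p :: "'l \<times> 'i"
  define \<rho>B where "\<rho>B = finsum DB (\<lambda>b. ?b 0 (f b) (j (a b))) S"
  define ZC where "ZC p = ?c (Suc (e p)) (f (snd p)) (z (fst p) (snd p))" for p
  define \<rho>C where "\<rho>C = finsum DC (\<lambda>b. ?c 0 (f b) (a b)) S"
  have jz: "j (z (fst p) (snd p)) \<in> carrier B" "z (fst p) (snd p) \<in> A" "z (fst p) (snd p) \<in> carrier C" "snd p \<in> S" "fst p \<in> Ls" if "p \<in> P" for p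
    using that z(1) j(1) Ac by (auto simp: P_def)
  have ja: "j (a b) \<in> carrier B" "a b \<in> carrier C" "\<epsilon> b \<in> carrier B" if "b \<in> S" for b
    using that a(1) j(1) Ac s(1) y by (auto simp: \<epsilon>_def)
  have \<sigma>: "\<sigma> \<in> carrier DB" unfolding \<sigma>_def using M s by (intro DB.finsum_closed) (auto intro!: bu)
  have v: "v \<in> carrier DB" using \<sigma> M y bu by (simp add: v_def)
  have nrm_\<sigma>: "nrm DB \<sigma> \<le> 1"
  proof -
    have "(nrm DB \<sigma>)\<^sup>2 = nrm B (finsum B (\<lambda>b. s b \<otimes>\<^sub>B star B (s b)) S)"
      unfolding \<sigma>_def bnrm unfolding DB_def using M s fin f(2) by (intro B.nrm_matrix_row) auto
    then have "(nrm DB \<sigma>)\<^sup>2 \<le> 1" using s(2) by simp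
    then show ?thesis using \<sigma> by (simp add: power_le_one_iff)
  qed
  have nrm_v: "nrm DB v \<le> Y"
  proof -
    have "nrm DB v \<le> nrm DB (?b 0 0 y) * nrm DB \<sigma>" unfolding v_def using \<sigma> M y bu by (intro DB.nrm_times) auto
    also have "nrm DB (?b 0 0 y) = Y" unfolding bnrm Y_def using M y by (intro B.matrix_norm_unit)
    also have "Y * nrm DB \<sigma> \<le> Y * 1" using nrm_\<sigma> y by (intro mult_left_mono) (auto simp: Y_def)
    finally show ?thesis by simp
  qed
  have v_eq: "v = finsum DB (\<lambda>b. ?b 0 (f b) (y \<otimes>\<^sub>B s b)) S"
  proof -
    have "v = finsum DB (\<lambda>b. ?b 0 0 y \<otimes>\<^sub>DB ?b 0 (f b) (s b)) S"
      unfolding v_def \<sigma>_def using M s y fin by (intro DB.finsum_rdistr) (auto intro!: bu)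
    also have "\<dots> = finsum DB (\<lambda>b. ?b 0 (f b) (y \<otimes>\<^sub>B s b)) S"
      using M s y by (intro DB.finsum_cong') (auto simp: bmult intro!: bu)
    finally show ?thesis .
  qed
  have \<rho>B: "v \<oplus>\<^sub>DB er = \<rho>B"
  proof -
    have "v \<oplus>\<^sub>DB er = finsum DB (\<lambda>b. ?b 0 (f b) (y \<otimes>\<^sub>B s b) \<oplus>\<^sub>DB ?b 0 (f b) (\<epsilon> b)) S"
      unfolding v_eq er_def using M s y ja by (intro DB.finsum_addf[symmetric]) (auto intro!: bu)
    also have "\<dots> = \<rho>B" unfolding \<rho>B_def
    proof (intro DB.finsum_cong')
      fix b assume b: "b \<in> S"
      have "p \<oplus>\<^sub>B (q \<ominus>\<^sub>B p) = q" if "p \<in> carrier B" "q \<in> carrier B" for p q using that by algebra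
      then have "y \<otimes>\<^sub>B s b \<oplus>\<^sub>B \<epsilon> b = j (a b)"
        unfolding \<epsilon>_def using b s y ja by simp
      then show "?b 0 (f b) (y \<otimes>\<^sub>B s b) \<oplus>\<^sub>DB ?b 0 (f b) (\<epsilon> b) = ?b 0 (f b) (j (a b))"
        using b s y ja B.matrix_unit_add[of "y \<otimes>\<^sub>B s b" "\<epsilon> b" 0 "f b" M "matrix_norm B M"] by (simp add: DB_def)
    qed (use M ja in \<open>auto intro!: bu\<close>)
    finally show ?thesis .
  qed
  define g where "g p = ?b (f (snd p)) (f (snd p)) (\<one>\<^sub>B \<ominus>\<^sub>B star B (j (z (fst p) (snd p))) \<otimes>\<^sub>B j (z (fst p) (snd p)))" for p
  have g: "E p \<ominus>\<^sub>DB star DB (ZB p) \<otimes>\<^sub>DB ZB p = g p" if "p \<in> P" for p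
    unfolding E_def ZB_def g_def bstar using that jz[OF that] M
    by (simp add: bmult B.matrix_unit_minus[where n = M and N = "matrix_norm B M", folded DB_def])
  have gc: "g p \<in> carrier DB" if "p \<in> P" for p using that jz[OF that] M by (auto simp: g_def intro!: bu)
  have gPos: "DB.Pos (g p)" if p: "p \<in> P" for p
  proof -
    have "B.le \<zero>\<^sub>B (\<one>\<^sub>B \<ominus>\<^sub>B star B (j (z (fst p) (snd p))) \<otimes>\<^sub>B j (z (fst p) (snd p)))"
      using B.Pos_nrm_sq_minus[of "j (z (fst p) (snd p))" 1] jz[OF p] z(3)[of "fst p" "snd p"]
      by (simp add: B.le_def B.minus_eq)
    then have "DB.le (?b (f (snd p)) (f (snd p)) \<zero>\<^sub>B) (g p)"
      unfolding g_def DB_def using jz[OF p] M by (intro B.matrix_unit_le) auto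
    then show ?thesis
      using gc[OF p] B.matrix_unit_zero[of "f (snd p)" "f (snd p)" M "matrix_norm B M"]
      by (simp add: DB.le_def DB.minus_eq flip: DB_def)
  qed
  have G_eq: "finsum DB (\<lambda>p. E p \<ominus>\<^sub>DB star DB (ZB p) \<otimes>\<^sub>DB ZB p) P = finsum DB g P"
    using g gc by (intro DB.finsum_cong') auto
  have dom: "DB.dom (finsum DB (\<lambda>p. E p \<ominus>\<^sub>DB star DB (ZB p) \<otimes>\<^sub>DB ZB p) P) er"
    unfolding G_eq er_def
  \<comment> \<open>The error in column \<open>b\<close> is controlled by the deficiencies in that
    column alone, which are part of the total.\<close>
  proof (rule DB.dom_finsum[OF fin(1)])
    show "finsum DB g P \<in> carrier DB" using gc by (intro DB.finsum_closed) auto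
    fix b assume b: "b \<in> S"
    define \<Delta> where "\<Delta> = finsum B (\<lambda>l. \<one>\<^sub>B \<ominus>\<^sub>B star B (j (z l b)) \<otimes>\<^sub>B j (z l b)) Ls"
    obtain K where K: "0 \<le> K" "B.le (star B (\<epsilon> b) \<otimes>\<^sub>B \<epsilon> b) (of_real K \<odot>\<^sub>B \<Delta>)"
      using err[OF b] by (auto simp: B.dom_def \<Delta>_def \<epsilon>_def)
    have "DB.le (?b (f b) (f b) (star B (\<epsilon> b) \<otimes>\<^sub>B \<epsilon> b)) (?b (f b) (f b) (of_real K \<odot>\<^sub>B \<Delta>))"
      unfolding DB_def using K M b by (intro B.matrix_unit_le) auto
    also have "?b (f b) (f b) (of_real K \<odot>\<^sub>B \<Delta>) = of_real K \<odot>\<^sub>DB ?b (f b) (f b) \<Delta>"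
      unfolding DB_def by (rule B.matrix_unit_scal)
    finally have 1: "DB.dom (?b (f b) (f b) \<Delta>) (?b 0 (f b) (\<epsilon> b))"
      using K(1) M b ja by (intro DB.domI[of _ K]) (auto simp: bstar bmult intro!: bu)
    have 2: "?b (f b) (f b) \<Delta> = finsum DB (\<lambda>l. g (l, b)) Ls"
      unfolding \<Delta>_def g_def fst_conv snd_conv using fin M b z j(1) by (intro bfinsum) auto
    have "DB.le (?b (f b) (f b) \<Delta>) (finsum DB (\<lambda>l. finsum DB (\<lambda>b. g (l, b)) S) Ls)"
      unfolding 2
    proof (rule DB.le_finsum[OF fin(2)])
      fix l assume "l \<in> Ls"
      then show "DB.le (g (l, b)) (finsum DB (\<lambda>b. g (l, b)) S)"
        using DB.le_finsum_single[of S b "\<lambda>b. g (l, b)"] fin b gPos by (auto simp: P_def)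
    qed
    also have "finsum DB (\<lambda>l. finsum DB (\<lambda>b. g (l, b)) S) Ls = finsum DB g P"
      unfolding P_def using fin gc by (intro DB.finsum_times[symmetric]) (auto simp: P_def)
    finally show "DB.dom (finsum DB g P) (?b 0 (f b) (\<epsilon> b))" by (rule DB.dom_mono[OF 1])
  qed
  have ZB: "ZB p \<in> carrier DB" "E p \<in> carrier DB" if "p \<in> P" for p
    using that jz[OF that] M by (auto simp: ZB_def E_def intro!: bu M(3))
  have orth: "star DB (ZB p) \<otimes>\<^sub>DB ZB q = \<zero>\<^sub>DB" if "p \<in> P" "q \<in> P" "p \<noteq> q" for p q
    unfolding ZB_def bstar using that jz M e_eq by (simp add: bmult)
  have orth': "star DB (v \<oplus>\<^sub>DB er) \<otimes>\<^sub>DB ZB p = \<zero>\<^sub>DB" if p: "p \<in> P" for p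
  proof -
    have "star DB \<rho>B = finsum DB (\<lambda>b. star DB (?b 0 (f b) (j (a b)))) S"
      unfolding \<rho>B_def using M fin ja by (intro DB.star_finsum) (auto intro!: bu)
    then have "star DB \<rho>B \<otimes>\<^sub>DB ZB p = finsum DB (\<lambda>b. star DB (?b 0 (f b) (j (a b))) \<otimes>\<^sub>DB ZB p) S"
      using M fin ja ZB[OF p] by (simp only:) (intro DB.finsum_ldistr, auto intro!: bu DB.star_cl)
    also have "\<dots> = finsum DB (\<lambda>b. \<zero>\<^sub>DB) S"
      unfolding ZB_def bstar using M ja jz[OF p] by (intro DB.finsum_cong') (auto simp: bmult)
    finally show ?thesis unfolding \<rho>B by simp
  qed
  have le_E: "DB.le (finsum DB E P) (of_real m \<odot>\<^sub>DB \<one>\<^sub>DB)"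
  proof -
    \<comment> \<open>The \<open>E p\<close> sum to \<open>m\<close> copies of the projection
      \<open>h\<close> onto the columns in use.\<close>
    define h where "h = finsum DB (\<lambda>b. ?b (f b) (f b) \<one>\<^sub>B) S"
    have h: "h \<in> carrier DB" unfolding h_def using M by (intro DB.finsum_closed) (auto intro!: bu)
    have hs: "star DB h = h"
    proof -
      have "star DB h = finsum DB (\<lambda>b. star DB (?b (f b) (f b) \<one>\<^sub>B)) S"
        unfolding h_def using M fin by (intro DB.star_finsum) (auto intro!: bu)
      then show ?thesis by (simp add: bstar h_def)
    qed
    have "star DB h \<otimes>\<^sub>DB h = finsum DB (\<lambda>b. star DB (?b (f b) (f b) \<one>\<^sub>B) \<otimes>\<^sub>DB ?b (f b) (f b) \<one>\<^sub>B) S"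
      unfolding h_def using M fin f_eq by (intro DB.star_mult_finsum_orthogonal) (auto simp: bstar bmult intro!: bu)
    also have "\<dots> = h" unfolding h_def using M by (intro DB.finsum_cong') (auto simp: bstar bmult intro!: bu)
    finally have hh: "h \<otimes>\<^sub>DB h = h" unfolding hs .
    have exp: "star DB (\<one>\<^sub>DB \<ominus>\<^sub>DB u) \<otimes>\<^sub>DB (\<one>\<^sub>DB \<ominus>\<^sub>DB u)
        = \<one>\<^sub>DB \<ominus>\<^sub>DB u \<ominus>\<^sub>DB star DB u \<oplus>\<^sub>DB star DB u \<otimes>\<^sub>DB u" if "u \<in> carrier DB" for u
      using that by algebra
    have "\<one>\<^sub>DB \<ominus>\<^sub>DB u \<ominus>\<^sub>DB u \<oplus>\<^sub>DB u = \<one>\<^sub>DB \<ominus>\<^sub>DB u" if "u \<in> carrier DB" for u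
      using that by algebra
    then have "star DB (\<one>\<^sub>DB \<ominus>\<^sub>DB h) \<otimes>\<^sub>DB (\<one>\<^sub>DB \<ominus>\<^sub>DB h) = \<one>\<^sub>DB \<ominus>\<^sub>DB h"
      unfolding exp[OF h] hs hh using h by simp
    then have le: "DB.le h \<one>\<^sub>DB" using DB.Pos_star_mult[of "\<one>\<^sub>DB \<ominus>\<^sub>DB h"] h by (simp add: DB.le_def)
    have "finsum DB E P = finsum DB (\<lambda>l. finsum DB (\<lambda>b. E (l, b)) S) Ls"
      unfolding P_def using fin ZB(2) by (intro DB.finsum_times) (auto simp: P_def)
    also have "\<dots> = of_real m \<odot>\<^sub>DB h"
      unfolding E_def snd_conv h_def[symmetric] m_def using DB.finsum_constant[OF fin(2) h] by simp
    finally have eq: "finsum DB E P = of_real m \<odot>\<^sub>DB h" .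
    show ?thesis unfolding eq using le by (intro DB.le_scal) (auto simp: m_def)
  qed
  \<comment> \<open>Since the \<open>W b \<otimes>\<^sub>C star C (W b)\<close> add up to the unit,
    this column is a contraction; multiplying the row of the \<open>a b\<close> by it recovers
    \<open>x\<close>.\<close>
  define V where "V = finsum DC (\<lambda>b. ?c (f b) 0 (star C (W b))) S"
  have V: "V \<in> carrier DC" unfolding V_def using M W by (intro DC.finsum_closed) (auto intro!: cu)
  have nrm_V: "nrm DC V \<le> 1"
  proof -
    have "(nrm DC V)\<^sup>2 = nrm C (finsum C (\<lambda>b. star C (star C (W b)) \<otimes>\<^sub>C star C (W b)) S)"
      unfolding V_def cnrm unfolding DC_def using M W fin f(2) by (intro C.nrm_matrix_column) auto
    also have "finsum C (\<lambda>b. star C (star C (W b)) \<otimes>\<^sub>C star C (W b)) S = finsum C (\<lambda>b. W b \<otimes>\<^sub>C star C (W b)) S"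
      using W(1) by (intro C.finsum_cong') auto
    finally have "(nrm DC V)\<^sup>2 \<le> 1" using W(2) C.nrm_one_le by simp
    then show ?thesis using V by (simp add: power_le_one_iff)
  qed
  have unit_V: "?c i (f b) c \<otimes>\<^sub>DC V = ?c i 0 (c \<otimes>\<^sub>C star C (W b))" if "b \<in> S" "i < M" "c \<in> carrier C" for i b c
  proof -
    have "?c i (f b) c \<otimes>\<^sub>DC V = finsum DC (\<lambda>b'. ?c i (f b) c \<otimes>\<^sub>DC ?c (f b') 0 (star C (W b'))) S"
      unfolding V_def using M W that fin by (intro DC.finsum_rdistr) (auto intro!: cu)
    also have "\<dots> = ?c i (f b) c \<otimes>\<^sub>DC ?c (f b) 0 (star C (W b))"
      using fin M W that f_eq by (intro DC.finsum_single) (auto simp: cmult intro!: cu)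
    finally show ?thesis using M that W by (simp add: cmult)
  qed
  have xc: "x \<in> carrier C" unfolding a(2)[symmetric] using ja W by (intro C.finsum_closed) auto
  have \<rho>C: "\<rho>C \<in> carrier DC" unfolding \<rho>C_def using M ja by (intro DC.finsum_closed) (auto intro!: cu)
  have ZC: "ZC p \<in> carrier DC" if "p \<in> P" for p using that jz[OF that] M by (auto simp: ZC_def intro!: cu M(3))
  define U where "U = finsum DC (\<lambda>p. ?c (Suc (e p)) 0 (z (fst p) (snd p) \<otimes>\<^sub>C star C (W (snd p)))) P"
  have Uc: "?c (Suc (e p)) 0 (z (fst p) (snd p) \<otimes>\<^sub>C star C (W (snd p))) \<in> carrier DC" if "p \<in> P" for p
    using that jz[OF that] M W by (auto intro!: cu M(3))
  have U: "U \<in> carrier DC" unfolding U_def using Uc by (intro DC.finsum_closed) auto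
  have \<rho>V: "\<rho>C \<otimes>\<^sub>DC V = ?c 0 0 x"
  proof -
    have "\<rho>C \<otimes>\<^sub>DC V = finsum DC (\<lambda>b. ?c 0 (f b) (a b) \<otimes>\<^sub>DC V) S"
      unfolding \<rho>C_def using M ja V fin by (intro DC.finsum_ldistr) (auto intro!: cu)
    also have "\<dots> = finsum DC (\<lambda>b. ?c 0 0 (a b \<otimes>\<^sub>C star C (W b))) S"
      using M ja W by (intro DC.finsum_cong') (auto simp: unit_V intro!: cu)
    also have "\<dots> = ?c 0 0 (finsum C (\<lambda>b. a b \<otimes>\<^sub>C star C (W b)) S)"
      using M ja W fin by (intro cfinsum[symmetric]) auto
    finally show ?thesis unfolding a(2) .
  qed
  have ZV: "finsum DC ZC P \<otimes>\<^sub>DC V = U"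
  proof -
    have "finsum DC ZC P \<otimes>\<^sub>DC V = finsum DC (\<lambda>p. ZC p \<otimes>\<^sub>DC V) P"
      using ZC V P by (intro DC.finsum_ldistr) auto
    also have "\<dots> = U"
      unfolding U_def using Uc by (intro DC.finsum_cong') (auto simp: ZC_def intro!: unit_V M jz)
    finally show ?thesis .
  qed
  \<comment> \<open>By \<open>z(2)\<close> each extra row is isometric on \<open>V\<close>; so every
    member of \<open>Ls\<close> contributes the sum of the
    \<open>W b \<otimes>\<^sub>C star C (W b)\<close>, which is the unit.\<close>
  have UU: "star DC U \<otimes>\<^sub>DC U = ?c 0 0 (of_real m \<odot>\<^sub>C \<one>\<^sub>C)"
  proof -
    have "star DC U \<otimes>\<^sub>DC U = finsum DC (\<lambda>p. star DC (?c (Suc (e p)) 0 (z (fst p) (snd p) \<otimes>\<^sub>C star C (W (snd p))))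
        \<otimes>\<^sub>DC ?c (Suc (e p)) 0 (z (fst p) (snd p) \<otimes>\<^sub>C star C (W (snd p)))) P"
      unfolding U_def using P Uc jz W M e_eq
      by (intro DC.star_mult_finsum_orthogonal) (simp_all add: cstar cmult)
    also have "\<dots> = finsum DC (\<lambda>p. ?c 0 0 (W (snd p) \<otimes>\<^sub>C star C (W (snd p)))) P"
    proof (rule DC.finsum_cong')
      fix p assume p: "p \<in> P"
      have "star C (z (fst p) (snd p) \<otimes>\<^sub>C star C (W (snd p))) \<otimes>\<^sub>C (z (fst p) (snd p) \<otimes>\<^sub>C star C (W (snd p)))
          = W (snd p) \<otimes>\<^sub>C (star C (z (fst p) (snd p)) \<otimes>\<^sub>C (z (fst p) (snd p) \<otimes>\<^sub>C star C (W (snd p))))"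
        using jz[OF p] W(1) by (simp add: C.m_assoc)
      also have "\<dots> = W (snd p) \<otimes>\<^sub>C star C (W (snd p))" using z(2) jz[OF p] by simp
      finally show "star DC (?c (Suc (e p)) 0 (z (fst p) (snd p) \<otimes>\<^sub>C star C (W (snd p))))
          \<otimes>\<^sub>DC ?c (Suc (e p)) 0 (z (fst p) (snd p) \<otimes>\<^sub>C star C (W (snd p))) = ?c 0 0 (W (snd p) \<otimes>\<^sub>C star C (W (snd p)))"
        unfolding cstar using jz[OF p] W(1) M p by (subst cmult) auto
    qed (use M W jz in \<open>auto intro!: cu\<close>)
    also have "\<dots> = ?c 0 0 (finsum C (\<lambda>p. W (snd p) \<otimes>\<^sub>C star C (W (snd p))) P)"
      using M W P jz by (intro cfinsum[symmetric]) auto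
    also have "finsum C (\<lambda>p. W (snd p) \<otimes>\<^sub>C star C (W (snd p))) P = finsum C (\<lambda>l. \<one>\<^sub>C) Ls"
      unfolding P_def using fin W by (subst C.finsum_times) auto
    also have "\<dots> = of_real m \<odot>\<^sub>C \<one>\<^sub>C" using C.finsum_constant[OF fin(2)] by (simp add: m_def)
    finally show ?thesis .
  qed
  have xU: "star DC (?c 0 0 x) \<otimes>\<^sub>DC U = \<zero>\<^sub>DC"
  proof -
    have "star DC (?c 0 0 x) \<otimes>\<^sub>DC U
        = finsum DC (\<lambda>p. star DC (?c 0 0 x) \<otimes>\<^sub>DC ?c (Suc (e p)) 0 (z (fst p) (snd p) \<otimes>\<^sub>C star C (W (snd p)))) P"
      unfolding U_def using P Uc M xc by (intro DC.finsum_rdistr) (auto intro!: cu DC.star_cl)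
    also have "\<dots> = finsum DC (\<lambda>p. \<zero>\<^sub>DC) P"
      unfolding cstar using M xc jz W by (intro DC.finsum_cong') (auto simp: cmult)
    finally show ?thesis by simp
  qed
  have main: "(nrm C x)\<^sup>2 \<le> (1 + r) * Y\<^sup>2" if r: "0 < r" for r
  proof -
    obtain l where l: "0 \<le> l" "(nrm DB ((v \<oplus>\<^sub>DB er) \<oplus>\<^sub>DB of_real l \<odot>\<^sub>DB finsum DB ZB P))\<^sup>2 \<le> (1 + r) * Y\<^sup>2 + l\<^sup>2 * m"
      by (rule DB.nrm_weighted_sum_le[of P ZB E v Y er m r])
        (use P ZB v nrm_v dom orth orth' le_E r in \<open>auto simp: m_def\<close>)
    define R where "R = \<rho>C \<oplus>\<^sub>DC of_real l \<odot>\<^sub>DC finsum DC ZC P"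
    have unitA: "?c i k c \<in> matrices_over C M A" if "i < M" "k < M" "c \<in> A" for i k c
      using that A(2) by (auto simp: C.matrix_unit_def intro!: matrices_overI)
    note mapf = matrix_map_finsum[OF C.star_alg_axioms B.star_alg_axioms A(1-3) j0 j, where n = M
        and N = "matrix_norm C M" and N' = "matrix_norm B M", folded DC_def DB_def]
    have m\<rho>: "\<rho>C \<in> matrices_over C M A \<and> matrix_map B M j \<rho>C = finsum DB (\<lambda>b. matrix_map B M j (?c 0 (f b) (a b))) S"
      unfolding \<rho>C_def by (rule mapf) (use fin M a in \<open>auto intro!: unitA\<close>)
    have mZ: "finsum DC ZC P \<in> matrices_over C M A \<and> matrix_map B M j (finsum DC ZC P) = finsum DB (\<lambda>p. matrix_map B M j (ZC p)) P"
      by (rule mapf) (use P M jz in \<open>auto simp: ZC_def intro!: unitA\<close>)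
    have "finsum DB (\<lambda>b. matrix_map B M j (?c 0 (f b) (a b))) S = \<rho>B"
      unfolding \<rho>B_def using M ja
      by (intro DB.finsum_cong') (auto simp: matrix_map_unit[where j = j, OF C.star_alg_axioms B.star_alg_axioms j0] intro!: bu)
    moreover have "finsum DB (\<lambda>p. matrix_map B M j (ZC p)) P = finsum DB ZB P"
      using ZB M jz
      by (intro DB.finsum_cong') (auto simp: ZC_def ZB_def matrix_map_unit[where j = j, OF C.star_alg_axioms B.star_alg_axioms j0])
    moreover have lZ: "of_real l \<odot>\<^sub>DC finsum DC ZC P \<in> matrices_over C M A"
      using mZ A(4) C.scal_0_right by (auto simp: DC_def matrix_algebra_simps matrices_over_def)
    ultimately have map_R: "matrix_map B M j R = (v \<oplus>\<^sub>DB er) \<oplus>\<^sub>DB of_real l \<odot>\<^sub>DB finsum DB ZB P"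
      unfolding R_def \<rho>B using m\<rho> mZ
        matrix_map_add_scal(1)[where j = j and N = "matrix_norm C M" and N' = "matrix_norm B M", OF conjunct1[OF m\<rho>] lZ B.star_alg_axioms j(2,3), folded DC_def DB_def]
        matrix_map_add_scal(2)[where j = j and c = "complex_of_real l" and N = "matrix_norm C M" and N' = "matrix_norm B M", OF conjunct1[OF m\<rho>] conjunct1[OF mZ] B.star_alg_axioms j(2,3), folded DC_def DB_def]
      by simp
    have RA: "R \<in> matrices_over C M A"
      unfolding R_def using m\<rho> lZ A(3) C.l_zero by (auto simp: DC_def matrix_algebra_simps matrices_over_def)
    have SZ: "finsum DC ZC P \<in> carrier DC" using ZC by (intro DC.finsum_closed) auto
    have Rc: "R \<in> carrier DC" using \<rho>C SZ by (simp add: R_def)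
    have "nrm DC R = nrm DB (matrix_map B M j R)"
      using ci RA unfolding completely_isometric_def cnrm bnrm by simp
    then have nrm_R: "(nrm DC R)\<^sup>2 \<le> (1 + r) * Y\<^sup>2 + l\<^sup>2 * m" using l(2) unfolding map_R by simp
    have RV: "R \<otimes>\<^sub>DC V = ?c 0 0 x \<oplus>\<^sub>DC of_real l \<odot>\<^sub>DC U"
      unfolding R_def using \<rho>C SZ V by (simp add: DC.l_distr \<rho>V ZV)
    \<comment> \<open>In \<open>C\<close> the extra rows contribute exactly
      \<open>l\<^sup>2 * m\<close>, the same amount as in the upper bound from \<open>B\<close>.
      Being a multiple of the unit, this term can be subtracted on both sides, however large
      \<open>l\<close> is.\<close>
    define x' where "x' = star C x \<otimes>\<^sub>C x \<oplus>\<^sub>C of_real (l\<^sup>2 * m) \<odot>\<^sub>C \<one>\<^sub>C"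
    have x': "x' \<in> carrier C" "star C x' = x'" using xc by (simp_all add: x'_def)
    have "star DC (R \<otimes>\<^sub>DC V) \<otimes>\<^sub>DC (R \<otimes>\<^sub>DC V) = ?c 0 0 x'"
    proof -
      have "star DC (R \<otimes>\<^sub>DC V) \<otimes>\<^sub>DC (R \<otimes>\<^sub>DC V)
          = star DC (?c 0 0 x) \<otimes>\<^sub>DC ?c 0 0 x \<oplus>\<^sub>DC (cnj (complex_of_real l) * complex_of_real l) \<odot>\<^sub>DC (star DC U \<otimes>\<^sub>DC U)"
        unfolding RV using M xc U xU by (intro DC.star_mult_add_orthogonal) (auto intro!: cu)
      also have "\<dots> = ?c 0 0 (star C x \<otimes>\<^sub>C x) \<oplus>\<^sub>DC ?c 0 0 (of_real (l\<^sup>2) \<odot>\<^sub>C (of_real m \<odot>\<^sub>C \<one>\<^sub>C))"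
        unfolding UU using M xc C.matrix_unit_scal[where n = M and N = "matrix_norm C M", folded DC_def] cu[of 0 0]
        by (simp add: cstar cmult power2_eq_square)
      also have "\<dots> = ?c 0 0 x'"
        unfolding x'_def DC_def using xc by (simp add: C.matrix_unit_add[where n = M and N = "matrix_norm C M"])
      finally show ?thesis .
    qed
    then have "nrm DC (?c 0 0 x') = (nrm DC (R \<otimes>\<^sub>DC V))\<^sup>2"
      using DC.nrm_cstar[of "R \<otimes>\<^sub>DC V"] Rc V by simp
    also have "\<dots> \<le> (nrm DC R)\<^sup>2"
    proof (rule power_mono)
      have "nrm DC (R \<otimes>\<^sub>DC V) \<le> nrm DC R * nrm DC V" using Rc V by (rule DC.nrm_times)
      also have "\<dots> \<le> nrm DC R * 1" using nrm_V Rc by (intro mult_left_mono) auto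
      finally show "nrm DC (R \<otimes>\<^sub>DC V) \<le> nrm DC R" by simp
    qed (use Rc V in auto)
    finally have "nrm C x' \<le> (1 + r) * Y\<^sup>2 + l\<^sup>2 * m"
      using nrm_R M x' by (simp add: cnrm C.matrix_norm_unit)
    then have "C.Pos (of_real ((1 + r) * Y\<^sup>2 + l\<^sup>2 * m) \<odot>\<^sub>C \<one>\<^sub>C \<ominus>\<^sub>C x')"
      by (rule C.Pos_const_minus[OF x'])
    moreover have "of_real ((1 + r) * Y\<^sup>2 + l\<^sup>2 * m) \<odot>\<^sub>C \<one>\<^sub>C \<ominus>\<^sub>C x'
        = of_real ((1 + r) * Y\<^sup>2) \<odot>\<^sub>C \<one>\<^sub>C \<ominus>\<^sub>C star C x \<otimes>\<^sub>C x"
    proof -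
      have canc: "(p \<oplus>\<^sub>C q) \<ominus>\<^sub>C (u \<oplus>\<^sub>C q) = p \<ominus>\<^sub>C u" if "p \<in> carrier C" "q \<in> carrier C" "u \<in> carrier C" for p q u
        using that by algebra
      have "of_real ((1 + r) * Y\<^sup>2 + l\<^sup>2 * m) \<odot>\<^sub>C \<one>\<^sub>C
          = of_real ((1 + r) * Y\<^sup>2) \<odot>\<^sub>C \<one>\<^sub>C \<oplus>\<^sub>C of_real (l\<^sup>2 * m) \<odot>\<^sub>C \<one>\<^sub>C"
        unfolding of_real_add by (rule C.scal_add_left) simp
      then show ?thesis unfolding x'_def using xc by (simp only:) (intro canc, auto)
    qed
    ultimately have "C.le (star C x \<otimes>\<^sub>C x) (of_real ((1 + r) * Y\<^sup>2) \<odot>\<^sub>C \<one>\<^sub>C)"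
      using xc by (simp add: C.le_def)
    then show ?thesis using r xc by (intro C.nrm_le_if_le) auto
  qed
  have "(nrm C x)\<^sup>2 \<le> Y\<^sup>2"
  proof (rule field_le_epsilon)
    fix d :: real assume "0 < d"
    \<comment> \<open>The summand 1 covers the case \<open>Y = 0\<close>.\<close>
    define r where "r = d / (Y\<^sup>2 + 1)"
    have r: "0 < r" "r * Y\<^sup>2 \<le> d"
      using \<open>0 < d\<close> by (auto simp: r_def field_simps add_pos_nonneg intro: divide_pos_pos)
    show "(nrm C x)\<^sup>2 \<le> Y\<^sup>2 + d" using main[OF r(1)] r(2) by (simp add: algebra_simps)
  qed
  then have "nrm C x \<le> Y" by (rule power2_le_imp_le) (use y in \<open>simp add: Y_def\<close>)
  then show ?thesis by (simp add: Y_def)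
qed

section \<open>The C*-envelope\<close>

context cstar
begin

text \<open>For \<open>w = star A e \<otimes> e \<ominus> e\<close> the element
  \<open>\<ominus> (star A w \<otimes> w)\<close> equals \<open>star A e \<otimes> (\<one> \<ominus>
  e \<otimes> star A e) \<otimes> e\<close>, which is positive because \<open>e\<close> is a
  contraction. So \<open>w = \<zero>\<close>, and \<open>e\<close> is the selfadjoint element
  \<open>star A e \<otimes> e\<close>.\<close>

lemma nrm_contractive_idempotent_selfadj:
  assumes e: "e \<in> carrier A" "e \<otimes> e = e" "nrm A e \<le> 1"
  shows "star A e = e"
proof -
  define w where "w = star A e \<otimes> e \<ominus> e"
  have w: "w \<in> carrier A" using e by (simp add: w_def)
  have ss: "star A e \<otimes> star A e = star A e" using star_times[of e e] e by simp
  have 1: "star A w \<otimes> w = star A e \<otimes> e \<otimes> star A e \<otimes> e \<ominus> star A e \<otimes> (e \<otimes> e) \<ominus> (star A e \<otimes> star A e) \<otimes> e \<oplus> star A e \<otimes> e"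
    unfolding w_def using e(1) by algebra
  have 2: "star A e \<otimes> (\<one> \<ominus> e \<otimes> star A e) \<otimes> e = star A e \<otimes> e \<ominus> star A e \<otimes> e \<otimes> star A e \<otimes> e"
    using e(1) by algebra
  have 3: "\<ominus> (p \<ominus> q \<ominus> q \<oplus> q) = q \<ominus> p" if "p \<in> carrier A" "q \<in> carrier A" for p q using that by algebra
  have "\<ominus> (star A w \<otimes> w) = star A e \<otimes> (\<one> \<ominus> e \<otimes> star A e) \<otimes> e"
    unfolding 1 2 e(2) ss using e(1) by (intro 3) auto
  moreover have "Pos (\<one> \<ominus> e \<otimes> star A e)" using Pos_nrm_sq_minus[of "star A e" 1] e by simp
  ultimately have "Pos (\<ominus> (star A w \<otimes> w))" using Pos_conj e(1) by simp
  then have "Pos (\<zero> \<ominus> star A w \<otimes> w)" using w by (simp add: minus_eq)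
  then have "nrm A (star A w \<otimes> w) \<le> nrm A \<zero>" using Pos_star_mult[OF w] by (intro nrm_Pos_mono) auto
  then have "star A w \<otimes> w = \<zero>" using w nrm_le_0 by simp
  then have "w = \<zero>" by (rule nrm_sq_eq_0[OF w])
  then have "star A e \<otimes> e = e" using minus_zero_iff[of "star A e \<otimes> e" e] e by (simp add: w_def)
  then show ?thesis using star_times[of "star A e" e] e(1) by simp
qed

text \<open>With \<open>a = star B (s l) \<otimes>\<^sub>B s l\<close> these bound the two kinds of
  error in \<open>dom_adjoint_step\<close>: cancelling a letter with its own adjoint, and meeting
  the adjoint of a different letter.\<close>

lemma le_one_minus:
  assumes a: "Pos a" and p: "Pos (\<one> \<ominus> a)"
  shows "le ((\<one> \<ominus> a) \<otimes> (\<one> \<ominus> a)) (\<one> \<ominus> a)" "le (a \<ominus> a \<otimes> a) (\<one> \<ominus> a)"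
proof -
  have ac: "a \<in> carrier A" using a by simp
  have "(\<one> \<ominus> a) \<ominus> (\<one> \<ominus> a) \<otimes> (\<one> \<ominus> a) = (\<one> \<ominus> a) \<otimes> a" using ac by algebra
  moreover have "(\<one> \<ominus> a) \<otimes> a = a \<otimes> (\<one> \<ominus> a)" using ac by algebra
  then have "Pos ((\<one> \<ominus> a) \<otimes> a)" by (rule Pos_mult[OF p a])
  ultimately show "le ((\<one> \<ominus> a) \<otimes> (\<one> \<ominus> a)) (\<one> \<ominus> a)" using ac by (simp add: le_def)
  have "(\<one> \<ominus> a) \<ominus> (a \<ominus> a \<otimes> a) = (\<one> \<ominus> a) \<otimes> (\<one> \<ominus> a)" using ac by algebra
  moreover have "Pos ((\<one> \<ominus> a) \<otimes> (\<one> \<ominus> a))" using p by (intro Pos_square) auto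
  ultimately show "le (a \<ominus> a \<otimes> a) (\<one> \<ominus> a)" using ac by (simp add: le_def)
qed

end

lemma finite_words: "finite {w :: 'd::finite list. length w = n}"
  using finite_lists_length_eq[of "UNIV :: 'd set" n] by simp

lemma (in star_alg) word_prod_closed: "(\<And>i. t i \<in> carrier A) \<Longrightarrow> word_prod A t w \<in> carrier A"
  by (induction w) auto

lemma (in star_alg) sum_words_Suc:
  fixes t :: "'d::finite \<Rightarrow> 'a"
  assumes t: "\<And>i. t i \<in> carrier A"
  shows "(\<Oplus>w\<in>{w. length w = Suc n}. word_prod A t w \<otimes> star A (word_prod A t w))
    = (\<Oplus>i\<in>UNIV. t i \<otimes> (\<Oplus>w\<in>{w. length w = n}. word_prod A t w \<otimes> star A (word_prod A t w)) \<otimes> star A (t i))"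
proof -
  let ?W = "word_prod A t" and ?L = "{w :: 'd list. length w = n}"
  have W: "?W w \<in> carrier A" for w by (rule word_prod_closed[OF t])
  have img: "{w :: 'd list. length w = Suc n} = (\<lambda>p. fst p # snd p) ` (UNIV \<times> ?L)"
    by (force simp: length_Suc_conv image_iff)
  have inj: "inj_on (\<lambda>p. fst p # snd p) (UNIV \<times> ?L)" by (auto simp: inj_on_def)
  have "(\<Oplus>w\<in>{w. length w = Suc n}. ?W w \<otimes> star A (?W w))
      = (\<Oplus>p\<in>UNIV \<times> ?L. ?W (fst p # snd p) \<otimes> star A (?W (fst p # snd p)))"
    unfolding img by (rule finsum_reindex[OF _ inj]) (use W t in \<open>auto intro!: m_closed\<close>)
  also have "\<dots> = (\<Oplus>i\<in>UNIV. \<Oplus>w\<in>?L. ?W (i # w) \<otimes> star A (?W (i # w)))"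
    using W t by (subst finsum_times) (auto simp: finite_words)
  also have "\<dots> = (\<Oplus>i\<in>UNIV. t i \<otimes> (\<Oplus>w\<in>?L. ?W w \<otimes> star A (?W w)) \<otimes> star A (t i))"
  proof (rule finsum_cong')
    fix i
    have "t i \<otimes> (\<Oplus>w\<in>?L. ?W w \<otimes> star A (?W w)) \<otimes> star A (t i)
        = (\<Oplus>w\<in>?L. t i \<otimes> (?W w \<otimes> star A (?W w))) \<otimes> star A (t i)"
      using W t finite_words by (subst finsum_rdistr) auto
    also have "\<dots> = (\<Oplus>w\<in>?L. t i \<otimes> (?W w \<otimes> star A (?W w)) \<otimes> star A (t i))"
      using W t finite_words by (intro finsum_ldistr) auto
    also have "\<dots> = (\<Oplus>w\<in>?L. ?W (i # w) \<otimes> star A (?W (i # w)))"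
      using W t by (intro finsum_cong') (auto simp: m_assoc)
    finally show "(\<Oplus>w\<in>?L. ?W (i # w) \<otimes> star A (?W (i # w))) = t i \<otimes> (\<Oplus>w\<in>?L. ?W w \<otimes> star A (?W w)) \<otimes> star A (t i)" ..
  qed (use W t in \<open>auto intro!: finsum_closed m_closed\<close>)
  finally show ?thesis .
qed

lemma (in cstar) sum_words_le_one:
  fixes t :: "'d::finite \<Rightarrow> 'a"
  assumes t: "\<And>i. t i \<in> carrier A" and le1: "le (\<Oplus>i\<in>UNIV. t i \<otimes> star A (t i)) \<one>"
  shows "le (\<Oplus>w\<in>{w. length w = n}. word_prod A t w \<otimes> star A (word_prod A t w)) \<one>"
proof (induction n)
  case 0
  have "{w :: 'd list. length w = 0} = {[]}" by auto
  then show ?case by (simp add: le_refl)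
next
  case (Suc n)
  let ?G = "\<Oplus>w\<in>{w. length w = n}. word_prod A t w \<otimes> star A (word_prod A t w)"
  have "le (\<Oplus>i\<in>UNIV. t i \<otimes> ?G \<otimes> star A (t i)) (\<Oplus>i\<in>UNIV. t i \<otimes> \<one> \<otimes> star A (t i))"
    using le_conj[OF Suc, of "star A (t i)" for i] t by (intro le_finsum) simp_all
  then have "le (\<Oplus>i\<in>UNIV. t i \<otimes> ?G \<otimes> star A (t i)) (\<Oplus>i\<in>UNIV. t i \<otimes> star A (t i))" using t by simp
  then show ?case unfolding sum_words_Suc[OF t] using le1 by (rule le_trans)
qed

text \<open>A word in the letters and their adjoints; the flag marks an adjoint.\<close>

primrec sword :: "('a, 'm) cstar_alg_scheme \<Rightarrow> ('d \<Rightarrow> 'a) \<Rightarrow> ('d \<times> bool) list \<Rightarrow> 'a" where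
  "sword A t [] = \<one>\<^sub>A"
| "sword A t (p # u) = (if snd p then star A (t (fst p)) else t (fst p)) \<otimes>\<^sub>A sword A t u"

text \<open>Formal *-polynomials, so that one and the same expression can be evaluated in
  \<open>C\<close> and in \<open>B\<close> before a map between these algebras exists.\<close>

primrec spoly :: "('a, 'm) cstar_alg_scheme \<Rightarrow> ('d \<Rightarrow> 'a) \<Rightarrow> (complex \<times> ('d \<times> bool) list) list \<Rightarrow> 'a" where
  "spoly A t [] = \<zero>\<^sub>A"
| "spoly A t (q # ps) = fst q \<odot>\<^sub>A sword A t (snd q) \<oplus>\<^sub>A spoly A t ps"

context star_alg
begin

lemma sword_closed: "(\<And>i. t i \<in> carrier A) \<Longrightarrow> sword A t u \<in> carrier A"
  by (induction u) auto

lemma spoly_closed: "(\<And>i. t i \<in> carrier A) \<Longrightarrow> spoly A t ps \<in> carrier A"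
  by (induction ps) (auto simp: sword_closed)

end

section \<open>Products of *-words with long words\<close>

context word_relations
begin

abbreviation X :: "('d \<times> bool) list \<Rightarrow> 'c" where "X \<equiv> sword C t"

lemma X_closed [simp]: "X u \<in> carrier C"
  by (simp add: sword_closed)

lemma sum_words: "(\<Oplus>w\<in>{w. length w = n}. W w \<otimes> star C (W w)) = \<one>"
proof (induction n)
  case 0
  have "{w :: 'd list. length w = 0} = {[]}" by auto
  then show ?case by simp
next
  case (Suc n)
  then show ?case unfolding sum_words_Suc[of t, OF t_closed] by (simp add: sum_ranges)
qed

text \<open>Recovers an element from its products with the words of one length, so that identities
  and norms can be tested on long words.\<close>

lemma sum_words_left:
  assumes a: "a \<in> carrier C" shows "(\<Oplus>w\<in>{w. length w = n}. (a \<otimes> W w) \<otimes> star C (W w)) = a"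
proof -
  have "a \<otimes> (\<Oplus>w\<in>{w. length w = n}. W w \<otimes> star C (W w)) = (\<Oplus>w\<in>{w. length w = n}. a \<otimes> (W w \<otimes> star C (W w)))"
    using a by (intro finsum_rdistr) (auto simp: finite_words)
  also have "\<dots> = (\<Oplus>w\<in>{w. length w = n}. (a \<otimes> W w) \<otimes> star C (W w))"
    using a by (intro finsum_cong') (auto simp: m_assoc)
  finally show ?thesis unfolding sum_words using a by simp
qed

text \<open>On the range of a word of length \<open>k\<close>, \<open>W v\<close> is isometric or
  zero by \<open>W_isometric\<close>, and these ranges add up to the unit.\<close>

lemma W_partial: "W v \<otimes> (star C (W v) \<otimes> W v) = W v"
proof -
  have "(W v \<otimes> (star C (W v) \<otimes> W v)) \<otimes> W u = W v \<otimes> W u" if "length u = k" for u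
    using W_isometric[of u v] that by (auto simp: m_assoc)
  then have "(\<Oplus>w\<in>{w. length w = k}. ((W v \<otimes> (star C (W v) \<otimes> W v)) \<otimes> W w) \<otimes> star C (W w))
      = (\<Oplus>w\<in>{w. length w = k}. (W v \<otimes> W w) \<otimes> star C (W w))"
    by (intro finsum_cong') auto
  then show ?thesis by (simp add: sum_words_left)
qed

text \<open>A letter is put in front of the current word, and an adjoint removes its first letter or
  gives zero. Since \<open>b\<close> is long, at least \<open>k\<close> letters always remain, so
  the relations apply at every step. None of these moves changes the source projection as long as
  the product is nonzero.\<close>

lemma X_times_W:
  assumes "k + length u \<le> length b"
  shows "X u \<otimes> W b = \<zero> \<or> (\<exists>w. X u \<otimes> W b = W w \<and> W w \<noteq> \<zero> \<and> length b \<le> length w + length u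
    \<and> star C (W w) \<otimes> W w = star C (W b) \<otimes> W b)"
  using assms
proof (induction u)
  case Nil
  then show ?case by auto
next
  case (Cons p u)
  obtain i f where p: "p = (i, f)" by fastforce
  show ?case
  proof (cases "X u \<otimes> W b = \<zero>")
    case True
    then have "X (p # u) \<otimes> W b = \<zero>" by (cases f) (simp_all add: p m_assoc)
    then show ?thesis ..
  next
    case False
    then obtain w where w: "X u \<otimes> W b = W w" "W w \<noteq> \<zero>" "length b \<le> length w + length u"
      "star C (W w) \<otimes> W w = star C (W b) \<otimes> W b" using Cons by auto
    \<comment> \<open>One letter may be stripped by \<open>p\<close>, and \<open>k\<close> letters
      must remain afterwards; the bound on the length of \<open>b\<close> includes
      \<open>p\<close>.\<close>
    have kw: "Suc k \<le> length w" using w(3) Cons.prems by simp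
    have Xp: "X (p # u) \<otimes> W b = (if f then star C (t i) else t i) \<otimes> W w"
      using w(1) by (simp add: p m_assoc)
    have source: "star C (W (l # v)) \<otimes> W (l # v) = star C (W v) \<otimes> W v" and un: "star C (t l) \<otimes> (t l \<otimes> W v) = W v"
      if "W (l # v) \<noteq> \<zero>" "k \<le> length v" for l v
    proof -
      show un: "star C (t l) \<otimes> (t l \<otimes> W v) = W v" using word_relation_ge[of v l] that by simp
      have "star C (W (l # v)) \<otimes> W (l # v) = star C (W v) \<otimes> (star C (t l) \<otimes> (t l \<otimes> W v))" by (simp add: m_assoc)
      then show "star C (W (l # v)) \<otimes> W (l # v) = star C (W v) \<otimes> W v" unfolding un .
    qed
    show ?thesis
    proof (cases f)
      case False
      then have eq: "X (p # u) \<otimes> W b = W (i # w)" using Xp by simp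
      show ?thesis
      proof (cases "W (i # w) = \<zero>")
        case False
        then have "star C (W (i # w)) \<otimes> W (i # w) = star C (W b) \<otimes> W b" using source[of i w] kw w(4) by simp
        moreover have "length b \<le> length (i # w) + length (p # u)" using w(3) by simp
        ultimately show ?thesis using eq False by blast
      qed (use eq in simp)
    next
      case True
      obtain l v where v: "w = l # v" using kw by (cases w) auto
      have kv: "k \<le> length v" using kw v by simp
      have eq: "X (p # u) \<otimes> W b = star C (t i) \<otimes> (t l \<otimes> W v)" using Xp True v by simp
      show ?thesis
      proof (cases "l = i")
        case True
        have "X (p # u) \<otimes> W b = W v" using eq un[of l v] w(2) v kv True by simp
        moreover have "W v \<noteq> \<zero>" using w(2) v by auto
        moreover have "star C (W v) \<otimes> W v = star C (W b) \<otimes> W b" using source[of l v] w(2,4) v kv by simp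
        moreover have "length b \<le> length v + length (p # u)" using w(3) v by simp
        ultimately show ?thesis by blast
      next
        case False
        have "star C (t i) \<otimes> (t l \<otimes> W v) = (star C (t i) \<otimes> t l) \<otimes> W v" by (simp add: m_assoc)
        also have "\<dots> = \<zero>" using orthogonal_ranges[of i l] False by simp
        finally show ?thesis unfolding eq by blast
      qed
    qed
  qed
qed

text \<open>Where the product vanishes there is nothing to control; the default
  \<open>\<one>\<close> satisfies \<open>xw_source\<close> and contributes no deficiency.\<close>

definition xw :: "('d \<times> bool) list \<Rightarrow> 'd list \<Rightarrow> 'c" where
  "xw u b = (if X u \<otimes> W b = \<zero> then \<one> else X u \<otimes> W b)"

lemma X_times_W_in_A: "k + length u \<le> length b \<Longrightarrow> X u \<otimes> W b \<in> A"
  using X_times_W[of u b] A_zero W_in_A by fastforce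

lemma xw_in_A: "k + length u \<le> length b \<Longrightarrow> xw u b \<in> A"
  using X_times_W_in_A A_one by (simp add: xw_def)

text \<open>A nonzero product has the same source projection as \<open>W b\<close> by
  \<open>X_times_W\<close>, and \<open>W b\<close> is a partial isometry.\<close>

lemma xw_source:
  assumes "k + length u \<le> length b"
  shows "star C (xw u b) \<otimes> (xw u b \<otimes> star C (W b)) = star C (W b)"
proof (cases "X u \<otimes> W b = \<zero>")
  case False
  then obtain w where w: "X u \<otimes> W b = W w" "star C (W w) \<otimes> W w = star C (W b) \<otimes> W b"
    using X_times_W[OF assms] by blast
  have "star C (W w) \<otimes> (W w \<otimes> star C (W b)) = (star C (W w) \<otimes> W w) \<otimes> star C (W b)" by (simp add: m_assoc)
  also have "\<dots> = star C (W b \<otimes> (star C (W b) \<otimes> W b))" unfolding w(2) by (simp add: m_assoc)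
  finally show ?thesis using w(1) False by (simp add: xw_def W_partial)
qed (simp add: xw_def)

lemma nrm_xw: "k + length u \<le> length b \<Longrightarrow> nrm C (xw u b) \<le> 1"
  using X_times_W[of u b] nrm_W nrm_one_le by (auto simp: xw_def)

lemma spoly_times_W_in_A:
  "(\<And>q. q \<in> set ps \<Longrightarrow> k + length (snd q) \<le> length b) \<Longrightarrow> spoly C t ps \<otimes> W b \<in> A"
proof (induction ps)
  case (Cons q ps)
  have "spoly C t (q # ps) \<otimes> W b = fst q \<odot> (X (snd q) \<otimes> W b) \<oplus> spoly C t ps \<otimes> W b"
    by (simp add: l_distr spoly_closed)
  moreover have "X (snd q) \<otimes> W b \<in> A" using Cons.prems[of q] by (intro X_times_W_in_A) simp
  ultimately show ?case using Cons by (auto intro!: A_add A_scal)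
qed (simp add: A_zero)

end

section \<open>The relations in a cover, up to domination\<close>

locale word_cover = word_relations C t k A + B: cstar B
  for C :: "('c, 'm) cstar_alg_scheme" (structure) and t :: "'d::finite \<Rightarrow> 'c" and k A
    and B :: "('b, 'n) cstar_alg_scheme" +
  fixes j :: "'c \<Rightarrow> 'b"
  assumes j_hom: "algebra_hom C A B j" and j_isometric: "completely_isometric C A B j"
    and B_generated: "generated_cstar B (j ` A) = carrier B"
begin

lemma j_closed [simp]: "x \<in> A \<Longrightarrow> j x \<in> carrier B"
  and j_add: "x \<in> A \<Longrightarrow> y \<in> A \<Longrightarrow> j (x \<oplus> y) = j x \<oplus>\<^sub>B j y"
  and j_mult: "x \<in> A \<Longrightarrow> y \<in> A \<Longrightarrow> j (x \<otimes> y) = j x \<otimes>\<^sub>B j y"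
  and j_scal: "x \<in> A \<Longrightarrow> j (c \<odot> x) = c \<odot>\<^sub>B j x"
  using j_hom by (auto simp: algebra_hom_def)

lemma j_zero [simp]: "j \<zero> = \<zero>\<^sub>B"
  using j_scal[OF A_zero, of 0] A_zero by simp

lemma j_nrm: assumes a: "a \<in> A" shows "nrm B (j a) = nrm C a"
proof -
  have "matrix_unit 0 0 a \<in> matrices_over C 1 A"
    using a A_zero by (simp add: matrix_unit_def matrices_over_def)
  then have "matrix_norm B 1 (matrix_map B 1 j (matrix_unit 0 0 a)) = matrix_norm C 1 (matrix_unit 0 0 a)"
    using j_isometric by (simp add: completely_isometric_def)
  moreover have "matrix_map B 1 j (matrix_unit 0 0 a) = B.matrix_unit 0 0 (j a)"
    by (intro matrix_map_unit star_alg_axioms B.star_alg_axioms) auto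
  ultimately show ?thesis using a by (simp add: matrix_norm_unit B.matrix_norm_unit)
qed

text \<open>The image of the unit is a contractive idempotent, hence a projection. The elements on
  which it acts as a unit form a C*-subalgebra that contains the image of \<open>A\<close> and
  therefore is all of \<open>B\<close>.\<close>

lemma j_one: "j \<one> = \<one>\<^sub>B"
proof -
  define e where "e = j \<one>"
  have e: "e \<in> carrier B" "e \<otimes>\<^sub>B e = e" "nrm B e \<le> 1"
    using A_one j_mult[of \<one> \<one>] j_nrm[of \<one>] nrm_one_le by (simp_all add: e_def)
  have se: "star B e = e" using B.nrm_contractive_idempotent_selfadj e by blast
  define S where "S = {b \<in> carrier B. e \<otimes>\<^sub>B b = b \<and> b \<otimes>\<^sub>B e = b}"
  have "cstar_subalgebra B S"
    unfolding cstar_subalgebra_def closed_subalgebra_def nrm_closed_def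
  proof (intro conjI ballI allI impI)
    fix x assume x: "x \<in> S"
    show "c \<odot>\<^sub>B x \<in> S" for c using x e by (simp add: S_def)
    have "e \<otimes>\<^sub>B star B x = star B x \<and> star B x \<otimes>\<^sub>B e = star B x"
      using x e(1) B.star_times[of e x] B.star_times[of x e] unfolding S_def mem_Collect_eq se by metis
    then show "star B x \<in> S" using x by (simp add: S_def)
    fix y assume y: "y \<in> S"
    show "x \<oplus>\<^sub>B y \<in> S" using x y e by (simp add: S_def B.l_distr B.r_distr)
    show "x \<otimes>\<^sub>B y \<in> S" using x y e B.m_assoc[of x y e] B.m_assoc[of e x y] by (simp add: S_def)
  next
    fix f x assume *: "(\<forall>n::nat. f n \<in> S) \<and> x \<in> carrier B \<and> (\<lambda>n. nrm B (f n \<ominus>\<^sub>B x)) \<longlonglongrightarrow> 0"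
    then have f: "\<And>n. f n \<in> carrier B" "\<And>n. e \<otimes>\<^sub>B f n = f n" "\<And>n. f n \<otimes>\<^sub>B e = f n" "B.cvg f x" and x: "x \<in> carrier B"
      by (auto simp: S_def B.cvg_def)
    have "B.cvg (\<lambda>n. e \<otimes>\<^sub>B f n) (e \<otimes>\<^sub>B x)"
      by (rule B.cvg_mult) (use f(1,4) x e in \<open>auto intro: B.cvg_const\<close>)
    moreover have "B.cvg (\<lambda>n. f n \<otimes>\<^sub>B e) (x \<otimes>\<^sub>B e)"
      by (rule B.cvg_mult) (use f(1,4) x e in \<open>auto intro: B.cvg_const\<close>)
    ultimately have "e \<otimes>\<^sub>B x = x" "x \<otimes>\<^sub>B e = x"
      unfolding f(2,3) using f(1,4) x e by (auto intro: B.cvg_unique)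
    then show "x \<in> S" using x by (simp add: S_def)
  qed (use e in \<open>auto simp: S_def\<close>)
  moreover have "j ` A \<subseteq> S"
    using A_one j_mult[of \<one>] j_mult[of _ \<one>] by (auto simp: S_def e_def simp flip: j_mult)
  ultimately have "carrier B \<subseteq> S"
    unfolding B_generated[symmetric] generated_cstar_def by (rule hull_minimal[rotated])
  then have "e \<otimes>\<^sub>B \<one>\<^sub>B = \<one>\<^sub>B" by (auto simp: S_def)
  then show ?thesis using e by (simp add: e_def)
qed

abbreviation s :: "'d \<Rightarrow> 'b" where "s i \<equiv> j (t i)"
abbreviation S :: "'d list \<Rightarrow> 'b" where "S \<equiv> word_prod B s"
abbreviation Y :: "('d \<times> bool) list \<Rightarrow> 'b" where "Y \<equiv> sword B s"

lemma s_closed [simp]: "s i \<in> carrier B"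
  by (simp add: A_t)

lemma S_closed [simp]: "S w \<in> carrier B"
  by (intro B.word_prod_closed) auto

lemma Y_closed [simp]: "Y u \<in> carrier B"
  by (intro B.sword_closed) auto

lemma j_W: "j (W w) = S w"
  by (induction w) (auto simp: j_one j_mult A_t W_in_A)

lemma nrm_S: "nrm B (S w) \<le> 1"
  using j_nrm[OF W_in_A, of w] nrm_W[of w] by (simp add: j_W)

lemma nrm_sum_j_le:
  assumes F: "finite F" and a: "\<And>b. b \<in> F \<Longrightarrow> a b \<in> A"
  shows "nrm B (\<Oplus>\<^bsub>B\<^esub>b\<in>F. j (a b) \<otimes>\<^sub>B star B (j (a b))) \<le> nrm C (\<Oplus>b\<in>F. a b \<otimes> star C (a b))"
proof -
  have "completely_contractive C A B j"
    using j_isometric by (auto simp: completely_isometric_def completely_contractive_def)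
  from completely_contractive_row[OF cstar_axioms B.cstar_axioms this A_carrier A_zero A_add j_zero j_closed j_add j_scal F a]
  show ?thesis .
qed

lemma sum_ranges_le: "B.le (\<Oplus>\<^bsub>B\<^esub>i\<in>UNIV. s i \<otimes>\<^sub>B star B (s i)) \<one>\<^sub>B"
proof -
  have "nrm B (\<Oplus>\<^bsub>B\<^esub>i\<in>UNIV. s i \<otimes>\<^sub>B star B (s i)) \<le> nrm C (\<Oplus>i\<in>UNIV. t i \<otimes> star C (t i))"
    by (rule nrm_sum_j_le) (auto simp: A_t)
  then have nrm: "nrm B (\<Oplus>\<^bsub>B\<^esub>i\<in>UNIV. s i \<otimes>\<^sub>B star B (s i)) \<le> 1" unfolding sum_ranges using nrm_one_le by simp
  have P: "B.Pos (\<Oplus>\<^bsub>B\<^esub>i\<in>UNIV. s i \<otimes>\<^sub>B star B (s i))" by (intro B.Pos_finsum B.Pos_mult_star) auto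
  then show ?thesis using B.Pos_const_minus[of _ 1] nrm B.Pos_closed[OF P] B.Pos_star[OF P] by (simp add: B.le_def)
qed

text \<open>Replaces the orthogonality of the ranges, which may be lost in \<open>B\<close>.\<close>

lemma ranges_le:
  assumes "i \<noteq> l" shows "B.le (s i \<otimes>\<^sub>B star B (s i)) (\<one>\<^sub>B \<ominus>\<^sub>B s l \<otimes>\<^sub>B star B (s l))"
proof -
  let ?f = "\<lambda>i. s i \<otimes>\<^sub>B star B (s i)"
  have P: "B.Pos (?f i)" for i by (intro B.Pos_mult_star) simp
  have "(UNIV :: 'd set) = insert l (UNIV - {l})" by auto
  then have "(\<Oplus>\<^bsub>B\<^esub>i\<in>UNIV. ?f i) = (\<Oplus>\<^bsub>B\<^esub>i\<in>insert l (UNIV - {l}). ?f i)" by simp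
  also have "\<dots> = ?f l \<oplus>\<^sub>B (\<Oplus>\<^bsub>B\<^esub>i\<in>UNIV - {l}. ?f i)" by (intro B.finsum_insert) auto
  finally have eq: "(\<Oplus>\<^bsub>B\<^esub>i\<in>UNIV. ?f i) = ?f l \<oplus>\<^sub>B (\<Oplus>\<^bsub>B\<^esub>i\<in>UNIV - {l}. ?f i)" .
  have R: "(\<Oplus>\<^bsub>B\<^esub>i\<in>UNIV - {l}. ?f i) \<in> carrier B" by (intro B.finsum_closed) auto
  have "B.le (?f i) (\<Oplus>\<^bsub>B\<^esub>i\<in>UNIV - {l}. ?f i)" using assms P by (intro B.le_finsum_single) auto
  also have "B.le (\<Oplus>\<^bsub>B\<^esub>i\<in>UNIV - {l}. ?f i) (\<one>\<^sub>B \<ominus>\<^sub>B ?f l)"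
  proof -
    have "x \<ominus>\<^sub>B (p \<oplus>\<^sub>B q) = (x \<ominus>\<^sub>B p) \<ominus>\<^sub>B q" if "x \<in> carrier B" "p \<in> carrier B" "q \<in> carrier B" for x p q
      using that by algebra
    then show ?thesis using sum_ranges_le R unfolding eq B.le_def by simp
  qed
  finally show ?thesis .
qed

text \<open>
  The relations of \<open>C\<close> may fail in \<open>B\<close>, but their failure is controlled by the failure of \<open>S (l # v)\<close>
  to be isometric.
\<close>

lemma dom_adjoint_step:
  assumes v: "k \<le> length v" "W (l # v) \<noteq> \<zero>"
  shows "B.dom (\<one>\<^sub>B \<ominus>\<^sub>B star B (S (l # v)) \<otimes>\<^sub>B S (l # v))
    (j (star C (t i) \<otimes> W (l # v)) \<ominus>\<^sub>B star B (s i) \<otimes>\<^sub>B S (l # v))"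
proof -
  define a where "a = star B (s l) \<otimes>\<^sub>B s l"
  have a: "B.Pos a" "a \<in> carrier B" unfolding a_def by (auto intro!: B.Pos_star_mult)
  have p: "B.Pos (\<one>\<^sub>B \<ominus>\<^sub>B a)"
    unfolding a_def using B.Pos_nrm_sq_minus[of "s l" 1] nrm_t[of l] by (simp add: j_nrm A_t)
  define \<eta> where "\<eta> = j (star C (t i) \<otimes> W (l # v)) \<ominus>\<^sub>B star B (s i) \<otimes>\<^sub>B S (l # v)"
  have rel: "star C (t l) \<otimes> (t l \<otimes> W v) = W v" using word_relation_ge[OF v(1), of l] v(2) by simp
  have 1: "\<eta> \<in> carrier B \<and> B.le (star B \<eta> \<otimes>\<^sub>B \<eta>) (star B (S v) \<otimes>\<^sub>B (\<one>\<^sub>B \<ominus>\<^sub>B a) \<otimes>\<^sub>B S v)"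
  proof (cases "i = l")
    case True
    have 1: "\<eta> = S v \<ominus>\<^sub>B a \<otimes>\<^sub>B S v" using True rel by (simp add: \<eta>_def a_def j_W B.m_assoc)
    have "x \<ominus>\<^sub>B a \<otimes>\<^sub>B x = (\<one>\<^sub>B \<ominus>\<^sub>B a) \<otimes>\<^sub>B x" if "x \<in> carrier B" for x
      using a(2) that by algebra
    then have "S v \<ominus>\<^sub>B a \<otimes>\<^sub>B S v = (\<one>\<^sub>B \<ominus>\<^sub>B a) \<otimes>\<^sub>B S v" by simp
    with 1 have \<eta>: "\<eta> = (\<one>\<^sub>B \<ominus>\<^sub>B a) \<otimes>\<^sub>B S v" by simp
    have "star B \<eta> \<otimes>\<^sub>B \<eta> = star B (S v) \<otimes>\<^sub>B ((\<one>\<^sub>B \<ominus>\<^sub>B a) \<otimes>\<^sub>B (\<one>\<^sub>B \<ominus>\<^sub>B a)) \<otimes>\<^sub>B S v"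
      unfolding \<eta> using a p by (simp add: B.m_assoc)
    then show ?thesis
      using B.le_conj[OF B.le_one_minus(1)[OF a(1) p], of "S v"] \<eta> a(2) by simp
  next
    case False
    have "star C (t i) \<otimes> W (l # v) = (star C (t i) \<otimes> t l) \<otimes> W v" by (simp add: m_assoc)
    then have "star C (t i) \<otimes> W (l # v) = \<zero>" using orthogonal_ranges False by simp
    then have \<eta>: "\<eta> = \<ominus>\<^sub>B (star B (s i) \<otimes>\<^sub>B (s l \<otimes>\<^sub>B S v))" by (simp add: \<eta>_def B.minus_eq)
    have e1: "star B (\<ominus>\<^sub>B (star B x \<otimes>\<^sub>B (y \<otimes>\<^sub>B z))) \<otimes>\<^sub>B (\<ominus>\<^sub>B (star B x \<otimes>\<^sub>B (y \<otimes>\<^sub>B z)))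
        = star B (y \<otimes>\<^sub>B z) \<otimes>\<^sub>B (x \<otimes>\<^sub>B star B x) \<otimes>\<^sub>B (y \<otimes>\<^sub>B z)"
      and e2: "star B (y \<otimes>\<^sub>B z) \<otimes>\<^sub>B (\<one>\<^sub>B \<ominus>\<^sub>B y \<otimes>\<^sub>B star B y) \<otimes>\<^sub>B (y \<otimes>\<^sub>B z)
        = star B z \<otimes>\<^sub>B (star B y \<otimes>\<^sub>B y \<ominus>\<^sub>B (star B y \<otimes>\<^sub>B y) \<otimes>\<^sub>B (star B y \<otimes>\<^sub>B y)) \<otimes>\<^sub>B z"
      if "x \<in> carrier B" "y \<in> carrier B" "z \<in> carrier B" for x y z using that by algebra+
    have c1: "star B \<eta> \<otimes>\<^sub>B \<eta> = star B (s l \<otimes>\<^sub>B S v) \<otimes>\<^sub>B (s i \<otimes>\<^sub>B star B (s i)) \<otimes>\<^sub>B (s l \<otimes>\<^sub>B S v)"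
      unfolding \<eta> by (rule e1) auto
    have c2: "star B (s l \<otimes>\<^sub>B S v) \<otimes>\<^sub>B (\<one>\<^sub>B \<ominus>\<^sub>B s l \<otimes>\<^sub>B star B (s l)) \<otimes>\<^sub>B (s l \<otimes>\<^sub>B S v)
        = star B (S v) \<otimes>\<^sub>B (a \<ominus>\<^sub>B a \<otimes>\<^sub>B a) \<otimes>\<^sub>B S v"
      unfolding a_def by (rule e2) auto
    \<comment> \<open>By \<open>ranges_le\<close> the range projection of \<open>s i\<close> may be
      replaced by \<open>\<one>\<^sub>B \<ominus>\<^sub>B s l \<otimes>\<^sub>B star B (s
      l)\<close>, which leaves a polynomial in \<open>a\<close> between the two copies of
      \<open>S v\<close>.\<close>
    have "B.le (star B \<eta> \<otimes>\<^sub>B \<eta>) (star B (S v) \<otimes>\<^sub>B (a \<ominus>\<^sub>B a \<otimes>\<^sub>B a) \<otimes>\<^sub>B S v)"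
      unfolding c1 c2[symmetric] using ranges_le[OF False] by (rule B.le_conj) auto
    then have "B.le (star B \<eta> \<otimes>\<^sub>B \<eta>) (star B (S v) \<otimes>\<^sub>B (\<one>\<^sub>B \<ominus>\<^sub>B a) \<otimes>\<^sub>B S v)"
      by (rule B.le_trans) (intro B.le_conj B.le_one_minus a p S_closed)
    then show ?thesis using \<eta> by simp
  qed
  \<comment> \<open>In both cases the error is bounded by what is lost when the letter
    \<open>l\<close> is put in front of \<open>v\<close>, and this loss is part of the deficiency of
    the whole word.\<close>
  have 2: "star B (S v) \<otimes>\<^sub>B (\<one>\<^sub>B \<ominus>\<^sub>B a) \<otimes>\<^sub>B S v
      = star B (S v) \<otimes>\<^sub>B S v \<ominus>\<^sub>B star B (S (l # v)) \<otimes>\<^sub>B S (l # v)"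
  proof -
    have "star B z \<otimes>\<^sub>B (\<one>\<^sub>B \<ominus>\<^sub>B star B y \<otimes>\<^sub>B y) \<otimes>\<^sub>B z
        = star B z \<otimes>\<^sub>B z \<ominus>\<^sub>B star B (y \<otimes>\<^sub>B z) \<otimes>\<^sub>B (y \<otimes>\<^sub>B z)" if "y \<in> carrier B" "z \<in> carrier B" for y z
      using that by algebra
    then show ?thesis by (simp add: a_def)
  qed
  have 3: "B.le (star B (S v) \<otimes>\<^sub>B S v \<ominus>\<^sub>B star B (S (l # v)) \<otimes>\<^sub>B S (l # v))
      (\<one>\<^sub>B \<ominus>\<^sub>B star B (S (l # v)) \<otimes>\<^sub>B S (l # v))"
  proof -
    have "B.le (star B (S v) \<otimes>\<^sub>B S v) \<one>\<^sub>B" using B.le_star_mult_const[OF _ nrm_S[of v]] by simp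
    then have "B.le (star B (S v) \<otimes>\<^sub>B S v \<oplus>\<^sub>B \<ominus>\<^sub>B (star B (S (l # v)) \<otimes>\<^sub>B S (l # v)))
        (\<one>\<^sub>B \<oplus>\<^sub>B \<ominus>\<^sub>B (star B (S (l # v)) \<otimes>\<^sub>B S (l # v)))"
      using B.m_closed[OF B.star_cl[OF S_closed] S_closed, of "l # v" "l # v"] by (intro B.le_add B.le_refl) auto
    then show ?thesis by (simp only: B.minus_eq)
  qed
  have 4: "B.le (star B \<eta> \<otimes>\<^sub>B \<eta>) (\<one>\<^sub>B \<ominus>\<^sub>B star B (S (l # v)) \<otimes>\<^sub>B S (l # v))"
    by (rule B.le_trans[OF conjunct2[OF 1, unfolded 2] 3])
  have "B.dom (\<one>\<^sub>B \<ominus>\<^sub>B star B (S (l # v)) \<otimes>\<^sub>B S (l # v)) \<eta>"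
    by (rule B.domI[OF conjunct1[OF 1] zero_le_one]) (use 4 B.le_closed(2)[OF 4] in \<open>simp only: of_real_1 B.scal_1\<close>)
  then show ?thesis by (simp only: \<eta>_def)
qed

text \<open>Sums over all *-words up to length \<open>N\<close>, so that it dominates the errors of
  all *-polynomials of degree at most \<open>N\<close> at once.\<close>

definition deficiency :: "nat \<Rightarrow> 'd list \<Rightarrow> 'b" where
  "deficiency N b = (\<Oplus>\<^bsub>B\<^esub>u\<in>{u. length u \<le> N}. \<one>\<^sub>B \<ominus>\<^sub>B star B (j (xw u b)) \<otimes>\<^sub>B j (xw u b))"

lemma finite_swords: "finite {u :: ('d \<times> bool) list. length u \<le> N}"
  using finite_lists_length_le[of "UNIV :: ('d \<times> bool) set" N] by simp

lemma deficiency_ge: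
  assumes b: "k + N \<le> length b" and u: "length u \<le> N"
  shows "B.le (\<one>\<^sub>B \<ominus>\<^sub>B star B (j (xw u b)) \<otimes>\<^sub>B j (xw u b)) (deficiency N b)"
  unfolding deficiency_def
proof (rule B.le_finsum_single[OF finite_swords])
  fix u' :: "('d \<times> bool) list" assume "u' \<in> {u. length u \<le> N}"
  then have "xw u' b \<in> A" "nrm C (xw u' b) \<le> 1" using xw_in_A[of u' b] nrm_xw[of u' b] b by auto
  then show "B.Pos (\<one>\<^sub>B \<ominus>\<^sub>B star B (j (xw u' b)) \<otimes>\<^sub>B j (xw u' b))"
    using B.Pos_nrm_sq_minus[of "j (xw u' b)" 1] by (simp add: j_nrm)
qed (use u in simp)

lemma deficiency_closed: "k + N \<le> length b \<Longrightarrow> deficiency N b \<in> carrier B"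
  using B.le_closed(2)[OF deficiency_ge[of N b "[]"]] by simp

text \<open>Only adjoints create new error, since \<open>j\<close> is multiplicative on
  \<open>A\<close>. For an adjoint the error is the one made by this step at the word equal to
  \<open>X u \<otimes> W b\<close>, plus the earlier error multiplied from the left.\<close>

lemma dom_sword:
  assumes b: "k + N \<le> length b" and "length u \<le> N"
  shows "B.dom (deficiency N b) (j (X u \<otimes> W b) \<ominus>\<^sub>B Y u \<otimes>\<^sub>B S b)"
  using assms(2)
proof (induction u)
  case Nil
  then show ?case using deficiency_closed[OF b] by (simp add: j_W B.minus_eq B.r_neg B.dom_zero)
next
  case (Cons p u)
  obtain i f where p: "p = (i, f)" by fastforce
  have IH: "B.dom (deficiency N b) (j (X u \<otimes> W b) \<ominus>\<^sub>B Y u \<otimes>\<^sub>B S b)" using Cons by simp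
  have XA: "X u \<otimes> W b \<in> A" using Cons.prems b by (intro X_times_W_in_A) simp
  have dist: "c \<otimes>\<^sub>B (x \<ominus>\<^sub>B y \<otimes>\<^sub>B z) = c \<otimes>\<^sub>B x \<ominus>\<^sub>B c \<otimes>\<^sub>B y \<otimes>\<^sub>B z"
    if "c \<in> carrier B" "x \<in> carrier B" "y \<in> carrier B" "z \<in> carrier B" for c x y z using that by algebra
  show ?case
  proof (cases f)
    case False
    have "j (X (p # u) \<otimes> W b) = s i \<otimes>\<^sub>B j (X u \<otimes> W b)"
      using XA A_t False by (simp add: p m_assoc j_mult)
    then have "j (X (p # u) \<otimes> W b) \<ominus>\<^sub>B Y (p # u) \<otimes>\<^sub>B S b = s i \<otimes>\<^sub>B (j (X u \<otimes> W b) \<ominus>\<^sub>B Y u \<otimes>\<^sub>B S b)"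
      using XA False by (simp add: p dist)
    then show ?thesis using B.dom_mult_left[OF IH _ deficiency_closed[OF b], of "s i"] by simp
  next
    case True
    have Xp: "X (p # u) \<otimes> W b = star C (t i) \<otimes> (X u \<otimes> W b)" using True by (simp add: p m_assoc)
    have Yp: "Y (p # u) = star B (s i) \<otimes>\<^sub>B Y u" using True by (simp add: p)
    have main: "B.dom (deficiency N b) (star B (s i) \<otimes>\<^sub>B (j (X u \<otimes> W b) \<ominus>\<^sub>B Y u \<otimes>\<^sub>B S b))"
      by (rule B.dom_mult_left[OF IH _ deficiency_closed[OF b]]) simp
    show ?thesis
    proof (cases "X u \<otimes> W b = \<zero>")
      case True
      have "j (X (p # u) \<otimes> W b) \<ominus>\<^sub>B Y (p # u) \<otimes>\<^sub>B S b = star B (s i) \<otimes>\<^sub>B (j (X u \<otimes> W b) \<ominus>\<^sub>B Y u \<otimes>\<^sub>B S b)"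
        unfolding Xp Yp True by (simp add: dist)
      then show ?thesis using main by simp
    next
      case False
      then obtain w where w: "X u \<otimes> W b = W w" "W w \<noteq> \<zero>" "length b \<le> length w + length u"
        using X_times_W[of u b] Cons.prems b by auto
      then have "Suc k \<le> length w" using Cons.prems b by simp
      then obtain l v where v: "w = l # v" "k \<le> length v" by (cases w) auto
      have "B.dom (\<one>\<^sub>B \<ominus>\<^sub>B star B (S w) \<otimes>\<^sub>B S w) (j (star C (t i) \<otimes> W w) \<ominus>\<^sub>B star B (s i) \<otimes>\<^sub>B S w)"
        using dom_adjoint_step[of v l i] v w(2) by blast
      \<comment> \<open>\<open>W w\<close> is \<open>xw u b\<close>, so its deficiency is one of the
        summands.\<close>
      moreover have "B.le (\<one>\<^sub>B \<ominus>\<^sub>B star B (S w) \<otimes>\<^sub>B S w) (deficiency N b)"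
        using deficiency_ge[OF b, of u] Cons.prems w(1,2) by (simp add: xw_def j_W)
      ultimately have \<eta>: "B.dom (deficiency N b) (j (star C (t i) \<otimes> W w) \<ominus>\<^sub>B star B (s i) \<otimes>\<^sub>B S w)"
        by (rule B.dom_mono)
      have jw: "j (star C (t i) \<otimes> W w) \<in> carrier B"
        using X_times_W_in_A[of "p # u" b] Cons.prems b unfolding Xp w(1) by simp
      have "x \<ominus>\<^sub>B c \<otimes>\<^sub>B y \<otimes>\<^sub>B z = (x \<ominus>\<^sub>B c \<otimes>\<^sub>B q) \<oplus>\<^sub>B c \<otimes>\<^sub>B (q \<ominus>\<^sub>B y \<otimes>\<^sub>B z)"
        if "c \<in> carrier B" "x \<in> carrier B" "y \<in> carrier B" "z \<in> carrier B" "q \<in> carrier B" for c x y z q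
        using that by algebra
      from this[of "star B (s i)" "j (star C (t i) \<otimes> W w)" "Y u" "S b" "S w"]
      have "j (X (p # u) \<otimes> W b) \<ominus>\<^sub>B Y (p # u) \<otimes>\<^sub>B S b
          = (j (star C (t i) \<otimes> W w) \<ominus>\<^sub>B star B (s i) \<otimes>\<^sub>B S w) \<oplus>\<^sub>B star B (s i) \<otimes>\<^sub>B (j (X u \<otimes> W b) \<ominus>\<^sub>B Y u \<otimes>\<^sub>B S b)"
        unfolding Xp Yp w(1) j_W using jw by simp
      then show ?thesis using B.dom_add[OF \<eta> main deficiency_closed[OF b]] by simp
    qed
  qed
qed

lemma dom_spoly:
  assumes b: "k + N \<le> length b" and "\<And>q. q \<in> set ps \<Longrightarrow> length (snd q) \<le> N"
  shows "B.dom (deficiency N b) (j (spoly C t ps \<otimes> W b) \<ominus>\<^sub>B spoly B s ps \<otimes>\<^sub>B S b)"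
  using assms(2)
proof (induction ps)
  case Nil
  then show ?case using deficiency_closed[OF b] by (simp add: B.minus_eq B.dom_zero)
next
  case (Cons q ps)
  have A1: "X (snd q) \<otimes> W b \<in> A" using Cons.prems[of q] b by (intro X_times_W_in_A) simp
  have A2: "spoly C t ps \<otimes> W b \<in> A" by (rule spoly_times_W_in_A) (use Cons.prems b in fastforce)
  have p: "spoly C t ps \<in> carrier C" "spoly B s ps \<in> carrier B" by (simp_all add: spoly_closed B.spoly_closed)
  have "spoly C t (q # ps) \<otimes> W b = fst q \<odot> (X (snd q) \<otimes> W b) \<oplus> spoly C t ps \<otimes> W b"
    using p by (simp add: l_distr)
  then have 1: "j (spoly C t (q # ps) \<otimes> W b) = fst q \<odot>\<^sub>B j (X (snd q) \<otimes> W b) \<oplus>\<^sub>B j (spoly C t ps \<otimes> W b)"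
    using A1 A2 A_scal by (simp add: j_add j_scal)
  have "(c \<odot>\<^sub>B x \<oplus>\<^sub>B y) \<ominus>\<^sub>B (c \<odot>\<^sub>B u \<oplus>\<^sub>B v) \<otimes>\<^sub>B z = c \<odot>\<^sub>B (x \<ominus>\<^sub>B u \<otimes>\<^sub>B z) \<oplus>\<^sub>B (y \<ominus>\<^sub>B v \<otimes>\<^sub>B z)"
    if "x \<in> carrier B" "y \<in> carrier B" "u \<in> carrier B" "v \<in> carrier B" "z \<in> carrier B" for c x y u v z
    using that by algebra
  then have "j (spoly C t (q # ps) \<otimes> W b) \<ominus>\<^sub>B spoly B s (q # ps) \<otimes>\<^sub>B S b
      = fst q \<odot>\<^sub>B (j (X (snd q) \<otimes> W b) \<ominus>\<^sub>B Y (snd q) \<otimes>\<^sub>B S b) \<oplus>\<^sub>B (j (spoly C t ps \<otimes> W b) \<ominus>\<^sub>B spoly B s ps \<otimes>\<^sub>B S b)"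
    unfolding 1 using A1 A2 p by simp
  moreover have "B.dom (deficiency N b) (fst q \<odot>\<^sub>B (j (X (snd q) \<otimes> W b) \<ominus>\<^sub>B Y (snd q) \<otimes>\<^sub>B S b))"
    using dom_sword[OF b, of "snd q"] Cons.prems deficiency_closed[OF b] by (intro B.dom_scal) auto
  moreover have "B.dom (deficiency N b) (j (spoly C t ps \<otimes> W b) \<ominus>\<^sub>B spoly B s ps \<otimes>\<^sub>B S b)"
    using Cons by auto
  ultimately show ?case using B.dom_add[OF _ _ deficiency_closed[OF b]] by simp
qed

lemma nrm_sum_words_le: "nrm B (\<Oplus>\<^bsub>B\<^esub>w\<in>{w. length w = n}. S w \<otimes>\<^sub>B star B (S w)) \<le> 1"
proof -
  have "B.Pos (\<Oplus>\<^bsub>B\<^esub>w\<in>{w. length w = n}. S w \<otimes>\<^sub>B star B (S w))"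
    by (intro B.Pos_finsum B.Pos_mult_star) (auto simp: finite_words)
  moreover have "B.le (\<Oplus>\<^bsub>B\<^esub>w\<in>{w. length w = n}. S w \<otimes>\<^sub>B star B (S w)) \<one>\<^sub>B"
    by (rule B.sum_words_le_one[OF _ sum_ranges_le]) simp
  ultimately show ?thesis using B.Pos_le_const_nrm[of _ 1] by (simp add: B.le_def)
qed

lemma ex_degree_bound:
  obtains N where "\<And>q. q \<in> set ps \<Longrightarrow> length (snd q) \<le> (N :: nat)"
proof (rule that)
  fix q assume "q \<in> set ps"
  then show "length (snd q) \<le> sum_list (map (\<lambda>q. length (snd q)) ps)"
    by (intro member_le_sum_list) auto
qed

text \<open>Tested on words of length \<open>k + N\<close>: a *-word of length at most
  \<open>N\<close> removes at most \<open>N\<close> letters, and \<open>k\<close> letters remain for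
  the relations.\<close>

lemma nrm_spoly_le: "nrm C (spoly C t ps) \<le> nrm B (spoly B s ps)"
proof -
  obtain N where N: "\<And>q. q \<in> set ps \<Longrightarrow> length (snd q) \<le> N" using ex_degree_bound by blast
  show ?thesis
  proof (rule nrm_le_if_approximate_factorization[OF cstar_axioms B.cstar_axioms j_hom j_isometric A_carrier A_zero A_add A_scal
        finite_words[of "k + N"] finite_swords[of N], where W = W and a = "\<lambda>b. spoly C t ps \<otimes> W b" and z = xw and s = S])
    show "(\<Oplus>w\<in>{w. length w = k + N}. W w \<otimes> star C (W w)) = \<one>" by (rule sum_words)
    show "(\<Oplus>b\<in>{b. length b = k + N}. spoly C t ps \<otimes> W b \<otimes> star C (W b)) = spoly C t ps"
      by (rule sum_words_left) (simp add: spoly_closed)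
    show "nrm B (\<Oplus>\<^bsub>B\<^esub>w\<in>{w. length w = k + N}. S w \<otimes>\<^sub>B star B (S w)) \<le> 1" by (rule nrm_sum_words_le)
    fix b :: "'d list" assume "b \<in> {b. length b = k + N}"
    then have b: "length b = k + N" by simp
    show "spoly C t ps \<otimes> W b \<in> A" by (rule spoly_times_W_in_A) (use N b in auto)
    show "B.dom (\<Oplus>\<^bsub>B\<^esub>l\<in>{u. length u \<le> N}. \<one>\<^sub>B \<ominus>\<^sub>B star B (j (xw l b)) \<otimes>\<^sub>B j (xw l b))
        (j (spoly C t ps \<otimes> W b) \<ominus>\<^sub>B spoly B s ps \<otimes>\<^sub>B S b)"
      using dom_spoly[of N b ps] N b by (simp add: deficiency_def)
    fix u :: "('d \<times> bool) list" assume "u \<in> {u. length u \<le> N}"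
    then have u: "k + length u \<le> length b" using b by simp
    show "xw u b \<in> A" "star C (xw u b) \<otimes> (xw u b \<otimes> star C (W b)) = star C (W b)" "nrm B (j (xw u b)) \<le> 1"
      using xw_in_A[OF u] xw_source[OF u] nrm_xw[OF u] by (auto simp: j_nrm)
  qed (auto simp: B.spoly_closed)
qed

end

text \<open>Cauchy-Schwarz for rows. With \<open>y\<close> the pairing of the two rows,
  \<open>L\<close> is the positive element formed from the
  \<open>a b \<ominus> y \<otimes> c b\<close>, and \<open>H \<ominus> y \<otimes> star A y\<close>
  is the sum of \<open>L\<close> and
  \<open>y \<otimes> (\<one> \<ominus> G) \<otimes> star A y\<close>.\<close>

lemma (in cstar) nrm_sum_mult_star_le:
  assumes F: "finite F" and a: "\<And>b. b \<in> F \<Longrightarrow> a b \<in> carrier A" and c: "\<And>b. b \<in> F \<Longrightarrow> c b \<in> carrier A"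
    and le1: "le (\<Oplus>b\<in>F. c b \<otimes> star A (c b)) \<one>"
  shows "(nrm A (\<Oplus>b\<in>F. a b \<otimes> star A (c b)))\<^sup>2 \<le> nrm A (\<Oplus>b\<in>F. a b \<otimes> star A (a b))"
proof -
  define y where "y = (\<Oplus>b\<in>F. a b \<otimes> star A (c b))"
  define G where "G = (\<Oplus>b\<in>F. c b \<otimes> star A (c b))"
  define H where "H = (\<Oplus>b\<in>F. a b \<otimes> star A (a b))"
  define L where "L = (\<Oplus>b\<in>F. (a b \<ominus> y \<otimes> c b) \<otimes> star A (a b \<ominus> y \<otimes> c b))"
  have y: "y \<in> carrier A" using a c by (auto simp: y_def intro!: finsum_closed)
  have G: "G \<in> carrier A" using c by (auto simp: G_def intro!: finsum_closed)
  have H: "H \<in> carrier A" using a by (auto simp: H_def intro!: finsum_closed)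
  have L: "Pos L" unfolding L_def using a c y F by (intro Pos_finsum Pos_mult_star) auto
  have ys: "star A y = (\<Oplus>b\<in>F. c b \<otimes> star A (a b))"
  proof -
    have "star A y = (\<Oplus>b\<in>F. star A (a b \<otimes> star A (c b)))" unfolding y_def using F a c by (intro star_finsum) auto
    also have "\<dots> = (\<Oplus>b\<in>F. c b \<otimes> star A (a b))" using a c by (intro finsum_cong') auto
    finally show ?thesis .
  qed
  have term_eq: "(x \<ominus> y \<otimes> z) \<otimes> star A (x \<ominus> y \<otimes> z) \<oplus> ((x \<otimes> star A z) \<otimes> star A y \<oplus> y \<otimes> (z \<otimes> star A x))
      = x \<otimes> star A x \<oplus> y \<otimes> (z \<otimes> star A z) \<otimes> star A y" if "x \<in> carrier A" "z \<in> carrier A" for x z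
    using that y by algebra
  have s1: "y \<otimes> star A y = (\<Oplus>b\<in>F. (a b \<otimes> star A (c b)) \<otimes> star A y)"
    using F a c y by (subst (1) y_def) (intro finsum_ldistr, auto)
  have s2: "y \<otimes> star A y = (\<Oplus>b\<in>F. y \<otimes> (c b \<otimes> star A (a b)))"
    unfolding ys using F a c y by (intro finsum_rdistr) auto
  have s3: "y \<otimes> G \<otimes> star A y = (\<Oplus>b\<in>F. y \<otimes> (c b \<otimes> star A (c b)) \<otimes> star A y)"
  proof -
    have "y \<otimes> G = (\<Oplus>b\<in>F. y \<otimes> (c b \<otimes> star A (c b)))" unfolding G_def using F c y by (intro finsum_rdistr) auto
    then show ?thesis using F c y by (simp only:) (intro finsum_ldistr, auto)
  qed
  have "L \<oplus> (y \<otimes> star A y \<oplus> y \<otimes> star A y)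
      = (\<Oplus>b\<in>F. (a b \<ominus> y \<otimes> c b) \<otimes> star A (a b \<ominus> y \<otimes> c b)
          \<oplus> ((a b \<otimes> star A (c b)) \<otimes> star A y \<oplus> y \<otimes> (c b \<otimes> star A (a b))))"
  proof -
    have "y \<otimes> star A y \<oplus> y \<otimes> star A y
        = (\<Oplus>b\<in>F. (a b \<otimes> star A (c b)) \<otimes> star A y) \<oplus> (\<Oplus>b\<in>F. y \<otimes> (c b \<otimes> star A (a b)))"
      using s1 s2 by simp
    also have "\<dots> = (\<Oplus>b\<in>F. (a b \<otimes> star A (c b)) \<otimes> star A y \<oplus> y \<otimes> (c b \<otimes> star A (a b)))"
      using a c y by (intro finsum_addf[symmetric]) auto
    finally have *: "y \<otimes> star A y \<oplus> y \<otimes> star A y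
      = (\<Oplus>b\<in>F. (a b \<otimes> star A (c b)) \<otimes> star A y \<oplus> y \<otimes> (c b \<otimes> star A (a b)))" .
    show ?thesis unfolding * L_def using a c y by (intro finsum_addf[symmetric]) auto
  qed
  also have "\<dots> = (\<Oplus>b\<in>F. a b \<otimes> star A (a b) \<oplus> y \<otimes> (c b \<otimes> star A (c b)) \<otimes> star A y)"
    using a c y by (intro finsum_cong' term_eq) auto
  also have "\<dots> = H \<oplus> y \<otimes> G \<otimes> star A y"
    unfolding s3 H_def using a c y by (intro finsum_addf) auto
  finally have eq: "L \<oplus> (y \<otimes> star A y \<oplus> y \<otimes> star A y) = H \<oplus> y \<otimes> G \<otimes> star A y" .
  have mv: "h \<ominus> p = l \<oplus> (p \<ominus> r)" if "l \<oplus> (p \<oplus> p) = h \<oplus> r" "l \<in> carrier A" "p \<in> carrier A" "h \<in> carrier A" "r \<in> carrier A" for l p h r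
  proof -
    have "h \<ominus> p = (h \<oplus> r) \<ominus> p \<ominus> r" using that(2-) by algebra
    also have "\<dots> = l \<oplus> (p \<ominus> r)" unfolding that(1)[symmetric] using that(2-) by algebra
    finally show ?thesis .
  qed
  have "H \<ominus> y \<otimes> star A y = L \<oplus> (y \<otimes> star A y \<ominus> y \<otimes> G \<otimes> star A y)"
    by (rule mv[OF eq]) (use L y G H in auto)
  moreover have "Pos (y \<otimes> star A y \<ominus> y \<otimes> G \<otimes> star A y)"
    using le_conj[OF le1, of "star A y"] y by (simp add: le_def G_def)
  ultimately have "Pos (H \<ominus> y \<otimes> star A y)" using L by (simp add: Pos_add)
  then have "nrm A (y \<otimes> star A y) \<le> nrm A H" using y H by (intro nrm_Pos_mono Pos_mult_star)
  then show ?thesis using y by (simp add: nrm_eq_cstar' y_def H_def)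
qed

section \<open>Operations on *-polynomials\<close>

definition scal_poly :: "complex \<Rightarrow> (complex \<times> ('d \<times> bool) list) list \<Rightarrow> (complex \<times> ('d \<times> bool) list) list" where
  "scal_poly c ps = map (\<lambda>q. (c * fst q, snd q)) ps"

definition mult_poly ::
    "(complex \<times> ('d \<times> bool) list) list \<Rightarrow> (complex \<times> ('d \<times> bool) list) list \<Rightarrow> (complex \<times> ('d \<times> bool) list) list" where
  "mult_poly ps qs = concat (map (\<lambda>p. map (\<lambda>q. (fst p * fst q, snd p @ snd q)) qs) ps)"

definition star_poly :: "(complex \<times> ('d \<times> bool) list) list \<Rightarrow> (complex \<times> ('d \<times> bool) list) list" where
  "star_poly ps = map (\<lambda>q. (cnj (fst q), rev (map (\<lambda>p. (fst p, \<not> snd p)) (snd q)))) ps"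

context star_alg
begin

context
  fixes t :: "'d \<Rightarrow> 'a" assumes t: "\<And>i. t i \<in> carrier A"
begin

lemma poly_closed: "sword A t u \<in> carrier A" "spoly A t ps \<in> carrier A"
  by (simp_all add: sword_closed[OF t] spoly_closed[OF t])

lemma sword_append: "sword A t (u @ v) = sword A t u \<otimes> sword A t v"
  by (induction u) (simp_all add: t poly_closed m_assoc)

lemma spoly_append: "spoly A t (ps @ qs) = spoly A t ps \<oplus> spoly A t qs"
  by (induction ps) (simp_all add: poly_closed a_assoc)

lemma spoly_scal: "spoly A t (scal_poly c ps) = c \<odot> spoly A t ps"
  by (induction ps) (simp_all add: scal_poly_def poly_closed scal_add_right)

lemma spoly_mult: "spoly A t (mult_poly ps qs) = spoly A t ps \<otimes> spoly A t qs"
proof (induction ps)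
  case (Cons p ps)
  have "spoly A t (map (\<lambda>q. (fst p * fst q, snd p @ snd q)) qs) = fst p \<odot> sword A t (snd p) \<otimes> spoly A t qs"
    by (induction qs) (simp_all add: poly_closed sword_append scal_add_right r_distr mult.commute[of "fst p"])
  then show ?case using Cons by (simp add: mult_poly_def spoly_append poly_closed l_distr)
qed (simp add: mult_poly_def poly_closed)

lemma sword_star: "sword A t (rev (map (\<lambda>p. (fst p, \<not> snd p)) u)) = star A (sword A t u)"
  by (induction u) (simp_all add: t poly_closed sword_append)

lemma spoly_star: "spoly A t (star_poly ps) = star A (spoly A t ps)"
  by (induction ps) (simp_all add: star_poly_def poly_closed sword_star)

end

end

lemma (in cstar) nrm_closure_mono: "S \<subseteq> S' \<Longrightarrow> nrm_closure S \<subseteq> nrm_closure S'"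
  unfolding nrm_closure_def by blast

lemma (in cstar) cstar_subalgebra_polys:
  assumes t: "\<And>i. t i \<in> carrier A"
  shows "cstar_subalgebra A (nrm_closure (range (spoly A t)))"
proof (rule cstar_subalgebra_nrm_closure)
  show "range (spoly A t) \<subseteq> carrier A" by (auto simp: spoly_closed[OF t])
  show "\<zero> \<in> range (spoly A t)" by (rule range_eqI[of _ _ "[]"]) simp
  fix x assume "x \<in> range (spoly A t)"
  then obtain ps where ps: "x = spoly A t ps" by blast
  show "c \<odot> x \<in> range (spoly A t)" for c
    by (rule range_eqI[of _ _ "scal_poly c ps"]) (simp add: ps spoly_scal[of t, OF t])
  show "star A x \<in> range (spoly A t)"
    by (rule range_eqI[of _ _ "star_poly ps"]) (simp add: ps spoly_star[of t, OF t])
  fix y assume "y \<in> range (spoly A t)"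
  then obtain qs where qs: "y = spoly A t qs" by blast
  show "x \<oplus> y \<in> range (spoly A t)"
    by (rule range_eqI[of _ _ "ps @ qs"]) (simp add: ps qs spoly_append[of t, OF t])
  show "x \<otimes> y \<in> range (spoly A t)"
    by (rule range_eqI[of _ _ "mult_poly ps qs"]) (simp add: ps qs spoly_mult[of t, OF t])
qed

text \<open>The *-polynomials without adjoints: their values at the \<open>t i\<close> lie in
  \<open>A\<close>, and \<open>j\<close> carries them over letter by letter.\<close>

definition analytic_polys :: "(complex \<times> ('d \<times> bool) list) list set" where
  "analytic_polys = {ps. \<forall>q\<in>set ps. \<forall>p\<in>set (snd q). \<not> snd p}"

context word_relations
begin

lemma A_analytic: "A \<subseteq> nrm_closure (spoly C t ` analytic_polys)"
proof -
  have "closed_subalgebra C (nrm_closure (spoly C t ` analytic_polys))"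
  proof (rule closed_subalgebra_nrm_closure)
    show "spoly C t ` analytic_polys \<subseteq> carrier C" by (auto simp: spoly_closed)
    have "[] \<in> analytic_polys" by (simp add: analytic_polys_def)
    then show "\<zero> \<in> spoly C t ` analytic_polys" by (intro image_eqI[of _ _ "[]"]) auto
    fix x y assume "x \<in> spoly C t ` analytic_polys" "y \<in> spoly C t ` analytic_polys"
    then obtain ps qs where ps: "ps \<in> analytic_polys" "x = spoly C t ps" and qs: "qs \<in> analytic_polys" "y = spoly C t qs"
      by auto
    have "ps @ qs \<in> analytic_polys" using ps qs by (auto simp: analytic_polys_def)
    then show "x \<oplus> y \<in> spoly C t ` analytic_polys"
      using ps qs by (intro image_eqI[of _ _ "ps @ qs"]) (auto simp: spoly_append[of t, OF t_closed])
    have "mult_poly ps qs \<in> analytic_polys" using ps qs by (fastforce simp: analytic_polys_def mult_poly_def)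
    then show "x \<otimes> y \<in> spoly C t ` analytic_polys"
      using ps qs by (intro image_eqI[of _ _ "mult_poly ps qs"]) (auto simp: spoly_mult[of t, OF t_closed])
    have "scal_poly c ps \<in> analytic_polys" for c using ps by (auto simp: analytic_polys_def scal_poly_def)
    then show "c \<odot> x \<in> spoly C t ` analytic_polys" for c
      using ps by (intro image_eqI[of _ _ "scal_poly c ps"]) (auto simp: spoly_scal[of t, OF t_closed])
  qed
  moreover have "insert \<one> (range t) \<subseteq> spoly C t ` analytic_polys"
  proof -
    have "\<one> \<in> spoly C t ` analytic_polys"
      by (rule image_eqI[of _ _ "[(1, [])]"]) (auto simp: analytic_polys_def)
    moreover have "t i \<in> spoly C t ` analytic_polys" for i
      by (rule image_eqI[of _ _ "[(1, [(i, False)])]"]) (auto simp: analytic_polys_def)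
    ultimately show ?thesis by auto
  qed
  then have "insert \<one> (range t) \<subseteq> nrm_closure (spoly C t ` analytic_polys)"
    by (rule order_trans) (intro subset_nrm_closure, auto simp: spoly_closed)
  ultimately show ?thesis
    using A_generated hull_minimal[of "insert \<one> (range t)" _ "closed_subalgebra C"]
    unfolding generated_algebra_def by blast
qed

lemma spoly_in_A: "ps \<in> analytic_polys \<Longrightarrow> spoly C t ps \<in> A"
proof (induction ps)
  case (Cons q ps)
  have "(\<And>p. p \<in> set u \<Longrightarrow> \<not> snd p) \<Longrightarrow> X u \<in> A" for u
    by (induction u) (auto intro: A_one A_mult A_t)
  then show ?case using Cons by (auto simp: analytic_polys_def intro!: A_add A_scal)
qed (simp add: A_zero)

end

section \<open>The *-homomorphism from a cover\<close>

context word_cover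
begin

lemma j_spoly: "ps \<in> analytic_polys \<Longrightarrow> j (spoly C t ps) = spoly B s ps"
proof (induction ps)
  case (Cons q ps)
  have "(\<And>p. p \<in> set u \<Longrightarrow> \<not> snd p) \<Longrightarrow> X u \<in> A \<and> j (X u) = Y u" for u
    by (induction u) (auto intro: A_one A_mult A_t simp: j_one j_mult A_t)
  moreover have "\<And>p. p \<in> set (snd q) \<Longrightarrow> \<not> snd p" "ps \<in> analytic_polys" using Cons.prems by (auto simp: analytic_polys_def)
  ultimately show ?case using Cons.IH spoly_in_A[of ps] by (simp add: j_add j_scal A_scal)
qed simp

lemma spoly_B_closed [simp]: "spoly B s ps \<in> carrier B"
  by (intro B.spoly_closed) auto

lemma spoly_C_closed [simp]: "spoly C t ps \<in> carrier C"
  by (intro spoly_closed) auto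

text \<open>The closure of the graph of the assignment that sends the value of a *-polynomial in
  \<open>B\<close> to its value in \<open>C\<close>. Well-definedness is not presupposed; it follows
  from \<open>rel_nrm\<close>.\<close>

definition rel :: "'b \<Rightarrow> 'c \<Rightarrow> bool" where
  "rel y x \<longleftrightarrow> y \<in> carrier B \<and> x \<in> carrier C \<and>
    (\<exists>f. B.cvg (\<lambda>n. spoly B s (f n)) y \<and> cvg (\<lambda>n. spoly C t (f n)) x)"

lemma relI: "\<lbrakk>y \<in> carrier B; x \<in> carrier C; B.cvg (\<lambda>n. spoly B s (f n)) y; cvg (\<lambda>n. spoly C t (f n)) x\<rbrakk> \<Longrightarrow> rel y x"
  by (auto simp: rel_def)

lemma relE:
  assumes "rel y x"
  obtains f where "y \<in> carrier B" "x \<in> carrier C" "B.cvg (\<lambda>n. spoly B s (f n)) y" "cvg (\<lambda>n. spoly C t (f n)) x"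
  using assms by (auto simp: rel_def)

lemma rel_spoly: "rel (spoly B s ps) (spoly C t ps)"
  by (rule relI[of _ _ "\<lambda>_. ps"]) (auto intro: cvg_const B.cvg_const)

lemma rel_add: assumes "rel y x" "rel y' x'" shows "rel (y \<oplus>\<^sub>B y') (x \<oplus> x')"
proof -
  obtain f where f: "y \<in> carrier B" "x \<in> carrier C" "B.cvg (\<lambda>n. spoly B s (f n)) y" "cvg (\<lambda>n. spoly C t (f n)) x"
    by (rule relE[OF assms(1)])
  obtain g where g: "y' \<in> carrier B" "x' \<in> carrier C" "B.cvg (\<lambda>n. spoly B s (g n)) y'" "cvg (\<lambda>n. spoly C t (g n)) x'"
    by (rule relE[OF assms(2)])
  show ?thesis
  proof (rule relI[of _ _ "\<lambda>n. f n @ g n"])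
    show "B.cvg (\<lambda>n. spoly B s (f n @ g n)) (y \<oplus>\<^sub>B y')"
      unfolding B.spoly_append[of s, OF s_closed] by (rule B.cvg_add) (use f g in auto)
    show "cvg (\<lambda>n. spoly C t (f n @ g n)) (x \<oplus> x')"
      unfolding spoly_append[of t, OF t_closed] by (rule cvg_add) (use f g in auto)
  qed (use f g in auto)
qed

lemma rel_mult: assumes "rel y x" "rel y' x'" shows "rel (y \<otimes>\<^sub>B y') (x \<otimes> x')"
proof -
  obtain f where f: "y \<in> carrier B" "x \<in> carrier C" "B.cvg (\<lambda>n. spoly B s (f n)) y" "cvg (\<lambda>n. spoly C t (f n)) x"
    by (rule relE[OF assms(1)])
  obtain g where g: "y' \<in> carrier B" "x' \<in> carrier C" "B.cvg (\<lambda>n. spoly B s (g n)) y'" "cvg (\<lambda>n. spoly C t (g n)) x'"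
    by (rule relE[OF assms(2)])
  show ?thesis
  proof (rule relI[of _ _ "\<lambda>n. mult_poly (f n) (g n)"])
    show "B.cvg (\<lambda>n. spoly B s (mult_poly (f n) (g n))) (y \<otimes>\<^sub>B y')"
      unfolding B.spoly_mult[of s, OF s_closed] by (rule B.cvg_mult) (use f g in auto)
    show "cvg (\<lambda>n. spoly C t (mult_poly (f n) (g n))) (x \<otimes> x')"
      unfolding spoly_mult[of t, OF t_closed] by (rule cvg_mult) (use f g in auto)
  qed (use f g in auto)
qed

lemma rel_scal: assumes "rel y x" shows "rel (c \<odot>\<^sub>B y) (c \<odot> x)"
proof -
  obtain f where f: "y \<in> carrier B" "x \<in> carrier C" "B.cvg (\<lambda>n. spoly B s (f n)) y" "cvg (\<lambda>n. spoly C t (f n)) x"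
    by (rule relE[OF assms(1)])
  show ?thesis
  proof (rule relI[of _ _ "\<lambda>n. scal_poly c (f n)"])
    show "B.cvg (\<lambda>n. spoly B s (scal_poly c (f n))) (c \<odot>\<^sub>B y)"
      unfolding B.spoly_scal[of s, OF s_closed] by (rule B.cvg_scal) (use f in auto)
    show "cvg (\<lambda>n. spoly C t (scal_poly c (f n))) (c \<odot> x)"
      unfolding spoly_scal[of t, OF t_closed] by (rule cvg_scal) (use f in auto)
  qed (use f in auto)
qed

lemma rel_star: assumes "rel y x" shows "rel (star B y) (star C x)"
proof -
  obtain f where f: "y \<in> carrier B" "x \<in> carrier C" "B.cvg (\<lambda>n. spoly B s (f n)) y" "cvg (\<lambda>n. spoly C t (f n)) x"
    by (rule relE[OF assms(1)])
  show ?thesis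
  proof (rule relI[of _ _ "\<lambda>n. star_poly (f n)"])
    show "B.cvg (\<lambda>n. spoly B s (star_poly (f n))) (star B y)"
      unfolding B.spoly_star[of s, OF s_closed] by (rule B.cvg_star) (use f in auto)
    show "cvg (\<lambda>n. spoly C t (star_poly (f n))) (star C x)"
      unfolding spoly_star[of t, OF t_closed] by (rule cvg_star) (use f in auto)
  qed (use f in auto)
qed

lemma rel_nrm: assumes "rel y x" shows "nrm C x \<le> nrm B y"
proof -
  obtain f where f: "y \<in> carrier B" "x \<in> carrier C" "B.cvg (\<lambda>n. spoly B s (f n)) y" "cvg (\<lambda>n. spoly C t (f n)) x"
    by (rule relE[OF assms(1)])
  show ?thesis
  proof (rule LIMSEQ_le)
    show "(\<lambda>n. nrm C (spoly C t (f n))) \<longlonglongrightarrow> nrm C x" by (rule cvg_nrm) (use f in auto)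
    show "(\<lambda>n. nrm B (spoly B s (f n))) \<longlonglongrightarrow> nrm B y" by (rule B.cvg_nrm) (use f in auto)
  qed (use nrm_spoly_le in blast)
qed

lemma rel_closed: "rel y x \<Longrightarrow> y \<in> carrier B" "rel y x \<Longrightarrow> x \<in> carrier C"
  by (auto simp: rel_def)

lemma rel_minus: assumes "rel y x" "rel y' x'" shows "rel (y \<ominus>\<^sub>B y') (x \<ominus> x')"
  using rel_add[OF assms(1) rel_scal[OF assms(2), of "-1"]] rel_closed[OF assms(1)] rel_closed[OF assms(2)]
  by (simp add: scal_neg1 B.scal_neg1 minus_eq B.minus_eq)

lemma rel_unique: assumes "rel y x" "rel y x'" shows "x = x'"
proof -
  have "nrm C (x \<ominus> x') \<le> 0"
    using rel_nrm[OF rel_minus[OF assms]] rel_closed[OF assms(1)] by (simp add: B.minus_eq B.r_neg)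
  then show ?thesis
    using nrm_le_0[of "x \<ominus> x'"] minus_zero_iff[of x x'] rel_closed[OF assms(1)] rel_closed[OF assms(2)] by simp
qed

text \<open>An element of \<open>A\<close> is a limit of analytic polynomials, and \<open>j\<close>
  is isometric on \<open>A\<close>, so the same polynomials converge in \<open>B\<close>.\<close>

lemma rel_j: assumes a: "a \<in> A" shows "rel (j a) a"
proof -
  have "a \<in> nrm_closure (spoly C t ` analytic_polys)" using a A_analytic by blast
  then obtain g where g: "\<And>n. g n \<in> spoly C t ` analytic_polys" "cvg g a"
    unfolding nrm_closure_def by blast
  then have "\<forall>n. \<exists>ps\<in>analytic_polys. g n = spoly C t ps" by blast
  then obtain f where f: "\<And>n. f n \<in> analytic_polys" "\<And>n. g n = spoly C t (f n)" by metis
  show ?thesis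
  proof (rule relI[of _ _ f])
    show "cvg (\<lambda>n. spoly C t (f n)) a" using g(2) f(2) by (simp add: cvg_def)
    show "B.cvg (\<lambda>n. spoly B s (f n)) (j a)"
    proof (rule B.cvg_le[OF g(2)[unfolded cvg_def]])
      fix n
      have fA: "spoly C t (f n) \<in> A" by (rule spoly_in_A[OF f(1)])
      have "spoly C t (f n) \<ominus> a = spoly C t (f n) \<oplus> (-1) \<odot> a" using a by (simp add: scal_neg1 minus_eq)
      moreover have "spoly C t (f n) \<oplus> (-1) \<odot> a \<in> A" using fA a by (intro A_add A_scal)
      moreover have "j (spoly C t (f n) \<oplus> (-1) \<odot> a) = spoly B s (f n) \<ominus>\<^sub>B j a"
        using fA a A_scal by (simp add: j_add j_scal j_spoly[OF f(1)] B.scal_neg1 B.minus_eq)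
      ultimately show "nrm B (spoly B s (f n) \<ominus>\<^sub>B j a) \<le> nrm C (g n \<ominus> a)"
        using j_nrm[of "spoly C t (f n) \<oplus> (-1) \<odot> a"] f(2) by simp
    qed (use a in auto)
  qed (use a in auto)
qed

lemma carrier_B: "carrier B \<subseteq> B.nrm_closure (range (spoly B s))"
proof -
  have "cstar_subalgebra B (B.nrm_closure (range (spoly B s)))"
    by (rule B.cstar_subalgebra_polys) simp
  moreover have "j ` A \<subseteq> B.nrm_closure (range (spoly B s))"
  proof
    fix y assume "y \<in> j ` A"
    then obtain a where a: "a \<in> A" "y = j a" by blast
    obtain f where "B.cvg (\<lambda>n. spoly B s (f n)) y" using rel_j[OF a(1)] a(2) by (auto simp: rel_def)
    then show "y \<in> B.nrm_closure (range (spoly B s))"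
      using a unfolding B.nrm_closure_def by (auto intro!: exI[of _ "\<lambda>n. spoly B s (f n)"])
  qed
  ultimately show ?thesis
    unfolding B_generated[symmetric] generated_cstar_def by (intro hull_minimal)
qed

text \<open>*-polynomials that converge in \<open>B\<close> are Cauchy in \<open>C\<close> by
  \<open>rel_nrm\<close>.\<close>

lemma ex_rel: assumes y: "y \<in> carrier B" shows "\<exists>x. rel y x"
proof -
  obtain g where g: "\<And>n. g n \<in> range (spoly B s)" "B.cvg g y" using y carrier_B by (auto simp: B.nrm_closure_def)
  then have "\<forall>n. \<exists>ps. g n = spoly B s ps" by blast
  then obtain f where f: "\<And>n. g n = spoly B s (f n)" by metis
  have cvg: "B.cvg (\<lambda>n. spoly B s (f n)) y" using g(2) f by (simp add: B.cvg_def)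
  have "\<exists>x\<in>carrier C. (\<lambda>n. nrm C (spoly C t (f n) \<ominus> x)) \<longlonglongrightarrow> 0"
  proof (rule nrm_cauchy)
    fix e :: real assume "0 < e"
    then obtain N where "\<forall>n\<ge>N. norm (nrm B (spoly B s (f n) \<ominus>\<^sub>B y) - 0) < e / 2"
      using LIMSEQ_D[OF cvg[unfolded B.cvg_def], of "e / 2"] by auto
    then have N: "\<And>n. N \<le> n \<Longrightarrow> nrm B (spoly B s (f n) \<ominus>\<^sub>B y) < e / 2" by auto
    have "nrm C (spoly C t (f m) \<ominus> spoly C t (f n)) < e" if "N \<le> m" "N \<le> n" for m n
    proof -
      have "nrm C (spoly C t (f m) \<ominus> spoly C t (f n)) \<le> nrm B (spoly B s (f m) \<ominus>\<^sub>B spoly B s (f n))"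
        by (intro rel_nrm rel_minus rel_spoly)
      also have "\<dots> \<le> nrm B (spoly B s (f m) \<ominus>\<^sub>B y) + nrm B (y \<ominus>\<^sub>B spoly B s (f n))"
        using y by (intro B.nrm_minus_trans) auto
      also have "\<dots> < e"
        using N[OF that(1)] N[OF that(2)] B.nrm_minus_commute[OF y spoly_B_closed[of "f n"]] by simp
      finally show ?thesis .
    qed
    then show "\<exists>N. \<forall>m\<ge>N. \<forall>n\<ge>N. nrm C (spoly C t (f m) \<ominus> spoly C t (f n)) < e" by blast
  qed auto
  then show ?thesis using cvg y relI[of y _ f] by (auto simp: cvg_def)
qed

definition \<Phi> :: "'b \<Rightarrow> 'c" where
  "\<Phi> y = (THE x. rel y x)"

lemma rel_\<Phi>: "y \<in> carrier B \<Longrightarrow> rel y (\<Phi> y)"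
  unfolding \<Phi>_def by (rule theI') (use ex_rel rel_unique in blast)

lemma \<Phi>_eqI: "rel y x \<Longrightarrow> \<Phi> y = x"
  using rel_unique[OF rel_\<Phi>[OF rel_closed(1)]] by blast

lemma star_hom_\<Phi>: "star_hom B C \<Phi>"
  unfolding star_hom_def algebra_hom_def
  by (auto intro!: \<Phi>_eqI rel_add rel_mult rel_scal rel_star rel_\<Phi> rel_closed(2)[OF rel_\<Phi>])

lemma \<Phi>_j: "a \<in> A \<Longrightarrow> \<Phi> (j a) = a"
  by (rule \<Phi>_eqI[OF rel_j])

lemma rel_finsum: "finite F \<Longrightarrow> (\<And>b. b \<in> F \<Longrightarrow> rel (f b) (g b)) \<Longrightarrow> rel (finsum B f F) (finsum C g F)"
proof (induction F rule: finite_induct)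
  case empty
  then show ?case using rel_spoly[of "[]"] by simp
next
  case (insert b F)
  have c: "f b' \<in> carrier B" "g b' \<in> carrier C" if "b' \<in> insert b F" for b'
    using rel_closed[OF insert.prems[OF that]] by auto
  have "finsum B f (insert b F) = f b \<oplus>\<^sub>B finsum B f F" "finsum C g (insert b F) = g b \<oplus> finsum C g F"
    using insert.hyps c by (auto intro!: finsum_insert B.finsum_insert)
  then show ?case using insert rel_add by simp
qed

text \<open>Lifting without increasing the norm is what makes the range of \<open>\<Phi>\<close> closed.\<close>

lemma ex_lift: "\<exists>y. rel y (spoly C t ps) \<and> nrm B y \<le> nrm C (spoly C t ps)"
proof -
  obtain N where N: "\<And>q. q \<in> set ps \<Longrightarrow> length (snd q) \<le> N" using ex_degree_bound by blast
  define F where "F = {b :: 'd list. length b = k + N}"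
  define x where "x = spoly C t ps"
  have x: "x \<in> carrier C" by (simp add: x_def)
  have F: "finite F" unfolding F_def by (rule finite_words)
  have xA: "x \<otimes> W b \<in> A" if "b \<in> F" for b
    unfolding x_def by (rule spoly_times_W_in_A) (use N that in \<open>auto simp: F_def\<close>)
  \<comment> \<open>Lifts the expansion of \<open>x\<close> as the sum of the
    \<open>(x \<otimes> W b) \<otimes> star C (W b)\<close>, whose first factors lie in
    \<open>A\<close>. Its norm is bounded because the \<open>S b\<close> form a row contraction and
    \<open>j\<close> does not increase the norm of the row of the
    \<open>x \<otimes> W b\<close>.\<close>
  define y where "y = (\<Oplus>\<^bsub>B\<^esub>b\<in>F. j (x \<otimes> W b) \<otimes>\<^sub>B star B (S b))"
  have "rel (S b) (W b)" for b using rel_j[OF W_in_A, of b] by (simp add: j_W)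
  then have "rel y (\<Oplus>b\<in>F. (x \<otimes> W b) \<otimes> star C (W b))"
    unfolding y_def using F xA by (intro rel_finsum rel_mult rel_star rel_j) auto
  then have rel: "rel y x" unfolding F_def sum_words_left[OF x] .
  have "(nrm B y)\<^sup>2 \<le> nrm B (\<Oplus>\<^bsub>B\<^esub>b\<in>F. j (x \<otimes> W b) \<otimes>\<^sub>B star B (j (x \<otimes> W b)))"
    unfolding y_def using F xA B.sum_words_le_one[OF _ sum_ranges_le, of "k + N"]
    by (intro B.nrm_sum_mult_star_le) (auto simp: F_def)
  also have "\<dots> \<le> nrm C (\<Oplus>b\<in>F. (x \<otimes> W b) \<otimes> star C (x \<otimes> W b))"
    by (rule nrm_sum_j_le[OF F xA])
  also have "(\<Oplus>b\<in>F. (x \<otimes> W b) \<otimes> star C (x \<otimes> W b)) = (\<Oplus>b\<in>F. ((x \<otimes> W b) \<otimes> star C (W b)) \<otimes> star C x)"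
    using x by (intro finsum_cong') (auto simp: m_assoc)
  also have "\<dots> = (\<Oplus>b\<in>F. (x \<otimes> W b) \<otimes> star C (W b)) \<otimes> star C x"
    using x F by (intro finsum_ldistr[symmetric]) auto
  also have "\<dots> = x \<otimes> star C x" unfolding F_def sum_words_left[OF x] ..
  finally have "(nrm B y)\<^sup>2 \<le> (nrm C x)\<^sup>2" using x by (simp add: nrm_eq_cstar')
  then have "nrm B y \<le> nrm C x" by (rule power2_le_imp_le) (use x in auto)
  then show ?thesis using rel by (auto simp: x_def)
qed

lemma carrier_C: "carrier C \<subseteq> nrm_closure (range (spoly C t))"
proof -
  have "cstar_subalgebra C (nrm_closure (range (spoly C t)))"
    by (rule cstar_subalgebra_polys) simp
  moreover have "A \<subseteq> nrm_closure (range (spoly C t))"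
    using A_analytic nrm_closure_mono[of "spoly C t ` analytic_polys" "range (spoly C t)"] by blast
  ultimately show ?thesis
    unfolding C_generated[symmetric] generated_cstar_def by (intro hull_minimal)
qed

text \<open>A rapidly convergent sequence of *-polynomials in \<open>C\<close> is lifted increment
  by increment; as the lifts do not increase norms, the partial sums \<open>z n\<close> converge in
  \<open>B\<close>.\<close>

lemma \<Phi>_surj: "\<Phi> ` carrier B = carrier C"
proof (intro equalityI subsetI)
  fix x assume x: "x \<in> carrier C"
  have "\<exists>ps. nrm C (spoly C t ps \<ominus> x) < (1 / 2) ^ n" for n :: nat
  proof -
    have "x \<in> nrm_closure (range (spoly C t))" "range (spoly C t) \<subseteq> carrier C" "0 < (1 / 2 :: real) ^ n" using x carrier_C by auto
    then show ?thesis by (rule nrm_closureD) auto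
  qed
  then obtain f where f: "\<And>n. nrm C (spoly C t (f n) \<ominus> x) < (1 / 2) ^ n" by metis
  define L where "L ps = (SOME y. rel y (spoly C t ps) \<and> nrm B y \<le> nrm C (spoly C t ps))" for ps
  have L: "rel (L ps) (spoly C t ps)" "nrm B (L ps) \<le> nrm C (spoly C t ps)" for ps
    using someI_ex[OF ex_lift[of ps]] by (auto simp: L_def)
  define D where "D n = f (Suc n) @ scal_poly (-1) (f n)" for n
  have D: "spoly C t (D n) = spoly C t (f (Suc n)) \<ominus> spoly C t (f n)" for n
    unfolding D_def spoly_append[of t, OF t_closed] spoly_scal[of t, OF t_closed] by (simp add: scal_neg1 minus_eq)
  define z where "z = rec_nat (L (f 0)) (\<lambda>n y. y \<oplus>\<^sub>B L (D n))"
  have z: "z 0 = L (f 0)" "z (Suc n) = z n \<oplus>\<^sub>B L (D n)" for n by (simp_all add: z_def)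
  have rel_z: "rel (z n) (spoly C t (f n))" for n
  proof (induction n)
    case (Suc n)
    have "p \<oplus> (q \<ominus> p) = q" if "p \<in> carrier C" "q \<in> carrier C" for p q using that by algebra
    then show ?case using rel_add[OF Suc L(1)[of "D n"]] unfolding z D by simp
  qed (simp add: z L)
  have zc: "z n \<in> carrier B" for n using rel_closed(1)[OF rel_z] .
  have step: "nrm B (L (D n)) \<le> 2 * (1 / 2) ^ n" for n
  proof -
    have "nrm B (L (D n)) \<le> nrm C (spoly C t (f (Suc n)) \<ominus> spoly C t (f n))" using L(2)[of "D n"] by (simp add: D)
    also have "\<dots> \<le> nrm C (spoly C t (f (Suc n)) \<ominus> x) + nrm C (x \<ominus> spoly C t (f n))"
      using x by (intro nrm_minus_trans) auto
    also have "\<dots> \<le> (1 / 2) ^ Suc n + (1 / 2) ^ n"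
      using f[of "Suc n"] f[of n] nrm_minus_commute[OF x spoly_C_closed[of "f n"]] by simp
    also have "\<dots> \<le> 2 * (1 / 2) ^ n" by simp
    finally show ?thesis .
  qed
  have "nrm B (z (Suc n) \<ominus>\<^sub>B z n) \<le> 2 * (1 / 2) ^ n" for n
  proof -
    have Lc: "L (D n) \<in> carrier B" using rel_closed(1)[OF L(1)] .
    have "(p \<oplus>\<^sub>B l) \<ominus>\<^sub>B p = l" if "p \<in> carrier B" "l \<in> carrier B" for p l using that by algebra
    then show ?thesis using step[of n] zc Lc by (simp add: z)
  qed
  then obtain y where y: "y \<in> carrier B" "B.cvg z y" using B.cvg_ex_geometric[of z 2] zc by blast
  have "cvg (\<lambda>n. spoly C t (f n)) (\<Phi> y)"
  proof (rule cvg_le[OF y(2)[unfolded B.cvg_def]])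
    show "nrm C (spoly C t (f n) \<ominus> \<Phi> y) \<le> nrm B (z n \<ominus>\<^sub>B y)" for n
      by (intro rel_nrm rel_minus rel_z rel_\<Phi> y)
  qed (use rel_closed(2)[OF rel_\<Phi>[OF y(1)]] in auto)
  moreover have "cvg (\<lambda>n. spoly C t (f n)) x"
    by (rule cvg_le[of "\<lambda>n. (1 / 2) ^ n"]) (use f x in \<open>auto intro: less_imp_le LIMSEQ_realpow_zero\<close>)
  ultimately have "\<Phi> y = x" using x rel_closed(2)[OF rel_\<Phi>[OF y(1)]] by (intro cvg_unique) auto
  then show "x \<in> \<Phi> ` carrier B" using y by blast
qed (auto intro: rel_closed(2)[OF rel_\<Phi>])

end

theorem (in word_relations) cstar_envelope:
  "cstar_envelope TYPE('b) C A C (\<lambda>x. x)"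
  unfolding cstar_envelope_def
proof (intro conjI allI impI)
  have "matrix_map C n (\<lambda>x. x) M = M" if "M \<in> matrices_over C n A" for n M
    using that by (auto simp: matrix_map_def matrices_over_def fun_eq_iff)
  then have "completely_isometric C A C (\<lambda>x. x)" by (simp add: completely_isometric_def)
  then show "cstar_cover C A C (\<lambda>x. x)"
    unfolding cstar_cover_def using cstar_iff cstar_axioms C_generated by (auto simp: algebra_hom_def)
next
  fix B :: "'b cstar_alg" and j assume "cstar_cover C A B j"
  then have "algebra_hom C A B j" "completely_isometric C A B j" "generated_cstar B (j ` A) = carrier B" "cstar B"
    by (auto simp: cstar_cover_def cstar_iff)
  then interpret word_cover C t k A B j
    by (intro word_cover.intro word_relations_axioms word_cover_axioms.intro)
  show "\<exists>\<Phi>. star_hom B C \<Phi> \<and> \<Phi> ` carrier B = carrier C \<and> (\<forall>a\<in>A. \<Phi> (j a) = a)"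
    using star_hom_\<Phi> \<Phi>_surj \<Phi>_j by blast
qed

section \<open>The Toeplitz algebra modulo the compact operators\<close>

context finite_type_language
begin

lemma tensor_algebra_eq: "tensor_algebra I = generated_algebra BF toeplitz_gens"
  by (simp add: tensor_algebra_def toeplitz_gens_def)

lemma closed_subalgebra_tensor_algebra: "closed_subalgebra BF (tensor_algebra I)"
  unfolding tensor_algebra_eq by (rule BF.closed_subalgebra_hull) (use gens_subset in simp)

lemma gens_in_tensor_algebra: "toeplitz_gens \<subseteq> tensor_algebra I"
  unfolding tensor_algebra_eq generated_algebra_def by (rule hull_subset)

lemma tensor_algebra_minimal:
  "closed_subalgebra BF S \<Longrightarrow> toeplitz_gens \<subseteq> S \<Longrightarrow> tensor_algebra I \<subseteq> S"
  unfolding tensor_algebra_eq generated_algebra_def by (rule hull_minimal)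

lemma tensor_algebra_subset: "tensor_algebra I \<subseteq> carrier TC"
  using BF.cstar_subalgebraD(1)[OF cstar_subalgebra_TC] gens_in_TC by (intro tensor_algebra_minimal) auto

lemmas q_hom = star_homD[OF Cal.star_hom_q]

lemma word_prod_q: "word_prod Cal.Q (\<lambda>i. Cal.q (T i)) w = Cal.q (word_prod TC T w)"
  using q_hom(3)[OF shift_in_TC word_prod_shift_closed] by (induction w) (simp_all add: Cal.Q_one)

text \<open>Transports statements about generated algebras from Fock space to the quotient: to see
  that the image of a generated algebra lies in \<open>S\<close>, it is enough to look at the
  generators.\<close>

lemma closed_subalgebra_q_preimage:
  assumes S: "closed_subalgebra Cal.Q S"
  shows "closed_subalgebra BF {a \<in> carrier TC. Cal.q a \<in> S}"
proof -
  interpret Q: cstar Cal.Q by (rule Cal.cstar_Q)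
  note SD = Q.closed_subalgebraD[OF S]
  show ?thesis
    unfolding closed_subalgebra_def nrm_closed_def
  proof (intro conjI ballI allI impI)
    show "{a \<in> carrier TC. Cal.q a \<in> S} \<subseteq> carrier BF" using TC_operators by auto
    show "\<zero>\<^sub>BF \<in> {a \<in> carrier TC. Cal.q a \<in> S}"
      using SD(2) TC.zero_closed by (simp add: Cal.Q_zero)
    fix a assume a: "a \<in> {a \<in> carrier TC. Cal.q a \<in> S}"
    show "c \<odot>\<^sub>BF a \<in> {a \<in> carrier TC. Cal.q a \<in> S}" for c
      using a SD(5)[of "Cal.q a" c] q_hom(4)[of a c] TC.scal_closed[of a c] by simp
    fix b assume b: "b \<in> {a \<in> carrier TC. Cal.q a \<in> S}"
    show "a \<oplus>\<^sub>BF b \<in> {a \<in> carrier TC. Cal.q a \<in> S}"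
      using a b SD(3)[of "Cal.q a" "Cal.q b"] q_hom(2)[of a b] TC.a_closed[of a b] by simp
    show "a \<otimes>\<^sub>BF b \<in> {a \<in> carrier TC. Cal.q a \<in> S}"
      using a b SD(4)[of "Cal.q a" "Cal.q b"] q_hom(3)[of a b] TC.m_closed[of a b] by simp
  next
    fix f x assume *: "(\<forall>n::nat. f n \<in> {a \<in> carrier TC. Cal.q a \<in> S}) \<and> x \<in> carrier BF
      \<and> (\<lambda>n. nrm BF (f n \<ominus>\<^sub>BF x)) \<longlonglongrightarrow> 0"
    then have f: "\<And>n. f n \<in> carrier TC" "\<And>n. Cal.q (f n) \<in> S" and cvg: "BF.cvg f x" by (auto simp: BF.cvg_def)
    have x: "x \<in> carrier TC" by (rule TC_sub(8)[OF f(1) _ cvg]) (use * in blast)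
    have "(\<lambda>n. norm (f n - x)) \<longlonglongrightarrow> 0"
      using cvg TC_operators[OF x] by (simp add: BF.cvg_def bounded_operators_minus[OF closed_csubspace_fock])
    then have "Q.cvg (\<lambda>n. Cal.q (f n)) (Cal.q x)"
    proof (rule Q.cvg_le)
      fix n
      show "Cal.q (f n) \<in> carrier Cal.Q" "Cal.q x \<in> carrier Cal.Q" using f x by (auto intro: q_hom(1))
      show "nrm Cal.Q (Cal.q (f n) \<ominus>\<^sub>Cal.Q Cal.q x) \<le> norm (f n - x)"
        unfolding Cal.Q_minus[OF f(1) x]
        using Cal.Q_nrm_le'[OF TC.minus_closed[OF f(1) x]] by (simp add: TC_minus[OF f(1) x])
    qed
    then show "x \<in> {a \<in> carrier TC. Cal.q a \<in> S}"
      using x SD(8)[OF f(2) q_hom(1)[OF x]] by simp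
  qed
qed

text \<open>The defect of this identity on Fock space is the vacuum projection, which is
  compact.\<close>

lemma sum_ranges_q: "(\<Oplus>\<^bsub>Cal.Q\<^esub>i\<in>UNIV. Cal.q (T i) \<otimes>\<^sub>Cal.Q star Cal.Q (Cal.q (T i))) = \<one>\<^sub>Cal.Q"
proof -
  interpret Q: cstar Cal.Q by (rule Cal.cstar_Q)
  have c: "T i o\<^sub>L adj (T i) \<in> carrier TC" for i
    using TC.m_closed[of "T i" "adj (T i)"] TC.star_cl[of "T i"] by simp
  have sc: "(\<Sum>i\<in>UNIV. T i o\<^sub>L adj (T i)) \<in> carrier TC" by (intro sum_in_TC c)
  have "Cal.q (T i) \<otimes>\<^sub>Cal.Q star Cal.Q (Cal.q (T i)) = Cal.q (T i o\<^sub>L adj (T i))" for i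
    using q_hom(3)[of "T i" "adj (T i)"] q_hom(5)[of "T i"] TC.star_cl[of "T i"] by simp
  then have "(\<Oplus>\<^bsub>Cal.Q\<^esub>i\<in>UNIV. Cal.q (T i) \<otimes>\<^sub>Cal.Q star Cal.Q (Cal.q (T i)))
      = Cal.q (finsum TC (\<lambda>i. T i o\<^sub>L adj (T i)) UNIV)"
    using c by (simp add: star_hom_finsum[OF TC.cstar_axioms Cal.cstar_Q Cal.star_hom_q])
  also have "finsum TC (\<lambda>i. T i o\<^sub>L adj (T i)) UNIV = (\<Sum>i\<in>UNIV. T i o\<^sub>L adj (T i))" by (intro finsum_TC c) simp
  also have "Cal.q (\<Sum>i\<in>UNIV. T i o\<^sub>L adj (T i)) = Cal.q (proj F)"
  proof -
    have "proj F \<ominus>\<^sub>TC (\<Sum>i\<in>UNIV. T i o\<^sub>L adj (T i)) = rank_one 0 0"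
      unfolding TC_minus[OF proj_in_TC sc] vacuum_projection ..
    also have "rank_one 0 0 \<in> K" using trunc_compact[of "{0}"] empty_allowed by (simp add: trunc_def)
    finally show ?thesis using Cal.q_eq_iff[OF proj_in_TC sc] by simp
  qed
  finally show ?thesis by (simp add: Cal.Q_one)
qed

lemma word_relations_q: "word_relations Cal.Q (\<lambda>i. Cal.q (T i)) k (Cal.q ` tensor_algebra I)"
proof (rule word_relations.intro[OF Cal.cstar_Q], rule word_relations_axioms.intro)
  interpret Q: cstar Cal.Q by (rule Cal.cstar_Q)
  note AD = BF.closed_subalgebraD[OF closed_subalgebra_tensor_algebra]
  have inTC: "a \<in> carrier TC" if "a \<in> tensor_algebra I" for a using that tensor_algebra_subset by auto
  have sT: "adj (T i) \<in> carrier TC" for i using TC.star_cl[of "T i"] by simp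
  have gens: "proj F \<in> tensor_algebra I" "T i \<in> tensor_algebra I" for i
    using gens_in_tensor_algebra by (auto simp: toeplitz_gens_def)
  show "Cal.q (T i) \<in> carrier Cal.Q" for i by (rule q_hom(1)) simp
  show "(\<Oplus>\<^bsub>Cal.Q\<^esub>i\<in>UNIV. Cal.q (T i) \<otimes>\<^sub>Cal.Q star Cal.Q (Cal.q (T i))) = \<one>\<^sub>Cal.Q" by (rule sum_ranges_q)
  show "star Cal.Q (Cal.q (T i)) \<otimes>\<^sub>Cal.Q Cal.q (T j) = \<zero>\<^sub>Cal.Q" if "i \<noteq> j" for i j
    using q_hom(3)[OF sT[of i] shift_in_TC[of j]] q_hom(5)[of "T i"] adj_shift_shift[OF that] by (simp add: Cal.Q_zero)
  show "Cal.q (T i) \<otimes>\<^sub>Cal.Q word_prod Cal.Q (\<lambda>i. Cal.q (T i)) w = \<zero>\<^sub>Cal.Q \<or>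
      star Cal.Q (Cal.q (T i)) \<otimes>\<^sub>Cal.Q (Cal.q (T i) \<otimes>\<^sub>Cal.Q word_prod Cal.Q (\<lambda>i. Cal.q (T i)) w)
        = word_prod Cal.Q (\<lambda>i. Cal.q (T i)) w" if w: "length w = k" for w i
  proof -
    let ?w = "word_prod TC T w"
    have 1: "Cal.q (T i) \<otimes>\<^sub>Cal.Q Cal.q ?w = Cal.q (T i o\<^sub>L ?w)"
      using q_hom(3)[OF shift_in_TC[of i] word_prod_shift_closed[of w]] by simp
    have "T i o\<^sub>L ?w \<in> carrier TC" using TC.m_closed[OF shift_in_TC[of i] word_prod_shift_closed[of w]] by simp
    then have 2: "star Cal.Q (Cal.q (T i)) \<otimes>\<^sub>Cal.Q Cal.q (T i o\<^sub>L ?w) = Cal.q (adj (T i) o\<^sub>L (T i o\<^sub>L ?w))"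
      using q_hom(3)[OF sT[of i], of "T i o\<^sub>L ?w"] q_hom(5)[of "T i"] by simp
    show ?thesis
      unfolding word_prod_q 1 2 using shift_relation[OF w, of i] by (auto simp: Cal.Q_zero)
  qed
  show "Cal.q ` tensor_algebra I \<subseteq> carrier Cal.Q" using inTC by (auto intro: q_hom(1))
  show "\<one>\<^sub>Cal.Q \<in> Cal.q ` tensor_algebra I" using gens(1) by (simp add: Cal.Q_one)
  show "Cal.q (T i) \<in> Cal.q ` tensor_algebra I" for i using gens(2) by blast
  fix x y assume "x \<in> Cal.q ` tensor_algebra I" "y \<in> Cal.q ` tensor_algebra I"
  then obtain a b where a: "a \<in> tensor_algebra I" "x = Cal.q a" and b: "b \<in> tensor_algebra I" "y = Cal.q b" by blast
  show "x \<oplus>\<^sub>Cal.Q y \<in> Cal.q ` tensor_algebra I"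
    using q_hom(2)[OF inTC[OF a(1)] inTC[OF b(1)]] AD(3)[OF a(1) b(1)] a b by auto
  show "x \<otimes>\<^sub>Cal.Q y \<in> Cal.q ` tensor_algebra I"
    using q_hom(3)[OF inTC[OF a(1)] inTC[OF b(1)]] AD(4)[OF a(1) b(1)] a b by auto
next
  interpret Q: cstar Cal.Q by (rule Cal.cstar_Q)
  note AD = BF.closed_subalgebraD[OF closed_subalgebra_tensor_algebra]
  have inTC: "a \<in> carrier TC" if "a \<in> tensor_algebra I" for a using that tensor_algebra_subset by auto
  show "c \<odot>\<^sub>Cal.Q x \<in> Cal.q ` tensor_algebra I" if "x \<in> Cal.q ` tensor_algebra I" for x c
  proof -
    from that obtain a where a: "a \<in> tensor_algebra I" "x = Cal.q a" by blast
    then show ?thesis using q_hom(4)[OF inTC[OF a(1)], of c] AD(5)[OF a(1), of c] by auto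
  qed
  have genQ: "insert \<one>\<^sub>Cal.Q (range (\<lambda>i. Cal.q (T i))) \<subseteq> carrier Cal.Q" by (auto intro: q_hom(1))
  show "Cal.q ` tensor_algebra I \<subseteq> generated_algebra Cal.Q (insert \<one>\<^sub>Cal.Q (range (\<lambda>i. Cal.q (T i))))"
    (is "_ \<subseteq> ?S")
  proof -
    have "insert \<one>\<^sub>Cal.Q (range (\<lambda>i. Cal.q (T i))) \<subseteq> ?S" unfolding generated_algebra_def by (rule hull_subset)
    then have "toeplitz_gens \<subseteq> {a \<in> carrier TC. Cal.q a \<in> ?S}"
      by (auto simp: toeplitz_gens_def Cal.Q_one)
    then have "tensor_algebra I \<subseteq> {a \<in> carrier TC. Cal.q a \<in> ?S}"
      by (intro tensor_algebra_minimal closed_subalgebra_q_preimage Q.closed_subalgebra_hull genQ)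
    then show ?thesis by blast
  qed
  have qA: "Cal.q ` tensor_algebra I \<subseteq> carrier Cal.Q" using inTC by (auto intro: q_hom(1))
  show "generated_cstar Cal.Q (Cal.q ` tensor_algebra I) = carrier Cal.Q" (is "?S = _")
  proof
    have S: "cstar_subalgebra Cal.Q ?S" by (rule Q.cstar_subalgebra_hull[OF qA])
    show "?S \<subseteq> carrier Cal.Q" by (rule Q.closed_subalgebraD(1)[OF Q.cstar_subalgebraD(1)[OF S]])
    have "closed_subalgebra BF {a \<in> carrier TC. Cal.q a \<in> ?S}"
      by (rule closed_subalgebra_q_preimage[OF Q.cstar_subalgebraD(1)[OF S]])
    moreover have "star BF a \<in> {a \<in> carrier TC. Cal.q a \<in> ?S}" if "a \<in> {a \<in> carrier TC. Cal.q a \<in> ?S}" for a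
      using that Q.cstar_subalgebraD(2)[OF S, of "Cal.q a"] q_hom(5)[of a] TC.star_cl[of a] by simp
    ultimately have "cstar_subalgebra BF {a \<in> carrier TC. Cal.q a \<in> ?S}" by (simp add: cstar_subalgebra_def)
    moreover have "Cal.q ` tensor_algebra I \<subseteq> ?S" unfolding generated_cstar_def by (rule hull_subset)
    then have "toeplitz_gens \<subseteq> {a \<in> carrier TC. Cal.q a \<in> ?S}"
      using gens_in_tensor_algebra gens_in_TC by blast
    ultimately have "carrier TC \<subseteq> {a \<in> carrier TC. Cal.q a \<in> ?S}"
      unfolding carrier_TC generated_cstar_def by (rule hull_minimal[rotated])
    then show "carrier Cal.Q \<subseteq> ?S" unfolding Cal.Q_carrier by blast
  qed
qed

end

theorem proposition7p5:
  fixes I :: "'d::finite ncpoly set" and k :: nat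
  assumes "monomial_ideal I"
    and "finite_type I k"
  shows "hyperrigid TYPE('h::complex_hilbert)
           (toeplitz_mod_compacts I) (mod_compacts_map I ` tensor_algebra I) \<and>
         cstar_envelope TYPE('b)
           (toeplitz_mod_compacts I) (mod_compacts_map I ` tensor_algebra I)
           (toeplitz_mod_compacts I) (\<lambda>x. x)"
proof -
  interpret finite_type_language I k by (rule finite_type_language[OF assms])
  have Q: "toeplitz_mod_compacts I = Cal.Q" by (simp add: toeplitz_mod_compacts_def)
  have q: "mod_compacts_map I = Cal.q" by (simp add: mod_compacts_map_def fun_eq_iff)
  interpret W: word_relations Cal.Q "\<lambda>i. Cal.q (T i)" k "Cal.q ` tensor_algebra I" by (rule word_relations_q)
  show ?thesis unfolding Q q using W.hyperrigid W.cstar_envelope by blast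
qed

end
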